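(* Let $A$ be an injective sectorial operator on a Banach space $X$ such that $-A$ generates an asymptotically analytic $C_0$-semigroup $(T(t))_{t\ge 0}$ on $X$. Suppose that $\overline{\mathbb{C}_-}\setminus\{0\}\subset\rho(A)$ and that there exist $\alpha\ge 1$ and $C>0$ such that $\|(\lambda-A)^{-1}\|_{\mathcal{L}(X)}\le C|\lambda|^{-\alpha}$ for each $\lambda\in\overline{\mathbb{C}_-}\setminus\{0\}$ with $|\lambda|\le 1$. Let $\sigma>\alpha-1$. Then, for each $\delta>0$, there exists $c_{\delta,\sigma}>0$ such that for each $t\ge 1$, $$\|T(t)A^{\sigma}(1+A)^{-\sigma}\|_{\mathcal{L}(X)}\le c_{\delta,\sigma}\,t^{1-\frac{\sigma+1}{\alpha}}\log(1+t)^{1+\delta}.$$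
   Context: $\mathbb{C}_-=\{z\in\mathbb{C}:\operatorname{Re} z<0\}$; $\rho(A)$ is the set of $\lambda$ for which $\lambda-A$ has a bounded inverse. A linear operator $A$ on $X$ is sectorial of angle $\omega\in(0,\pi)$ if $\sigma(A)\subset\overline{S_\omega}$, with $S_\omega=\{z: 0<|\arg z|<\omega\}$, and $\|\lambda(\lambda-A)^{-1}\|$ is bounded for $\lambda\in\mathbb{C}\setminus\overline{S_{\omega'}}$ for every $\omega'\in(\omega,\pi)$. Fractional powers are those of the functional calculus of sectorial operators. The non-analytic growth bound of a $C_0$-semigroup $(T(t))_{t\ge 0}$ is $$\zeta(T)=\inf\{w\in\mathbb{R}:\ \sup_{t>0}e^{-tw}\|T(t)-S(t)\|_{\mathcal{L}(X)}<\infty\ \text{for some } S\in\mathcal{H}(\mathcal{L}(X))\},$$ where $\mathcal{H}(\mathcal{L}(X))$ is the set of functions $S:(0,\infty)\to\mathcal{L}(X)$ having an exponentially bounded analytic extension to some sector containing $(0,\infty)$. The semigroup is asymptotically analytic if $\zeta(T)<0$. *)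

theory Defs
  imports "HOL-Analysis.Analysis"
begin

section \<open>Complex Banach spaces and bounded operators\<close>

class complex_banach = banach +
  fixes scaleC :: "complex \<Rightarrow> 'a \<Rightarrow> 'a"  (infixr \<open>*\<^sub>C\<close> 75)
  assumes scaleC_add_right: "c *\<^sub>C (x + y) = c *\<^sub>C x + c *\<^sub>C y"
    and scaleC_add_left: "(c + d) *\<^sub>C x = c *\<^sub>C x + d *\<^sub>C x"
    and scaleC_scaleC: "c *\<^sub>C d *\<^sub>C x = (c * d) *\<^sub>C x"
    and scaleC_of_real: "complex_of_real r *\<^sub>C x = r *\<^sub>R x"
    and norm_scaleC: "norm (c *\<^sub>C x) = cmod c * norm x"

lemma bounded_linear_scaleC: "bounded_linear (\<lambda>x. c *\<^sub>C (x::'a::complex_banach))"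
proof (rule bounded_linear_intro[where K = "cmod c"])
  fix r :: real and x :: 'a
  have "c *\<^sub>C r *\<^sub>R x = (c * complex_of_real r) *\<^sub>C x"
    by (simp add: scaleC_scaleC flip: scaleC_of_real)
  also have "\<dots> = r *\<^sub>R c *\<^sub>C x"
    by (simp add: scaleC_scaleC mult.commute flip: scaleC_of_real)
  finally show "c *\<^sub>C r *\<^sub>R x = r *\<^sub>R c *\<^sub>C x" .
qed (simp_all add: scaleC_add_right norm_scaleC mult.commute)

text \<open>
  The type \<open>'a \<Rightarrow>\<^sub>L 'b\<close> consists of the bounded real-linear maps; with the scalar multiplication
  below it is a complex Banach space, of which the bounded complex-linear maps form a closed
  subspace with the usual operator norm.
\<close>

instantiation blinfun :: (real_normed_vector, complex_banach) complex_banach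
begin

lift_definition scaleC_blinfun :: "complex \<Rightarrow> ('a \<Rightarrow>\<^sub>L 'b) \<Rightarrow> 'a \<Rightarrow>\<^sub>L 'b"
  is "\<lambda>c f x. c *\<^sub>C f x"
  by (rule bounded_linear_compose[OF bounded_linear_scaleC])

instance
proof
  fix c d :: complex and r :: real and f g :: "'a \<Rightarrow>\<^sub>L 'b"
  show "c *\<^sub>C (f + g) = c *\<^sub>C f + c *\<^sub>C g"
    by transfer (simp add: scaleC_add_right)
  show "(c + d) *\<^sub>C f = c *\<^sub>C f + d *\<^sub>C f"
    by transfer (simp add: scaleC_add_left)
  show "c *\<^sub>C d *\<^sub>C f = (c * d) *\<^sub>C f"
    by transfer (simp add: scaleC_scaleC)
  show "complex_of_real r *\<^sub>C f = r *\<^sub>R f"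
    by transfer (simp add: scaleC_of_real)
  have "onorm (\<lambda>x. c *\<^sub>C h x) = cmod c * onorm h" if "bounded_linear h" for h :: "'a \<Rightarrow> 'b"
  proof -
    have "onorm (\<lambda>x. c *\<^sub>C h x) = onorm (\<lambda>x. cmod c *\<^sub>R h x)"
      by (simp add: onorm_def norm_scaleC)
    then show ?thesis
      by (simp add: onorm_scaleR that)
  qed
  then show "norm (c *\<^sub>C f) = cmod c * norm f"
    by transfer
qed

end

definition bounded_clinear_ops :: "('a::complex_banach \<Rightarrow>\<^sub>L 'b::complex_banach) set" where
  "bounded_clinear_ops = {B. \<forall>c x. blinfun_apply B (c *\<^sub>C x) = c *\<^sub>C blinfun_apply B x}"

definition vector_holomorphic_on ::
    "(complex \<Rightarrow> 'a::complex_banach) \<Rightarrow> complex set \<Rightarrow> bool" where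
  "vector_holomorphic_on F U \<longleftrightarrow>
     (\<forall>z\<in>U. \<exists>D. (F has_derivative (\<lambda>h. h *\<^sub>C D)) (at z within U))"


section \<open>Unbounded operators\<close>

text \<open>
  An operator is represented by its graph.  Hence \<open>B O A\<close> is the operator product
  ``first \<open>B\<close>, then \<open>A\<close>'' on its natural domain, and \<open>A\<inverse>\<close> the inverse relation.
\<close>

type_synonym 'a oper = "('a \<times> 'a) set"

definition linear_operator :: "'a::complex_banach oper \<Rightarrow> bool" where
  "linear_operator A \<longleftrightarrow>
     single_valued A \<and> (0, 0) \<in> A \<and>
     (\<forall>x y x' y'. (x, y) \<in> A \<and> (x', y') \<in> A \<longrightarrow> (x + x', y + y') \<in> A) \<and>
     (\<forall>c x y. (x, y) \<in> A \<longrightarrow> (c *\<^sub>C x, c *\<^sub>C y) \<in> A)"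

definition injective_operator :: "'a oper \<Rightarrow> bool" where
  "injective_operator A \<longleftrightarrow> single_valued (A\<inverse>)"

definition bounded_graph :: "('a::complex_banach \<Rightarrow>\<^sub>L 'a) \<Rightarrow> 'a oper" where
  "bounded_graph B = {(x, B x) | x. True}"

definition minus_op :: "'a::complex_banach oper \<Rightarrow> 'a oper" where
  "minus_op A = {(x, - y) | x y. (x, y) \<in> A}"

definition one_plus_op :: "'a::complex_banach oper \<Rightarrow> 'a oper" where
  "one_plus_op A = {(x, x + y) | x y. (x, y) \<in> A}"

definition scalar_minus_op :: "complex \<Rightarrow> 'a::complex_banach oper \<Rightarrow> 'a oper" where
  "scalar_minus_op \<mu> A = {(x, \<mu> *\<^sub>C x - y) | x y. (x, y) \<in> A}"

definition resolvent_set :: "'a::complex_banach oper \<Rightarrow> complex set" where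
  "resolvent_set A =
     {\<mu>. \<exists>R\<in>bounded_clinear_ops. (scalar_minus_op \<mu> A)\<inverse> = bounded_graph R}"

definition spectrum :: "'a::complex_banach oper \<Rightarrow> complex set" where
  "spectrum A = - resolvent_set A"

definition resolvent :: "'a::complex_banach oper \<Rightarrow> complex \<Rightarrow> 'a \<Rightarrow>\<^sub>L 'a" where
  "resolvent A \<mu> =
     (THE R. R \<in> bounded_clinear_ops \<and> (scalar_minus_op \<mu> A)\<inverse> = bounded_graph R)"


section \<open>Sectorial operators and their functional calculus\<close>

text \<open>
  The positive half-line belongs to the sector.  Leaving it out would not change the closure,
  which is all that matters for sectoriality.
\<close>

definition sector :: "real \<Rightarrow> complex set" where
  "sector \<omega> = {z. z \<noteq> 0 \<and> \<bar>Arg z\<bar> < \<omega>}"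

definition sectorial_of_angle :: "real \<Rightarrow> 'a::complex_banach oper \<Rightarrow> bool" where
  "sectorial_of_angle \<omega> A \<longleftrightarrow>
     linear_operator A \<and> 0 < \<omega> \<and> \<omega> < pi \<and>
     spectrum A \<subseteq> closure (sector \<omega>) \<and>
     (\<forall>\<omega>'. \<omega> < \<omega>' \<and> \<omega>' < pi \<longrightarrow>
        (\<exists>M. \<forall>\<mu>. \<mu> \<notin> closure (sector \<omega>') \<longrightarrow> norm (\<mu> *\<^sub>C resolvent A \<mu>) \<le> M))"

definition sectorial :: "'a::complex_banach oper \<Rightarrow> bool" where
  "sectorial A \<longleftrightarrow> (\<exists>\<omega>. sectorial_of_angle \<omega> A)"

definition H0_infinity :: "real \<Rightarrow> (complex \<Rightarrow> complex) set" where
  "H0_infinity \<phi> =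
     {f. f holomorphic_on sector \<phi> \<and>
         (\<exists>C s. s > 0 \<and>
            (\<forall>z\<in>sector \<phi>. cmod (f z) \<le> C * min (cmod z powr s) (cmod z powr (- s))))}"

text \<open>
  The Cauchy integral of \<open>f(z) (z - A)\<^sup>-\<^sup>1\<close> over the boundary of \<open>sector \<theta>\<close>, which is traversed
  with the sector on the left: inwards along the upper ray, then outwards along the lower ray.
  The rays are parametrised by \<open>z = exp (u \<plusminus> \<i>\<theta>)\<close> with real \<open>u\<close>, so \<open>dz = z du\<close>.
\<close>

definition elementary_calculus ::
    "real \<Rightarrow> 'a::complex_banach oper \<Rightarrow> (complex \<Rightarrow> complex) \<Rightarrow> 'a \<Rightarrow>\<^sub>L 'a" where
  "elementary_calculus \<theta> A f =
     (let g = (\<lambda>z. (z * f z) *\<^sub>C resolvent A z)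
      in (1 / (2 * complex_of_real pi * \<i>)) *\<^sub>C
           (integral UNIV (\<lambda>u::real. g (exp (Complex u (- \<theta>)))) -
            integral UNIV (\<lambda>u::real. g (exp (Complex u \<theta>)))))"

text \<open>
  The functional calculus of an injective sectorial operator:
  \<open>f(A) = e(A)\<^sup>-\<^sup>1 (e f)(A)\<close>, where the regulariser \<open>e\<close> is such that \<open>e\<close> and \<open>e f\<close> are elementary
  and \<open>e(A)\<close> is injective.  The resulting operator depends neither on \<open>e\<close> nor on the angles,
  so these are quantified existentially.  Injectivity of \<open>A\<close> is what allows taking
  regularisers that decay at \<open>0\<close>, such as powers of \<open>z / (1 + z)\<^sup>2\<close>.
\<close>

definition functional_calculus ::
    "(complex \<Rightarrow> complex) \<Rightarrow> 'a::complex_banach oper \<Rightarrow> 'a oper" where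
  "functional_calculus f A =
     {(x, y). \<exists>\<omega> \<theta> \<phi> e.
        sectorial_of_angle \<omega> A \<and> \<omega> < \<theta> \<and> \<theta> < \<phi> \<and> \<phi> < pi \<and>
        e \<in> H0_infinity \<phi> \<and> (\<lambda>z. e z * f z) \<in> H0_infinity \<phi> \<and>
        inj (blinfun_apply (elementary_calculus \<theta> A e)) \<and>
        elementary_calculus \<theta> A e y = elementary_calculus \<theta> A (\<lambda>z. e z * f z) x}"

definition fractional_power :: "'a::complex_banach oper \<Rightarrow> real \<Rightarrow> 'a oper" where
  "fractional_power A \<sigma> = functional_calculus (\<lambda>z. z powr complex_of_real \<sigma>) A"


section \<open>Semigroups\<close>

text \<open>Only the values of \<open>T\<close> on \<open>[0, \<infinity>)\<close> are relevant.\<close>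

definition C0_semigroup :: "(real \<Rightarrow> 'a::complex_banach \<Rightarrow>\<^sub>L 'a) \<Rightarrow> bool" where
  "C0_semigroup T \<longleftrightarrow>
     (\<forall>t\<ge>0. T t \<in> bounded_clinear_ops) \<and>
     T 0 = id_blinfun \<and>
     (\<forall>s\<ge>0. \<forall>t\<ge>0. T (s + t) = T s o\<^sub>L T t) \<and>
     (\<forall>x. continuous_on {0..} (\<lambda>t. T t x))"

definition generator :: "(real \<Rightarrow> 'a::complex_banach \<Rightarrow>\<^sub>L 'a) \<Rightarrow> 'a oper" where
  "generator T = {(x, y). ((\<lambda>h. (T h x - x) /\<^sub>R h) \<longlongrightarrow> y) (at_right 0)}"

definition exp_bounded_analytic :: "(real \<Rightarrow> 'a::complex_banach \<Rightarrow>\<^sub>L 'a) set" where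
  "exp_bounded_analytic =
     {S. \<exists>\<theta> F. 0 < \<theta> \<and> \<theta> < pi \<and>
        F ` sector \<theta> \<subseteq> bounded_clinear_ops \<and>
        vector_holomorphic_on F (sector \<theta>) \<and>
        (\<exists>M w. \<forall>z\<in>sector \<theta>. norm (F z) \<le> M * exp (w * cmod z)) \<and>
        (\<forall>t>0. S t = F (complex_of_real t))}"

text \<open>The infimum is taken in the extended reals, since it is \<open>-\<infinity>\<close> for every analytic semigroup.\<close>

definition nonanalytic_growth_bound :: "(real \<Rightarrow> 'a::complex_banach \<Rightarrow>\<^sub>L 'a) \<Rightarrow> ereal" where
  "nonanalytic_growth_bound T =
     Inf (ereal ` {w. \<exists>S\<in>exp_bounded_analytic. \<exists>M. \<forall>t>0. exp (- t * w) * norm (T t - S t) \<le> M})"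

definition asymptotically_analytic :: "(real \<Rightarrow> 'a::complex_banach \<Rightarrow>\<^sub>L 'a) \<Rightarrow> bool" where
  "asymptotically_analytic T \<longleftrightarrow> nonanalytic_growth_bound T < 0"

end

theory Submission
  imports Defs "HOL-Complex_Analysis.Complex_Analysis" "HOL-Real_Asymp.Real_Asymp"
begin

text \<open>
  The operator \<open>A\<^sup>\<sigma> (1 + A)\<^sup>-\<^sup>\<sigma>\<close> is bounded: with \<open>\<sigma> = k + s\<close>, \<open>0 \<le> s < 1\<close>, it is the \<open>k\<close>-th power of
  \<open>1 - (1 + A)\<^sup>-\<^sup>1\<close> times an absolutely convergent integral of resolvents.

  For an orbit, the Laplace transform of the analytic part of the semigroup extends to a larger
  sector and that of the rest to \<open>Re \<mu> > - \<omega>\<close>.  Hence \<open>T(t)\<close> is a Laplace inversion integral of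
  \<open>(\<mu> + A)\<^sup>-\<^sup>1\<close> over a compact path from \<open>- \<epsilon> - \<i>Y\<close> to \<open>- \<epsilon> + \<i>Y\<close>, up to an error of order
  \<open>exp (- \<epsilon> t)\<close>.  By a Neumann series, \<open>\<parallel>(\<mu> + A)\<^sup>-\<^sup>1\<parallel> \<le> C \<bar>\<mu>\<bar>\<^sup>-\<^sup>\<alpha>\<close> holds down to a curve
  \<open>Re \<mu> = - \<kappa> \<bar>Im \<mu>\<bar>\<^sup>\<alpha>\<close>, so the path can be moved to such a curve, shifted by \<open>\<epsilon> / t\<close> so as to
  avoid \<open>0\<close>.  There the integrand is, up to a polynomial in \<open>\<mu>\<close>, of size
  \<open>\<bar>\<mu>\<bar>\<^sup>\<sigma>\<^sup>-\<^sup>\<alpha> exp (t Re \<mu>)\<close>, and integration gives \<open>t\<close> to the power \<open>1 - (\<sigma> + 1) / \<alpha>\<close>.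
\<close>


section \<open>Integrals over the real line of exponentially decaying functions\<close>

text \<open>Since T is merely strongly continuous, Laplace inversion over vertical lines need not
  converge absolutely. Instead Cauchy's formula is applied to the analytic part on the two boundary
  rays of a sector, with a factor exp (p (t - z)) that equals 1 at z = t. Varying p turns the rays
  into Laplace transforms and yields a compact path at once.

  Contours are shifted only for scalar functions \<phi> (B x), with \<phi> a complex functional of
  norm at most 1; a norming \<phi> is chosen at the end. Rays are written in the coordinate z = exp
  w: a sector becomes a horizontal strip, powers at 0 and infinity become exponential decay along a
  line, and one residue theorem on strips serves all rotations.

  The definition of fractional powers leaves regulariser and angles open. Hence e(A) B = (e f)(A) is
  shown for every admissible e, where B is the bounded operator expected for f(A); injectivity of
  e(A) then identifies the power with B.\<close>

lemma continuous_on_section: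
  assumes "continuous_on (S \<times> T) (\<lambda>(x, u). f x u)"
  shows "x \<in> S \<Longrightarrow> continuous_on T (f x)" and "u \<in> T \<Longrightarrow> continuous_on S (\<lambda>x. f x u)"
proof -
  assume "x \<in> S"
  then have "(\<lambda>u. (x, u)) ` T \<subseteq> S \<times> T" by blast
  from continuous_on_compose2[OF assms _ this] show "continuous_on T (f x)"
    by (simp add: continuous_on_Pair[OF continuous_on_const continuous_on_id])
next
  assume "u \<in> T"
  then have "(\<lambda>x. (x, u)) ` S \<subseteq> S \<times> T" by blast
  from continuous_on_compose2[OF assms _ this] show "continuous_on S (\<lambda>x. f x u)"
    by (simp add: continuous_on_Pair[OF continuous_on_id continuous_on_const])
qed

lemma continuous_on_swap_args:
  assumes "continuous_on (S \<times> T) (\<lambda>(x, u). f x u)"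
  shows "continuous_on (T \<times> S) (\<lambda>(u, x). f x u)"
proof -
  have "(\<lambda>p. (snd p, fst p)) ` (T \<times> S) \<subseteq> S \<times> T" by auto
  from continuous_on_compose2[OF assms _ this] show ?thesis
    by (simp add: case_prod_beta continuous_on_Pair continuous_on_fst continuous_on_snd)
qed

text \<open>The gauge integral over the line is the limit of integrals over growing intervals, and
  these are differences of values of \<open>G\<close>. Convergence of \<open>G\<close> at both ends
  therefore takes the place of a dominating function for \<open>g\<close>. The finite set
  \<open>S\<close> admits primitives glued from several branches.\<close>

lemma has_integral_line_FTC:
  fixes G :: "real \<Rightarrow> 'b::banach"
  assumes "finite S" "continuous_on UNIV G"
    and "\<And>x. x \<notin> S \<Longrightarrow> (G has_vector_derivative g x) (at x)"
    and top: "(G \<longlongrightarrow> L) at_top" and bot: "(G \<longlongrightarrow> l) at_bot"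
  shows "(g has_integral (L - l)) UNIV"
proof -
  have I: "(g has_integral (G b - G a)) {a..b}" if "a \<le> b" for a b
    using assms that by (intro fundamental_theorem_of_calculus_interior_strong[of S])
      (auto intro: continuous_on_subset)
  have J: "g integrable_on cbox a b" for a b
  proof (cases "a \<le> b")
    case True
    then show ?thesis using I[OF True] by auto
  qed auto
  have K: "\<exists>B>0. \<forall>a b. ball 0 B \<subseteq> cbox a b \<longrightarrow> norm (integral (cbox a b) g - (L - l)) < e"
    if "e > 0" for e
  proof -
    have "eventually (\<lambda>x. dist (G x) L < e/2) at_top" "eventually (\<lambda>x. dist (G x) l < e/2) at_bot"
      using tendstoD[OF top, of "e/2"] tendstoD[OF bot, of "e/2"] that by simp_all
    then obtain B1 B2 where B: "\<And>x. x \<ge> B1 \<Longrightarrow> dist (G x) L < e/2" "\<And>x. x \<le> B2 \<Longrightarrow> dist (G x) l < e/2"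
      by (auto simp: eventually_at_top_linorder eventually_at_bot_linorder)
    define B where "B = 1 + \<bar>B1\<bar> + \<bar>B2\<bar>"
    show ?thesis
    proof (intro exI[of _ "B + 1"] conjI allI impI)
      show "B + 1 > 0" by (simp add: B_def)
      fix a b :: real assume "ball 0 (B + 1) \<subseteq> cbox a b"
      moreover have "B \<in> ball 0 (B+1)" "- B \<in> ball 0 (B+1)"
        by (auto simp: B_def)
      ultimately have "B \<in> cbox a b" "- B \<in> cbox a b" by blast+
      then have ab: "a \<le> - B" "B \<le> b" by auto
      then have eq: "integral (cbox a b) g = G b - G a"
        using I[of a b] by (simp add: B_def integral_unique)
      moreover have "dist (G b) L < e/2" "dist (G a) l < e/2"
        using ab by (intro B; simp add: B_def)+
      ultimately show "norm (integral (cbox a b) g - (L - l)) < e"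
        using norm_triangle_ineq4[of "G b - L" "G a - l"] unfolding eq dist_norm
        by (simp add: algebra_simps)
    qed
  qed
  show ?thesis
    unfolding has_integral_alt' using J K by simp
qed

lemma has_integral_exp_abs:
  fixes a p :: real
  assumes "a > 0"
  shows "((\<lambda>u. exp (- a * \<bar>u - p\<bar>)) has_integral 2 / a) UNIV"
proof -
  \<comment> \<open>The constant \<open>2 / a\<close> makes both branches equal to
    \<open>1 / a\<close> at \<open>p\<close>.\<close>
  define G where "G u = (if u \<le> p then exp (a * (u - p)) / a else 2 / a - exp (- a * (u - p)) / a)" for u
  have "((\<lambda>u. exp (- a * \<bar>u - p\<bar>)) has_integral (2 / a - 0)) UNIV"
  proof (rule has_integral_line_FTC[of "{p}" G])
    have "continuous_on ({..p} \<union> {p..}) G"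
      unfolding G_def using assms
      by (intro continuous_on_If continuous_intros) (auto simp: field_simps)
    then show "continuous_on UNIV G"
      by (rule back_subst[of "\<lambda>S. continuous_on S G"]) auto
    fix x assume "x \<notin> {p}"
    then consider "x < p" | "x > p" by fastforce
    then show "(G has_vector_derivative exp (- a * \<bar>x - p\<bar>)) (at x)"
    proof cases
      case 1
      have "((\<lambda>u. exp (a * (u - p)) / a) has_real_derivative exp (- a * \<bar>x - p\<bar>)) (at x)"
        using 1 assms by (auto intro!: derivative_eq_intros simp: algebra_simps)
      then have "((\<lambda>u. exp (a * (u - p)) / a) has_vector_derivative exp (- a * \<bar>x - p\<bar>)) (at x)"
        by (simp add: has_real_derivative_iff_has_vector_derivative)
      then show ?thesis
        by (rule has_vector_derivative_transform_within_open[of _ _ _ "{..<p}"]) (use 1 in \<open>auto simp: G_def\<close>)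
    next
      case 2
      have "((\<lambda>u. 2 / a - exp (- a * (u - p)) / a) has_real_derivative exp (- a * \<bar>x - p\<bar>)) (at x)"
        using 2 assms by (auto intro!: derivative_eq_intros simp: algebra_simps)
      then have "((\<lambda>u. 2 / a - exp (- a * (u - p)) / a) has_vector_derivative exp (- a * \<bar>x - p\<bar>)) (at x)"
        by (simp add: has_real_derivative_iff_has_vector_derivative)
      then show ?thesis
        by (rule has_vector_derivative_transform_within_open[of _ _ _ "{p<..}"]) (use 2 in \<open>auto simp: G_def\<close>)
    qed
  next
    have "((\<lambda>u. 2 / a - exp (- a * (u - p)) / a) \<longlongrightarrow> 2 / a) at_top"
      using assms by real_asymp
    then show "(G \<longlongrightarrow> 2 / a) at_top"
      by (rule Lim_transform_eventually) (auto simp: G_def intro!: eventually_mono[OF eventually_gt_at_top[of p]])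
    have "((\<lambda>u. exp (a * (u - p)) / a) \<longlongrightarrow> 0) at_bot"
      using assms by real_asymp
    then show "(G \<longlongrightarrow> 0) at_bot"
      by (rule Lim_transform_eventually) (auto simp: G_def intro!: eventually_mono[OF eventually_le_at_bot[of p]])
  qed auto
  then show ?thesis by simp
qed

text \<open>The convergence criterion behind most integrals below: in the coordinate z = exp w a
  bound by powers of \<bar>z\<bar> at 0 and at infinity becomes decay of this kind along the
  line.\<close>

lemma exp_decay_integrable:
  fixes f :: "real \<Rightarrow> 'b::banach"
  assumes cont: "continuous_on UNIV f" and "a > 0"
    and bound: "\<And>u. norm (f u) \<le> K * exp (- a * \<bar>u - p\<bar>)"
  shows "f integrable_on UNIV" and "norm (integral UNIV f) \<le> 2 * K / a"
proof -
  have I: "((\<lambda>u. K * exp (- a * \<bar>u - p\<bar>)) has_integral K * (2 / a)) UNIV"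
    using has_integral_exp_abs[OF \<open>a > 0\<close>] by (rule has_integral_mult_right)
  show f: "f integrable_on UNIV"
  proof (rule integrable_on_all_intervals_integrable_bound)
    show "(\<lambda>x. if x \<in> UNIV then f x else 0) integrable_on cbox c d" for c d
      using cont by (auto intro!: integrable_continuous_real intro: continuous_on_subset)
    show "(\<lambda>u. K * exp (- a * \<bar>u - p\<bar>)) integrable_on UNIV"
      using I by blast
  qed (use bound in auto)
  show "norm (integral UNIV f) \<le> 2 * K / a"
    using integral_norm_bound_integral[OF f has_integral_integrable[OF I], OF bound]
    unfolding integral_unique[OF I] by (simp add: mult_ac)
qed

lemmas exp_decay_integrable0 = exp_decay_integrable[where p = 0, simplified diff_zero]

text \<open>Outside the interval \<bar>u\<bar> exceeds n, so half of the decay rate pays for the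
  factor \<open>exp (- a * real n / 2)\<close>; the other half keeps the integral
  convergent.\<close>

lemma exp_decay_tail:
  fixes f :: "real \<Rightarrow> 'b::banach"
  assumes cont: "continuous_on UNIV f" and "a > 0"
    and bound: "\<And>u. norm (f u) \<le> K * exp (- a * \<bar>u\<bar>)"
  shows "norm (integral UNIV f - integral {- real n..real n} f) \<le> 4 * K / a * exp (- a * real n / 2)"
proof -
  have "0 \<le> K" using bound[of 0] norm_ge_zero[of "f 0"] by (simp del: norm_ge_zero)
  define h where "h u = (if u \<in> {- real n..real n} then f u else 0)" for u
  have f: "f integrable_on UNIV"
    by (rule exp_decay_integrable0(1)[OF cont \<open>a > 0\<close> bound])
  have "f integrable_on {- real n..real n}"
    using cont by (auto intro!: integrable_continuous_real intro: continuous_on_subset)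
  then have h: "h integrable_on UNIV"
    unfolding h_def by (rule integrable_restrict_UNIV[THEN iffD2])
  have "integral UNIV f - integral {- real n..real n} f = integral UNIV (\<lambda>u. f u - h u)"
    unfolding integral_diff[OF f h] by (simp add: h_def[abs_def] integral_restrict_UNIV del: atLeastAtMost_iff)
  also have "norm \<dots> \<le> integral UNIV (\<lambda>u. (K * exp (- a * real n / 2)) * exp (- (a/2) * \<bar>u - 0\<bar>))"
  proof (rule integral_norm_bound_integral)
    show "(\<lambda>u. (K * exp (- a * real n / 2)) * exp (- (a/2) * \<bar>u - 0\<bar>)) integrable_on UNIV"
      using has_integral_mult_right[OF has_integral_exp_abs[of "a/2" 0]] \<open>a > 0\<close>
      by (metis has_integral_integrable half_gt_zero)
    show "norm (f u - h u) \<le> (K * exp (- a * real n / 2)) * exp (- (a/2) * \<bar>u - 0\<bar>)" for u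
    proof (cases "u \<in> {- real n..real n}")
      case False
      then have "- a * \<bar>u\<bar> \<le> - a * real n / 2 + - (a/2) * \<bar>u\<bar>"
        using \<open>a > 0\<close> by (auto simp: field_simps)
      then have "exp (- a * \<bar>u\<bar>) \<le> exp (- a * real n / 2) * exp (- (a/2) * \<bar>u\<bar>)"
        by (metis exp_le_cancel_iff exp_add)
      then have "K * exp (- a * \<bar>u\<bar>) \<le> K * (exp (- a * real n / 2) * exp (- (a/2) * \<bar>u\<bar>))"
        using \<open>0 \<le> K\<close> by (rule mult_left_mono)
      then show ?thesis using bound[of u] False by (auto simp: h_def mult_ac)
    qed (use \<open>0 \<le> K\<close> in \<open>simp add: h_def\<close>)
  qed (use f h integrable_diff in blast)
  also have "\<dots> = 4 * K / a * exp (- a * real n / 2)"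
    using integral_unique[OF has_integral_mult_right[OF has_integral_exp_abs[of "a/2" 0]]] \<open>a > 0\<close>
    by simp
  finally show ?thesis .
qed

lemma tail_tendsto_0: "a > 0 \<Longrightarrow> (\<lambda>n. c * exp (- a * real n / 2)) \<longlonglongrightarrow> 0"
  by real_asymp

lemma exp_decay_integral_limit:
  fixes f :: "real \<Rightarrow> 'b::banach"
  assumes "continuous_on UNIV f" and "a > 0"
    and "\<And>u. norm (f u) \<le> K * exp (- a * \<bar>u\<bar>)"
  shows "(\<lambda>n. integral {- real n..real n} f) \<longlonglongrightarrow> integral UNIV f"
proof -
  have "(\<lambda>n. integral UNIV f - integral {- real n..real n} f) \<longlonglongrightarrow> 0"
    by (rule Lim_null_comparison[OF always_eventually tail_tendsto_0[OF \<open>a > 0\<close>]])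
      (rule allI, rule exp_decay_tail[OF assms])
  from tendsto_diff[OF tendsto_const[of "integral UNIV f"] this] show ?thesis
    by simp
qed

text \<open>The dominating function does not depend on \<open>x\<close>, so neither does the tail
  bound. Continuity in a parameter, interchange of integrals and holomorphy in a parameter are
  carried over from compact intervals to the line by this uniformity.\<close>

lemma line_integral_uniform_limit:
  fixes f :: "'c::topological_space \<Rightarrow> real \<Rightarrow> 'b::banach"
  assumes cont: "\<And>x. x \<in> S \<Longrightarrow> continuous_on UNIV (f x)" and "a > 0"
    and bound: "\<And>x u. x \<in> S \<Longrightarrow> norm (f x u) \<le> K * exp (- a * \<bar>u\<bar>)"
  shows "uniform_limit S (\<lambda>n x. integral {- real n..real n} (f x)) (\<lambda>x. integral UNIV (f x)) sequentially"
proof (rule uniform_limitI)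
  fix e :: real assume "e > 0"
  have "eventually (\<lambda>n. 4 * K / a * exp (- a * real n / 2) < e) sequentially"
    by (rule order_tendstoD(2)[OF tail_tendsto_0[OF \<open>a > 0\<close>] \<open>e > 0\<close>])
  then show "\<forall>\<^sub>F n in sequentially. \<forall>x\<in>S. dist (integral {- real n..real n} (f x)) (integral UNIV (f x)) < e"
  proof eventually_elim
    case (elim n)
    then show ?case
      using exp_decay_tail[of "f _", OF cont \<open>a > 0\<close> bound, of _ n]
      by (auto simp: dist_norm norm_minus_commute intro: le_less_trans)
  qed
qed

lemma line_integral_continuous:
  fixes f :: "'c::topological_space \<Rightarrow> real \<Rightarrow> 'b::banach"
  assumes cont: "continuous_on (S \<times> UNIV) (\<lambda>(x, u). f x u)" and "a > 0"
    and bound: "\<And>x u. x \<in> S \<Longrightarrow> norm (f x u) \<le> K * exp (- a * \<bar>u\<bar>)"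
  shows "continuous_on S (\<lambda>x. integral UNIV (f x))"
proof (rule uniform_limit_theorem)
  have c: "continuous_on UNIV (f x)" if "x \<in> S" for x
    using continuous_on_section(1)[OF cont] that by blast
  show "uniform_limit S (\<lambda>n x. integral {- real n..real n} (f x)) (\<lambda>x. integral UNIV (f x)) sequentially"
    by (rule line_integral_uniform_limit[OF c assms(2,3)])
  have "continuous_on S (\<lambda>x. integral (cbox (- real n) (real n)) (f x))" for n
    by (rule integral_continuous_on_param) (auto intro: continuous_on_subset[OF cont])
  then show "\<forall>\<^sub>F n in sequentially. continuous_on S (\<lambda>x. integral {- real n..real n} (f x))"
    by simp
qed simp

text \<open>On rectangles continuity suffices. When the side in \<open>u\<close> grows, the left
  side converges because the inner integrals converge uniformly on the compact interval, the right
  side because \<open>G\<close> itself decays.\<close>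

lemma line_integral_swap_interval:
  fixes f :: "real \<Rightarrow> real \<Rightarrow> 'b::banach"
  assumes cont: "continuous_on ({c..d} \<times> UNIV) (\<lambda>(x, u). f x u)" and "a > 0"
    and bound: "\<And>x u. x \<in> {c..d} \<Longrightarrow> norm (f x u) \<le> K * exp (- a * \<bar>u\<bar>)"
    and "c \<le> d"
  shows "integral {c..d} (\<lambda>x. integral UNIV (f x)) = integral UNIV (\<lambda>u. integral {c..d} (\<lambda>x. f x u))"
proof -
  define G where "G u = integral {c..d} (\<lambda>x. f x u)" for u
  have c1: "continuous_on UNIV (f x)" if "x \<in> {c..d}" for x
    using continuous_on_section(1)[OF cont] that by blast
  have c2: "continuous_on {c..d} (\<lambda>x. f x u)" for u
    using continuous_on_section(2)[OF cont] by blast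
  have "continuous_on (UNIV \<times> {c..d}) (\<lambda>(u, x). f x u)"
    by (rule continuous_on_swap_args[OF cont])
  then have Gc: "continuous_on UNIV G"
    unfolding G_def using integral_continuous_on_param[of UNIV c d "\<lambda>u x. f x u"] by simp
  have Gb: "norm (G u) \<le> K * (d - c) * exp (- a * \<bar>u\<bar>)" for u
  proof -
    have "norm (G u) \<le> (K * exp (- a * \<bar>u\<bar>)) * (d - c)"
      unfolding G_def by (rule integral_bound) (use \<open>c \<le> d\<close> c2 bound in auto)
    then show ?thesis by (simp add: mult_ac)
  qed
  have "(\<lambda>n. integral {- real n..real n} G) \<longlonglongrightarrow> integral UNIV G"
    by (rule exp_decay_integral_limit[OF Gc \<open>a > 0\<close> Gb])
  moreover have "integral {- real n..real n} G = integral {c..d} (\<lambda>x. integral {- real n..real n} (f x))" for n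
    unfolding G_def
    using integral_swap_continuous[of c "- real n" d "real n" f] continuous_on_subset[OF cont]
    by (auto simp: cbox_Pair_eq Sigma_mono)
  moreover have "(\<lambda>n. integral {c..d} (\<lambda>x. integral {- real n..real n} (f x))) \<longlonglongrightarrow> integral {c..d} (\<lambda>x. integral UNIV (f x))"
  proof -
    have ul: "uniform_limit {c..d} (\<lambda>n x. integral {- real n..real n} (f x)) (\<lambda>x. integral UNIV (f x)) sequentially"
      by (rule line_integral_uniform_limit[OF c1 assms(2,3)])
    have cn: "continuous_on {c..d} (\<lambda>x. integral {- real n..real n} (f x))" for n
    proof -
      have "continuous_on {c..d} (\<lambda>x. integral (cbox (- real n) (real n)) (f x))"
        by (rule integral_continuous_on_param) (auto intro: continuous_on_subset[OF cont])
      then show ?thesis by simp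
    qed
    obtain I J where "\<And>n. ((\<lambda>x. integral {- real n..real n} (f x)) has_integral I n) {c..d}"
      "((\<lambda>x. integral UNIV (f x)) has_integral J) {c..d}" "I \<longlonglongrightarrow> J"
      by (rule uniform_limit_integral[OF ul cn]) auto
    moreover from this have "I = (\<lambda>n. integral {c..d} (\<lambda>x. integral {- real n..real n} (f x)))"
      by (metis integral_unique)
    ultimately show ?thesis by (simp add: integral_unique)
  qed
  ultimately have "integral UNIV G = integral {c..d} (\<lambda>x. integral UNIV (f x))"
    by (simp add: LIMSEQ_unique)
  then show ?thesis by (simp add: G_def[abs_def])
qed

text \<open>Only the variable \<open>x\<close> is truncated, which reduces the claim to
  \<open>line_integral_swap_interval\<close>. The truncation error tends to 0 and still carries the
  factor \<open>exp (- a * \<bar>u\<bar>)\<close>, so it can be integrated over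
  \<open>u\<close>.\<close>

lemma line_integral_swap:
  fixes f :: "real \<Rightarrow> real \<Rightarrow> 'b::banach"
  assumes cont: "continuous_on UNIV (\<lambda>(x, u). f x u)" and "a > 0"
    and bound: "\<And>x u. norm (f x u) \<le> K * exp (- a * \<bar>x\<bar>) * exp (- a * \<bar>u\<bar>)"
  shows "integral UNIV (\<lambda>x. integral UNIV (f x)) = integral UNIV (\<lambda>u. integral UNIV (\<lambda>x. f x u))"
proof -
  have "0 \<le> norm (f 0 0)" by simp
  also have "\<dots> \<le> K" using bound[of 0 0] by simp
  finally have "0 \<le> K" .
  have b1: "norm (f x u) \<le> K * exp (- a * \<bar>u\<bar>)" "norm (f x u) \<le> K * exp (- a * \<bar>x\<bar>)" for x u
  proof -
    have "exp (- a * \<bar>x\<bar>) * exp (- a * \<bar>u\<bar>) \<le> 1 * exp (- a * \<bar>u\<bar>)"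
      "exp (- a * \<bar>x\<bar>) * exp (- a * \<bar>u\<bar>) \<le> exp (- a * \<bar>x\<bar>) * 1"
      using \<open>a > 0\<close> by (intro mult_mono; simp)+
    then have "K * (exp (- a * \<bar>x\<bar>) * exp (- a * \<bar>u\<bar>)) \<le> K * exp (- a * \<bar>u\<bar>)"
       "K * (exp (- a * \<bar>x\<bar>) * exp (- a * \<bar>u\<bar>)) \<le> K * exp (- a * \<bar>x\<bar>)"
      using \<open>0 \<le> K\<close> by (auto intro: mult_left_mono)
    then show "norm (f x u) \<le> K * exp (- a * \<bar>u\<bar>)" "norm (f x u) \<le> K * exp (- a * \<bar>x\<bar>)"
      using bound[of x u] by auto
  qed
  have cont': "continuous_on UNIV (\<lambda>(u, x). f x u)"
    using continuous_on_swap_args[of UNIV UNIV f] cont by simp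
  have cu: "continuous_on UNIV (\<lambda>u. f x u)" for x
    using continuous_on_section(1)[of UNIV UNIV f] cont by simp
  have cx: "continuous_on UNIV (\<lambda>x. f x u)" for u
    using continuous_on_section(2)[of UNIV UNIV f] cont by simp
  define F where "F x = integral UNIV (f x)" for x
  define G where "G u = integral UNIV (\<lambda>x. f x u)" for u
  define Gn where "Gn n u = integral {- real n..real n} (\<lambda>x. f x u)" for n u
  have Fc: "continuous_on UNIV F" unfolding F_def
    by (rule line_integral_continuous[where f = f, OF _ \<open>a > 0\<close> b1(1)]) (use cont in simp)
  have Fb: "norm (F x) \<le> (2 * K / a) * exp (- a * \<bar>x\<bar>)" for x
  proof -
    have "norm (F x) \<le> 2 * (K * exp (- a * \<bar>x\<bar>)) / a" unfolding F_def
      by (rule exp_decay_integrable0(2)[OF cu \<open>a > 0\<close>]) (rule bound)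
    then show ?thesis by (simp add: mult_ac)
  qed
  have Gc: "continuous_on UNIV G" unfolding G_def
    by (rule line_integral_continuous[where f = "\<lambda>u x. f x u", OF _ \<open>a > 0\<close> b1(2)]) (use cont' in simp)
  have Gnc: "continuous_on UNIV (Gn n)" for n
  proof -
    have "continuous_on UNIV (\<lambda>u. integral (cbox (- real n) (real n)) (\<lambda>x. f x u))"
      by (rule integral_continuous_on_param) (auto intro: continuous_on_subset[OF cont'])
    then show ?thesis by (simp add: Gn_def[abs_def])
  qed
  have diff: "norm (G u - Gn n u) \<le> (4 * K / a * exp (- a * real n / 2)) * exp (- a * \<bar>u\<bar>)" for n u
  proof -
    have "norm (G u - Gn n u) \<le> 4 * (K * exp (- a * \<bar>u\<bar>)) / a * exp (- a * real n / 2)"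
      unfolding G_def Gn_def
      by (rule exp_decay_tail[OF cx \<open>a > 0\<close>]) (use bound in \<open>auto simp: mult_ac\<close>)
    then show ?thesis by (simp add: mult_ac)
  qed
  have Gb: "norm (G u) \<le> (2 * K / a) * exp (- a * \<bar>u\<bar>)" for u
  proof -
    have "norm (G u) \<le> 2 * (K * exp (- a * \<bar>u\<bar>)) / a" unfolding G_def
      by (rule exp_decay_integrable0(2)[OF cx \<open>a > 0\<close>]) (metis bound mult.assoc mult.commute)
    then show ?thesis by (simp add: mult_ac)
  qed
  have Gi: "G integrable_on UNIV"
    by (rule exp_decay_integrable0(1)[OF Gc \<open>a > 0\<close> Gb])
  have Di: "(\<lambda>u. G u - Gn n u) integrable_on UNIV" for n
    by (rule exp_decay_integrable0(1)[OF continuous_on_diff[OF Gc Gnc] \<open>a > 0\<close> diff])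
  have Gni: "Gn n integrable_on UNIV" for n
    using integrable_diff[OF Gi Di[of n]] by simp
  have "norm (integral UNIV G - integral UNIV (Gn n)) \<le> 2 * (4 * K / a * exp (- a * real n / 2)) / a" for n
    unfolding integral_diff[OF Gi Gni, symmetric]
    by (rule exp_decay_integrable0(2)[OF continuous_on_diff[OF Gc Gnc] \<open>a > 0\<close> diff])
  then have "norm (integral UNIV G - integral UNIV (Gn n)) \<le> (8 * K / a / a) * exp (- a * real n / 2)" for n
    by (simp add: mult_ac)
  then have "(\<lambda>n. integral UNIV G - integral UNIV (Gn n)) \<longlonglongrightarrow> 0"
    by (intro Lim_null_comparison[OF always_eventually tail_tendsto_0[OF \<open>a > 0\<close>]]) (rule allI)
  from tendsto_diff[OF tendsto_const[of "integral UNIV G"] this]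
  have "(\<lambda>n. integral UNIV (Gn n)) \<longlonglongrightarrow> integral UNIV G"
    by simp
  moreover have "integral UNIV (Gn n) = integral {- real n..real n} F" for n
    unfolding Gn_def F_def
    by (rule line_integral_swap_interval[symmetric, OF _ \<open>a > 0\<close> b1(1)]) (use cont continuous_on_subset in auto)
  moreover have "(\<lambda>n. integral {- real n..real n} F) \<longlonglongrightarrow> integral UNIV F"
    by (rule exp_decay_integral_limit[OF Fc \<open>a > 0\<close> Fb])
  ultimately have "integral UNIV F = integral UNIV G"
    by (simp add: LIMSEQ_unique)
  then show ?thesis by (simp add: F_def[abs_def] G_def[abs_def])
qed


section \<open>Norming functionals\<close>

text \<open>Homogeneity is asked for as an inequality, the form that is easy to verify for infima;
  scaling back by the inverse factor gives equality.\<close>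

definition sublinear :: "('a::real_vector \<Rightarrow> real) \<Rightarrow> bool" where
  "sublinear p \<longleftrightarrow> (\<forall>x y. p (x + y) \<le> p x + p y) \<and> (\<forall>c>0. \<forall>x. p (c *\<^sub>R x) \<le> c * p x)"

lemma sublinear_scale:
  assumes "sublinear p" "c > 0"
  shows "p (c *\<^sub>R x) = c * p x"
proof (rule antisym)
  have "p (inverse c *\<^sub>R c *\<^sub>R x) \<le> inverse c * p (c *\<^sub>R x)"
    using assms unfolding sublinear_def by (meson positive_imp_inverse_positive)
  then show "c * p x \<le> p (c *\<^sub>R x)" using assms by (simp add: field_simps)
qed (use assms in \<open>auto simp: sublinear_def\<close>)

lemma sublinear_0: "sublinear p \<Longrightarrow> p 0 = 0"
  using sublinear_scale[of p 2 0] by simp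

lemma sublinear_ge:
  assumes "sublinear p"
  shows "- p (- x) \<le> p x"
proof -
  have "p (x + - x) \<le> p x + p (- x)" using assms by (simp only: sublinear_def)
  then show ?thesis using sublinear_0[OF assms] by simp
qed

text \<open>The standard modification of a sublinear functional in the direction y: it stays
  sublinear and below p, and drops to at most - p y at - y. A minimal p must therefore be
  odd.\<close>

definition sublinear_shift :: "('a::real_vector \<Rightarrow> real) \<Rightarrow> 'a \<Rightarrow> 'a \<Rightarrow> real" where
  "sublinear_shift p y x = (INF t\<in>{0..}. p (x + t *\<^sub>R y) - t * p y)"

text \<open>The lower bound - p (- x) is independent of t, so the infimum defining the shift is
  taken over a set bounded below.\<close>

lemma sublinear_shift_lower:
  assumes p: "sublinear p" and "t \<ge> 0"
  shows "- p (- x) \<le> p (x + t *\<^sub>R y) - t * p y"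
proof -
  have "t * p y = p (t *\<^sub>R y)"
    using sublinear_scale[OF p, of t y] sublinear_0[OF p] \<open>t \<ge> 0\<close> by (cases "t = 0") auto
  also have "\<dots> \<le> p (x + t *\<^sub>R y) + p (- x)"
  proof -
    have "p ((x + t *\<^sub>R y) + - x) \<le> p (x + t *\<^sub>R y) + p (- x)" using p by (simp only: sublinear_def)
    then show ?thesis by simp
  qed
  finally show ?thesis by simp
qed

lemma sublinear_shift_le:
  assumes "sublinear p" "t \<ge> 0"
  shows "sublinear_shift p y x \<le> p (x + t *\<^sub>R y) - t * p y"
  unfolding sublinear_shift_def
  by (rule cINF_lower[OF bdd_belowI2[of _ "- p (- x)"]]) (use sublinear_shift_lower assms in auto)

lemma sublinear_shift_greatest:
  assumes "\<And>t. t \<ge> 0 \<Longrightarrow> m \<le> p (x + t *\<^sub>R y) - t * p y"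
  shows "m \<le> sublinear_shift p y x"
  unfolding sublinear_shift_def by (rule cINF_greatest) (use assms in auto)

lemma sublinear_sublinear_shift:
  assumes p: "sublinear p"
  shows "sublinear (sublinear_shift p y)"
  unfolding sublinear_def
proof (intro conjI allI impI)
  fix x x'
  have "sublinear_shift p y (x + x') - (p (x' + t *\<^sub>R y) - t * p y) \<le> p (x + s *\<^sub>R y) - s * p y"
    if "s \<ge> 0" "t \<ge> 0" for s t
  proof -
    have "sublinear_shift p y (x + x') \<le> p (x + x' + (s + t) *\<^sub>R y) - (s + t) * p y"
      using that by (intro sublinear_shift_le[OF p]) auto
    also have "x + x' + (s + t) *\<^sub>R y = (x + s *\<^sub>R y) + (x' + t *\<^sub>R y)"
      by (simp add: algebra_simps)
    also have "p \<dots> \<le> p (x + s *\<^sub>R y) + p (x' + t *\<^sub>R y)"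
      using p by (auto simp: sublinear_def)
    finally show ?thesis by (simp add: algebra_simps)
  qed
  then have "sublinear_shift p y (x + x') - (p (x' + t *\<^sub>R y) - t * p y) \<le> sublinear_shift p y x"
    if "t \<ge> 0" for t
    using that by (intro sublinear_shift_greatest) auto
  then have "sublinear_shift p y (x + x') - sublinear_shift p y x \<le> sublinear_shift p y x'"
    by (intro sublinear_shift_greatest) (auto simp: algebra_simps)
  then show "sublinear_shift p y (x + x') \<le> sublinear_shift p y x + sublinear_shift p y x'"
    by simp
next
  fix c :: real and x assume "c > 0"
  have "sublinear_shift p y (c *\<^sub>R x) / c \<le> sublinear_shift p y x"
  proof (rule sublinear_shift_greatest)
    fix t :: real assume "t \<ge> 0"
    have "sublinear_shift p y (c *\<^sub>R x) \<le> p (c *\<^sub>R x + (c * t) *\<^sub>R y) - (c * t) * p y"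
      using \<open>c > 0\<close> \<open>t \<ge> 0\<close> by (intro sublinear_shift_le[OF p]) auto
    also have "c *\<^sub>R x + (c * t) *\<^sub>R y = c *\<^sub>R (x + t *\<^sub>R y)"
      by (simp add: algebra_simps)
    also have "p \<dots> = c * p (x + t *\<^sub>R y)"
      by (rule sublinear_scale[OF p \<open>c > 0\<close>])
    finally show "sublinear_shift p y (c *\<^sub>R x) / c \<le> p (x + t *\<^sub>R y) - t * p y"
      using \<open>c > 0\<close> by (simp add: field_simps)
  qed
  then show "sublinear_shift p y (c *\<^sub>R x) \<le> c * sublinear_shift p y x"
    using \<open>c > 0\<close> by (simp add: field_simps)
qed

lemma sublinear_shift_le_self: "sublinear p \<Longrightarrow> sublinear_shift p y x \<le> p x"
  using sublinear_shift_le[of p 0 y x] by simp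

lemma sublinear_shift_minus: "sublinear p \<Longrightarrow> sublinear_shift p y (- y) \<le> - p y"
  using sublinear_shift_le[of p 1 y "- y"] by (simp add: sublinear_0)

text \<open>An infimum of sublinear functionals need not be subadditive, since the nearly optimal
  members at x and at y may differ. In a chain one of them lies below the other and serves at both
  points. The function \<open>b\<close> keeps the infima finite.\<close>

lemma sublinear_INF_chain:
  assumes "C \<noteq> {}" and sub: "\<And>p. p \<in> C \<Longrightarrow> sublinear p"
    and chain: "\<And>p q. p \<in> C \<Longrightarrow> q \<in> C \<Longrightarrow> p \<le> q \<or> q \<le> p"
    and bdd: "\<And>p x. p \<in> C \<Longrightarrow> b x \<le> p x"
  shows "sublinear (\<lambda>x. INF p\<in>C. p x)"
proof -
  have bd: "bdd_below ((\<lambda>p. p x) ` C)" for x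
    by (rule bdd_belowI2[of _ "b x"]) (rule bdd)
  have low: "(INF p\<in>C. p x) \<le> p x" if "p \<in> C" for p x
    by (rule cINF_lower[OF bd that])
  show ?thesis
    unfolding sublinear_def
  proof (intro conjI allI impI)
    fix x y
    have "(INF p\<in>C. p (x + y)) - q y \<le> p x" if "p \<in> C" "q \<in> C" for p q
    proof -
      have "\<exists>r\<in>C. r \<le> p \<and> r \<le> q"
        using chain[of p q] that by auto
      then obtain r where "r \<in> C" "r \<le> p" "r \<le> q" by blast
      then have "(INF p\<in>C. p (x + y)) \<le> r x + r y"
        using low[of r "x + y"] sub[of r] unfolding sublinear_def by (meson order_trans)
      then show ?thesis
        using le_funD[OF \<open>r \<le> p\<close>, of x] le_funD[OF \<open>r \<le> q\<close>, of y] by linarith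
    qed
    then have "(INF p\<in>C. p (x + y)) - q y \<le> (INF p\<in>C. p x)" if "q \<in> C" for q
      using \<open>C \<noteq> {}\<close> that by (intro cINF_greatest) auto
    then have "(INF p\<in>C. p (x + y)) - (INF p\<in>C. p x) \<le> (INF p\<in>C. p y)"
      using \<open>C \<noteq> {}\<close> by (intro cINF_greatest) (auto simp: algebra_simps)
    then show "(INF p\<in>C. p (x + y)) \<le> (INF p\<in>C. p x) + (INF p\<in>C. p y)"
      by simp
  next
    fix c :: real and x assume "c > 0"
    have "(INF p\<in>C. p (c *\<^sub>R x)) / c \<le> (INF p\<in>C. p x)"
    proof (intro cINF_greatest \<open>C \<noteq> {}\<close>)
      fix p assume "p \<in> C"
      then have "(INF p\<in>C. p (c *\<^sub>R x)) \<le> c * p x"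
        using low[of p "c *\<^sub>R x"] sublinear_scale[OF sub \<open>c > 0\<close>, of p x] by simp
      then show "(INF p\<in>C. p (c *\<^sub>R x)) / c \<le> p x"
        using \<open>c > 0\<close> by (simp add: field_simps)
    qed
    then show "(INF p\<in>C. p (c *\<^sub>R x)) \<le> c * (INF p\<in>C. p x)"
      using \<open>c > 0\<close> by (simp add: field_simps)
  qed
qed

text \<open>
  A minimal sublinear functional is linear, since it equals all its shifts.  Shifting the norm
  once before minimising makes the resulting linear functional norming.
\<close>

lemma real_norming_functional:
  fixes x0 :: "'a::real_normed_vector"
  obtains f :: "'a \<Rightarrow> real" where "linear f" "\<And>x. f x \<le> norm x" "f x0 = norm x0"
proof -
  have nrm: "sublinear (norm :: 'a \<Rightarrow> real)"
    by (auto simp: sublinear_def norm_triangle_ineq)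
  define p0 where "p0 = sublinear_shift norm x0"
  have p0: "sublinear p0" "p0 \<le> norm" "p0 (- x0) \<le> - norm x0"
    using sublinear_sublinear_shift[OF nrm] sublinear_shift_le_self[OF nrm] sublinear_shift_minus[OF nrm]
    by (auto simp: p0_def le_fun_def)
  define D where "D = {p. sublinear p \<and> p \<le> p0}"
  \<comment> \<open>The order is reversed, so that the maximal element supplied by Zorn's lemma is a
    minimal functional.\<close>
  define P where "P p q \<longleftrightarrow> q \<le> p" for p q :: "'a \<Rightarrow> real"
  have "\<exists>m\<in>D. \<forall>a\<in>D. P m a \<longrightarrow> a = m"
  proof (rule predicate_Zorn)
    show "partial_order_on D (relation_of P D)"
      by (rule partial_order_on_relation_ofI) (auto simp: P_def)
    fix C assume C: "C \<in> Chains (relation_of P D)"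
    then have CD: "C \<subseteq> D" and ch: "\<And>p q. p \<in> C \<Longrightarrow> q \<in> C \<Longrightarrow> p \<le> q \<or> q \<le> p"
      by (auto simp: Chains_def relation_of_def P_def)
    show "\<exists>u\<in>D. \<forall>a\<in>C. P a u"
    proof (cases "C = {}")
      case True
      then show ?thesis using p0 by (auto simp: D_def)
    next
      case False
      have lb: "- norm x \<le> p x" if "p \<in> C" for p x
      proof -
        have "p \<le> p0" "sublinear p" using CD that by (auto simp: D_def)
        then show ?thesis
          using sublinear_ge[of p x] le_funD[OF p0(2), of "- x"] le_funD[OF \<open>p \<le> p0\<close>, of "- x"] by simp
      qed
      define u where "u x = (INF p\<in>C. p x)" for x
      have "sublinear u"
        unfolding u_def using False CD ch lb by (intro sublinear_INF_chain[where b = "\<lambda>x. - norm x"]) (auto simp: D_def)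
      moreover have "u \<le> p" if "p \<in> C" for p
        unfolding u_def le_fun_def using lb that
        by (auto intro!: cINF_lower bdd_belowI2[of _ "- norm _"])
      moreover from this obtain p where "u \<le> p" "p \<le> p0"
        using False CD by (auto simp: D_def)
      ultimately have "u \<in> D" "\<forall>p\<in>C. P p u"
        using order_trans[of u p p0] by (simp_all add: D_def P_def)
      then show ?thesis by blast
    qed
  qed
  then obtain p where p: "sublinear p" "p \<le> p0" and min: "\<And>q. sublinear q \<Longrightarrow> q \<le> p \<Longrightarrow> q = p"
    by (simp add: D_def P_def) (metis order_trans)
  have "p (- y) \<le> - p y" for y
  proof -
    have "sublinear_shift p y = p"
      by (rule min[OF sublinear_sublinear_shift[OF p(1)]]) (auto simp: le_fun_def sublinear_shift_le_self[OF p(1)])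
    then show ?thesis using sublinear_shift_minus[OF p(1), of y] by simp
  qed
  then have odd: "p (- y) = - p y" for y
    using sublinear_ge[OF p(1), of "- y"] by (intro antisym) simp_all
  have add: "p (x + y) = p x + p y" for x y
  proof (rule antisym)
    show "p (x + y) \<le> p x + p y" using p(1) by (simp add: sublinear_def)
    have "p ((x + y) + - y) \<le> p (x + y) + p (- y)" using p(1) by (simp only: sublinear_def)
    then show "p x + p y \<le> p (x + y)" by (simp add: odd)
  qed
  have scale: "p (c *\<^sub>R x) = c * p x" for c x
  proof (cases c "0::real" rule: linorder_cases)
    case less
    then show ?thesis using sublinear_scale[OF p(1), of "- c" x] odd[of "c *\<^sub>R x"] by simp
  qed (use sublinear_scale[OF p(1)] sublinear_0[OF p(1)] in auto)
  show ?thesis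
  proof
    show "linear p" by (rule linearI) (auto simp: add scale)
    show le: "p x \<le> norm x" for x
      using le_funD[OF p(2), of x] le_funD[OF p0(2), of x] by linarith
    have "p (- x0) \<le> - norm x0" using le_funD[OF p(2), of "- x0"] p0(3) by linarith
    then show "p x0 = norm x0" using le[of x0] odd[of x0] by linarith
  qed
qed

definition contractive_functional :: "('a::complex_banach \<Rightarrow> complex) \<Rightarrow> bool" where
  "contractive_functional \<phi> \<longleftrightarrow>
     (\<forall>x y. \<phi> (x + y) = \<phi> x + \<phi> y) \<and> (\<forall>c x. \<phi> (c *\<^sub>C x) = c * \<phi> x) \<and> (\<forall>x. cmod (\<phi> x) \<le> norm x)"

lemma contractive_functionalD:
  assumes "contractive_functional \<phi>"
  shows "\<phi> (x + y) = \<phi> x + \<phi> y" "\<phi> (c *\<^sub>C x) = c * \<phi> x" "cmod (\<phi> x) \<le> norm x"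
    "bounded_linear \<phi>" "\<phi> (x - y) = \<phi> x - \<phi> y" "\<phi> 0 = 0" "\<phi> (- x) = - \<phi> x" "\<phi> (r *\<^sub>R x) = r *\<^sub>R \<phi> x"
proof -
  show 1: "\<phi> (x + y) = \<phi> x + \<phi> y" "\<phi> (c *\<^sub>C x) = c * \<phi> x" "cmod (\<phi> x) \<le> norm x" for x y c
    using assms by (auto simp: contractive_functional_def)
  show 2: "\<phi> (r *\<^sub>R x) = r *\<^sub>R \<phi> x" for r x
    using 1(2)[of "complex_of_real r" x] by (simp add: scaleC_of_real scaleR_conv_of_real)
  show bl: "bounded_linear \<phi>"
    by (rule bounded_linear_intro[of _ 1]) (auto simp: 1 2)
  show "\<phi> (x - y) = \<phi> x - \<phi> y" "\<phi> 0 = 0" "\<phi> (- x) = - \<phi> x"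
    using bl by (auto simp: linear_simps)
qed

text \<open>Complexification f x - i f (i x) of a real norming functional. Its bound follows because
  multiplication of x by a scalar of modulus at most 1 makes the value real, and a real value is a
  value of f. At \<open>x0\<close> the real part already exhausts the norm, so the imaginary part
  vanishes.\<close>

lemma norming_functional:
  fixes x0 :: "'a::complex_banach"
  obtains \<phi> where "contractive_functional \<phi>" "\<phi> x0 = complex_of_real (norm x0)"
proof -
  obtain f :: "'a \<Rightarrow> real" where f: "linear f" "\<And>x. f x \<le> norm x" "f x0 = norm x0"
    using real_norming_functional by blast
  interpret f: linear f by fact
  define \<phi> where "\<phi> x = Complex (f x) (- f (\<i> *\<^sub>C x))" for x
  have add: "\<phi> (x + y) = \<phi> x + \<phi> y" for x y
    by (simp add: \<phi>_def f.add scaleC_add_right complex_eq_iff)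
  have re: "r *\<^sub>C x = Re r *\<^sub>R x + Im r *\<^sub>R (\<i> *\<^sub>C x)" for r and x :: 'a
  proof -
    have "r *\<^sub>C x = (complex_of_real (Re r) + complex_of_real (Im r) * \<i>) *\<^sub>C x"
      using complex_eq[of r] by (simp add: mult.commute)
    also have "\<dots> = Re r *\<^sub>R x + Im r *\<^sub>R (\<i> *\<^sub>C x)"
      by (simp only: scaleC_add_left flip: scaleC_scaleC scaleC_of_real)
    finally show ?thesis .
  qed
  have ii: "\<i> *\<^sub>C \<i> *\<^sub>C x = - x" for x :: 'a
    using re[of "-1" x] by (simp add: scaleC_scaleC)
  have fc: "f (c *\<^sub>C x) = Re c * f x + Im c * f (\<i> *\<^sub>C x)" for c x
    by (subst re) (simp add: f.add f.scaleR)
  have scale: "\<phi> (c *\<^sub>C x) = c * \<phi> x" for c x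
  proof -
    have "f (\<i> *\<^sub>C c *\<^sub>C x) = f (c *\<^sub>C \<i> *\<^sub>C x)"
      by (simp add: scaleC_scaleC mult.commute)
    also have "\<dots> = Re c * f (\<i> *\<^sub>C x) - Im c * f x"
      by (subst fc) (simp add: ii f.neg)
    finally show ?thesis
      using fc[of c x] by (simp add: \<phi>_def complex_eq_iff)
  qed
  have bound: "cmod (\<phi> x) \<le> norm x" for x
  proof -
    define c where "c = cnj (sgn (\<phi> x))"
    have "complex_of_real (cmod (\<phi> x)) = c * \<phi> x"
      by (simp add: c_def sgn_div_norm scaleR_conv_of_real complex_norm_square[symmetric] power2_eq_square field_simps)
    also have "\<dots> = \<phi> (c *\<^sub>C x)" by (simp add: scale)
    finally have "cmod (\<phi> x) = f (c *\<^sub>C x)" by (simp add: \<phi>_def complex_eq_iff)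
    also have "\<dots> \<le> cmod c * norm x" using f(2)[of "c *\<^sub>C x"] by (simp add: norm_scaleC)
    also have "\<dots> \<le> norm x" by (simp add: c_def norm_sgn)
    finally show ?thesis .
  qed
  show ?thesis
  proof
    show "contractive_functional \<phi>" by (simp add: contractive_functional_def add scale bound)
    have "Re (\<phi> x0) = norm x0" by (simp add: \<phi>_def f)
    moreover have "Im (\<phi> x0) = 0"
    proof -
      have "(Re (\<phi> x0))\<^sup>2 + (Im (\<phi> x0))\<^sup>2 \<le> (norm x0)\<^sup>2"
        using bound[of x0] unfolding cmod_power2[symmetric] by (intro power_mono) auto
      then show ?thesis using \<open>Re (\<phi> x0) = norm x0\<close> by simp
    qed
    ultimately show "\<phi> x0 = complex_of_real (norm x0)" by (simp add: complex_eq_iff)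
  qed
qed

text \<open>Reduces identities between vectors to scalar ones, to which the residue theorem
  applies.\<close>

lemma functional_separation:
  fixes x y :: "'a::complex_banach"
  assumes "\<And>\<phi>. contractive_functional \<phi> \<Longrightarrow> \<phi> x = \<phi> y"
  shows "x = y"
proof -
  obtain \<phi> where \<phi>: "contractive_functional \<phi>" "\<phi> (x - y) = complex_of_real (norm (x - y))"
    using norming_functional by blast
  have "\<phi> (x - y) = 0"
    using assms[OF \<phi>(1)] contractive_functionalD(5)[OF \<phi>(1), of x y] by simp
  then show ?thesis using \<phi>(2) by simp
qed


section \<open>The residue theorem on a horizontal strip\<close>

lemma contour_integral_linepath_same_Im:
  assumes "a < b"
  shows "contour_integral (linepath (Complex a c) (Complex b c)) f = integral {a..b} (\<lambda>x. f (Complex x c))"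
proof -
  have "contour_integral (linepath (Complex a c) (Complex b c)) f =
      (Complex b c - Complex a c) * integral {0..1} (\<lambda>x. f (linepath (Complex a c) (Complex b c) x))"
    by (simp add: contour_integral_integral)
  also have "Complex b c - Complex a c = complex_of_real (b - a)"
    by (simp add: complex_eq_iff)
  also have "integral {0..1} (\<lambda>x. f (linepath (Complex a c) (Complex b c) x)) =
      integral ((\<lambda>x. x / (b - a)) ` {0..b - a}) (\<lambda>x. f (Complex (a + (b - a) * x) c))"
  proof -
    have "linepath (Complex a c) (Complex b c) x = Complex (a + (b - a) * x) c" for x
      by (simp add: linepath_def complex_eq_iff algebra_simps)
    then show ?thesis using assms by simp
  qed
  also have "\<dots> = integral {a-a..b-a} (\<lambda>x. f (Complex (x + a) c)) / of_real (b - a)"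
    using assms by (subst integral_stretch_real) (auto simp: scaleR_conv_of_real add_ac)
  also have "\<dots> = integral {a..b} (\<lambda>x. f (Complex x c)) / of_real (b - a)"
    by (subst integral_shift_real_ivl) (rule refl)
  finally show ?thesis using assms by simp
qed

text \<open>Decay far out is enough, since a compact interval only changes the constant. Estimates
  on a strip can then be confined to the part away from the poles.\<close>

lemma exp_decay_extend:
  fixes f :: "real \<Rightarrow> 'b::real_normed_vector"
  assumes "continuous_on UNIV f" and "\<And>u. \<bar>u\<bar> \<ge> B \<Longrightarrow> norm (f u) \<le> K * exp (- a * \<bar>u\<bar>)"
  obtains K' where "\<And>u. norm (f u) \<le> K' * exp (- a * \<bar>u\<bar>)"
proof -
  have "compact ((\<lambda>u. norm (f u) * exp (a * \<bar>u\<bar>)) ` {-\<bar>B\<bar>..\<bar>B\<bar>})"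
    by (intro compact_continuous_image continuous_intros continuous_on_subset[OF assms(1)]) auto
  then obtain M where M: "\<And>u. u \<in> {-\<bar>B\<bar>..\<bar>B\<bar>} \<Longrightarrow> norm (f u) * exp (a * \<bar>u\<bar>) \<le> M"
    by (force dest!: compact_imp_bounded simp: bounded_iff)
  have *: "norm (f u) * exp (a * \<bar>u\<bar>) \<le> max M K" for u
  proof (cases "\<bar>u\<bar> \<ge> B")
    case True
    then have "norm (f u) * exp (a * \<bar>u\<bar>) \<le> K * exp (- a * \<bar>u\<bar>) * exp (a * \<bar>u\<bar>)"
      by (intro mult_right_mono assms) auto
    also have "\<dots> = K" by (simp flip: exp_add)
    finally show ?thesis by simp
  next
    case False
    then have "u \<in> {-\<bar>B\<bar>..\<bar>B\<bar>}" by auto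
    then show ?thesis using M[of u] by (simp add: max.coboundedI1)
  qed
  have "norm (f u) \<le> max M K * exp (- a * \<bar>u\<bar>)" for u
    using *[of u] by (simp add: exp_minus field_simps)
  then show ?thesis by (rule that)
qed

text \<open>The map z = exp w turns rays into horizontal lines, so this covers every rotation of a
  ray below, with \<open>pts = {}\<close> as the case of Cauchy's theorem. Rectangles with real
  parts in [- n, n] are used; their vertical sides vanish in the limit by the decay.\<close>

lemma strip_residue:
  fixes G :: "complex \<Rightarrow> complex"
  assumes "l' < l" "l < h" "h < h'" and pts: "finite pts" "\<And>p. p \<in> pts \<Longrightarrow> l < Im p \<and> Im p < h"
    and hol: "G holomorphic_on {w. l' < Im w \<and> Im w < h'} - pts" and "a > 0"
    and decay: "\<And>w. l \<le> Im w \<Longrightarrow> Im w \<le> h \<Longrightarrow> \<bar>Re w\<bar> \<ge> B \<Longrightarrow> cmod (G w) \<le> K * exp (- a * \<bar>Re w\<bar>)"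
  shows "integral UNIV (\<lambda>u. G (Complex u l)) - integral UNIV (\<lambda>u. G (Complex u h)) =
    2 * pi * \<i> * (\<Sum>p\<in>pts. residue G p)"
proof -
  define S where "S = {w. l' < Im w \<and> Im w < h'}"
  have S: "S = {w. l' < Im w} \<inter> {w. Im w < h'}" by (auto simp: S_def)
  have "open S" unfolding S by (intro open_Int open_halfspace_Im_gt open_halfspace_Im_lt)
  have "convex S" unfolding S by (intro convex_Int convex_halfspace_Im_gt convex_halfspace_Im_lt)
  have hol': "G holomorphic_on S - pts" using hol by (simp add: S_def)
  have G: "continuous_on (S - pts) G" by (rule holomorphic_on_imp_continuous_on[OF hol'])
  have line: "(\<lambda>n. integral {- real n..real n} (\<lambda>u. G (Complex u c))) \<longlonglongrightarrow> integral UNIV (\<lambda>u. G (Complex u c))"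
    if c: "c = l \<or> c = h" for c
  proof -
    have cont: "continuous_on UNIV (\<lambda>u. G (Complex u c))"
      using c assms(1-3) pts(2)
      by (intro continuous_on_compose2[OF G] continuous_on_Complex continuous_intros) (force simp: S_def)
    then obtain K' where "\<And>u. norm (G (Complex u c)) \<le> K' * exp (- a * \<bar>u\<bar>)"
      by (rule exp_decay_extend[where B = B and K = K and a = a]) (use decay[of "Complex _ c"] c \<open>l < h\<close> in auto)
    then show ?thesis by (intro exp_decay_integral_limit[OF cont \<open>a > 0\<close>])
  qed
  define side where "side c = contour_integral (linepath (Complex c l) (Complex c h)) G" for c
  \<comment> \<open>Rectangles reaching beyond this abscissa enclose all poles, and their vertical
    sides avoid them.\<close>
  obtain N0 where N0: "\<And>p. p \<in> pts \<Longrightarrow> \<bar>Re p\<bar> < N0"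
  proof
    fix p assume "p \<in> pts"
    then have "\<bar>Re p\<bar> \<le> (\<Sum>p\<in>pts. \<bar>Re p\<bar>)"
      using pts(1) by (intro member_le_sum) auto
    then show "\<bar>Re p\<bar> < (\<Sum>p\<in>pts. \<bar>Re p\<bar>) + 1" by simp
  qed
  have side_bound: "cmod (side c) \<le> K * exp (- a * \<bar>c\<bar>) * (h - l)" if "\<bar>c\<bar> \<ge> B" "\<bar>c\<bar> \<ge> N0" for c
  proof -
    have im: "w \<in> closed_segment (Complex c l) (Complex c h) \<Longrightarrow> Re w = c \<and> l \<le> Im w \<and> Im w \<le> h" for w
      using \<open>l < h\<close> by (auto simp: closed_segment_same_Re closed_segment_eq_real_ivl)
    have "G contour_integrable_on linepath (Complex c l) (Complex c h)"
    proof (rule contour_integrable_continuous_linepath, rule continuous_on_subset[OF G])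
      show "closed_segment (Complex c l) (Complex c h) \<subseteq> S - pts"
      proof
        fix w assume "w \<in> closed_segment (Complex c l) (Complex c h)"
        from im[OF this] show "w \<in> S - pts"
          using assms(1-3) that N0[of w] by (auto simp: S_def)
      qed
    qed
    then have "cmod (side c) \<le> K * exp (- a * \<bar>c\<bar>) * cmod (Complex c h - Complex c l)"
      unfolding side_def
    proof (rule contour_integral_bound_linepath)
      have "0 \<le> cmod (G (Complex c l))" by simp
      also have "\<dots> \<le> K * exp (- a * \<bar>c\<bar>)"
        using decay[of "Complex c l"] that \<open>l < h\<close> by simp
      finally show "0 \<le> K * exp (- a * \<bar>c\<bar>)" .
      show "cmod (G w) \<le> K * exp (- a * \<bar>c\<bar>)" if "w \<in> closed_segment (Complex c l) (Complex c h)" for w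
        using decay[of w] im[OF that] \<open>\<bar>c\<bar> \<ge> B\<close> by simp
    qed
    also have "cmod (Complex c h - Complex c l) = h - l"
      using \<open>l < h\<close> by (simp add: cmod_def)
    finally show ?thesis .
  qed
  have side0: "(\<lambda>n. side (real n)) \<longlonglongrightarrow> 0" "(\<lambda>n. side (- real n)) \<longlonglongrightarrow> 0"
  proof -
    have lim: "(\<lambda>n. K * exp (- a * real n) * (h - l)) \<longlonglongrightarrow> 0"
      using \<open>a > 0\<close> by real_asymp
    have ev: "eventually (\<lambda>n. real n \<ge> max B N0) sequentially"
      by (rule filterlim_real_sequentially[unfolded filterlim_at_top, rule_format])
    then have "eventually (\<lambda>n. cmod (side (real n)) \<le> K * exp (- a * real n) * (h - l)) sequentially"
      by eventually_elim (use side_bound[of "real _"] in simp)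
    then show "(\<lambda>n. side (real n)) \<longlonglongrightarrow> 0"
      by (rule Lim_null_comparison[OF _ lim])
    from ev have "eventually (\<lambda>n. cmod (side (- real n)) \<le> K * exp (- a * real n) * (h - l)) sequentially"
      by eventually_elim (use side_bound[of "- real _"] in simp)
    then show "(\<lambda>n. side (- real n)) \<longlonglongrightarrow> 0"
      by (rule Lim_null_comparison[OF _ lim])
  qed
  define I where "I n c = integral {- real n..real n} (\<lambda>u. G (Complex u c))" for n c
  have rect: "I n l + side (real n) - I n h - side (- real n) = 2 * pi * \<i> * (\<Sum>p\<in>pts. residue G p)"
    if n: "real n > N0" "real n > 0" for n
  proof -
    define r where "r = rectpath (Complex (- real n) l) (Complex (real n) h)"
    have img: "path_image r \<subseteq> S - pts"
    proof -
      have "path_image r = cbox (Complex (- real n) l) (Complex (real n) h) - box (Complex (- real n) l) (Complex (real n) h)"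
        unfolding r_def using n \<open>l < h\<close> by (intro path_image_rectpath_cbox_minus_box) auto
      then show ?thesis
        using assms(1-3) pts(2) N0 n by (force simp: S_def in_cbox_complex_iff in_box_complex_iff)
    qed
    have w1: "winding_number r p = 1" if "p \<in> pts" for p
      unfolding r_def using that pts(2) N0[of p] n by (intro winding_number_rectpath) (auto simp: in_box_complex_iff)
    have "contour_integral r G = 2 * pi * \<i> * (\<Sum>p\<in>pts. winding_number r p * residue G p)"
    proof (rule Residue_theorem[OF \<open>open S\<close> convex_connected[OF \<open>convex S\<close>] pts(1) hol' _ _ img])
      show "\<forall>z. z \<notin> S \<longrightarrow> winding_number r z = 0"
        using img by (auto intro!: winding_number_zero_outside[OF _ \<open>convex S\<close>] simp: r_def)
    qed (auto simp: r_def)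
    also have "(\<Sum>p\<in>pts. winding_number r p * residue G p) = (\<Sum>p\<in>pts. residue G p)"
      by (intro sum.cong) (auto simp: w1)
    finally have "contour_integral r G = 2 * pi * \<i> * (\<Sum>p\<in>pts. residue G p)" .
    moreover have "contour_integral r G = I n l + side (real n) - I n h - side (- real n)"
    proof -
      have int: "G contour_integrable_on linepath x y"
        if "closed_segment x y \<subseteq> path_image r" for x y
        using that img by (intro contour_integrable_continuous_linepath continuous_on_subset[OF G]) auto
      have *: "path_image r = closed_segment (Complex (- real n) l) (Complex (real n) l) \<union>
        (closed_segment (Complex (real n) l) (Complex (real n) h) \<union>
        (closed_segment (Complex (real n) h) (Complex (- real n) h) \<union>
         closed_segment (Complex (- real n) h) (Complex (- real n) l)))"
        by (simp add: r_def rectpath_def Let_def path_image_join)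
      have ints: "G contour_integrable_on linepath (Complex (- real n) l) (Complex (real n) l)"
        "G contour_integrable_on linepath (Complex (real n) l) (Complex (real n) h)"
        "G contour_integrable_on linepath (Complex (real n) h) (Complex (- real n) h)"
        "G contour_integrable_on linepath (Complex (- real n) h) (Complex (- real n) l)"
        by (intro int; unfold *; blast)+
      have "contour_integral r G = contour_integral (linepath (Complex (- real n) l) (Complex (real n) l)) G +
        (contour_integral (linepath (Complex (real n) l) (Complex (real n) h)) G +
        (contour_integral (linepath (Complex (real n) h) (Complex (- real n) h)) G +
         contour_integral (linepath (Complex (- real n) h) (Complex (- real n) l)) G))"
        using ints unfolding r_def rectpath_def Let_def by simp
      also have "contour_integral (linepath (Complex (real n) h) (Complex (- real n) h)) G = - I n h"
        using contour_integral_reversepath[of "linepath (Complex (- real n) h) (Complex (real n) h)" G] n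
        by (simp add: contour_integral_linepath_same_Im I_def)
      also have "contour_integral (linepath (Complex (- real n) h) (Complex (- real n) l)) G = - side (- real n)"
        using contour_integral_reversepath[of "linepath (Complex (- real n) l) (Complex (- real n) h)" G]
        by (simp add: side_def)
      also have "contour_integral (linepath (Complex (- real n) l) (Complex (real n) l)) G = I n l"
        using n by (simp add: contour_integral_linepath_same_Im I_def)
      finally show ?thesis by (simp add: side_def)
    qed
    ultimately show ?thesis by simp
  qed
  have "eventually (\<lambda>n. real n > max N0 0) sequentially"
    by (rule filterlim_real_sequentially[unfolded filterlim_at_top_dense, rule_format])
  then have "eventually (\<lambda>n. I n l + side (real n) - I n h - side (- real n) = 2 * pi * \<i> * (\<Sum>p\<in>pts. residue G p)) sequentially"
    by eventually_elim (use rect in auto)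
  moreover have "(\<lambda>n. I n l + side (real n) - I n h - side (- real n)) \<longlonglongrightarrow>
    integral UNIV (\<lambda>u. G (Complex u l)) + 0 - integral UNIV (\<lambda>u. G (Complex u h)) - 0"
    unfolding I_def by (intro tendsto_intros line side0) auto
  ultimately have "(\<lambda>n. 2 * pi * \<i> * (\<Sum>p\<in>pts. residue G p)) \<longlonglongrightarrow>
      integral UNIV (\<lambda>u. G (Complex u l)) + 0 - integral UNIV (\<lambda>u. G (Complex u h)) - 0"
    by (rule Lim_transform_eventually[rotated])
  then show ?thesis by (simp add: LIMSEQ_const_iff)
qed


section \<open>Resolvents\<close>

lemma scaleC_simps [simp]:
  fixes x y :: "'a::complex_banach"
  shows "1 *\<^sub>C x = x" "0 *\<^sub>C x = 0" "c *\<^sub>C 0 = (0::'a)" "c *\<^sub>C (- x) = - (c *\<^sub>C x)" "(- c) *\<^sub>C x = - (c *\<^sub>C x)"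
proof -
  show "1 *\<^sub>C x = x" "0 *\<^sub>C x = 0"
    using scaleC_of_real[of 1 x] scaleC_of_real[of 0 x] by simp_all
  show "c *\<^sub>C 0 = (0::'a)" "c *\<^sub>C (- x) = - (c *\<^sub>C x)"
    using linear_0[OF bounded_linear.linear[OF bounded_linear_scaleC]]
      linear_neg[OF bounded_linear.linear[OF bounded_linear_scaleC]] by blast+
  have "(- c) *\<^sub>C x + c *\<^sub>C x = (- c + c) *\<^sub>C x" by (simp only: scaleC_add_left)
  then show "(- c) *\<^sub>C x = - (c *\<^sub>C x)"
    using scaleC_of_real[of 0 x] by (simp add: eq_neg_iff_add_eq_0)
qed

lemma scaleC_diff:
  fixes x y :: "'a::complex_banach"
  shows "c *\<^sub>C (x - y) = c *\<^sub>C x - c *\<^sub>C y" "(c - d) *\<^sub>C x = c *\<^sub>C x - d *\<^sub>C x"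
  using scaleC_add_right[of c x "- y"] scaleC_add_left[of c "- d" x] by simp_all

lemma bounded_bilinear_scaleC: "bounded_bilinear (\<lambda>c (x::'a::complex_banach). c *\<^sub>C x)"
proof
  show "(r *\<^sub>R c) *\<^sub>C x = r *\<^sub>R c *\<^sub>C x" "c *\<^sub>C r *\<^sub>R x = r *\<^sub>R c *\<^sub>C x" for r c and x :: 'a
    by (simp_all add: scaleC_scaleC scaleR_conv_of_real mult.commute flip: scaleC_of_real)
  show "\<exists>K. \<forall>c x. norm (c *\<^sub>C (x::'a)) \<le> cmod c * norm x * K"
    by (rule exI[of _ 1]) (simp add: norm_scaleC)
qed (simp_all add: scaleC_add_left scaleC_add_right)

lemmas continuous_on_scaleC [continuous_intros] = bounded_bilinear.continuous_on[OF bounded_bilinear_scaleC]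

lemma bounded_clinear_ops_simps:
  "B \<in> bounded_clinear_ops \<Longrightarrow> blinfun_apply B (c *\<^sub>C x) = c *\<^sub>C blinfun_apply B x"
  by (simp add: bounded_clinear_ops_def)

lemma bounded_clinear_ops_intros:
  "id_blinfun \<in> bounded_clinear_ops"
  "B \<in> bounded_clinear_ops \<Longrightarrow> B' \<in> bounded_clinear_ops \<Longrightarrow> B o\<^sub>L B' \<in> bounded_clinear_ops"
  "B \<in> bounded_clinear_ops \<Longrightarrow> B'' \<in> bounded_clinear_ops \<Longrightarrow> B + B'' \<in> bounded_clinear_ops"
  "B \<in> bounded_clinear_ops \<Longrightarrow> B'' \<in> bounded_clinear_ops \<Longrightarrow> B - B'' \<in> bounded_clinear_ops"
  "B \<in> bounded_clinear_ops \<Longrightarrow> - B \<in> bounded_clinear_ops"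
  "B \<in> bounded_clinear_ops \<Longrightarrow> c *\<^sub>C B \<in> bounded_clinear_ops"
  by (simp_all add: bounded_clinear_ops_def blinfun.add_left blinfun.diff_left blinfun.minus_left
      scaleC_add_right scaleC_diff scaleC_blinfun.rep_eq scaleC_scaleC mult.commute)

lemma scaleC_compose:
  fixes B B' :: "'a::complex_banach \<Rightarrow>\<^sub>L 'a"
  shows "(c *\<^sub>C B) o\<^sub>L B' = c *\<^sub>C (B o\<^sub>L B')"
    "B \<in> bounded_clinear_ops \<Longrightarrow> B o\<^sub>L (c *\<^sub>C B') = c *\<^sub>C (B o\<^sub>L B')"
  by (auto intro!: blinfun_eqI simp: scaleC_blinfun.rep_eq bounded_clinear_ops_simps)

lemma bounded_graph_inject: "bounded_graph B = bounded_graph B' \<Longrightarrow> B = B'"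
  by (rule blinfun_eqI) (auto simp: bounded_graph_def set_eq_iff)

text \<open>One equivalence contains the domain, injectivity and surjectivity of z - A; the facts on
  resolvents below are read off it.\<close>

lemma scalar_minus_converse_iff:
  "(scalar_minus_op z A)\<inverse> = bounded_graph R \<longleftrightarrow> (\<forall>x y. (y, z *\<^sub>C y - x) \<in> A \<longleftrightarrow> y = R x)"
proof -
  have "(x, y) \<in> (scalar_minus_op z A)\<inverse> \<longleftrightarrow> (y, z *\<^sub>C y - x) \<in> A" for x y
    by (auto simp: scalar_minus_op_def intro!: exI[of _ "z *\<^sub>C y - x"])
  then show ?thesis
    by (auto simp: set_eq_iff bounded_graph_def)
qed

lemma resolventI:
  assumes "R \<in> bounded_clinear_ops" "\<And>x y. (y, z *\<^sub>C y - x) \<in> A \<longleftrightarrow> y = R x"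
  shows "z \<in> resolvent_set A" "resolvent A z = R"
proof -
  have R: "(scalar_minus_op z A)\<inverse> = bounded_graph R"
    using assms(2) by (simp add: scalar_minus_converse_iff)
  then show "z \<in> resolvent_set A" using assms(1) by (auto simp: resolvent_set_def)
  show "resolvent A z = R"
    unfolding resolvent_def
    by (rule the_equality) (use R assms(1) in \<open>auto intro: bounded_graph_inject\<close>)
qed

lemma resolvent_clinear: "z \<in> resolvent_set A \<Longrightarrow> resolvent A z \<in> bounded_clinear_ops"
  and resolvent_iff: "z \<in> resolvent_set A \<Longrightarrow> (y, z *\<^sub>C y - x) \<in> A \<longleftrightarrow> y = resolvent A z x"
proof -
  assume "z \<in> resolvent_set A"
  then obtain R where R: "R \<in> bounded_clinear_ops" "\<And>x y. (y, z *\<^sub>C y - x) \<in> A \<longleftrightarrow> y = R x"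
    by (auto simp: resolvent_set_def scalar_minus_converse_iff)
  then show "resolvent A z \<in> bounded_clinear_ops" "(y, z *\<^sub>C y - x) \<in> A \<longleftrightarrow> y = resolvent A z x"
    using resolventI[OF R] by auto
qed

lemma linear_operator_diff:
  assumes "linear_operator A" "(x, y) \<in> A" "(x', y') \<in> A"
  shows "(x - x', y - y') \<in> A"
proof -
  have add: "\<And>x y x' y'. (x, y) \<in> A \<Longrightarrow> (x', y') \<in> A \<Longrightarrow> (x + x', y + y') \<in> A"
    using assms(1) unfolding linear_operator_def by blast
  have "((-1) *\<^sub>C x', (-1) *\<^sub>C y') \<in> A" using assms by (simp only: linear_operator_def)
  from add[OF assms(2) this] show ?thesis by simp
qed

lemma resolvent_identity:
  assumes A: "linear_operator A" and z: "z \<in> resolvent_set A" and w: "w \<in> resolvent_set A"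
  shows "resolvent A z - resolvent A w = (w - z) *\<^sub>C (resolvent A z o\<^sub>L resolvent A w)"
proof (rule blinfun_eqI)
  fix x
  define y where "y = resolvent A w x"
  define u where "u = resolvent A z x"
  have "(u - y, (z *\<^sub>C u - x) - (w *\<^sub>C y - x)) \<in> A"
    using resolvent_iff[OF z, of u x] resolvent_iff[OF w, of y x]
    by (intro linear_operator_diff[OF A]) (simp_all add: u_def y_def)
  moreover have "(z *\<^sub>C u - x) - (w *\<^sub>C y - x) = z *\<^sub>C (u - y) - (w - z) *\<^sub>C y"
    by (simp add: scaleC_diff)
  ultimately have "u - y = resolvent A z ((w - z) *\<^sub>C y)"
    using resolvent_iff[OF z] by simp
  then show "(resolvent A z - resolvent A w) x = ((w - z) *\<^sub>C (resolvent A z o\<^sub>L resolvent A w)) x"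
    by (simp add: blinfun.diff_left scaleC_blinfun.rep_eq bounded_clinear_ops_simps[OF resolvent_clinear[OF z]] u_def y_def)
qed

text \<open>For distinct points the resolvent identity can be written in either order and divided by
  w - z.\<close>

lemma resolvent_commute:
  assumes A: "linear_operator A" and z: "z \<in> resolvent_set A" and w: "w \<in> resolvent_set A"
  shows "resolvent A z o\<^sub>L resolvent A w = resolvent A w o\<^sub>L resolvent A z"
proof (cases "w = z")
  case False
  have "(w - z) *\<^sub>C (resolvent A z o\<^sub>L resolvent A w) = (w - z) *\<^sub>C (resolvent A w o\<^sub>L resolvent A z)"
    using resolvent_identity[OF A z w] resolvent_identity[OF A w z]
    by (metis (no_types, opaque_lifting) minus_diff_eq scaleC_simps(5))
  then have "inverse (w - z) *\<^sub>C (w - z) *\<^sub>C (resolvent A z o\<^sub>L resolvent A w) =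
    inverse (w - z) *\<^sub>C (w - z) *\<^sub>C (resolvent A w o\<^sub>L resolvent A z)" by simp
  then show ?thesis using False by (simp add: scaleC_scaleC)
qed simp

text \<open>The equation (w - A) y = x is y = R (x - (w - z) y) with R the resolvent at z, a fixed
  point problem with contraction constant 1 / 2. Uniqueness of the fixed point makes the solution
  linear in x, and the constant 1 / 2 produces the factor 2 in the bound.\<close>

lemma resolvent_perturbation:
  fixes A :: "'a::complex_banach oper"
  assumes A: "linear_operator A" and z: "z \<in> resolvent_set A"
    and small: "cmod (w - z) * norm (resolvent A z) \<le> 1 / 2"
  shows "w \<in> resolvent_set A" and "norm (resolvent A w) \<le> 2 * norm (resolvent A z)"
proof -
  define R where "R = resolvent A z"
  have Rc: "R (c *\<^sub>C x) = c *\<^sub>C R x" for c x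
    using resolvent_clinear[OF z] by (simp add: R_def bounded_clinear_ops_simps)
  have contr: "norm (R ((w - z) *\<^sub>C y)) \<le> norm y / 2" for y
  proof -
    have "norm (R ((w - z) *\<^sub>C y)) \<le> norm R * (cmod (w - z) * norm y)"
      using norm_blinfun[of R "(w - z) *\<^sub>C y"] by (simp add: norm_scaleC)
    also have "\<dots> = (cmod (w - z) * norm R) * norm y" by simp
    also have "\<dots> \<le> (1 / 2) * norm y"
      using small by (intro mult_right_mono) (auto simp: R_def)
    finally show ?thesis by simp
  qed
  have fix1: "\<exists>!y. y = R (x - (w - z) *\<^sub>C y)" for x
  proof -
    have "\<exists>!y. R (x - (w - z) *\<^sub>C y) = y"
    proof (rule banach_fix_type[where c = "1 / 2"]; (intro allI)?)
      fix y y'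
      have "(x - (w - z) *\<^sub>C y) - (x - (w - z) *\<^sub>C y') = (w - z) *\<^sub>C (y' - y)"
        by (simp add: scaleC_diff)
      then have "R (x - (w - z) *\<^sub>C y) - R (x - (w - z) *\<^sub>C y') = R ((w - z) *\<^sub>C (y' - y))"
        by (simp flip: blinfun.diff_right)
      then show "dist (R (x - (w - z) *\<^sub>C y)) (R (x - (w - z) *\<^sub>C y')) \<le> 1 / 2 * dist y y'"
        using contr[of "y' - y"] by (simp add: dist_norm norm_minus_commute[of y y'])
    qed auto
    then show ?thesis by (auto simp: eq_commute)
  qed
  define f where "f x = (THE y. y = R (x - (w - z) *\<^sub>C y))" for x
  have f_iff: "y = R (x - (w - z) *\<^sub>C y) \<longleftrightarrow> y = f x" for x y
    using theI'[OF fix1, of x] fix1[of x] unfolding f_def by blast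
  have f_eq: "f x = R (x - (w - z) *\<^sub>C f x)" for x
    using f_iff[of "f x" x] by simp
  have f_add: "f (x + x') = f x + f x'" for x x'
  proof -
    have "f x + f x' = R (x - (w - z) *\<^sub>C f x) + R (x' - (w - z) *\<^sub>C f x')"
      using f_eq by simp
    also have "\<dots> = R ((x + x') - (w - z) *\<^sub>C (f x + f x'))"
      by (simp add: scaleC_add_right algebra_simps flip: blinfun.add_right)
    finally show ?thesis using f_iff by metis
  qed
  have f_scale: "f (c *\<^sub>C x) = c *\<^sub>C f x" for c x
  proof -
    have "c *\<^sub>C f x = c *\<^sub>C R (x - (w - z) *\<^sub>C f x)"
      using f_eq by simp
    also have "\<dots> = R (c *\<^sub>C x - (w - z) *\<^sub>C (c *\<^sub>C f x))"
      by (simp add: scaleC_diff(1) scaleC_scaleC mult.commute flip: Rc)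
    finally show ?thesis using f_iff by metis
  qed
  have f_bound: "norm (f x) \<le> norm x * (2 * norm R)" for x
  proof -
    have "f x = R x - R ((w - z) *\<^sub>C f x)"
      using f_eq[of x] by (simp add: blinfun.diff_right)
    then have "norm (f x) \<le> norm (R x) + norm (R ((w - z) *\<^sub>C f x))"
      by (metis norm_triangle_ineq4)
    also have "\<dots> \<le> norm R * norm x + norm (f x) / 2"
      using norm_blinfun contr by (intro add_mono)
    finally show ?thesis by (simp add: algebra_simps)
  qed
  have bl: "bounded_linear f"
    by (rule bounded_linear_intro[OF f_add _ f_bound]) (simp add: f_scale flip: scaleC_of_real)
  define F where "F = Blinfun f"
  have F: "blinfun_apply F = f" using bl by (simp add: F_def bounded_linear_Blinfun_apply)
  have *: "(y, w *\<^sub>C y - x) \<in> A \<longleftrightarrow> y = F x" for x y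
  proof -
    have "w *\<^sub>C y - x = z *\<^sub>C y - (x - (w - z) *\<^sub>C y)" by (simp add: scaleC_diff)
    then have "(y, w *\<^sub>C y - x) \<in> A \<longleftrightarrow> y = R (x - (w - z) *\<^sub>C y)"
      using resolvent_iff[OF z, of y "x - (w - z) *\<^sub>C y"] by (simp only: R_def)
    then show ?thesis using f_iff by (simp add: F)
  qed
  have Fc: "F \<in> bounded_clinear_ops" by (simp add: bounded_clinear_ops_def F f_scale)
  show "w \<in> resolvent_set A" by (rule resolventI(1)[OF Fc *])
  have "norm F \<le> 2 * norm R"
    using f_bound by (intro norm_blinfun_bound) (auto simp: F mult.commute)
  then show "norm (resolvent A w) \<le> 2 * norm (resolvent A z)"
    using resolventI(2)[OF Fc *] by (simp add: R_def)
qed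

lemma open_resolvent_set:
  fixes A :: "'a::complex_banach oper"
  assumes "linear_operator A"
  shows "open (resolvent_set A)"
  unfolding open_contains_ball
proof
  fix z assume z: "z \<in> resolvent_set A"
  \<comment> \<open>The \<open>+ 1\<close> keeps the radius meaningful when the resolvent has norm
    0, as on the zero space.\<close>
  have "w \<in> resolvent_set A" if "w \<in> ball z (1 / (2 * (norm (resolvent A z) + 1)))" for w
  proof (rule resolvent_perturbation(1)[OF assms z])
    have "cmod (w - z) * norm (resolvent A z) \<le> 1 / (2 * (norm (resolvent A z) + 1)) * (norm (resolvent A z) + 1)"
      using that by (intro mult_mono) (auto simp: dist_norm norm_minus_commute)
    also have "\<dots> = 1 / 2"
      using norm_ge_zero[of "resolvent A z"] by (simp add: field_simps del: norm_ge_zero)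
    finally show "cmod (w - z) * norm (resolvent A z) \<le> 1 / 2" .
  qed
  moreover have "1 / (2 * (norm (resolvent A z) + 1)) > 0"
    by (simp add: add_nonneg_pos)
  ultimately show "\<exists>e>0. ball z e \<subseteq> resolvent_set A"
    by blast
qed

lemma continuous_on_resolvent:
  fixes A :: "'a::complex_banach oper"
  assumes A: "linear_operator A"
  shows "continuous_on (resolvent_set A) (resolvent A)"
  unfolding continuous_on_def
proof
  fix z assume z: "z \<in> resolvent_set A"
  define r where "r = norm (resolvent A z)"
  have "((\<lambda>w. resolvent A w - resolvent A z) \<longlongrightarrow> 0) (at z within resolvent_set A)"
  proof (rule Lim_null_comparison)
    have "((\<lambda>w. cmod (w - z) * r) \<longlongrightarrow> cmod (z - z) * r) (at z within resolvent_set A)"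
      by (intro tendsto_intros)
    then have "eventually (\<lambda>w. cmod (w - z) * r < 1 / 2) (at z within resolvent_set A)"
      by (rule order_tendstoD(2)) simp
    moreover have "eventually (\<lambda>w. w \<in> resolvent_set A) (at z within resolvent_set A)"
      by (auto simp: eventually_at_filter)
    ultimately show "eventually (\<lambda>w. norm (resolvent A w - resolvent A z) \<le> cmod (w - z) * (2 * r * r)) (at z within resolvent_set A)"
    proof eventually_elim
      case (elim w)
      have "norm (resolvent A w - resolvent A z) = cmod (z - w) * norm (resolvent A w o\<^sub>L resolvent A z)"
        using resolvent_identity[OF A elim(2) z] by (simp add: norm_scaleC)
      also have "\<dots> \<le> cmod (z - w) * (2 * r * r)"
        unfolding r_def using resolvent_perturbation(2)[OF A z, of w] elim
        by (intro mult_left_mono order_trans[OF norm_blinfun_compose] mult_right_mono) (auto simp: r_def)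
      finally show ?case by (simp add: norm_minus_commute)
    qed
    have "((\<lambda>w. cmod (w - z) * (2 * r * r)) \<longlongrightarrow> cmod (z - z) * (2 * r * r)) (at z within resolvent_set A)"
      by (intro tendsto_intros)
    then show "((\<lambda>w. cmod (w - z) * (2 * r * r)) \<longlongrightarrow> 0) (at z within resolvent_set A)" by simp
  qed
  then show "(resolvent A \<longlongrightarrow> resolvent A z) (at z within resolvent_set A)"
    by (rule LIM_zero_cancel)
qed

text \<open>The resolvent identity gives the difference quotient - R(z) R(w) x, which converges by
  continuity of the resolvent.\<close>

lemma resolvent_holomorphic:
  fixes A :: "'a::complex_banach oper"
  assumes A: "linear_operator A" and \<phi>: "contractive_functional \<phi>"
  shows "(\<lambda>z. \<phi> (resolvent A z x)) holomorphic_on resolvent_set A"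
  unfolding holomorphic_on_open[OF open_resolvent_set[OF A]]
proof (intro ballI exI)
  fix z assume z: "z \<in> resolvent_set A"
  have "eventually (\<lambda>w. w \<in> resolvent_set A) (at z)"
    using open_resolvent_set[OF A] z by (rule eventually_at_in_open')
  then have ev: "eventually (\<lambda>w. - \<phi> (resolvent A z (resolvent A w x)) =
      (\<phi> (resolvent A w x) - \<phi> (resolvent A z x)) / (w - z)) (at z)"
    using eventually_neq_at_within[of z]
  proof eventually_elim
    case (elim w)
    have "\<phi> (resolvent A z x) - \<phi> (resolvent A w x) = \<phi> ((resolvent A z - resolvent A w) x)"
      by (simp add: blinfun.diff_left contractive_functionalD(5)[OF \<phi>])
    also have "\<dots> = (w - z) * \<phi> (resolvent A z (resolvent A w x))"
      by (simp add: resolvent_identity[OF A z elim(1)] scaleC_blinfun.rep_eq contractive_functionalD(2)[OF \<phi>])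
    finally have "\<phi> (resolvent A w x) - \<phi> (resolvent A z x) = - ((w - z) * \<phi> (resolvent A z (resolvent A w x)))"
      by (metis minus_diff_eq)
    then show ?case using elim(2) by simp
  qed
  have "(resolvent A \<longlongrightarrow> resolvent A z) (at z)"
    using continuous_on_resolvent[OF A] open_resolvent_set[OF A] z
    by (simp add: continuous_on_eq_continuous_at isCont_def)
  then have "((\<lambda>w. - \<phi> (resolvent A z (resolvent A w x))) \<longlongrightarrow> - \<phi> (resolvent A z (resolvent A z x))) (at z)"
    by (intro tendsto_minus bounded_linear.tendsto[OF contractive_functionalD(4)[OF \<phi>]]
      bounded_linear.tendsto[OF blinfun.bounded_linear_right] blinfun.tendsto tendsto_const)
  then show "((\<lambda>z. \<phi> (resolvent A z x)) has_field_derivative - \<phi> (resolvent A z (resolvent A z x))) (at z)"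
    unfolding has_field_derivative_iff by (rule Lim_transform_eventually[OF _ ev])
qed

lemma resolvent_one_plus:
  "z \<in> resolvent_set (one_plus_op A) \<longleftrightarrow> z - 1 \<in> resolvent_set A"
  "resolvent (one_plus_op A) z = resolvent A (z - 1)"
proof -
  have "scalar_minus_op z (one_plus_op A) = scalar_minus_op (z - 1) A"
    by (force simp: scalar_minus_op_def one_plus_op_def scaleC_diff algebra_simps)
  then show "z \<in> resolvent_set (one_plus_op A) \<longleftrightarrow> z - 1 \<in> resolvent_set A"
    "resolvent (one_plus_op A) z = resolvent A (z - 1)"
    by (simp_all add: resolvent_set_def resolvent_def)
qed

lemma linear_operator_one_plus:
  assumes "linear_operator A" shows "linear_operator (one_plus_op A)"
  unfolding linear_operator_def
proof (intro conjI allI impI)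
  show "single_valued (one_plus_op A)"
    using assms by (auto simp: linear_operator_def one_plus_op_def single_valued_def)
  show "(0, 0) \<in> one_plus_op A"
    using assms by (force simp: linear_operator_def one_plus_op_def)
  show "(x + x', y + y') \<in> one_plus_op A" if "(x, y) \<in> one_plus_op A \<and> (x', y') \<in> one_plus_op A" for x y x' y'
  proof -
    from that obtain a a' where "(x, a) \<in> A" "(x', a') \<in> A" "y = x + a" "y' = x' + a'"
      by (auto simp: one_plus_op_def)
    then have "(x + x', a + a') \<in> A" "y + y' = (x + x') + (a + a')"
      using assms by (auto simp: linear_operator_def)
    then show ?thesis by (auto simp: one_plus_op_def)
  qed
  show "(c *\<^sub>C x, c *\<^sub>C y) \<in> one_plus_op A" if "(x, y) \<in> one_plus_op A" for c x y
  proof -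
    from that obtain a where "(x, a) \<in> A" "y = x + a" by (auto simp: one_plus_op_def)
    then have "(c *\<^sub>C x, c *\<^sub>C a) \<in> A" "c *\<^sub>C y = c *\<^sub>C x + c *\<^sub>C a"
      using assms by (auto simp: linear_operator_def scaleC_add_right)
    then show ?thesis by (auto simp: one_plus_op_def)
  qed
qed

section \<open>Sectorial operators\<close>

text \<open>The cosine is decreasing on [0, pi], so the angle condition becomes an inequality
  between continuous functions. Openness, closures and translations of sectors are treated in this
  form, without the discontinuous \<open>Arg\<close>.\<close>

lemma sector_iff:
  assumes "0 < \<omega>" "\<omega> \<le> pi"
  shows "z \<in> sector \<omega> \<longleftrightarrow> Re z > cmod z * cos \<omega>"
proof (cases "z = 0")
  case False
  have "Re z = cmod z * cos \<bar>Arg z\<bar>"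
    using rcis_cmod_Arg[of z] by (metis Re_rcis cos_abs_real)
  then have "Re z > cmod z * cos \<omega> \<longleftrightarrow> cos \<bar>Arg z\<bar> > cos \<omega>"
    using False by simp
  also have "\<dots> \<longleftrightarrow> \<bar>Arg z\<bar> < \<omega>"
    using assms Arg_bounded[of z] by (intro cos_mono_less_eq) auto
  finally show ?thesis using False by (simp add: sector_def)
qed (simp add: sector_def)

lemma closure_sector_ge:
  assumes "0 < \<omega>" "\<omega> \<le> pi" "z \<in> closure (sector \<omega>)"
  shows "Re z \<ge> cmod z * cos \<omega>"
proof -
  have "closed {z. cmod z * cos \<omega> \<le> Re z}"
    by (intro closed_Collect_le continuous_intros)
  moreover have "sector \<omega> \<subseteq> {z. cmod z * cos \<omega> \<le> Re z}"
    using sector_iff[OF assms(1,2)] by auto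
  ultimately show ?thesis using assms(3) closure_minimal by blast
qed

lemma open_sector:
  assumes "0 < \<omega>" "\<omega> \<le> pi"
  shows "open (sector \<omega>)"
proof -
  have "sector \<omega> = {z. cmod z * cos \<omega> < Re z}" using sector_iff[OF assms] by auto
  then show ?thesis by (simp add: open_Collect_less continuous_intros)
qed

lemma exp_in_sector_iff:
  assumes "\<bar>t\<bar> \<le> pi" "0 < \<omega>" "\<omega> \<le> pi"
  shows "exp (Complex u t) \<in> sector \<omega> \<longleftrightarrow> \<bar>t\<bar> < \<omega>"
proof -
  have "exp (Complex u t) \<in> sector \<omega> \<longleftrightarrow> cos \<omega> < cos \<bar>t\<bar>"
    using sector_iff[OF assms(2,3)] by (simp add: Re_exp)
  also have "\<dots> \<longleftrightarrow> \<bar>t\<bar> < \<omega>" using assms by (intro cos_mono_less_eq) auto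
  finally show ?thesis .
qed

text \<open>Adding r increases the real part by r and changes the modulus by at most r; the sign of
  cos \<omega> decides which of the two estimates of the modulus is needed.\<close>

lemma sector_plus_pos:
  assumes "0 < \<omega>" "\<omega> \<le> pi" "z \<in> sector \<omega>" "r \<ge> 0"
  shows "z + of_real r \<in> sector \<omega>"
proof -
  have "cmod (z + of_real r) * cos \<omega> \<le> cmod z * cos \<omega> + r"
  proof (cases "cos \<omega> \<ge> 0")
    case True
    then have "cmod (z + of_real r) * cos \<omega> \<le> (cmod z + r) * cos \<omega>"
      using norm_triangle_ineq[of z "of_real r"] \<open>r \<ge> 0\<close> by (intro mult_right_mono) auto
    moreover have "r * cos \<omega> \<le> r * 1" using \<open>r \<ge> 0\<close> by (intro mult_left_mono) auto
    ultimately show ?thesis by (simp add: algebra_simps)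
  next
    case False
    have "cmod z - r \<le> cmod (z + of_real r)"
      using norm_triangle_ineq4[of "z + of_real r" "of_real r"] \<open>r \<ge> 0\<close> by simp
    then have "cmod (z + of_real r) * cos \<omega> \<le> (cmod z - r) * cos \<omega>"
      using False by (intro mult_right_mono_neg) auto
    moreover have "r * (- cos \<omega>) \<le> r * 1" using \<open>r \<ge> 0\<close> cos_ge_minus_one[of \<omega>] by (intro mult_left_mono) auto
    ultimately show ?thesis by (simp add: algebra_simps)
  qed
  then show ?thesis using assms sector_iff by simp
qed

text \<open>The definition gives a bound off the closure of a sector of angle larger than \<omega>.
  An angle strictly between \<omega> and \<theta> is taken, so that the rays of angle \<theta>, over
  which the calculus integrates, are included.\<close>

lemma sectorial_bound:
  assumes "sectorial_of_angle \<omega> A" "\<omega> < \<theta>" "\<theta> < pi"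
  obtains M where "M > 0"
    "\<And>z. z \<noteq> 0 \<Longrightarrow> Re z \<le> cmod z * cos \<theta> \<Longrightarrow> z \<in> resolvent_set A \<and> norm (resolvent A z) \<le> M / cmod z"
proof -
  have \<omega>: "0 < \<omega>" "\<omega> < pi" using assms by (auto simp: sectorial_of_angle_def)
  define \<eta> where "\<eta> = (\<omega> + \<theta>) / 2"
  have \<eta>: "\<omega> < \<eta>" "\<eta> < \<theta>" "\<eta> < pi" "0 < \<eta>" using assms \<omega> by (auto simp: \<eta>_def)
  then obtain M where M: "\<And>z. z \<notin> closure (sector \<eta>) \<Longrightarrow> norm (z *\<^sub>C resolvent A z) \<le> M"
    using assms unfolding sectorial_of_angle_def by meson
  show ?thesis
  proof
    show "max M 1 > 0" by simp
    fix z :: complex assume z: "z \<noteq> 0" "Re z \<le> cmod z * cos \<theta>"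
    have *: "z \<notin> closure (sector \<beta>)" if "0 < \<beta>" "\<beta> < \<theta>" for \<beta>
    proof
      assume "z \<in> closure (sector \<beta>)"
      then have "cmod z * cos \<beta> \<le> cmod z * cos \<theta>"
        using closure_sector_ge[of \<beta> z] that z assms by linarith
      then have "cos \<beta> \<le> cos \<theta>" using z by simp
      then show False using cos_monotone_0_pi[of \<beta> \<theta>] that assms by simp
    qed
    have "z \<in> resolvent_set A"
      using *[of \<omega>] \<omega> assms by (auto simp: sectorial_of_angle_def spectrum_def)
    moreover have "cmod z * norm (resolvent A z) \<le> max M 1"
      using M[OF *[OF \<eta>(4,2)]] by (simp add: norm_scaleC)
    ultimately show "z \<in> resolvent_set A \<and> norm (resolvent A z) \<le> max M 1 / cmod z"
      using z by (simp add: field_simps)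
  qed
qed

text \<open>Translation by 1 maps closed sectors into themselves. The bound for \<mu> R(\<mu> - 1),
  with R the resolvent of A, follows from that for (\<mu> - 1) R(\<mu> - 1): since \<mu> stays off a
  ball about 1 inside the sector, \<bar>\<mu>\<bar> / \<bar>\<mu> - 1\<bar> is bounded.\<close>

lemma sectorial_one_plus:
  assumes "sectorial_of_angle \<omega> A"
  shows "sectorial_of_angle \<omega> (one_plus_op A)"
  unfolding sectorial_of_angle_def
proof (intro conjI allI impI)
  have \<omega>: "0 < \<omega>" "\<omega> < pi" using assms by (auto simp: sectorial_of_angle_def)
  then show "0 < \<omega>" "\<omega> < pi" by auto
  show "linear_operator (one_plus_op A)"
    using assms by (intro linear_operator_one_plus) (simp add: sectorial_of_angle_def)
  have shift: "z \<in> closure (sector \<beta>)" if "z - 1 \<in> closure (sector \<beta>)" "0 < \<beta>" "\<beta> < pi" for z \<beta>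
  proof -
    have "(\<lambda>z. z + 1) ` closure (sector \<beta>) \<subseteq> closure (sector \<beta>)"
    proof (rule image_closure_subset)
      show "(\<lambda>z. z + 1) ` sector \<beta> \<subseteq> closure (sector \<beta>)"
        using sector_plus_pos[of \<beta> _ 1] that closure_subset[of "sector \<beta>"] by auto
    qed (auto intro!: continuous_intros)
    then show ?thesis using that(1) by force
  qed
  show "spectrum (one_plus_op A) \<subseteq> closure (sector \<omega>)"
  proof
    fix z assume "z \<in> spectrum (one_plus_op A)"
    then have "z - 1 \<in> spectrum A" by (simp add: spectrum_def resolvent_one_plus)
    then show "z \<in> closure (sector \<omega>)"
      using assms shift[of z \<omega>] \<omega> by (auto simp: sectorial_of_angle_def)
  qed
  fix \<eta> assume \<eta>: "\<omega> < \<eta> \<and> \<eta> < pi"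
  then obtain M where M: "\<And>z. z \<notin> closure (sector \<eta>) \<Longrightarrow> norm (z *\<^sub>C resolvent A z) \<le> M"
    using assms unfolding sectorial_of_angle_def by meson
  have "1 \<in> sector \<eta>" using \<eta> \<omega> by (auto simp: sector_def)
  then obtain d where d: "d > 0" "ball 1 d \<subseteq> sector \<eta>"
    using open_sector[of \<eta>] \<eta> \<omega> open_contains_ball[of "sector \<eta>"] by auto
  show "\<exists>M. \<forall>\<mu>. \<mu> \<notin> closure (sector \<eta>) \<longrightarrow> norm (\<mu> *\<^sub>C resolvent (one_plus_op A) \<mu>) \<le> M"
  proof (intro exI allI impI)
    fix \<mu> assume \<mu>: "\<mu> \<notin> closure (sector \<eta>)"
    then have "\<mu> \<notin> ball 1 d" using d closure_subset by blast
    then have "d \<le> cmod (\<mu> - 1)" by (simp add: dist_norm norm_minus_commute)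
    have "\<mu> - 1 \<notin> closure (sector \<eta>)" using \<mu> shift[of \<mu> \<eta>] \<eta> \<omega> by auto
    from M[OF this] have b: "cmod (\<mu> - 1) * norm (resolvent A (\<mu> - 1)) \<le> M" by (simp add: norm_scaleC)
    have "cmod \<mu> \<le> cmod (\<mu> - 1) + 1" using norm_triangle_ineq[of "\<mu> - 1" 1] by simp
    also have "1 \<le> cmod (\<mu> - 1) / d" using \<open>d \<le> cmod (\<mu> - 1)\<close> d by simp
    finally have "cmod \<mu> \<le> (1 + 1 / d) * cmod (\<mu> - 1)" by (simp add: algebra_simps)
    then have "cmod \<mu> * norm (resolvent A (\<mu> - 1)) \<le> (1 + 1 / d) * cmod (\<mu> - 1) * norm (resolvent A (\<mu> - 1))"
      by (intro mult_right_mono) auto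
    also have "\<dots> \<le> (1 + 1 / d) * M"
      using b d by (simp only: mult.assoc) (intro mult_left_mono, auto)
    finally show "norm (\<mu> *\<^sub>C resolvent (one_plus_op A) \<mu>) \<le> (1 + 1 / d) * M"
      by (simp add: norm_scaleC resolvent_one_plus)
  qed
qed


section \<open>The elementary functional calculus\<close>

text \<open>This is (\<mu> + A)^-1, the sign that occurs in the integral formulas for powers and in
  the Laplace transform of a semigroup generated by - A. The resolvent at - \<mu> inverts - \<mu> -
  A, hence the minus sign.\<close>

definition shift_inverse :: "'a::complex_banach oper \<Rightarrow> complex \<Rightarrow> 'a \<Rightarrow>\<^sub>L 'a" where
  "shift_inverse A \<mu> = - resolvent A (- \<mu>)"

lemma exp_Ln_polar: "z \<noteq> 0 \<Longrightarrow> exp (Complex (ln (cmod z)) (Arg z)) = z"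
proof -
  assume "z \<noteq> 0"
  then have "Complex (ln (cmod z)) (Arg z) = Ln z" by (simp add: complex_eq_iff Arg_eq_Im_Ln)
  then show ?thesis using \<open>z \<noteq> 0\<close> by simp
qed

lemma norm_exp_Complex [simp]: "cmod (exp (Complex u t)) = exp u"
  by simp

lemma min_exp:
  fixes s u :: real
  assumes "s > 0" shows "min (exp (s * u)) (exp (- s * u)) = exp (- s * \<bar>u\<bar>)"
proof (cases "u \<ge> 0")
  case True
  then have "0 \<le> s * u" using assms by simp
  then show ?thesis using True by (simp add: min_def)
next
  case False
  then have "s * u \<le> 0" using assms by (simp add: mult_nonneg_nonpos)
  then show ?thesis using False by (simp add: min_def)
qed

text \<open>In logarithmic coordinates decay of power type at 0 and at infinity is one two-sided
  exponential bound, uniform over the angles of the sector.\<close>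

lemma H0_infinity_bound:
  assumes "g \<in> H0_infinity \<phi>" "0 < \<phi>" "\<phi> \<le> pi"
  obtains C s where "C \<ge> 0" "s > 0"
    "\<And>u t. \<bar>t\<bar> < \<phi> \<Longrightarrow> cmod (g (exp (Complex u t))) \<le> C * exp (- s * \<bar>u\<bar>)"
proof -
  obtain C s where s: "s > 0" and C: "\<And>z. z \<in> sector \<phi> \<Longrightarrow> cmod (g z) \<le> C * min (cmod z powr s) (cmod z powr (- s))"
    using assms(1) by (auto simp: H0_infinity_def)
  have *: "cmod (g (exp (Complex u t))) \<le> C * exp (- s * \<bar>u\<bar>)" if "\<bar>t\<bar> < \<phi>" for u t
  proof -
    have "exp (Complex u t) \<in> sector \<phi>" using that assms by (subst exp_in_sector_iff) auto
    moreover have "min (exp u powr s) (exp u powr (- s)) = exp (- s * \<bar>u\<bar>)"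
      using min_exp[OF s, of u] by (simp add: powr_def)
    ultimately show ?thesis using C[of "exp (Complex u t)"] by simp
  qed
  have "0 \<le> cmod (g (exp (Complex 0 0)))" by simp
  also have "\<dots> \<le> C" using *[of 0 0] assms by simp
  finally show ?thesis using that[of C s] s * by blast
qed

lemma H0_infinityI:
  assumes "g holomorphic_on sector \<phi>" "s > 0"
    "\<And>u t. \<bar>t\<bar> < \<phi> \<Longrightarrow> cmod (g (exp (Complex u t))) \<le> C * exp (- s * \<bar>u\<bar>)"
  shows "g \<in> H0_infinity \<phi>"
proof -
  have "cmod (g z) \<le> C * min (cmod z powr s) (cmod z powr (- s))" if "z \<in> sector \<phi>" for z
  proof -
    have z: "z \<noteq> 0" "\<bar>Arg z\<bar> < \<phi>" using that by (auto simp: sector_def)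
    have "min (cmod z powr s) (cmod z powr (- s)) = exp (- s * \<bar>ln (cmod z)\<bar>)"
      using min_exp[OF assms(2), of "ln (cmod z)"] z by (simp add: powr_def)
    then show ?thesis
      using assms(3)[OF z(2), of "ln (cmod z)"] exp_Ln_polar[OF z(1)] by simp
  qed
  then show ?thesis unfolding H0_infinity_def using assms(1,2) by blast
qed

lemma H0_infinity_mult:
  assumes g: "g \<in> H0_infinity \<phi>" and \<phi>: "0 < \<phi>" "\<phi> \<le> pi"
    and h: "h holomorphic_on sector \<phi>" "\<And>z. z \<in> sector \<phi> \<Longrightarrow> cmod (h z) \<le> B"
  shows "(\<lambda>z. g z * h z) \<in> H0_infinity \<phi>"
proof -
  obtain C s where C: "C \<ge> 0" "s > 0"
    "\<And>u t. \<bar>t\<bar> < \<phi> \<Longrightarrow> cmod (g (exp (Complex u t))) \<le> C * exp (- s * \<bar>u\<bar>)"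
    using H0_infinity_bound[OF g \<phi>] by blast
  show ?thesis
  proof (rule H0_infinityI[OF _ C(2)])
    show "(\<lambda>z. g z * h z) holomorphic_on sector \<phi>"
      using g h by (intro holomorphic_intros) (auto simp: H0_infinity_def)
    fix u t :: real assume t: "\<bar>t\<bar> < \<phi>"
    then have "exp (Complex u t) \<in> sector \<phi>" using \<phi> by (subst exp_in_sector_iff) auto
    then have "cmod (g (exp (Complex u t)) * h (exp (Complex u t))) \<le> (C * exp (- s * \<bar>u\<bar>)) * B"
      unfolding norm_mult using C(3)[OF t, of u] h(2) C(1) by (intro mult_mono) auto
    then show "cmod (g (exp (Complex u t)) * h (exp (Complex u t))) \<le> (C * B) * exp (- s * \<bar>u\<bar>)"
      by (simp add: mult_ac)
  qed
qed

text \<open>With \<rho> = exp u the squared modulus is at least (1 + cos \<theta>) / 2 (r +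
  \<rho>)^2 + (1 - cos \<theta>) / 2 (r - \<rho>)^2, and (1 + cos \<theta>) / 2 is the square of cos
  (\<theta> / 2).\<close>

lemma norm_add_sector_ge:
  assumes "\<bar>t\<bar> \<le> \<theta>" "\<theta> \<le> pi" "r \<ge> 0"
  shows "cmod (of_real r + exp (Complex u t)) \<ge> cos (\<theta> / 2) * (r + exp u)"
proof -
  have c: "cos \<theta> \<le> cos t" using assms cos_monotone_0_pi_le[of "\<bar>t\<bar>" \<theta>] by simp
  have half: "(cos (\<theta> / 2))\<^sup>2 = (1 + cos \<theta>) / 2" using cos_double_cos[of "\<theta> / 2"] by simp
  have "(cmod (of_real r + exp (Complex u t)))\<^sup>2 = (r + exp u * cos t)\<^sup>2 + (exp u * sin t)\<^sup>2"
    by (simp add: cmod_power2 Re_exp Im_exp)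
  also have "\<dots> = r\<^sup>2 + 2 * r * exp u * cos t + (exp u)\<^sup>2 * ((cos t)\<^sup>2 + (sin t)\<^sup>2)"
    by algebra
  also have "\<dots> = r\<^sup>2 + 2 * r * exp u * cos t + (exp u)\<^sup>2" by simp
  also have "\<dots> \<ge> r\<^sup>2 + 2 * r * exp u * cos \<theta> + (exp u)\<^sup>2"
    using c assms(3) by (intro add_mono mult_left_mono) auto
  also have "r\<^sup>2 + 2 * r * exp u * cos \<theta> + (exp u)\<^sup>2 =
      (1 + cos \<theta>) / 2 * (r + exp u)\<^sup>2 + (1 - cos \<theta>) / 2 * (r - exp u)\<^sup>2"
    by (simp add: power2_eq_square field_simps)
  also have "\<dots> \<ge> (cos (\<theta> / 2))\<^sup>2 * (r + exp u)\<^sup>2"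
    using cos_le_one[of \<theta>] by (simp add: half)
  finally have "(cos (\<theta> / 2) * (r + exp u))\<^sup>2 \<le> (cmod (of_real r + exp (Complex u t)))\<^sup>2"
    by (simp add: power_mult_distrib)
  then show ?thesis by (rule power2_le_imp_le) simp
qed

lemma sector_add_nonneg_bounds:
  assumes "z \<in> sector \<phi>" "0 < \<phi>" "\<phi> < pi" "r \<ge> 0"
  shows "cos (\<phi> / 2) > 0" "of_real r + z \<noteq> 0" "cmod (of_real r + z) \<ge> cos (\<phi> / 2) * (r + cmod z)"
proof -
  have z: "z \<noteq> 0" "\<bar>Arg z\<bar> < \<phi>" using assms by (auto simp: sector_def)
  show c: "cos (\<phi> / 2) > 0" using assms by (intro cos_gt_zero) auto
  show b: "cmod (of_real r + z) \<ge> cos (\<phi> / 2) * (r + cmod z)"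
    using norm_add_sector_ge[of "Arg z" \<phi> r "ln (cmod z)"] assms z exp_Ln_polar[OF z(1)] by simp
  have "cos (\<phi> / 2) * (r + cmod z) > 0" using c z assms by (intro mult_pos_pos add_nonneg_pos) auto
  with b show "of_real r + z \<noteq> 0" by auto
qed

text \<open>One admissible triple of angles, for the spectrum, the integration path and the domain
  of the functions. The definition of the calculus quantifies over such triples, so the results are
  needed for each of them.\<close>

locale sector_calculus =
  fixes A :: "'a::complex_banach oper" and \<omega> \<theta> \<phi> :: real
  assumes sec: "sectorial_of_angle \<omega> A" and angles: "\<omega> < \<theta>" "\<theta> < \<phi>" "\<phi> < pi"
begin

abbreviation calc :: "(complex \<Rightarrow> complex) \<Rightarrow> 'a \<Rightarrow>\<^sub>L 'a" where "calc \<equiv> elementary_calculus \<theta> A"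

definition integrand :: "real \<Rightarrow> (complex \<Rightarrow> complex) \<Rightarrow> real \<Rightarrow> 'a \<Rightarrow>\<^sub>L 'a" where
  "integrand t g u = (exp (Complex u t) * g (exp (Complex u t))) *\<^sub>C resolvent A (exp (Complex u t))"

lemma calc_eq:
  "calc g = (1 / (2 * complex_of_real pi * \<i>)) *\<^sub>C
     (integral UNIV (integrand (- \<theta>) g) - integral UNIV (integrand \<theta> g))"
  by (simp add: elementary_calculus_def integrand_def[abs_def] Let_def)

lemma linear: "linear_operator A" and \<omega>_pos: "0 < \<omega>"
  using sec by (auto simp: sectorial_of_angle_def)

lemma pos: "0 < \<theta>" "0 < \<phi>" "\<theta> < pi" "\<phi> \<le> pi"
  using \<omega>_pos angles by auto

lemma resolvent_bound:
  obtains M where "M > 0"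
    "\<And>z. z \<noteq> 0 \<Longrightarrow> Re z \<le> cmod z * cos \<theta> \<Longrightarrow> z \<in> resolvent_set A \<and> norm (resolvent A z) \<le> M / cmod z"
  using sectorial_bound[OF sec angles(1) pos(3)] by blast

lemma ray_Re_le: "\<theta> \<le> \<bar>t\<bar> \<Longrightarrow> \<bar>t\<bar> \<le> pi \<Longrightarrow> Re (exp (Complex u t)) \<le> cmod (exp (Complex u t)) * cos \<theta>"
  using cos_monotone_0_pi_le[of \<theta> "\<bar>t\<bar>"] pos by (simp add: Re_exp)

lemma ray_resolvent_set: "\<bar>t\<bar> = \<theta> \<Longrightarrow> exp (Complex u t) \<in> resolvent_set A"
  using resolvent_bound ray_Re_le[of t u] pos by (metis exp_not_eq_zero order_refl less_imp_le)

lemma ray_sector: "\<bar>t\<bar> = \<theta> \<Longrightarrow> exp (Complex u t) \<in> sector \<phi>"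
  using pos angles by (subst exp_in_sector_iff) auto

lemma neg_resolvent_set:
  assumes "r > 0" shows "- complex_of_real r \<in> resolvent_set A"
proof -
  obtain M where "\<And>z. z \<noteq> 0 \<Longrightarrow> Re z \<le> cmod z * cos \<theta> \<Longrightarrow> z \<in> resolvent_set A \<and> norm (resolvent A z) \<le> M / cmod z"
    using resolvent_bound by blast
  moreover have "- r \<le> r * cos \<theta>"
    using mult_left_mono[of "- 1" "cos \<theta>" r] assms by simp
  ultimately show ?thesis using assms by simp
qed

lemma shift_inverse_bound:
  obtains M where "M > 0" "\<And>r. r > 0 \<Longrightarrow> norm (shift_inverse A (of_real r)) \<le> M / r"
proof -
  obtain M where M: "M > 0" "\<And>z. z \<noteq> 0 \<Longrightarrow> Re z \<le> cmod z * cos \<theta> \<Longrightarrow> z \<in> resolvent_set A \<and> norm (resolvent A z) \<le> M / cmod z"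
    using resolvent_bound by blast
  have "norm (shift_inverse A (of_real r)) \<le> M / r" if "r > 0" for r
  proof -
    have "- r \<le> r * cos \<theta>"
      using mult_left_mono[of "- 1" "cos \<theta>" r] that by simp
    then show ?thesis using M(2)[of "- complex_of_real r"] that by (simp add: shift_inverse_def)
  qed
  then show ?thesis using that M(1) by blast
qed

lemma continuous_on_ray:
  assumes "\<bar>t\<bar> = \<theta>" "continuous_on (sector \<phi>) g"
  shows "continuous_on S (\<lambda>u. g (exp (Complex u t)))"
  by (rule continuous_on_compose2[OF assms(2)])
    (use ray_sector[OF assms(1)] in \<open>auto intro!: continuous_intros continuous_on_Complex\<close>)

lemma continuous_on_ray_resolvent:
  assumes "\<bar>t\<bar> = \<theta>"
  shows "continuous_on S (\<lambda>u. resolvent A (exp (Complex u t)))"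
  by (rule continuous_on_compose2[OF continuous_on_resolvent[OF linear]])
    (use ray_resolvent_set[OF assms] in \<open>auto intro!: continuous_intros continuous_on_Complex\<close>)

text \<open>On the rays z R(z) is bounded, so with respect to du the integrand of the calculus is
  controlled by the function alone.\<close>

lemma integrand_scaled_bound:
  obtains M where "M > 0" "\<And>t u c. \<bar>t\<bar> = \<theta> \<Longrightarrow>
    norm ((exp (Complex u t) * c) *\<^sub>C resolvent A (exp (Complex u t))) \<le> M * cmod c"
proof -
  obtain M where M: "M > 0" "\<And>z. z \<noteq> 0 \<Longrightarrow> Re z \<le> cmod z * cos \<theta> \<Longrightarrow> z \<in> resolvent_set A \<and> norm (resolvent A z) \<le> M / cmod z"
    using resolvent_bound by blast
  have "norm ((exp (Complex u t) * c) *\<^sub>C resolvent A (exp (Complex u t))) \<le> M * cmod c" if "\<bar>t\<bar> = \<theta>" for t u c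
  proof -
    have "norm (resolvent A (exp (Complex u t))) \<le> M / exp u"
      using M(2)[of "exp (Complex u t)"] ray_Re_le[of t u] that pos by simp
    then have "exp u * cmod c * norm (resolvent A (exp (Complex u t))) \<le> exp u * cmod c * (M / exp u)"
      by (intro mult_left_mono) auto
    then show ?thesis by (simp add: norm_scaleC norm_mult mult_ac)
  qed
  then show ?thesis using M(1) that by blast
qed

lemma integrand_continuous:
  assumes "g \<in> H0_infinity \<phi>" "\<bar>t\<bar> = \<theta>"
  shows "continuous_on S (integrand t g)"
proof -
  have "continuous_on (sector \<phi>) g"
    using assms by (auto simp: H0_infinity_def holomorphic_on_imp_continuous_on)
  then show ?thesis
    unfolding integrand_def[abs_def] using assms(2)
    by (intro continuous_intros continuous_on_ray continuous_on_ray_resolvent continuous_on_Complex)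
qed

lemma integrand_integrable:
  assumes "g \<in> H0_infinity \<phi>" "\<bar>t\<bar> = \<theta>"
  shows "integrand t g integrable_on UNIV"
proof -
  obtain C s where C: "C \<ge> 0" "s > 0"
    "\<And>u t. \<bar>t\<bar> < \<phi> \<Longrightarrow> cmod (g (exp (Complex u t))) \<le> C * exp (- s * \<bar>u\<bar>)"
    using H0_infinity_bound[OF assms(1) pos(2,4)] by blast
  obtain M where M: "M > 0" "\<And>t u c. \<bar>t\<bar> = \<theta> \<Longrightarrow>
    norm ((exp (Complex u t) * c) *\<^sub>C resolvent A (exp (Complex u t))) \<le> M * cmod c"
    using integrand_scaled_bound by blast
  show ?thesis
  proof (rule exp_decay_integrable0(1)[OF integrand_continuous[OF assms] C(2)])
    fix u
    have "norm (integrand t g u) \<le> M * cmod (g (exp (Complex u t)))"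
      unfolding integrand_def by (rule M(2)[OF assms(2)])
    also have "\<dots> \<le> M * (C * exp (- s * \<bar>u\<bar>))"
      using C(3)[of t u] M(1) assms(2) angles by (intro mult_left_mono) auto
    finally show "norm (integrand t g u) \<le> (M * C) * exp (- s * \<bar>u\<bar>)" by simp
  qed
qed

lemma calc_cong:
  assumes "\<And>z. z \<in> sector \<phi> \<Longrightarrow> g z = h z"
  shows "calc g = calc h"
proof -
  have "integrand t g = integrand t h" if "\<bar>t\<bar> = \<theta>" for t
    using assms[OF ray_sector[OF that]] by (simp add: integrand_def[abs_def])
  from this[of \<theta>] this[of "- \<theta>"] show ?thesis using pos by (simp add: calc_eq)
qed

lemma calc_diff:
  assumes "g \<in> H0_infinity \<phi>" "h \<in> H0_infinity \<phi>"
  shows "calc (\<lambda>z. g z - c * h z) = calc g - c *\<^sub>C calc h"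
proof -
  have "integral UNIV (integrand t (\<lambda>z. g z - c * h z)) =
      integral UNIV (integrand t g) - c *\<^sub>C integral UNIV (integrand t h)" if "\<bar>t\<bar> = \<theta>" for t
  proof -
    note int = integrand_integrable[OF assms(1) that] integrand_integrable[OF assms(2) that]
    have "integrand t (\<lambda>z. g z - c * h z) = (\<lambda>u. integrand t g u - ((\<lambda>B. c *\<^sub>C B) \<circ> integrand t h) u)"
      by (simp add: integrand_def[abs_def] fun_eq_iff scaleC_scaleC algebra_simps scaleC_diff)
    then show ?thesis
      using integral_linear[OF int(2) bounded_linear_scaleC[of c]]
        integral_diff[OF int(1) integrable_linear[OF int(2) bounded_linear_scaleC[of c]]] by simp
  qed
  from this[of \<theta>] this[of "- \<theta>"] show ?thesis
    using pos by (simp add: calc_eq scaleC_diff scaleC_scaleC mult.commute)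
qed

lemma shift_inverse_clinear: "r > 0 \<Longrightarrow> shift_inverse A (of_real r) \<in> bounded_clinear_ops"
  by (simp add: shift_inverse_def bounded_clinear_ops_intros resolvent_clinear neg_resolvent_set)

text \<open>Cauchy's theorem for g(z) / (r + z), whose pole - r is outside the sector. The decay is
  that of g, as z / (r + z) is bounded on the sector, also for r = 0.\<close>

lemma rational_integral_eq:
  assumes g: "(\<lambda>z. g z / (of_real r + z)) \<in> H0_infinity \<phi>" "g \<in> H0_infinity \<phi>" and "r \<ge> 0"
  shows "integral UNIV (\<lambda>u. exp (Complex u (- \<theta>)) * (g (exp (Complex u (- \<theta>))) / (of_real r + exp (Complex u (- \<theta>))))) =
    integral UNIV (\<lambda>u. exp (Complex u \<theta>) * (g (exp (Complex u \<theta>)) / (of_real r + exp (Complex u \<theta>))))"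
proof -
  define G where "G w = exp w * (g (exp w) / (of_real r + exp w))" for w
  obtain C s where C: "C \<ge> 0" "s > 0"
    "\<And>u t. \<bar>t\<bar> < \<phi> \<Longrightarrow> cmod (g (exp (Complex u t))) \<le> C * exp (- s * \<bar>u\<bar>)"
    using H0_infinity_bound[OF g(2) pos(2,4)] by blast
  have sect: "exp w \<in> sector \<phi>" if "\<bar>Im w\<bar> < \<phi>" for w
    using exp_in_sector_iff[of "Im w" \<phi> "Re w"] that pos by simp
  have "integral UNIV (\<lambda>u. G (Complex u (- \<theta>))) - integral UNIV (\<lambda>u. G (Complex u \<theta>)) = 2 * pi * \<i> * (\<Sum>p\<in>{}. residue G p)"
  proof (rule strip_residue[where l' = "- \<phi>" and h' = \<phi> and a = s and B = 0 and K = "C / cos (\<phi> / 2)"])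
    have "((\<lambda>z. z * (g z / (of_real r + z))) \<circ> exp) holomorphic_on {w. - \<phi> < Im w \<and> Im w < \<phi>}"
    proof (rule holomorphic_on_compose_gen)
      show "(\<lambda>z. z * (g z / (of_real r + z))) holomorphic_on sector \<phi>"
        using g(1) by (intro holomorphic_on_mult holomorphic_on_ident) (simp add: H0_infinity_def)
    qed (auto intro!: holomorphic_intros sect)
    then show "G holomorphic_on {w. - \<phi> < Im w \<and> Im w < \<phi>} - {}"
      by (simp add: G_def[abs_def] o_def)
    fix w assume w: "- \<theta> \<le> Im w" "Im w \<le> \<theta>"
    then have "\<bar>Im w\<bar> < \<phi>" using angles by auto
    note b = sector_add_nonneg_bounds[OF sect[OF this] pos(2) angles(3) \<open>r \<ge> 0\<close>]
    have "cos (\<phi> / 2) * cmod (exp w) \<le> cmod (of_real r + exp w)"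
      using b \<open>r \<ge> 0\<close> by (intro order_trans[OF _ b(3)]) (auto intro!: mult_left_mono)
    then have "cmod (exp w / (of_real r + exp w)) \<le> 1 / cos (\<phi> / 2)"
      using b by (simp add: norm_divide field_simps)
    moreover have "cmod (g (exp w)) \<le> C * exp (- s * \<bar>Re w\<bar>)"
      using C(3)[of "Im w" "Re w"] \<open>\<bar>Im w\<bar> < \<phi>\<close> by simp
    ultimately have "cmod (exp w / (of_real r + exp w)) * cmod (g (exp w)) \<le> (1 / cos (\<phi> / 2)) * (C * exp (- s * \<bar>Re w\<bar>))"
      using b by (intro mult_mono) auto
    then show "cmod (G w) \<le> C / cos (\<phi> / 2) * exp (- s * \<bar>Re w\<bar>)"
      by (simp add: G_def norm_mult norm_divide mult_ac)
  qed (use C pos angles in auto)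
  then show ?thesis by (simp add: G_def)
qed

text \<open>With K = (r + A)^-1 the resolvent identity reads R(z) K = (R(z) + K) / (r + z). The term
  with K contributes a scalar Cauchy integral times K, which is the same on both rays and cancels.
  The case r = 0 is included for the sake of 1 + A, which is invertible.\<close>

lemma calc_shift_inverse:
  assumes g: "g \<in> H0_infinity \<phi>" and gr: "(\<lambda>z. g z / (of_real r + z)) \<in> H0_infinity \<phi>"
    and r: "r \<ge> 0" "- complex_of_real r \<in> resolvent_set A"
  shows "calc g o\<^sub>L shift_inverse A (of_real r) = calc (\<lambda>z. g z / (of_real r + z))"
proof -
  define K where "K = shift_inverse A (of_real r)"
  have Kc: "K \<in> bounded_clinear_ops"
    using r by (simp add: K_def shift_inverse_def bounded_clinear_ops_intros resolvent_clinear)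
  have RK: "resolvent A z o\<^sub>L K = (1 / (of_real r + z)) *\<^sub>C (resolvent A z + K)"
    if "z \<in> resolvent_set A" "of_real r + z \<noteq> 0" for z
  proof -
    have "resolvent A z - resolvent A (- of_real r) = (- of_real r - z) *\<^sub>C (resolvent A z o\<^sub>L resolvent A (- of_real r))"
      by (rule resolvent_identity[OF linear that(1) r(2)])
    also have "- of_real r - z = - (of_real r + z)" by simp
    finally have eq: "resolvent A z + K = (of_real r + z) *\<^sub>C (resolvent A z o\<^sub>L K)"
      by (simp add: K_def shift_inverse_def bounded_bilinear.minus_right[OF bounded_bilinear_blinfun_compose]
          scaleC_diff scaleC_add_left)
    show ?thesis unfolding eq using that by (simp add: scaleC_scaleC)
  qed
  have bl: "bounded_linear (\<lambda>B. B o\<^sub>L K)" 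
    by (rule bounded_bilinear.bounded_linear_left[OF bounded_bilinear_blinfun_compose])
  define q where "q t u = exp (Complex u t) * (g (exp (Complex u t)) / (of_real r + exp (Complex u t)))" for t u
  have main: "integral UNIV (integrand t g) o\<^sub>L K =
      integral UNIV (integrand t (\<lambda>z. g z / (of_real r + z))) + integral UNIV (q t) *\<^sub>C K" if t: "\<bar>t\<bar> = \<theta>" for t
  proof -
    have blK: "bounded_linear (\<lambda>c. c *\<^sub>C K)"
      by (rule bounded_bilinear.bounded_linear_left[OF bounded_bilinear_scaleC])
    have qi: "q t integrable_on UNIV"
    proof -
      obtain C s where C: "C \<ge> 0" "s > 0"
        "\<And>u t. \<bar>t\<bar> < \<phi> \<Longrightarrow> cmod (g (exp (Complex u t))) \<le> C * exp (- s * \<bar>u\<bar>)"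
        using H0_infinity_bound[OF g pos(2,4)] by blast
      have "continuous_on (sector \<phi>) (\<lambda>z. g z / (of_real r + z))"
        using gr by (auto simp: H0_infinity_def holomorphic_on_imp_continuous_on)
      from continuous_on_ray[OF t this] have "continuous_on UNIV (q t)"
        unfolding q_def[abs_def]
        by (intro continuous_on_mult continuous_on_exp continuous_on_Complex continuous_on_id continuous_on_const)
      then show ?thesis
      proof (rule exp_decay_integrable0(1)[OF _ C(2)])
        fix u
        note b = sector_add_nonneg_bounds[OF ray_sector[OF t, of u] pos(2) angles(3) \<open>r \<ge> 0\<close>]
        have "cos (\<phi> / 2) * exp u \<le> cmod (of_real r + exp (Complex u t))"
          using b(1) \<open>r \<ge> 0\<close> by (intro order_trans[OF _ b(3)]) (auto intro!: mult_left_mono)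
        then have "exp u / cmod (of_real r + exp (Complex u t)) \<le> 1 / cos (\<phi> / 2)"
          using b(1,2) by (simp add: field_simps)
        then have "(exp u / cmod (of_real r + exp (Complex u t))) * cmod (g (exp (Complex u t))) \<le> (1 / cos (\<phi> / 2)) * (C * exp (- s * \<bar>u\<bar>))"
          using C(3)[of t u] t angles b(1) by (intro mult_mono) auto
        then show "cmod (q t u) \<le> (C / cos (\<phi> / 2)) * exp (- s * \<bar>u\<bar>)"
          by (simp add: q_def norm_mult norm_divide mult_ac)
      qed
    qed
    have "integrand t g u o\<^sub>L K = integrand t (\<lambda>z. g z / (of_real r + z)) u + q t u *\<^sub>C K" for u
    proof -
      have "of_real r + exp (Complex u t) \<noteq> 0"
        using sector_add_nonneg_bounds(2)[OF ray_sector[OF t] pos(2) angles(3) r(1)] .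
      from RK[OF ray_resolvent_set[OF t] this] show ?thesis
        by (simp add: integrand_def q_def scaleC_compose scaleC_scaleC scaleC_add_right)
    qed
    then have "(\<lambda>B. B o\<^sub>L K) \<circ> integrand t g = (\<lambda>u. integrand t (\<lambda>z. g z / (of_real r + z)) u + ((\<lambda>c. c *\<^sub>C K) \<circ> q t) u)"
      by (simp add: fun_eq_iff)
    then show ?thesis
      using integral_linear[OF integrand_integrable[OF g t] bl] integral_linear[OF qi blK]
        integral_add[OF integrand_integrable[OF gr t] integrable_linear[OF qi blK]] by simp
  qed
  have "integral UNIV (q (- \<theta>)) = integral UNIV (q \<theta>)"
    using rational_integral_eq[OF gr g r(1)] by (simp add: q_def[abs_def])
  moreover have "\<bar>- \<theta>\<bar> = \<theta>" "\<bar>\<theta>\<bar> = \<theta>" using pos by auto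
  ultimately show ?thesis
    by (simp add: calc_eq scaleC_compose bounded_bilinear.diff_left[OF bounded_bilinear_blinfun_compose] main flip: K_def)
qed

text \<open>Multiplication rules pass from a family \<open>K v\<close> to its integral, because
  Fubini exchanges the integral over v with the one along the rays. The bound must decay in v and u
  simultaneously, and the decay in u has to come from the regulariser g.\<close>

lemma calc_comp_integral:
  assumes g: "g \<in> H0_infinity \<phi>" and K: "continuous_on UNIV K" "\<And>v. norm (K v) \<le> C * exp (- a * \<bar>v\<bar>)" and "a > 0"
    and comp: "\<And>v. calc g o\<^sub>L K v = calc (\<lambda>z. \<kappa> v z * g z)"
    and cont: "\<And>t. \<bar>t\<bar> = \<theta> \<Longrightarrow> continuous_on UNIV (\<lambda>(v, u). \<kappa> v (exp (Complex u t)))"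
    and bound: "\<And>t u v. \<bar>t\<bar> = \<theta> \<Longrightarrow>
      cmod (\<kappa> v (exp (Complex u t)) * g (exp (Complex u t))) \<le> D * exp (- a * \<bar>v\<bar>) * exp (- a * \<bar>u\<bar>)"
  shows "calc g o\<^sub>L integral UNIV K = calc (\<lambda>z. integral UNIV (\<lambda>v. \<kappa> v z) * g z)"
proof -
  have pm: "\<bar>\<theta>\<bar> = \<theta>" "\<bar>- \<theta>\<bar> = \<theta>" using pos by auto
  obtain M where M: "M > 0" "\<And>t u c. \<bar>t\<bar> = \<theta> \<Longrightarrow>
    norm ((exp (Complex u t) * c) *\<^sub>C resolvent A (exp (Complex u t))) \<le> M * cmod c"
    using integrand_scaled_bound by blast
  define f where "f t v u = integrand t (\<lambda>z. \<kappa> v z * g z) u" for t v u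
  have fc: "continuous_on UNIV (\<lambda>(v, u). f t v u)" if t: "\<bar>t\<bar> = \<theta>" for t
  proof -
    have gs: "continuous_on (sector \<phi>) g"
      using g by (auto simp: H0_infinity_def holomorphic_on_imp_continuous_on)
    have 1: "continuous_on UNIV (\<lambda>p. g (exp (Complex (snd p) t)))"
      by (rule continuous_on_compose2[OF continuous_on_ray[OF t gs, of UNIV]]) (auto intro!: continuous_intros)
    have 2: "continuous_on UNIV (\<lambda>p. resolvent A (exp (Complex (snd p) t)))"
      by (rule continuous_on_compose2[OF continuous_on_ray_resolvent[OF t, of UNIV]]) (auto intro!: continuous_intros)
    show ?thesis
      using cont[OF t] unfolding f_def integrand_def case_prod_beta
      by (intro continuous_intros 1 2 continuous_on_Complex) 
  qed
  have fb: "norm (f t v u) \<le> (M * D) * exp (- a * \<bar>v\<bar>) * exp (- a * \<bar>u\<bar>)" if t: "\<bar>t\<bar> = \<theta>" for t v u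
  proof -
    have "norm (f t v u) \<le> M * cmod (\<kappa> v (exp (Complex u t)) * g (exp (Complex u t)))"
      unfolding f_def integrand_def by (rule M(2)[OF t])
    also have "\<dots> \<le> M * (D * exp (- a * \<bar>v\<bar>) * exp (- a * \<bar>u\<bar>))"
      using bound[OF t] M(1) by (intro mult_left_mono) auto
    finally show ?thesis by (simp add: mult_ac)
  qed
  have "0 \<le> norm (f \<theta> 0 0)" by simp
  also have "\<dots> \<le> M * D" using fb[OF pm(1), of 0 0] by simp
  finally have MD: "0 \<le> M * D" .
  have fb': "norm (f t v u) \<le> (M * D) * exp (- a * \<bar>u\<bar>)" if t: "\<bar>t\<bar> = \<theta>" for t v u
  proof -
    have "(M * D) * exp (- a * \<bar>v\<bar>) * exp (- a * \<bar>u\<bar>) \<le> (M * D) * 1 * exp (- a * \<bar>u\<bar>)"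
      using MD \<open>a > 0\<close> by (intro mult_right_mono mult_left_mono) auto
    then show ?thesis using fb[OF t, of v u] by simp
  qed
  define F where "F t v = integral UNIV (f t v)" for t v
  have Fc: "continuous_on UNIV (F t)" if t: "\<bar>t\<bar> = \<theta>" for t
    unfolding F_def[abs_def] by (rule line_integral_continuous[OF _ \<open>a > 0\<close> fb'[OF t]]) (use fc[OF t] in simp)
  have Fi: "F t integrable_on UNIV" if t: "\<bar>t\<bar> = \<theta>" for t
  proof (rule exp_decay_integrable0(1)[OF Fc[OF t] \<open>a > 0\<close>])
    fix v
    have "norm (F t v) \<le> 2 * (M * D * exp (- a * \<bar>v\<bar>)) / a" unfolding F_def
      by (rule exp_decay_integrable0(2)[OF _ \<open>a > 0\<close> fb[OF t]])
        (use continuous_on_section(1)[of UNIV UNIV "f t"] fc[OF t] in simp)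
    then show "norm (F t v) \<le> (2 * (M * D) / a) * exp (- a * \<bar>v\<bar>)" by (simp add: mult_ac)
  qed
  have swap: "integral UNIV (F t) = integral UNIV (integrand t (\<lambda>z. integral UNIV (\<lambda>v. \<kappa> v z) * g z))" if t: "\<bar>t\<bar> = \<theta>" for t
  proof -
    have "integral UNIV (F t) = integral UNIV (\<lambda>u. integral UNIV (\<lambda>v. f t v u))"
      unfolding F_def[abs_def] by (rule line_integral_swap[OF fc[OF t] \<open>a > 0\<close> fb[OF t]])
    moreover have "integral UNIV (\<lambda>v. f t v u) = integrand t (\<lambda>z. integral UNIV (\<lambda>v. \<kappa> v z) * g z) u" for u
    proof -
      define z where "z = exp (Complex u t)"
      have bl: "bounded_linear (\<lambda>c. (z * c) *\<^sub>C resolvent A z)"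
        by (rule bounded_linear_compose[OF bounded_bilinear.bounded_linear_left[OF bounded_bilinear_scaleC]
            bounded_linear_mult_right])
      have "(\<lambda>v. \<kappa> v z * g z) integrable_on UNIV"
      proof (rule exp_decay_integrable0(1)[OF _ \<open>a > 0\<close>])
        show "continuous_on UNIV (\<lambda>v. \<kappa> v z * g z)" unfolding z_def
          using continuous_on_section(2)[of UNIV UNIV "\<lambda>v u. \<kappa> v (exp (Complex u t))" u] cont[OF t]
          by (intro continuous_intros) simp_all
        show "cmod (\<kappa> v z * g z) \<le> D * exp (- a * \<bar>u\<bar>) * exp (- a * \<bar>v\<bar>)" for v
          using bound[OF t, of v u] by (simp add: z_def mult_ac)
      qed
      from integral_linear[OF this bl]
      have "integral UNIV (\<lambda>v. (z * (\<kappa> v z * g z)) *\<^sub>C resolvent A z) = (z * integral UNIV (\<lambda>v. \<kappa> v z * g z)) *\<^sub>C resolvent A z"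
        by (simp add: o_def)
      then show ?thesis by (simp add: f_def integrand_def z_def)
    qed
    ultimately show ?thesis by simp
  qed
  have Ki: "K integrable_on UNIV" by (rule exp_decay_integrable0(1)[OF K(1) \<open>a > 0\<close> K(2)])
  have "calc g o\<^sub>L integral UNIV K = integral UNIV ((\<lambda>B. calc g o\<^sub>L B) \<circ> K)"
    by (rule integral_linear[OF Ki bounded_bilinear.bounded_linear_right[OF bounded_bilinear_blinfun_compose], symmetric])
  also have "\<dots> = integral UNIV ((\<lambda>B. (1 / (2 * complex_of_real pi * \<i>)) *\<^sub>C B) \<circ> (\<lambda>v. F (- \<theta>) v - F \<theta> v))"
    by (simp only: o_def comp) (simp add: calc_eq F_def f_def[abs_def])
  also have "\<dots> = (1 / (2 * complex_of_real pi * \<i>)) *\<^sub>C integral UNIV (\<lambda>v. F (- \<theta>) v - F \<theta> v)"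
    by (rule integral_linear[OF integrable_diff[OF Fi[OF pm(2)] Fi[OF pm(1)]] bounded_linear_scaleC])
  also have "\<dots> = (1 / (2 * complex_of_real pi * \<i>)) *\<^sub>C (integral UNIV (F (- \<theta>)) - integral UNIV (F \<theta>))"
    by (simp add: integral_diff[OF Fi[OF pm(2)] Fi[OF pm(1)]])
  finally show ?thesis by (simp add: swap[OF pm(1)] swap[OF pm(2)] calc_eq)
qed

end


section \<open>Fractional powers\<close>

lemma has_integral_line_shift:
  fixes f :: "real \<Rightarrow> 'b::banach"
  assumes "(f has_integral i) UNIV"
  shows "((\<lambda>x. f (x + c)) has_integral i) UNIV"
proof -
  have *: "(\<forall>a b. f integrable_on cbox a b)"
    "\<And>e. e > 0 \<Longrightarrow> \<exists>B>0. \<forall>a b. ball 0 B \<subseteq> cbox a b \<longrightarrow> norm (integral (cbox a b) f - i) < e"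
    using assms unfolding has_integral_alt' by auto
  have eq: "((\<lambda>x. f (x + c)) has_integral integral {a + c..b + c} f) {a..b}" for a b
  proof -
    have "f integrable_on {a + c..b + c}" using *(1)[rule_format, of "a + c" "b + c"] by simp
    then show ?thesis
      using has_integral_shift_real_ivl[of f "integral {a + c..b + c} f" "a + c" "b + c" c]
      by (simp add: integrable_integral)
  qed
  show ?thesis
    unfolding has_integral_alt'
  proof (intro conjI allI impI)
    show "(\<lambda>x. if x \<in> UNIV then f (x + c) else 0) integrable_on cbox a b" for a b
      using eq[of a b] by auto
    fix e :: real assume "e > 0"
    then obtain B where B: "B > 0" "\<And>a b. ball 0 B \<subseteq> cbox a b \<Longrightarrow> norm (integral (cbox a b) f - i) < e"
      using *(2) by blast
    show "\<exists>B>0. \<forall>a b. ball 0 B \<subseteq> cbox a b \<longrightarrow> norm (integral (cbox a b) (\<lambda>x. if x \<in> UNIV then f (x + c) else 0) - i) < e"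
    proof (intro exI[of _ "B + \<bar>c\<bar> + 1"] conjI allI impI)
      show "B + \<bar>c\<bar> + 1 > 0" using B by simp
      fix a b :: real assume ab: "ball 0 (B + \<bar>c\<bar> + 1) \<subseteq> cbox a b"
      have "B + \<bar>c\<bar> \<in> ball 0 (B + \<bar>c\<bar> + 1)" "- (B + \<bar>c\<bar>) \<in> ball 0 (B + \<bar>c\<bar> + 1)"
        using B(1) by (auto simp: abs_real_def)
      with ab have "B + \<bar>c\<bar> \<in> cbox a b" "- (B + \<bar>c\<bar>) \<in> cbox a b" by blast+
      then have "a + c \<le> - B" "B \<le> b + c" by auto
      then have "ball 0 B \<subseteq> cbox (a + c) (b + c)" by (auto simp: abs_less_iff)
      from B(2)[OF this] show "norm (integral (cbox a b) (\<lambda>x. if x \<in> UNIV then f (x + c) else 0) - i) < e"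
        using integral_unique[OF eq[of a b]] by simp
    qed
  qed
qed

section \<open>The scalar Balakrishnan integral\<close>

lemma frac_kernel_le:
  fixes s x :: real
  assumes "0 < s" "s < 1"
  shows "exp ((1 - s) * x) / (exp x + 1) \<le> exp (- min s (1 - s) * \<bar>x\<bar>)"
proof (cases "x \<ge> 0")
  case True
  have "exp ((1 - s) * x) / (exp x + 1) \<le> exp ((1 - s) * x) / exp x"
    by (intro divide_left_mono) (auto intro!: mult_pos_pos add_pos_pos)
  also have "\<dots> = exp (- s * x)" by (simp add: algebra_simps flip: exp_diff)
  also have "\<dots> \<le> exp (- min s (1 - s) * \<bar>x\<bar>)"
    using True by (auto intro!: mult_right_mono)
  finally show ?thesis .
next
  case False
  have "exp ((1 - s) * x) / (exp x + 1) \<le> exp ((1 - s) * x) / 1"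
    by (intro divide_left_mono) (auto intro!: mult_pos_pos add_pos_pos)
  also have "\<dots> \<le> exp (- min s (1 - s) * \<bar>x\<bar>)"
    using False by (auto intro!: mult_right_mono_neg)
  finally show ?thesis .
qed

text \<open>After the substitution \<lambda> = exp v this is the integral of \<lambda>^(-s) /
  (\<lambda> + 1) over the half-line, which is pi / sin (pi s) for 0 < s < 1: the normalising
  constant in Balakrishnan's formula.\<close>

definition frac_const :: "real \<Rightarrow> complex" where
  "frac_const s = integral UNIV (\<lambda>v. of_real (exp ((1 - s) * v) / (exp v + 1)))"

lemma frac_const_nonzero:
  assumes "0 < s" "s < 1"
  shows "frac_const s \<noteq> 0"
proof -
  define f where "f v = exp ((1 - s) * v) / (exp v + 1)" for v :: real
  define b where "b = min s (1 - s)"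
  have b: "b > 0" using assms by (simp add: b_def)
  have pos: "exp v + 1 > (0::real)" for v by (simp add: add_pos_pos)
  have fpos: "f v > 0" for v unfolding f_def using pos[of v] by simp
  have cont: "continuous_on S f" for S
    unfolding f_def[abs_def] using pos by (intro continuous_intros) (metis less_irrefl)
  have i: "f integrable_on UNIV"
    by (rule exp_decay_integrable0(1)[OF cont b, where K = 1])
      (use frac_kernel_le[OF assms] fpos in \<open>auto simp: f_def b_def less_imp_le abs_of_pos\<close>)
  have ci: "f integrable_on {0..1}" using cont by (rule integrable_continuous_real)
  define c :: real where "c = 1 / (exp 1 + 1)"
  have "0 < c" using pos[of 1] by (simp add: c_def)
  also have "c \<le> integral {0..1} f"
  proof (rule has_integral_le[where f = "\<lambda>_. c" and S = "{0..1::real}", rotated])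
    show "(f has_integral integral {0..1} f) {0..1}" using ci by (rule integrable_integral)
    show "c \<le> f v" if "v \<in> {0..1}" for v
      unfolding f_def c_def using that assms pos[of v] by (intro frac_le) auto
    show "((\<lambda>_. c) has_integral c) {0..1::real}"
      using has_integral_const_real[of c 0 1] by simp
  qed
  also have "\<dots> \<le> integral UNIV f"
    by (rule integral_subset_le[OF _ ci i]) (use fpos less_imp_le in auto)
  finally have "integral UNIV f > 0" .
  moreover have "frac_const s = of_real (integral UNIV f)"
    unfolding frac_const_def f_def[symmetric] using integral_linear[OF i, of complex_of_real] bounded_linear_of_real
    by (simp add: o_def)
  ultimately show ?thesis by simp
qed

text \<open>Homogeneity in exp x and exp u reduces this to \<open>frac_kernel_le\<close> at x - u
  and splits off exp (- s u).\<close>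

lemma frac_kernel_shift_le:
  fixes s x u :: real
  assumes "0 < s" "s < 1"
  shows "exp ((1 - s) * x) / (exp x + exp u) \<le> exp (- s * u) * exp (- min s (1 - s) * \<bar>x - u\<bar>)"
proof -
  have "exp x = exp u * exp (x - u)" by (simp flip: exp_add)
  then have "exp ((1 - s) * x) / (exp x + exp u) = (exp ((1 - s) * x) / exp u) / (exp (x - u) + 1)"
    by (simp add: field_simps)
  also have "exp ((1 - s) * x) / exp u = exp (- s * u) * exp ((1 - s) * (x - u))"
    by (simp add: algebra_simps flip: exp_diff exp_add)
  also have "exp (- s * u) * exp ((1 - s) * (x - u)) / (exp (x - u) + 1) =
      exp (- s * u) * (exp ((1 - s) * (x - u)) / (exp (x - u) + 1))" by simp
  also have "\<dots> \<le> exp (- s * u) * exp (- min s (1 - s) * \<bar>x - u\<bar>)"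
    by (intro mult_left_mono frac_kernel_le assms) auto
  finally show ?thesis .
qed

text \<open>For positive z = exp u the translation v - u reduces the integral to
  \<open>frac_const\<close>. A complex z = exp (u + i t) is reached by moving the line of
  integration to Im w = - t, which is possible because exp w + exp u has no zero with \<bar>Im
  w\<bar> < pi.\<close>

lemma frac_integral_polar:
  assumes s: "0 < s" "s < 1" and t: "\<bar>t\<bar> < pi"
  shows "integral UNIV (\<lambda>v. of_real (exp ((1 - s) * v)) / (of_real (exp v) + exp (Complex u t))) =
    frac_const s * exp (- of_real s * Complex u t)"
proof -
  define b where "b = min s (1 - s)"
  have b: "b > 0" using s by (simp add: b_def)
  define G where "G w = exp (of_real (1 - s) * w) / (exp w + of_real (exp u))" for w :: complex
  have nz: "exp w + of_real (exp u) \<noteq> 0" if "\<bar>Im w\<bar> < pi" for w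
  proof -
    have "cos (\<bar>Im w\<bar> / 2) * (exp u + exp (Re w)) > 0"
      using that by (intro mult_pos_pos cos_gt_zero_pi add_pos_pos) auto
    then show ?thesis
      using norm_add_sector_ge[of "Im w" "\<bar>Im w\<bar>" "exp u" "Re w"] that by (auto simp: add.commute)
  qed
  have strip: "integral UNIV (\<lambda>v. G (Complex v l)) = integral UNIV (\<lambda>v. G (Complex v h))"
    if lh: "l < h" "- pi < l" "h < pi" for l h
  proof -
    define m where "m = max \<bar>l\<bar> \<bar>h\<bar>"
    have m: "m < pi" "m \<ge> 0" using lh by (auto simp: m_def)
    then have c: "cos (m / 2) > 0" by (intro cos_gt_zero_pi) auto
    have "integral UNIV (\<lambda>v. G (Complex v l)) - integral UNIV (\<lambda>v. G (Complex v h)) = 2 * pi * \<i> * (\<Sum>p\<in>{}. residue G p)"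
    proof (rule strip_residue[where l' = "- pi" and h' = pi and a = b and B = 0
          and K = "1 / cos (m / 2) * exp (- s * u) * exp (b * \<bar>u\<bar>)"])
      show "G holomorphic_on {w. - pi < Im w \<and> Im w < pi} - {}"
        unfolding G_def[abs_def] using nz by (intro holomorphic_intros) auto
      fix w assume w: "l \<le> Im w" "Im w \<le> h"
      then have "\<bar>Im w\<bar> \<le> m" by (auto simp: m_def)
      then have ge: "cos (m / 2) * (exp (Re w) + exp u) \<le> cmod (exp w + of_real (exp u))"
        using norm_add_sector_ge[of "Im w" m "exp u" "Re w"] m by (simp add: add.commute)
      have "cmod (G w) = exp ((1 - s) * Re w) / cmod (exp w + of_real (exp u))"
        by (simp add: G_def norm_divide del: of_real_diff)
      also have "\<dots> \<le> exp ((1 - s) * Re w) / (cos (m / 2) * (exp (Re w) + exp u))"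
      proof (intro divide_left_mono ge)
        have p: "0 < cos (m / 2) * (exp (Re w) + exp u)" using c by (intro mult_pos_pos add_pos_pos) auto
        then have "0 < cmod (exp w + of_real (exp u))" using ge by linarith
        then show "0 < cmod (exp w + of_real (exp u)) * (cos (m / 2) * (exp (Re w) + exp u))"
          using p by (rule mult_pos_pos)
      qed auto
      also have "\<dots> = 1 / cos (m / 2) * (exp ((1 - s) * Re w) / (exp (Re w) + exp u))" by simp
      also have "\<dots> \<le> 1 / cos (m / 2) * (exp (- s * u) * exp (- b * \<bar>Re w - u\<bar>))"
        using c frac_kernel_shift_le[OF s, of "Re w" u] by (intro mult_left_mono) (auto simp: b_def)
      also have "\<dots> \<le> 1 / cos (m / 2) * (exp (- s * u) * (exp (b * \<bar>u\<bar>) * exp (- b * \<bar>Re w\<bar>)))"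
      proof -
        have "b * (\<bar>Re w\<bar> - \<bar>u\<bar>) \<le> b * \<bar>Re w - u\<bar>"
          using b by (intro mult_left_mono) auto
        then have "exp (- b * \<bar>Re w - u\<bar>) \<le> exp (b * \<bar>u\<bar>) * exp (- b * \<bar>Re w\<bar>)"
          by (simp add: algebra_simps flip: exp_add)
        then show ?thesis using c by (intro mult_left_mono) auto
      qed
      finally show "cmod (G w) \<le> 1 / cos (m / 2) * exp (- s * u) * exp (b * \<bar>u\<bar>) * exp (- b * \<bar>Re w\<bar>)"
        by (simp only: mult.assoc)
    qed (use lh b in auto)
    then show ?thesis by simp
  qed
  have "integral UNIV (\<lambda>v. G (Complex v (- t))) = integral UNIV (\<lambda>v. G (Complex v 0))"
    using strip[of 0 "- t"] strip[of "- t" 0] t by (cases t "0::real" rule: linorder_cases) auto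
  also have "\<dots> = exp (- of_real (s * u)) * frac_const s"
  proof -
    define f where "f v = complex_of_real (exp ((1 - s) * v) / (exp v + 1))" for v
    have "f integrable_on UNIV"
    proof (rule exp_decay_integrable0(1)[OF _ b, where K = 1])
      have "exp v + 1 \<noteq> (0::real)" for v by (smt (verit) exp_gt_zero)
      then show "continuous_on UNIV f" unfolding f_def[abs_def] by (intro continuous_intros) auto
      show "cmod (f v) \<le> 1 * exp (- b * \<bar>v\<bar>)" for v
        using frac_kernel_le[OF s, of v] by (simp add: f_def b_def norm_divide abs_of_pos add_pos_pos del: of_real_divide)
    qed
    then have "(f has_integral frac_const s) UNIV"
      unfolding frac_const_def f_def[symmetric] by (rule integrable_integral)
    from has_integral_mult_right[OF has_integral_line_shift[OF this, of "- u"], of "exp (- of_real (s * u))"]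
    have "integral UNIV (\<lambda>v. exp (- of_real (s * u)) * f (v + - u)) = exp (- of_real (s * u)) * frac_const s"
      by (rule integral_unique)
    moreover have "exp (- of_real (s * u)) * f (v + - u) = G (Complex v 0)" for v
    proof -
      have "exp v = exp u * exp (v - u)" by (simp flip: exp_add)
      then have "exp ((1 - s) * v) / (exp v + exp u) = (exp ((1 - s) * v) / exp u) / (exp (v - u) + 1)"
        by (simp add: field_simps)
      also have "exp ((1 - s) * v) / exp u = exp (- s * u) * exp ((1 - s) * (v - u))"
        by (simp add: algebra_simps flip: exp_diff exp_add)
      finally have "exp (- s * u) * (exp ((1 - s) * (v - u)) / (exp (v - u) + 1)) = exp ((1 - s) * v) / (exp v + exp u)"
        by simp
      from arg_cong[OF this, of complex_of_real] show ?thesis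
        by (simp add: f_def G_def Complex_eq exp_of_real flip: of_real_mult of_real_minus of_real_diff)
    qed
    ultimately show ?thesis by (simp only:)
  qed
  finally have main: "integral UNIV (\<lambda>v. G (Complex v (- t))) = exp (- of_real (s * u)) * frac_const s" .
  \<comment> \<open>On the shifted line exp w + exp u is exp (- i t) times exp v + exp (u + i t), so
    \<open>G\<close> is the wanted integrand up to a constant phase.\<close>
  have "G (Complex v (- t)) = exp (\<i> * of_real (s * t)) * (of_real (exp ((1 - s) * v)) / (of_real (exp v) + exp (Complex u t)))" for v
  proof -
    have e: "exp (Complex v (- t)) + of_real (exp u) = exp (- \<i> * t) * (of_real (exp v) + exp (Complex u t))"
      by (simp add: Complex_eq exp_of_real distrib_left flip: exp_add) (simp add: exp_diff exp_minus divide_inverse exp_of_real)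
    have "exp (of_real (1 - s) * Complex v (- t)) = exp (- \<i> * t) * (exp (\<i> * of_real (s * t)) * of_real (exp ((1 - s) * v)))"
      by (simp add: Complex_eq algebra_simps flip: exp_add exp_of_real)
    then show ?thesis unfolding G_def e by simp
  qed
  then have "exp (\<i> * of_real (s * t)) * integral UNIV (\<lambda>v. of_real (exp ((1 - s) * v)) / (of_real (exp v) + exp (Complex u t))) =
     exp (- of_real (s * u)) * frac_const s"
    using main by (simp only: integral_mult_right)
  then have "exp (- (\<i> * of_real (s * t))) * exp (\<i> * of_real (s * t)) * integral UNIV (\<lambda>v. of_real (exp ((1 - s) * v)) / (of_real (exp v) + exp (Complex u t))) =
     exp (- (\<i> * of_real (s * t))) * (exp (- of_real (s * u)) * frac_const s)"
    by (simp only: mult.assoc)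
  moreover have "exp (- (\<i> * of_real (s * t))) * exp (- of_real (s * u)) = exp (- of_real s * Complex u t)"
    by (simp add: Complex_eq algebra_simps flip: exp_add)
  ultimately show ?thesis by (simp add: exp_minus mult_ac)
qed

lemma frac_integral:
  assumes "0 < s" "s < 1" "z \<noteq> 0" "\<bar>Arg z\<bar> < pi"
  shows "integral UNIV (\<lambda>v. of_real (exp ((1 - s) * v)) / (of_real (exp v) + z)) = frac_const s * z powr (- of_real s)"
proof -
  have "Ln z = Complex (ln (cmod z)) (Arg z)"
    using assms(3) by (simp add: complex_eq_iff Arg_eq_Im_Ln)
  then show ?thesis
    using frac_integral_polar[OF assms(1,2,4), of "ln (cmod z)"] exp_Ln_polar[OF assms(3)] assms(3)
    by (simp add: powr_def)
qed

section \<open>Operator integrals for exponents between 0 and 1\<close>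

lemma integral_clinear:
  fixes K :: "real \<Rightarrow> 'a::complex_banach \<Rightarrow>\<^sub>L 'a"
  assumes "K integrable_on S" "\<And>v. K v \<in> bounded_clinear_ops"
  shows "integral S K \<in> bounded_clinear_ops"
proof -
  have app: "integral S K x = integral S (\<lambda>v. K v x)" "(\<lambda>v. K v x) integrable_on S" for x
    using integral_linear[OF assms(1) blinfun.bounded_linear_left[of x]]
      integrable_linear[OF assms(1) blinfun.bounded_linear_left[of x]] by (simp_all add: o_def)
  have "integral S K (c *\<^sub>C x) = c *\<^sub>C integral S K x" for c x
    using integral_linear[OF app(2)[of x] bounded_linear_scaleC[of c]]
    by (simp add: app(1) o_def bounded_clinear_ops_simps[OF assms(2)])
  then show ?thesis by (simp add: bounded_clinear_ops_def)
qed

lemma continuous_on_shift_inverse: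
  fixes A :: "'a::complex_banach oper"
  assumes "linear_operator A" "continuous_on S f" "\<And>x. x \<in> S \<Longrightarrow> - f x \<in> resolvent_set A"
  shows "continuous_on S (\<lambda>x. shift_inverse A (f x))"
  unfolding shift_inverse_def
  by (intro continuous_on_minus continuous_on_compose2[OF continuous_on_resolvent[OF assms(1)]] assms(2))
    (use assms(3) in auto)

text \<open>Balakrishnan's integrand for the operator 1 + A with \<lambda> = exp v; the shift
  \<open>exp v + 1\<close> is \<lambda> plus the 1 of 1 + A.\<close>

definition inv_power_kernel :: "'a::complex_banach oper \<Rightarrow> real \<Rightarrow> real \<Rightarrow> 'a \<Rightarrow>\<^sub>L 'a" where
  "inv_power_kernel A s v = exp ((1 - s) * v) *\<^sub>R shift_inverse A (of_real (exp v + 1))"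

definition inv_power_op :: "'a::complex_banach oper \<Rightarrow> real \<Rightarrow> 'a \<Rightarrow>\<^sub>L 'a" where
  "inv_power_op A s = (1 / frac_const s) *\<^sub>C integral UNIV (inv_power_kernel A s)"

text \<open>The source is w^s = w w^(-(1 - s)) for w = z / (1 + z), with Balakrishnan's formula for
  the exponent 1 - s. For \<lambda> = exp v and r = \<lambda> / (\<lambda> + 1) one has w /
  (\<lambda> + w) = z / ((\<lambda> + 1) (r + z)), and z / (r + z) corresponds to 1 - r (r + A)^-1.
  Only resolvents on the negative axis occur, so the integral is a bounded operator although A^s
  need not be one.\<close>

definition ratio_power_kernel :: "'a::complex_banach oper \<Rightarrow> real \<Rightarrow> real \<Rightarrow> 'a \<Rightarrow>\<^sub>L 'a" where
  "ratio_power_kernel A s v = (exp (s * v) / (exp v + 1)) *\<^sub>R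
     (id_blinfun - (exp v / (exp v + 1)) *\<^sub>R shift_inverse A (of_real (exp v / (exp v + 1))))"

definition ratio_power_op :: "'a::complex_banach oper \<Rightarrow> real \<Rightarrow> 'a \<Rightarrow>\<^sub>L 'a" where
  "ratio_power_op A s = (1 / frac_const (1 - s)) *\<^sub>C integral UNIV (ratio_power_kernel A s)"


lemma sector_not_nonpos:
  assumes "z \<in> sector \<phi>" "0 < \<phi>" "\<phi> \<le> pi"
  shows "z \<notin> \<real>\<^sub>\<le>\<^sub>0"
proof
  assume "z \<in> \<real>\<^sub>\<le>\<^sub>0"
  then have "Im z = 0" "Re z \<le> 0" by (auto simp: complex_nonpos_Reals_iff)
  then have "Re z = - cmod z" by (simp add: cmod_eq_Re)
  moreover have "cmod z * (- 1) \<le> cmod z * cos \<phi>" by (intro mult_left_mono) auto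
  ultimately show False using assms(1) sector_iff[OF assms(2,3), of z] by simp
qed

lemma sector_inverse:
  assumes "z \<in> sector \<phi>" "0 < \<phi>" "\<phi> \<le> pi"
  shows "inverse z \<in> sector \<phi>"
proof -
  have z: "z \<noteq> 0" using assms(1) by (auto simp: sector_def)
  have "Re z / (cmod z)\<^sup>2 > cmod z * cos \<phi> / (cmod z)\<^sup>2"
    using assms(1) z unfolding sector_iff[OF assms(2,3)] by (intro divide_strict_right_mono) auto
  moreover have "Re (inverse z) = Re z / (cmod z)\<^sup>2" by (simp add: cmod_power2)
  moreover have "cmod (inverse z) * cos \<phi> = cmod z * cos \<phi> / (cmod z)\<^sup>2"
    using z by (simp add: norm_divide inverse_eq_divide power2_eq_square)
  ultimately show ?thesis unfolding sector_iff[OF assms(2,3)] by (simp only:)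
qed

lemma sector_ratio:
  assumes "z \<in> sector \<phi>" "0 < \<phi>" "\<phi> \<le> pi"
  shows "z / (1 + z) \<in> sector \<phi>"
proof -
  have z: "z \<noteq> 0" using assms(1) by (auto simp: sector_def)
  have "inverse (inverse z + of_real 1) \<in> sector \<phi>"
    using assms by (intro sector_inverse sector_plus_pos) auto
  also have "inverse (inverse z + of_real 1) = z / (1 + z)" using z by (simp add: field_simps)
  finally show ?thesis .
qed

lemma power_eq_exp_Ln: "w \<noteq> 0 \<Longrightarrow> w ^ k = exp (of_nat k * Ln w)"
  by (simp add: exp_of_nat_mult)

lemma powr_minus_add_nat:
  fixes w :: complex
  assumes "w \<noteq> 0"
  shows "w powr (- of_real (s + real k)) = w powr (- of_real s) / w ^ k"
  using assms unfolding power_eq_exp_Ln[OF assms]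
  by (simp add: powr_def exp_diff[symmetric]) (simp add: algebra_simps)

lemma powr_add_nat:
  fixes w :: complex
  assumes "w \<noteq> 0"
  shows "w powr of_real (s + real k) = w powr of_real s * w ^ k"
  using assms unfolding power_eq_exp_Ln[OF assms]
  by (simp add: powr_def exp_add[symmetric]) (simp add: algebra_simps)

text \<open>No multiple of 2 pi i arises: the imaginary parts of Ln z and Ln (1 + z) never have
  opposite signs, so their difference stays in the principal strip.\<close>

lemma ratio_powr:
  assumes "z \<in> sector pi"
  shows "(z / (1 + z)) powr (of_real s) = z powr (of_real s) * (1 + z) powr (- of_real s)"
proof -
  have z: "z \<notin> \<real>\<^sub>\<le>\<^sub>0" using sector_not_nonpos[OF assms] by auto
  have "z + of_real 1 \<in> sector pi" using assms by (intro sector_plus_pos) auto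
  then have z1: "1 + z \<notin> \<real>\<^sub>\<le>\<^sub>0" using sector_not_nonpos[of "1 + z" pi] by (simp add: add.commute)
  have nz: "z \<noteq> 0" "1 + z \<noteq> 0" using z z1 by auto
  have "\<bar>Im (Ln z) - Im (Ln (1 + z))\<bar> < pi"
  proof (cases "Im z" "0::real" rule: linorder_cases)
    case equal
    then have "Re z > 0" using z by (auto simp: complex_nonpos_Reals_iff)
    then have "z = of_real (Re z)" "1 + z = of_real (1 + Re z)" using equal by (auto simp: complex_eq_iff)
    then have "Im (Ln z) = 0" "Im (Ln (1 + z)) = 0" using \<open>Re z > 0\<close>
      by (metis Im_Ln_eq_0 nz(1) Im_complex_of_real Re_complex_of_real, metis Im_Ln_eq_0 nz(2) Im_complex_of_real Re_complex_of_real add_pos_pos zero_less_one)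
    then show ?thesis by simp
  next
    case less
    then have "0 < Im (cnj z)" "0 < Im (cnj (1 + z))" by auto
    then have "0 < Im (Ln (cnj z))" "Im (Ln (cnj z)) < pi" "0 < Im (Ln (cnj (1 + z)))" "Im (Ln (cnj (1 + z))) < pi"
      using Im_Ln_pos_lt_imp by blast+
    moreover have "Ln (cnj z) = cnj (Ln z)" "Ln (cnj (1 + z)) = cnj (Ln (1 + z))"
      using cnj_Ln[OF z] cnj_Ln[OF z1] by auto
    ultimately show ?thesis by auto
  next
    case greater
    then have "0 < Im z" "0 < Im (1 + z)" by auto
    then have "0 < Im (Ln z)" "Im (Ln z) < pi" "0 < Im (Ln (1 + z))" "Im (Ln (1 + z)) < pi"
      using Im_Ln_pos_lt_imp by blast+
    then show ?thesis by auto
  qed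
  then have "Ln (exp (Ln z - Ln (1 + z))) = Ln z - Ln (1 + z)"
    by (intro Ln_exp) auto
  then have L: "Ln (z / (1 + z)) = Ln z - Ln (1 + z)"
    using nz by (simp add: exp_diff)
  have "(z / (1 + z)) powr (of_real s) = exp (of_real s * (Ln z - Ln (1 + z)))"
    using nz by (simp add: powr_def L)
  then show ?thesis using nz by (simp add: powr_def right_diff_distrib exp_diff exp_minus divide_inverse)
qed

lemma norm_powr_le:
  fixes z :: complex
  assumes "z \<noteq> 0"
  shows "cmod (z powr of_real s) = cmod z powr s"
  using assms by (simp add: powr_def)

definition op_power :: "('a::complex_banach \<Rightarrow>\<^sub>L 'a) \<Rightarrow> nat \<Rightarrow> 'a \<Rightarrow>\<^sub>L 'a" where
  "op_power B k = ((\<lambda>X. X o\<^sub>L B) ^^ k) id_blinfun"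

lemma op_power_simps [simp]: "op_power B 0 = id_blinfun" "op_power B (Suc k) = op_power B k o\<^sub>L B"
  by (simp_all add: op_power_def)

lemma op_power_clinear: "B \<in> bounded_clinear_ops \<Longrightarrow> op_power B k \<in> bounded_clinear_ops"
  by (induction k) (auto intro: bounded_clinear_ops_intros)

lemma blinfun_compose_id [simp]: "B o\<^sub>L id_blinfun = B" "id_blinfun o\<^sub>L B = B"
  by (auto intro!: blinfun_eqI)

lemmas blinfun_compose_simps =
  bounded_bilinear.diff_right[OF bounded_bilinear_blinfun_compose]
  bounded_bilinear.diff_left[OF bounded_bilinear_blinfun_compose]
  bounded_bilinear.minus_right[OF bounded_bilinear_blinfun_compose]
  bounded_bilinear.minus_left[OF bounded_bilinear_blinfun_compose]
  bounded_bilinear.scaleR_right[OF bounded_bilinear_blinfun_compose]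
  bounded_bilinear.scaleR_left[OF bounded_bilinear_blinfun_compose]

section \<open>Action of these operators on the elementary calculus\<close>

context sector_calculus
begin

lemma calc_clinear: "g \<in> H0_infinity \<phi> \<Longrightarrow> calc g \<in> bounded_clinear_ops"
proof -
  assume g: "g \<in> H0_infinity \<phi>"
  have pm: "\<bar>\<theta>\<bar> = \<theta>" "\<bar>- \<theta>\<bar> = \<theta>" using pos by auto
  show ?thesis unfolding calc_eq
    by (intro bounded_clinear_ops_intros integral_clinear integrand_integrable[OF g] pm)
      (simp_all add: integrand_def bounded_clinear_ops_intros resolvent_clinear ray_resolvent_set pm)
qed

lemma calc_scale: "g \<in> H0_infinity \<phi> \<Longrightarrow> calc (\<lambda>z. c * g z) = c *\<^sub>C calc g"
  using calc_diff[of g g "1 - c"] by (simp add: scaleC_diff algebra_simps)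

lemma calc_comp_scaleC:
  fixes B :: "'a \<Rightarrow>\<^sub>L 'a"
  shows "g \<in> H0_infinity \<phi> \<Longrightarrow> calc g o\<^sub>L (c *\<^sub>C B) = c *\<^sub>C (calc g o\<^sub>L B)"
  by (rule scaleC_compose(2)[OF calc_clinear])

lemma H0_div_pos:
  assumes "g \<in> H0_infinity \<phi>" "r > 0"
  shows "(\<lambda>z. g z / (of_real r + z)) \<in> H0_infinity \<phi>"
proof -
  have "(\<lambda>z. g z * (1 / (of_real r + z))) \<in> H0_infinity \<phi>"
  proof (rule H0_infinity_mult[OF assms(1) pos(2,4)])
    show "(\<lambda>z. 1 / (of_real r + z)) holomorphic_on sector \<phi>"
      using sector_add_nonneg_bounds(2)[OF _ pos(2) angles(3), of _ r] assms(2)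
      by (intro holomorphic_intros) auto
    fix z assume z: "z \<in> sector \<phi>"
    note b = sector_add_nonneg_bounds[OF z pos(2) angles(3), of r]
    have "cos (\<phi> / 2) * r \<le> cmod (of_real r + z)"
      using b(1,3) assms(2) by (intro order_trans[OF _ b(3)]) (auto intro!: mult_left_mono)
    moreover have "cos (\<phi> / 2) * r > 0" using b(1) assms(2) by simp
    ultimately show "cmod (1 / (of_real r + z)) \<le> 1 / (cos (\<phi> / 2) * r)"
      unfolding norm_divide norm_one by (intro frac_le) auto
  qed
  then show ?thesis by simp
qed

lemma calc_shift_inverse_pos:
  assumes "g \<in> H0_infinity \<phi>" "r > 0"
  shows "calc g o\<^sub>L shift_inverse A (of_real r) = calc (\<lambda>z. g z / (of_real r + z))"
  using assms by (intro calc_shift_inverse H0_div_pos neg_resolvent_set) auto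

lemma H0_ratio:
  assumes "g \<in> H0_infinity \<phi>" "r > 0"
  shows "(\<lambda>z. g z * (z / (of_real r + z))) \<in> H0_infinity \<phi>"
proof (rule H0_infinity_mult[OF assms(1) pos(2,4)])
  show "(\<lambda>z. z / (of_real r + z)) holomorphic_on sector \<phi>"
    using sector_add_nonneg_bounds(2)[OF _ pos(2) angles(3), of _ r] assms(2)
    by (intro holomorphic_intros) auto
  fix z assume z: "z \<in> sector \<phi>"
  note b = sector_add_nonneg_bounds[OF z pos(2) angles(3), of r]
  have "cos (\<phi> / 2) * cmod z \<le> cmod (of_real r + z)"
    using b(1,3) assms(2) by (intro order_trans[OF _ b(3)]) (auto intro!: mult_left_mono)
  then show "cmod (z / (of_real r + z)) \<le> 1 / cos (\<phi> / 2)"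
    using b assms(2) by (simp add: norm_divide field_simps)
qed

lemma calc_ratio:
  assumes g: "g \<in> H0_infinity \<phi>" and r: "r > 0"
  shows "calc g o\<^sub>L (id_blinfun - r *\<^sub>R shift_inverse A (of_real r)) = calc (\<lambda>z. g z * (z / (of_real r + z)))"
proof -
  have "calc g o\<^sub>L (id_blinfun - r *\<^sub>R shift_inverse A (of_real r)) =
      calc g - of_real r *\<^sub>C calc (\<lambda>z. g z / (of_real r + z))"
    by (simp add: blinfun_compose_simps calc_shift_inverse_pos[OF g r] scaleC_of_real)
  also have "\<dots> = calc (\<lambda>z. g z - of_real r * (g z / (of_real r + z)))"
    by (rule calc_diff[symmetric, OF g H0_div_pos[OF g r]])
  also have "\<dots> = calc (\<lambda>z. g z * (z / (of_real r + z)))"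
  proof (rule calc_cong)
    fix z assume "z \<in> sector \<phi>"
    then have "of_real r + z \<noteq> 0" using sector_add_nonneg_bounds(2)[OF _ pos(2) angles(3), of z r] r by auto
    then show "g z - of_real r * (g z / (of_real r + z)) = g z * (z / (of_real r + z))"
      by (simp add: field_simps)
  qed
  finally show ?thesis .
qed

lemma inv_power_kernel_props:
  assumes s: "0 < s" "s < 1"
  shows "continuous_on UNIV (inv_power_kernel A s)"
    and "\<exists>C. \<forall>v. norm (inv_power_kernel A s v) \<le> C * exp (- min s (1 - s) * \<bar>v\<bar>)"
    and "inv_power_kernel A s v \<in> bounded_clinear_ops"
proof -
  have p: "exp v + 1 > (0::real)" for v by (simp add: add_pos_pos)
  show "continuous_on UNIV (inv_power_kernel A s)"
    unfolding inv_power_kernel_def[abs_def]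
    by (intro continuous_intros continuous_on_shift_inverse[OF linear] neg_resolvent_set p)
  obtain M where M: "M > 0" "\<And>r. r > 0 \<Longrightarrow> norm (shift_inverse A (of_real r)) \<le> M / r"
    using shift_inverse_bound by blast
  have "norm (inv_power_kernel A s v) \<le> M * exp (- min s (1 - s) * \<bar>v\<bar>)" for v
  proof -
    have "norm (inv_power_kernel A s v) \<le> exp ((1 - s) * v) * (M / (exp v + 1))"
      unfolding inv_power_kernel_def norm_scaleR abs_exp_cancel by (intro mult_left_mono M(2) p) simp
    also have "\<dots> = M * (exp ((1 - s) * v) / (exp v + 1))" by simp
    also have "\<dots> \<le> M * exp (- min s (1 - s) * \<bar>v\<bar>)"
      using M(1) frac_kernel_le[OF s] by (intro mult_left_mono) auto
    finally show ?thesis .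
  qed
  then show "\<exists>C. \<forall>v. norm (inv_power_kernel A s v) \<le> C * exp (- min s (1 - s) * \<bar>v\<bar>)" by blast
  show "inv_power_kernel A s v \<in> bounded_clinear_ops"
    unfolding inv_power_kernel_def scaleC_of_real[symmetric]
    by (intro bounded_clinear_ops_intros shift_inverse_clinear p)
qed

text \<open>By sectoriality r (r + A)^-1 is bounded uniformly in r > 0; what remains is the scalar
  kernel for the exponent 1 - s.\<close>

lemma ratio_power_kernel_props:
  assumes s: "0 < s" "s < 1"
  shows "continuous_on UNIV (ratio_power_kernel A s)"
    and "\<exists>C. \<forall>v. norm (ratio_power_kernel A s v) \<le> C * exp (- min s (1 - s) * \<bar>v\<bar>)"
    and "ratio_power_kernel A s v \<in> bounded_clinear_ops"
proof -
  have p: "exp v + 1 > (0::real)" for v by (simp add: add_pos_pos)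
  have r: "exp v / (exp v + 1) > (0::real)" for v using p by simp
  have nz: "exp v + 1 \<noteq> (0::real)" for v using p[of v] by simp
  show "continuous_on UNIV (ratio_power_kernel A s)"
    unfolding ratio_power_kernel_def[abs_def]
    by (intro continuous_intros continuous_on_shift_inverse[OF linear] neg_resolvent_set r ballI nz)
  obtain M where M: "M > 0" "\<And>r. r > 0 \<Longrightarrow> norm (shift_inverse A (of_real r)) \<le> M / r"
    using shift_inverse_bound by blast
  have "norm (ratio_power_kernel A s v) \<le> (1 + M) * exp (- min s (1 - s) * \<bar>v\<bar>)" for v
  proof -
    define q where "q = exp v / (exp v + 1)"
    have q: "q > 0" using r by (simp add: q_def)
    have "norm (id_blinfun - q *\<^sub>R shift_inverse A (of_real q)) \<le> norm (id_blinfun :: 'a \<Rightarrow>\<^sub>L 'a) + norm (q *\<^sub>R shift_inverse A (of_real q))"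
      by (rule norm_triangle_ineq4)
    also have "\<dots> \<le> 1 + q * (M / q)"
      using mult_left_mono[OF M(2)[OF q], of q] q norm_blinfun_id_le by (intro add_mono) auto
    also have "\<dots> = 1 + M" using q by simp
    finally have "norm (ratio_power_kernel A s v) \<le> (exp (s * v) / (exp v + 1)) * (1 + M)"
      unfolding ratio_power_kernel_def norm_scaleR q_def[symmetric] using p[of v] by (intro mult_mono) auto
    also have "\<dots> \<le> exp (- min s (1 - s) * \<bar>v\<bar>) * (1 + M)"
      using M(1) frac_kernel_le[of "1 - s" v] s by (intro mult_right_mono) (auto simp: min.commute)
    finally show ?thesis by (simp add: mult_ac)
  qed
  then show "\<exists>C. \<forall>v. norm (ratio_power_kernel A s v) \<le> C * exp (- min s (1 - s) * \<bar>v\<bar>)" by blast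
  show "ratio_power_kernel A s v \<in> bounded_clinear_ops"
    unfolding ratio_power_kernel_def scaleC_of_real[symmetric]
    by (intro bounded_clinear_ops_intros shift_inverse_clinear r)
qed

lemma inv_power_op_clinear: "0 < s \<Longrightarrow> s < 1 \<Longrightarrow> inv_power_op A s \<in> bounded_clinear_ops"
  and ratio_power_op_clinear: "0 < s \<Longrightarrow> s < 1 \<Longrightarrow> ratio_power_op A s \<in> bounded_clinear_ops"
proof -
  assume s: "0 < s" "s < 1"
  then have b: "min s (1 - s) > 0" by simp
  obtain C where "\<And>v. norm (inv_power_kernel A s v) \<le> C * exp (- min s (1 - s) * \<bar>v\<bar>)"
    using inv_power_kernel_props(2)[OF s] by blast
  from exp_decay_integrable0(1)[OF inv_power_kernel_props(1)[OF s] b this]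
  show "inv_power_op A s \<in> bounded_clinear_ops"
    unfolding inv_power_op_def
    by (intro bounded_clinear_ops_intros integral_clinear inv_power_kernel_props(3)[OF s])
  obtain C where "\<And>v. norm (ratio_power_kernel A s v) \<le> C * exp (- min s (1 - s) * \<bar>v\<bar>)"
    using ratio_power_kernel_props(2)[OF s] by blast
  from exp_decay_integrable0(1)[OF ratio_power_kernel_props(1)[OF s] b this]
  show "ratio_power_op A s \<in> bounded_clinear_ops"
    unfolding ratio_power_op_def
    by (intro bounded_clinear_ops_intros integral_clinear ratio_power_kernel_props(3)[OF s])
qed

lemma sector_one_plus:
  assumes "z \<in> sector \<phi>"
  shows "1 + z \<in> sector \<phi>" "1 + z \<noteq> 0" "\<bar>Arg (1 + z)\<bar> < pi" "1 + z \<notin> \<real>\<^sub>\<le>\<^sub>0"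
proof -
  show "1 + z \<in> sector \<phi>" using sector_plus_pos[OF pos(2,4) assms, of 1] by (simp add: add.commute)
  then show "1 + z \<noteq> 0" "\<bar>Arg (1 + z)\<bar> < pi" "1 + z \<notin> \<real>\<^sub>\<le>\<^sub>0"
    using angles(3) sector_not_nonpos[of "1 + z" \<phi>] pos by (auto simp: sector_def)
qed

lemma H0_inv_power:
  assumes "g \<in> H0_infinity \<phi>" "s \<ge> 0"
  shows "(\<lambda>z. g z * (1 + z) powr (- of_real s)) \<in> H0_infinity \<phi>"
proof (rule H0_infinity_mult[OF assms(1) pos(2,4)])
  show "(\<lambda>z. (1 + z) powr (- of_real s)) holomorphic_on sector \<phi>"
    using sector_one_plus(4) by (intro holomorphic_intros) auto
  fix z assume z: "z \<in> sector \<phi>"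
  note b = sector_add_nonneg_bounds[OF z pos(2) angles(3), of 1]
  have "cos (\<phi> / 2) * 1 \<le> cmod (1 + z)"
    using b(1,3) by (intro order_trans[OF _ b(3)[simplified]]) (auto intro!: mult_left_mono)
  then have "cmod (1 + z) powr (- s) \<le> cos (\<phi> / 2) powr (- s)"
    using b(1) assms(2) by (intro powr_mono2') auto
  then show "cmod ((1 + z) powr (- of_real s)) \<le> cos (\<phi> / 2) powr (- s)"
    using norm_powr_le[OF sector_one_plus(2)[OF z], of "- s"] by simp
qed

lemma H0_ratio_power:
  assumes "g \<in> H0_infinity \<phi>" "s \<ge> 0"
  shows "(\<lambda>z. g z * (z / (1 + z)) powr (of_real s)) \<in> H0_infinity \<phi>"
proof (rule H0_infinity_mult[OF assms(1) pos(2,4)])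
  show "(\<lambda>z. (z / (1 + z)) powr (of_real s)) holomorphic_on sector \<phi>"
    using sector_not_nonpos[OF sector_ratio[OF _ pos(2,4)] pos(2,4)] sector_one_plus(2)
    by (intro holomorphic_intros) auto
  fix z assume z: "z \<in> sector \<phi>"
  note b = sector_add_nonneg_bounds[OF z pos(2) angles(3), of 1]
  have nz: "z / (1 + z) \<noteq> 0" using z sector_one_plus(2)[OF z] by (auto simp: sector_def)
  have "cos (\<phi> / 2) * cmod z \<le> cmod (1 + z)"
    using b(1,3) by (intro order_trans[OF _ b(3)[simplified]]) (auto intro!: mult_left_mono)
  then have "cmod (z / (1 + z)) \<le> 1 / cos (\<phi> / 2)"
    using b(1) sector_one_plus(2)[OF z] by (simp add: norm_divide field_simps)
  then have "cmod (z / (1 + z)) powr s \<le> (1 / cos (\<phi> / 2)) powr s"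
    using assms(2) by (intro powr_mono2) auto
  then show "cmod ((z / (1 + z)) powr (of_real s)) \<le> (1 / cos (\<phi> / 2)) powr s"
    using norm_powr_le[OF nz, of s] by simp
qed

text \<open>The function (1 + z)^(-s) does not decay at 0 and so has no elementary calculus of its
  own; hence the regulariser g on the left. \<open>calc_comp_integral\<close> reduces the claim to
  the scalar formula at the point 1 + z.\<close>

lemma calc_inv_power_op:
  assumes g: "g \<in> H0_infinity \<phi>" and s: "0 < s" "s < 1"
  shows "calc g o\<^sub>L inv_power_op A s = calc (\<lambda>z. g z * (1 + z) powr (- of_real s))"
proof -
  define b where "b = min s (1 - s)"
  have "b > 0" using s by (simp add: b_def)
  obtain C where C: "\<And>v. norm (inv_power_kernel A s v) \<le> C * exp (- b * \<bar>v\<bar>)"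
    using inv_power_kernel_props(2)[OF s] by (auto simp: b_def)
  obtain D q where D: "D \<ge> 0" "q > 0"
    "\<And>u t. \<bar>t\<bar> < \<phi> \<Longrightarrow> cmod (g (exp (Complex u t))) \<le> D * exp (- q * \<bar>u\<bar>)"
    using H0_infinity_bound[OF g pos(2,4)] by blast
  \<comment> \<open>A common rate for the decay in v, which comes from the kernel, and in u, which
    comes from g.\<close>
  define a where "a = min b q"
  have a: "a > 0" "a \<le> b" "a \<le> q" using \<open>b > 0\<close> D by (auto simp: a_def)
  have p: "exp v + 1 > (0::real)" for v by (simp add: add_pos_pos)
  define \<kappa> where "\<kappa> v z = of_real (exp ((1 - s) * v)) / (of_real (exp v + 1) + z)" for v and z :: complex
  have "C \<ge> 0" using order_trans[OF norm_ge_zero C[of 0]] by simp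
  have "calc g o\<^sub>L integral UNIV (inv_power_kernel A s) = calc (\<lambda>z. integral UNIV (\<lambda>v. \<kappa> v z) * g z)"
  proof (rule calc_comp_integral[OF g inv_power_kernel_props(1)[OF s] _ a(1)])
    show "norm (inv_power_kernel A s v) \<le> C * exp (- a * \<bar>v\<bar>)" for v
      using a \<open>C \<ge> 0\<close> by (intro order_trans[OF C] mult_left_mono) (auto intro!: mult_right_mono)
    show "calc g o\<^sub>L inv_power_kernel A s v = calc (\<lambda>z. \<kappa> v z * g z)" for v
    proof -
      have "calc g o\<^sub>L inv_power_kernel A s v = of_real (exp ((1 - s) * v)) *\<^sub>C calc (\<lambda>z. g z / (of_real (exp v + 1) + z))"
        by (simp only: inv_power_kernel_def blinfun_compose_simps calc_shift_inverse_pos[OF g p] scaleC_of_real)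
      also have "\<dots> = calc (\<lambda>z. of_real (exp ((1 - s) * v)) * (g z / (of_real (exp v + 1) + z)))"
        by (rule calc_scale[symmetric, OF H0_div_pos[OF g p]])
      finally show ?thesis by (simp add: \<kappa>_def)
    qed
    fix t assume t: "\<bar>t\<bar> = \<theta>"
    have nz: "of_real (exp v + 1) + exp (Complex u t) \<noteq> 0" for u v
      using sector_add_nonneg_bounds(2)[OF ray_sector[OF t] pos(2) angles(3), of "exp v + 1" u] p[of v] by simp
    show "continuous_on UNIV (\<lambda>(v, u). \<kappa> v (exp (Complex u t)))"
      unfolding \<kappa>_def case_prod_beta using nz by (intro continuous_intros continuous_on_Complex) auto
    fix u v
    define z where "z = exp (Complex u t)"
    note b = sector_add_nonneg_bounds[OF ray_sector[OF t, of u] pos(2) angles(3), of "exp v + 1", folded z_def]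
    have ge: "cos (\<phi> / 2) * (exp v + 1) \<le> cmod (of_real (exp v + 1) + z)"
      using b(1,3) p[of v] by (intro order_trans[OF _ b(3)]) (auto intro!: mult_left_mono)
    have "cmod (\<kappa> v z) = exp ((1 - s) * v) / cmod (of_real (exp v + 1) + z)"
      by (simp add: \<kappa>_def norm_divide del: of_real_add)
    also have "\<dots> \<le> exp ((1 - s) * v) / (cos (\<phi> / 2) * (exp v + 1))"
      using ge b(1,2) p[of v] by (intro divide_left_mono mult_pos_pos) (auto simp del: of_real_add)
    also have "\<dots> = (1 / cos (\<phi> / 2)) * (exp ((1 - s) * v) / (exp v + 1))" by simp
    also have "\<dots> \<le> (1 / cos (\<phi> / 2)) * exp (- a * \<bar>v\<bar>)"
    proof -
      have "exp ((1 - s) * v) / (exp v + 1) \<le> exp (- min s (1 - s) * \<bar>v\<bar>)"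
        by (rule frac_kernel_le[OF s])
      also have "\<dots> \<le> exp (- a * \<bar>v\<bar>)" using a(2) unfolding b_def by (auto intro!: mult_right_mono)
      finally show ?thesis using b(1) by (intro mult_left_mono) auto
    qed
    finally have "cmod (\<kappa> v z) * cmod (g z) \<le> ((1 / cos (\<phi> / 2)) * exp (- a * \<bar>v\<bar>)) * (D * exp (- q * \<bar>u\<bar>))"
      using D(3)[of t u] t angles b(1) by (intro mult_mono) (auto simp: z_def)
    also have "\<dots> \<le> ((1 / cos (\<phi> / 2)) * exp (- a * \<bar>v\<bar>)) * (D * exp (- a * \<bar>u\<bar>))"
      using a D(1) b(1) by (intro mult_left_mono) (auto intro!: mult_right_mono)
    finally show "cmod (\<kappa> v (exp (Complex u t)) * g (exp (Complex u t))) \<le> (D / cos (\<phi> / 2)) * exp (- a * \<bar>v\<bar>) * exp (- a * \<bar>u\<bar>)"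
      by (simp add: norm_mult z_def mult_ac)
  qed
  also have "\<dots> = calc (\<lambda>z. frac_const s * (g z * (1 + z) powr (- of_real s)))"
  proof (rule calc_cong)
    fix z assume z: "z \<in> sector \<phi>"
    have "integral UNIV (\<lambda>v. \<kappa> v z) = frac_const s * (1 + z) powr (- of_real s)"
      using frac_integral[OF s sector_one_plus(2,3)[OF z]] by (simp add: \<kappa>_def[abs_def] add.assoc)
    then show "integral UNIV (\<lambda>v. \<kappa> v z) * g z = frac_const s * (g z * (1 + z) powr (- of_real s))" by simp
  qed
  also have "\<dots> = frac_const s *\<^sub>C calc (\<lambda>z. g z * (1 + z) powr (- of_real s))"
    using s by (intro calc_scale H0_inv_power[OF g]) auto
  finally show ?thesis
    unfolding inv_power_op_def calc_comp_scaleC[OF g] using frac_const_nonzero[OF s] by (simp add: scaleC_scaleC)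
qed

lemma calc_ratio_power_op:
  assumes g: "g \<in> H0_infinity \<phi>" and s: "0 < s" "s < 1"
  shows "calc g o\<^sub>L ratio_power_op A s = calc (\<lambda>z. g z * (z / (1 + z)) powr (of_real s))"
proof -
  define b where "b = min s (1 - s)"
  have s': "0 < 1 - s" "1 - s < 1" using s by auto
  have "b > 0" using s by (simp add: b_def)
  obtain C where C: "\<And>v. norm (ratio_power_kernel A s v) \<le> C * exp (- b * \<bar>v\<bar>)"
    using ratio_power_kernel_props(2)[OF s] by (auto simp: b_def)
  obtain D q where D: "D \<ge> 0" "q > 0"
    "\<And>u t. \<bar>t\<bar> < \<phi> \<Longrightarrow> cmod (g (exp (Complex u t))) \<le> D * exp (- q * \<bar>u\<bar>)"
    using H0_infinity_bound[OF g pos(2,4)] by blast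
  define a where "a = min b q"
  have a: "a > 0" "a \<le> b" "a \<le> q" using \<open>b > 0\<close> D by (auto simp: a_def)
  have p: "exp v + 1 > (0::real)" for v by (simp add: add_pos_pos)
  define r where "r v = exp v / (exp v + 1)" for v :: real
  have r: "r v > 0" for v using p[of v] by (simp add: r_def)
  define \<kappa> where "\<kappa> v z = of_real (exp (s * v) / (exp v + 1)) * (z / (of_real (r v) + z))" for v and z :: complex
  have "C \<ge> 0" using order_trans[OF norm_ge_zero C[of 0]] by simp
  have "calc g o\<^sub>L integral UNIV (ratio_power_kernel A s) = calc (\<lambda>z. integral UNIV (\<lambda>v. \<kappa> v z) * g z)"
  proof (rule calc_comp_integral[OF g ratio_power_kernel_props(1)[OF s] _ a(1)])
    show "norm (ratio_power_kernel A s v) \<le> C * exp (- a * \<bar>v\<bar>)" for v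
      using a \<open>C \<ge> 0\<close> by (intro order_trans[OF C] mult_left_mono) (auto intro!: mult_right_mono)
    show "calc g o\<^sub>L ratio_power_kernel A s v = calc (\<lambda>z. \<kappa> v z * g z)" for v
    proof -
      have "calc g o\<^sub>L ratio_power_kernel A s v = of_real (exp (s * v) / (exp v + 1)) *\<^sub>C calc (\<lambda>z. g z * (z / (of_real (r v) + z)))"
        by (simp only: ratio_power_kernel_def bounded_bilinear.scaleR_right[OF bounded_bilinear_blinfun_compose]
            calc_ratio[OF g r] scaleC_of_real flip: r_def)
      also have "\<dots> = calc (\<lambda>z. of_real (exp (s * v) / (exp v + 1)) * (g z * (z / (of_real (r v) + z))))"
        by (rule calc_scale[symmetric, OF H0_ratio[OF g r]])
      finally show ?thesis by (simp add: \<kappa>_def mult_ac)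
    qed
    fix t assume t: "\<bar>t\<bar> = \<theta>"
    have nz: "of_real (r v) + exp (Complex u t) \<noteq> 0" for u v
      using sector_add_nonneg_bounds(2)[OF ray_sector[OF t] pos(2) angles(3), of "r v" u] r[of v] by simp
    have p': "exp v + 1 \<noteq> (0::real)" for v using p[of v] by simp
    show "continuous_on UNIV (\<lambda>(v, u). \<kappa> v (exp (Complex u t)))"
      using nz p' unfolding \<kappa>_def case_prod_beta r_def 
      by (intro continuous_intros continuous_on_Complex) auto
    fix u v
    define z where "z = exp (Complex u t)"
    note b = sector_add_nonneg_bounds[OF ray_sector[OF t, of u] pos(2) angles(3) less_imp_le[OF r[of v]], folded z_def]
    have ge: "cos (\<phi> / 2) * cmod z \<le> cmod (of_real (r v) + z)"
      using b(1,3) r[of v] by (intro order_trans[OF _ b(3)]) (auto intro!: mult_left_mono)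
    have "cmod (z / (of_real (r v) + z)) \<le> 1 / cos (\<phi> / 2)"
      using ge b(1,2) r[of v] by (simp add: norm_divide field_simps)
    moreover have "exp (s * v) / (exp v + 1) \<le> exp (- a * \<bar>v\<bar>)"
    proof -
      have "exp (s * v) / (exp v + 1) \<le> exp (- b * \<bar>v\<bar>)"
        using frac_kernel_le[OF s', of v] by (simp add: b_def min.commute)
      also have "\<dots> \<le> exp (- a * \<bar>v\<bar>)" using a by (auto intro!: mult_right_mono)
      finally show ?thesis .
    qed
    ultimately have "(exp (s * v) / (exp v + 1)) * cmod (z / (of_real (r v) + z)) \<le> exp (- a * \<bar>v\<bar>) * (1 / cos (\<phi> / 2))"
      by (intro mult_mono) auto
    moreover have "cmod (\<kappa> v z) = (exp (s * v) / (exp v + 1)) * cmod (z / (of_real (r v) + z))"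
      using p[of v] unfolding \<kappa>_def norm_mult norm_of_real by simp
    ultimately have "cmod (\<kappa> v z) * cmod (g z) \<le> (exp (- a * \<bar>v\<bar>) * (1 / cos (\<phi> / 2))) * (D * exp (- q * \<bar>u\<bar>))"
      using D(3)[of t u] t angles b(1) by (intro mult_mono) (auto simp: z_def)
    also have "\<dots> \<le> (exp (- a * \<bar>v\<bar>) * (1 / cos (\<phi> / 2))) * (D * exp (- a * \<bar>u\<bar>))"
      using a D(1) b(1) by (intro mult_left_mono) (auto intro!: mult_right_mono)
    finally show "cmod (\<kappa> v (exp (Complex u t)) * g (exp (Complex u t))) \<le> (D / cos (\<phi> / 2)) * exp (- a * \<bar>v\<bar>) * exp (- a * \<bar>u\<bar>)"
      by (simp add: norm_mult z_def mult_ac)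
  qed
  also have "\<dots> = calc (\<lambda>z. frac_const (1 - s) * (g z * (z / (1 + z)) powr (of_real s)))"
  proof (rule calc_cong)
    fix z assume z: "z \<in> sector \<phi>"
    define w where "w = z / (1 + z)"
    have w: "w \<in> sector \<phi>" using sector_ratio[OF z pos(2,4)] by (simp add: w_def)
    then have w': "w \<noteq> 0" "\<bar>Arg w\<bar> < pi" using angles(3) by (auto simp: sector_def)
    have "\<kappa> v z = w * (of_real (exp ((1 - (1 - s)) * v)) / (of_real (exp v) + w))" for v
    proof -
      have 1: "of_real (exp v) + w \<noteq> 0" "of_real (r v) + z \<noteq> 0"
        using sector_add_nonneg_bounds(2)[OF _ pos(2) angles(3), of _ "exp v"] w
          sector_add_nonneg_bounds(2)[OF _ pos(2) angles(3), of _ "r v"] z r[of v] by (auto simp del: of_real_exp)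
      have e: "of_real (exp v + 1) \<noteq> (0::complex)" using p[of v] unfolding of_real_eq_0_iff by simp
      \<comment> \<open>This identity turns the kernel in z into the Balakrishnan kernel in w = z /
        (1 + z).\<close>
      have "of_real (exp v + 1) * (of_real (r v) + z) = (1 + z) * (of_real (exp v) + w)"
      proof -
        have "of_real (exp v + 1) * of_real (r v) = complex_of_real (exp v)"
          unfolding r_def of_real_mult[symmetric] using p[of v] by simp
        moreover have "(1 + z) * w = z" using sector_one_plus(2)[OF z] by (simp add: w_def)
        ultimately show ?thesis by (simp add: algebra_simps)
      qed
      moreover have "\<kappa> v z = of_real (exp (s * v)) * z / (of_real (exp v + 1) * (of_real (r v) + z))"
        by (simp add: \<kappa>_def)
      ultimately have "\<kappa> v z = of_real (exp (s * v)) * z / ((1 + z) * (of_real (exp v) + w))"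
        by (simp only:)
      also have "\<dots> = w * (of_real (exp ((1 - (1 - s)) * v)) / (of_real (exp v) + w))"
        by (simp add: w_def mult_ac)
      finally show ?thesis .
    qed
    then have "integral UNIV (\<lambda>v. \<kappa> v z) = w * (frac_const (1 - s) * w powr (- of_real (1 - s)))"
      using frac_integral[OF s' w'] by (simp only: integral_mult_right)
    also have "\<dots> = frac_const (1 - s) * (w powr 1 * w powr (- of_real (1 - s)))"
      using w' by simp
    also have "w powr 1 * w powr (- of_real (1 - s)) = w powr (of_real s)"
      unfolding powr_add[symmetric] by simp
    finally show "integral UNIV (\<lambda>v. \<kappa> v z) * g z = frac_const (1 - s) * (g z * (z / (1 + z)) powr (of_real s))"
      by (simp add: w_def)
  qed
  also have "\<dots> = frac_const (1 - s) *\<^sub>C calc (\<lambda>z. g z * (z / (1 + z)) powr (of_real s))"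
    using s by (intro calc_scale H0_ratio_power[OF g]) auto
  finally show ?thesis
    unfolding ratio_power_op_def calc_comp_scaleC[OF g] using frac_const_nonzero[OF s'] by (simp add: scaleC_scaleC)
qed

end


section \<open>A regulariser evaluated by residues\<close>

lemma residue_quotient:
  assumes "open S" "p \<in> S" and F: "F holomorphic_on S" and D: "D holomorphic_on S"
    and nz: "\<And>w. w \<in> S \<Longrightarrow> w \<noteq> p \<Longrightarrow> D w \<noteq> 0" and "D p = 0"
    and d: "(D has_field_derivative d) (at p)" "d \<noteq> 0"
  shows "residue (\<lambda>w. F w / D w) p = F p / d"
proof (rule residue_simple'[OF assms(1,2)])
  show "(\<lambda>w. F w / D w) holomorphic_on S - {p}"
    using F D nz by (intro holomorphic_intros) (auto intro: holomorphic_on_subset)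
  have "((\<lambda>w. (D w - D p) / (w - p)) \<longlongrightarrow> d) (at p)"
    using d(1) by (simp add: has_field_derivative_iff)
  moreover have "(F \<longlongrightarrow> F p) (at p)"
    using holomorphic_on_imp_continuous_on[OF F] assms(1,2) by (simp add: continuous_on_eq_continuous_at isCont_def)
  ultimately have "((\<lambda>w. F w / ((D w - D p) / (w - p))) \<longlongrightarrow> F p / d) (at p)"
    using d(2) by (intro tendsto_divide)
  then show "((\<lambda>w. F w / D w * (w - p)) \<longlongrightarrow> F p / d) (at p)"
    by (simp add: \<open>D p = 0\<close>)
qed

text \<open>Locates the poles: for Im w between 0 and 2 pi the exponential is injective and covers
  the negative axis by the line Im w = pi.\<close>

lemma exp_eq_neg_real:
  assumes "exp w = - complex_of_real r" "0 < Im w" "Im w < 2 * pi" "r > 0"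
  shows "w = Complex (ln r) pi"
proof -
  have "Im (exp w) = 0" "Re (exp w) = - r" using assms(1) by auto
  then have "sin (Im w) = 0" by (simp add: Im_exp)
  then have "sin (Im w - pi) = 0" by (simp add: sin_diff)
  then have "Im w - pi = 0" using sin_eq_0_pi[of "Im w - pi"] assms(2,3) by linarith
  then have im: "Im w = pi" by simp
  then have "exp (Re w) = r" using \<open>Re (exp w) = - r\<close> by (simp add: Re_exp)
  then have "Re w = ln r" using ln_exp[of "Re w"] by simp
  with im show ?thesis by (simp add: complex_eq_iff)
qed

lemma exp_Complex_pi: "r > 0 \<Longrightarrow> exp (Complex (ln r) pi) = - complex_of_real r"
  by (simp add: complex_eq_iff Re_exp Im_exp)

lemma blinfun_compose_assoc:
  fixes B :: "'c::real_normed_vector \<Rightarrow>\<^sub>L 'd::real_normed_vector"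
    and C :: "'b::real_normed_vector \<Rightarrow>\<^sub>L 'c" and D :: "'a::real_normed_vector \<Rightarrow>\<^sub>L 'b"
  shows "(B o\<^sub>L C) o\<^sub>L D = B o\<^sub>L (C o\<^sub>L D)"
  by (rule blinfun_eqI) simp

text \<open>Like z / (1 + z)^2 it decays to first order at 0 and at infinity, but its poles - 1 and
  - 2 are simple, so the residues involve values of the resolvent and no derivatives.\<close>

definition base_regulariser :: "complex \<Rightarrow> complex" where
  "base_regulariser z = z / ((1 + z) * (2 + z))"

context sector_calculus
begin

lemma base_regulariser_bound:
  assumes "\<bar>t\<bar> < \<phi>"
  shows "cmod (base_regulariser (exp (Complex u t))) \<le> 1 / (cos (\<phi> / 2))\<^sup>2 * exp (- \<bar>u\<bar>)"
    and "base_regulariser holomorphic_on sector \<phi>"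
proof -
  define z where "z = exp (Complex u t)"
  have z: "z \<in> sector \<phi>" unfolding z_def using assms pos by (subst exp_in_sector_iff) auto
  note b1 = sector_add_nonneg_bounds[OF z pos(2) angles(3) zero_le_one, simplified]
  have "0 \<le> (2::real)" by simp
  note b2 = sector_add_nonneg_bounds[OF z pos(2) angles(3) this, simplified]
  define c where "c = cos (\<phi> / 2)"
  have c: "c > 0" using b1(1) by (simp add: c_def)
  have "exp u * exp \<bar>u\<bar> \<le> (1 + exp u) * (2 + exp u)"
  proof (cases "u \<ge> 0")
    case True
    then have "exp u * exp \<bar>u\<bar> = exp u * exp u" by simp
    also have "\<dots> \<le> (1 + exp u) * (2 + exp u)" by (intro mult_mono) auto
    finally show ?thesis .
  next
    case False
    then have "exp u * exp \<bar>u\<bar> = 1" by (simp flip: exp_add)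
    also have "\<dots> = 1 * 1" by simp
    also have "\<dots> \<le> (1 + exp u) * (2 + exp u)" by (intro mult_mono) (auto intro: add_increasing2)
    finally show ?thesis .
  qed
  then have "c\<^sup>2 * (exp u * exp \<bar>u\<bar>) \<le> (c * (1 + exp u)) * (c * (2 + exp u))"
    using c by (simp add: power2_eq_square mult_ac mult_left_mono)
  also have "\<dots> \<le> cmod (1 + z) * cmod (2 + z)"
    using b1 b2 c by (intro mult_mono) (auto simp: z_def c_def intro: add_nonneg_nonneg)
  finally have le: "c\<^sup>2 * (exp u * exp \<bar>u\<bar>) \<le> cmod (1 + z) * cmod (2 + z)" .
  have "cmod (base_regulariser z) = exp u / (cmod (1 + z) * cmod (2 + z))"
    by (simp add: base_regulariser_def norm_divide norm_mult z_def)
  also have "\<dots> \<le> exp u / (c\<^sup>2 * (exp u * exp \<bar>u\<bar>))"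
    using le c b1(2) b2(2) by (intro divide_left_mono mult_pos_pos) auto
  also have "\<dots> = 1 / c\<^sup>2 * exp (- \<bar>u\<bar>)" by (simp add: exp_minus divide_inverse)
  finally show "cmod (base_regulariser (exp (Complex u t))) \<le> 1 / (cos (\<phi> / 2))\<^sup>2 * exp (- \<bar>u\<bar>)"
    by (simp add: z_def c_def)
next
  show "base_regulariser holomorphic_on sector \<phi>"
    unfolding base_regulariser_def[abs_def]
    using sector_add_nonneg_bounds(2)[OF _ pos(2) angles(3), of _ 1] sector_add_nonneg_bounds(2)[OF _ pos(2) angles(3), of _ 2]
    by (intro holomorphic_intros) auto
qed

text \<open>The n-th power decays like \<bar>z\<bar>^n at 0 and like \<bar>z\<bar>^(-n) at infinity,
  which beats z^\<tau> at either end.\<close>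

lemma base_regulariser_power:
  assumes "\<bar>\<tau>\<bar> < real n"
  shows "(\<lambda>z. base_regulariser z ^ n * z powr of_real \<tau>) \<in> H0_infinity \<phi>"
proof (rule H0_infinityI)
  show "(\<lambda>z. base_regulariser z ^ n * z powr of_real \<tau>) holomorphic_on sector \<phi>"
    using sector_not_nonpos[OF _ pos(2,4)] base_regulariser_bound(2)[of 0] pos by (intro holomorphic_intros) auto
  show "real n - \<bar>\<tau>\<bar> > 0" using assms by simp
  fix u t :: real assume t: "\<bar>t\<bar> < \<phi>"
  define D where "D = 1 / (cos (\<phi> / 2))\<^sup>2"
  have "cmod (base_regulariser (exp (Complex u t)) ^ n * exp (Complex u t) powr of_real \<tau>) =
      cmod (base_regulariser (exp (Complex u t))) ^ n * exp (\<tau> * u)"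
    using norm_powr_le[of "exp (Complex u t)" \<tau>] by (simp add: norm_mult norm_power powr_def)
  also have "\<dots> \<le> (D * exp (- \<bar>u\<bar>)) ^ n * exp (\<tau> * u)"
    using base_regulariser_bound(1)[OF t, of u] by (intro mult_right_mono power_mono) (auto simp: D_def)
  also have "\<dots> = D ^ n * exp (- real n * \<bar>u\<bar> + \<tau> * u)"
    by (simp add: power_mult_distrib exp_of_nat_mult[symmetric] mult_exp_exp)
  also have "\<dots> \<le> D ^ n * exp (- (real n - \<bar>\<tau>\<bar>) * \<bar>u\<bar>)"
  proof -
    have "\<tau> * u \<le> \<bar>\<tau>\<bar> * \<bar>u\<bar>" by (metis abs_ge_self abs_mult)
    then show ?thesis by (intro mult_left_mono) (auto simp: algebra_simps D_def)
  qed
  finally show "cmod (base_regulariser (exp (Complex u t)) ^ n * exp (Complex u t) powr of_real \<tau>)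
    \<le> D ^ n * exp (- (real n - \<bar>\<tau>\<bar>) * \<bar>u\<bar>)" .
qed

lemma base_regulariser_H0:
  assumes "n > 0" shows "(\<lambda>z. base_regulariser z ^ n) \<in> H0_infinity \<phi>"
proof (rule H0_infinityI)
  show "(\<lambda>z. base_regulariser z ^ n) holomorphic_on sector \<phi>"
    using base_regulariser_bound(2)[of 0] pos by (intro holomorphic_intros) auto
  show "real n > 0" using assms by simp
  fix u t :: real assume t: "\<bar>t\<bar> < \<phi>"
  have "cmod (base_regulariser (exp (Complex u t)) ^ n) \<le> (1 / (cos (\<phi> / 2))\<^sup>2 * exp (- \<bar>u\<bar>)) ^ n"
    unfolding norm_power using base_regulariser_bound(1)[OF t, of u] by (intro power_mono) auto
  also have "\<dots> = (1 / (cos (\<phi> / 2))\<^sup>2) ^ n * exp (- real n * \<bar>u\<bar>)"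
    unfolding power_mult_distrib by (simp flip: exp_of_nat_mult)
  finally show "cmod (base_regulariser (exp (Complex u t)) ^ n) \<le> (1 / (cos (\<phi> / 2))\<^sup>2) ^ n * exp (- real n * \<bar>u\<bar>)" .
qed

lemma shift_inverse_identity:
  assumes "- \<mu> \<in> resolvent_set A" "- \<nu> \<in> resolvent_set A"
  shows "shift_inverse A \<mu> - shift_inverse A \<nu> = (\<nu> - \<mu>) *\<^sub>C (shift_inverse A \<mu> o\<^sub>L shift_inverse A \<nu>)"
  using resolvent_identity[OF linear assms]
  by (simp add: shift_inverse_def blinfun_compose_simps scaleC_diff algebra_simps)

text \<open>The contour is moved to the negative axis, where the two poles of the regulariser lie.\<close>

lemma calc_base_regulariser:
  "calc base_regulariser = (id_blinfun - shift_inverse A 1) o\<^sub>L shift_inverse A 2"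
proof (rule blinfun_eqI, rule functional_separation)
  fix x :: 'a and \<psi> :: "'a \<Rightarrow> complex" assume \<psi>: "contractive_functional \<psi>"
  note \<psi>D = contractive_functionalD[OF \<psi>]
  \<comment> \<open>Leaves room beyond the integration rays: the strip for the residue theorem has
    to be open around the lines Im w = \<theta> and Im w = 2 pi - \<theta>.\<close>
  define \<eta> where "\<eta> = (\<omega> + \<theta>) / 2"
  have \<eta>: "\<omega> < \<eta>" "\<eta> < \<theta>" "\<eta> < pi" "0 < \<eta>" using angles pos \<omega>_pos by (auto simp: \<eta>_def)
  obtain M where M: "M > 0" "\<And>z. z \<noteq> 0 \<Longrightarrow> Re z \<le> cmod z * cos \<eta> \<Longrightarrow> z \<in> resolvent_set A \<and> norm (resolvent A z) \<le> M / cmod z"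
    using sectorial_bound[OF sec \<eta>(1,3)] by blast
  define f where "f w = \<psi> (resolvent A (exp w) x)" for w
  define S where "S = {w. \<eta> < Im w \<and> Im w < 2 * pi - \<eta>}"
  have "open S"
    unfolding S_def by (simp add: open_Collect_conj open_halfspace_Im_gt open_halfspace_Im_lt)
  have res: "exp w \<in> resolvent_set A \<and> norm (resolvent A (exp w)) \<le> M / exp (Re w)" if "w \<in> S" for w
  proof -
    have "cos (Im w) \<le> cos \<eta>"
    proof (cases "Im w \<le> pi")
      case True
      then show ?thesis using that \<eta> by (intro cos_monotone_0_pi_le) (auto simp: S_def)
    next
      case False
      then have "cos (2 * pi - Im w) \<le> cos \<eta>" using that \<eta> by (intro cos_monotone_0_pi_le) (auto simp: S_def)
      then show ?thesis by simp
    qed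
    then show ?thesis using M(2)[of "exp w"] by (simp add: Re_exp)
  qed
  have f_hol: "f holomorphic_on S"
  proof -
    have "((\<lambda>z. \<psi> (resolvent A z x)) \<circ> exp) holomorphic_on S"
      by (rule holomorphic_on_compose_gen[OF holomorphic_on_exp resolvent_holomorphic[OF linear \<psi>]]) (use res in blast)
    then show ?thesis by (simp add: f_def[abs_def] o_def)
  qed
  have f_bound: "cmod (f w) \<le> M * norm x / exp (Re w)" if "w \<in> S" for w
  proof -
    have "cmod (f w) \<le> norm (resolvent A (exp w)) * norm x"
      unfolding f_def by (rule order_trans[OF \<psi>D(3) norm_blinfun])
    also have "\<dots> \<le> (M / exp (Re w)) * norm x" using res[OF that] by (intro mult_right_mono) auto
    finally show ?thesis by simp
  qed
  define p where "p r = Complex (ln r) pi" for r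
  have pS: "p r \<in> S" for r using \<eta> by (simp add: S_def p_def)
  have ep: "exp (p r) = - complex_of_real r" if "r > 0" for r using exp_Complex_pi[OF that] by (simp add: p_def)
  have zero: "w = p r" if "of_real r + exp w = 0" "w \<in> S" "r > 0" for w r
  proof -
    have "exp w = - complex_of_real r" using that(1) by (metis add_eq_0_iff2 add.commute)
    then show ?thesis unfolding p_def using that(2,3) \<eta> by (intro exp_eq_neg_real) (auto simp: S_def)
  qed
  have p12: "p 1 \<noteq> p 2" by (simp add: p_def)
  define G where "G w = exp w * base_regulariser (exp w) * f w" for w
  define F1 where "F1 w = exp w * exp w * f w / (2 + exp w)" for w
  define F2 where "F2 w = exp w * exp w * f w / (1 + exp w)" for w
  \<comment> \<open>Each form isolates one of the two simple poles, with a numerator that is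
    holomorphic near it.\<close>
  have GF: "G = (\<lambda>w. F1 w / (1 + exp w))" "G = (\<lambda>w. F2 w / (2 + exp w))"
    by (auto simp: G_def F1_def F2_def base_regulariser_def fun_eq_iff)
  have res1: "residue G (p 1) = \<psi> (shift_inverse A 1 x)"
  proof -
    have "residue (\<lambda>w. F1 w / (1 + exp w)) (p 1) = F1 (p 1) / exp (p 1)"
    proof (rule residue_quotient[of "S - {p 2}"])
      show "F1 holomorphic_on S - {p 2}" unfolding F1_def[abs_def]
        using zero[of 2] f_hol by (intro holomorphic_intros) (auto intro: holomorphic_on_subset)
      show "1 + exp w \<noteq> 0" if "w \<in> S - {p 2}" "w \<noteq> p 1" for w
        using zero[of 1 w] that by auto
      show "((\<lambda>w. 1 + exp w) has_field_derivative exp (p 1)) (at (p 1))"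
        by (auto intro!: derivative_eq_intros)
    qed (use pS p12 \<open>open S\<close> ep[of 1] in \<open>auto intro!: holomorphic_intros open_Diff\<close>)
    also have "\<dots> = - f (p 1)" using ep[of 1] by (simp add: F1_def)
    also have "\<dots> = \<psi> (shift_inverse A 1 x)"
      using ep[of 1] by (simp add: f_def shift_inverse_def blinfun.minus_left \<psi>D)
    finally show ?thesis by (simp add: GF(1))
  qed
  have res2: "residue G (p 2) = - 2 * \<psi> (shift_inverse A 2 x)"
  proof -
    have "residue (\<lambda>w. F2 w / (2 + exp w)) (p 2) = F2 (p 2) / exp (p 2)"
    proof (rule residue_quotient[of "S - {p 1}"])
      show "F2 holomorphic_on S - {p 1}" unfolding F2_def[abs_def]
        using zero[of 1] f_hol by (intro holomorphic_intros) (auto intro: holomorphic_on_subset)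
      show "2 + exp w \<noteq> 0" if "w \<in> S - {p 1}" "w \<noteq> p 2" for w
        using zero[of 2 w] that by auto
      show "((\<lambda>w. 2 + exp w) has_field_derivative exp (p 2)) (at (p 2))"
        by (auto intro!: derivative_eq_intros)
    qed (use pS p12 \<open>open S\<close> ep[of 2] in \<open>auto intro!: holomorphic_intros open_Diff\<close>)
    also have "\<dots> = 2 * f (p 2)" using ep[of 2] by (simp add: F2_def)
    also have "\<dots> = - 2 * \<psi> (shift_inverse A 2 x)"
      using ep[of 2] by (simp add: f_def shift_inverse_def blinfun.minus_left \<psi>D)
    finally show ?thesis by (simp add: GF(2))
  qed
  have strip: "integral UNIV (\<lambda>u. G (Complex u \<theta>)) - integral UNIV (\<lambda>u. G (Complex u (2 * pi - \<theta>))) =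
    2 * pi * \<i> * (\<Sum>q\<in>{p 1, p 2}. residue G q)"
  \<comment> \<open>For \<bar>Re w\<bar> \<ge> 2 the modulus exp (Re w) is at least 4 or at most 1 /
    2, hence away from the moduli 1 and 2 of the poles; the factor 4 in \<open>K\<close> covers both
    cases.\<close>
  proof (rule strip_residue[where l' = \<eta> and h' = "2 * pi - \<eta>" and a = 1 and B = 2 and K = "4 * (M * norm x)"])
    show "G holomorphic_on {w. \<eta> < Im w \<and> Im w < 2 * pi - \<eta>} - {p 1, p 2}"
      unfolding S_def[symmetric] G_def[abs_def] base_regulariser_def
      using zero[of 1] zero[of 2] f_hol by (intro holomorphic_intros) (auto intro: holomorphic_on_subset)
    show "\<theta> < Im q \<and> Im q < 2 * pi - \<theta>" if "q \<in> {p 1, p 2}" for q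
      using that pos by (auto simp: p_def)
    fix w assume w: "\<theta> \<le> Im w" "Im w \<le> 2 * pi - \<theta>" "2 \<le> \<bar>Re w\<bar>"
    then have "w \<in> S" using \<eta> by (auto simp: S_def)
    define e where "e = exp (Re w)"
    have e: "e > 0" by (simp add: e_def)
    have n: "cmod (1 + exp w) \<ge> \<bar>e - 1\<bar>" "cmod (2 + exp w) \<ge> \<bar>e - 2\<bar>"
      using norm_triangle_ineq3[of "exp w" "- 1"] norm_triangle_ineq3[of "exp w" "- 2"]
      by (auto simp: e_def add.commute)
    have "e * exp \<bar>Re w\<bar> \<le> 4 * (\<bar>e - 1\<bar> * \<bar>e - 2\<bar>) \<and> \<bar>e - 1\<bar> * \<bar>e - 2\<bar> > 0"
    proof (cases "Re w \<ge> 0")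
      case True
      then have "Re w \<ge> 2" using w by simp
      have "(4::real) = (1 + 1)\<^sup>2" by simp
      also have "\<dots> \<le> (exp (1::real))\<^sup>2" using exp_ge_add_one_self[of "1::real"] by (intro power_mono) auto
      also have "\<dots> = exp 2" by (simp flip: exp_double)
      also have "exp 2 \<le> e" using \<open>Re w \<ge> 2\<close> by (simp add: e_def)
      finally have "4 \<le> e" .
      then have "e / 2 \<le> \<bar>e - 1\<bar>" "e / 2 \<le> \<bar>e - 2\<bar>" by auto
      then have "e / 2 * (e / 2) \<le> \<bar>e - 1\<bar> * \<bar>e - 2\<bar>" using e by (intro mult_mono) auto
      then show ?thesis using True e \<open>4 \<le> e\<close> by (simp add: e_def[symmetric])
    next
      case False
      then have "Re w \<le> - 2" using w by simp
      then have "e \<le> exp (- 2)" by (simp add: e_def)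
      also have "\<dots> = 1 / exp 2" by (simp add: exp_minus inverse_eq_divide)
      also have "\<dots> \<le> 1 / 2" using exp_ge_add_one_self[of "2::real"] by (intro divide_left_mono) auto
      finally have "1 / 2 \<le> \<bar>e - 1\<bar>" "1 / 2 \<le> \<bar>e - 2\<bar>" by linarith+
      then have "1 / 2 * (1 / 2) \<le> \<bar>e - 1\<bar> * \<bar>e - 2\<bar>" by (intro mult_mono) auto
      moreover have "e * exp \<bar>Re w\<bar> = 1" using False by (simp add: e_def flip: exp_add)
      ultimately show ?thesis by simp
    qed
    then have ee: "e * exp \<bar>Re w\<bar> \<le> 4 * (\<bar>e - 1\<bar> * \<bar>e - 2\<bar>)" and pos': "\<bar>e - 1\<bar> * \<bar>e - 2\<bar> > 0" by auto
    define q where "q = \<bar>e - 1\<bar> * \<bar>e - 2\<bar>"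
    have q: "q > 0" "q \<le> cmod (1 + exp w) * cmod (2 + exp w)"
      unfolding q_def using pos' n by (auto intro!: mult_mono)
    have "e = e * exp \<bar>Re w\<bar> * exp (- \<bar>Re w\<bar>)" by (simp add: mult_exp_exp)
    also have "\<dots> \<le> 4 * q * exp (- \<bar>Re w\<bar>)"
      using ee by (intro mult_right_mono) (auto simp: q_def)
    finally have eq: "e / q \<le> 4 * exp (- \<bar>Re w\<bar>)"
      using q(1) by (simp add: pos_divide_le_eq mult_ac)
    have "cmod (G w) = e * e * cmod (f w) / (cmod (1 + exp w) * cmod (2 + exp w))"
      by (simp add: G_def base_regulariser_def norm_mult norm_divide e_def)
    also have "\<dots> \<le> e * e * (M * norm x / e) / q"
      using q e M(1) f_bound[OF \<open>w \<in> S\<close>] by (intro frac_le mult_left_mono) (auto simp flip: e_def)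
    also have "\<dots> = (M * norm x) * (e / q)" using e by simp
    also have "\<dots> \<le> (M * norm x) * (4 * exp (- \<bar>Re w\<bar>))"
      using eq M(1) by (intro mult_left_mono) auto
    finally show "cmod (G w) \<le> 4 * (M * norm x) * exp (- 1 * \<bar>Re w\<bar>)" by simp
  qed (use \<eta> pos in auto)
  have bl: "bounded_linear (\<lambda>B. \<psi> (blinfun_apply B x))"
    by (rule bounded_linear_compose[OF \<psi>D(4) blinfun.bounded_linear_left])
  have H0: "base_regulariser \<in> H0_infinity \<phi>" using base_regulariser_H0[of 1] by simp
  have int: "\<psi> (integral UNIV (integrand t base_regulariser) x) = integral UNIV (\<lambda>u. G (Complex u t))" if "\<bar>t\<bar> = \<theta>" for t
  proof -
    have "\<psi> (integral UNIV (integrand t base_regulariser) x) = integral UNIV ((\<lambda>B. \<psi> (blinfun_apply B x)) \<circ> integrand t base_regulariser)"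
      by (rule integral_linear[OF integrand_integrable[OF H0 that] bl, symmetric])
    then show ?thesis by (simp add: o_def integrand_def G_def f_def scaleC_blinfun.rep_eq \<psi>D)
  qed
  \<comment> \<open>The exponential has period 2 pi i, so the upper line of the strip is the lower
    ray of the sector.\<close>
  have "G (Complex u (2 * pi - \<theta>)) = G (Complex u (- \<theta>))" for u
  proof -
    have "exp (Complex u (2 * pi - \<theta>)) = exp (Complex u (- \<theta>))"
      by (simp add: complex_eq_iff Re_exp Im_exp)
    then show ?thesis by (simp add: G_def f_def)
  qed
  then have "integral UNIV (\<lambda>u. G (Complex u (- \<theta>))) - integral UNIV (\<lambda>u. G (Complex u \<theta>)) =
    - (2 * complex_of_real pi * \<i>) * (residue G (p 1) + residue G (p 2))"
    using strip p12 by (simp add: algebra_simps)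
  also have "\<dots> = (2 * complex_of_real pi * \<i>) * (2 * \<psi> (blinfun_apply (shift_inverse A 2) x) - \<psi> (blinfun_apply (shift_inverse A 1) x))"
    by (simp add: res1 res2 algebra_simps)
  finally have "\<psi> (calc base_regulariser x) = 2 * \<psi> (shift_inverse A 2 x) - \<psi> (shift_inverse A 1 x)"
    using int[of \<theta>] int[of "- \<theta>"] pos
    by (simp add: calc_eq scaleC_blinfun.rep_eq blinfun.diff_left \<psi>D)
  moreover have "\<psi> (((id_blinfun - shift_inverse A 1) o\<^sub>L shift_inverse A 2) x) =
      2 * \<psi> (shift_inverse A 2 x) - \<psi> (shift_inverse A 1 x)"
  proof -
    have "shift_inverse A 1 - shift_inverse A 2 = (2 - 1) *\<^sub>C (shift_inverse A 1 o\<^sub>L shift_inverse A 2)"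
      by (rule shift_inverse_identity) (use neg_resolvent_set[of 1] neg_resolvent_set[of 2] in auto)
    then have K12: "shift_inverse A 1 o\<^sub>L shift_inverse A 2 = shift_inverse A 1 - shift_inverse A 2" by simp
    have "((id_blinfun - shift_inverse A 1) o\<^sub>L shift_inverse A 2) x =
        shift_inverse A 2 x - (shift_inverse A 1 o\<^sub>L shift_inverse A 2) x"
      by (simp add: blinfun.diff_left)
    also have "\<dots> = shift_inverse A 2 x - (shift_inverse A 1 x - shift_inverse A 2 x)"
      unfolding K12 by (simp only: blinfun.diff_left)
    finally show ?thesis by (simp only: \<psi>D) simp
  qed
  ultimately show "\<psi> (calc base_regulariser x) = \<psi> (((id_blinfun - shift_inverse A 1) o\<^sub>L shift_inverse A 2) x)"
    by (simp only:)
qed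

lemma calc_base_regulariser_power:
  "calc (\<lambda>z. base_regulariser z ^ Suc n) = op_power ((id_blinfun - shift_inverse A 1) o\<^sub>L shift_inverse A 2) (Suc n)"
proof (induction n)
  case 0
  then show ?case by (simp add: calc_base_regulariser)
next
  case (Suc n)
  let ?g = "\<lambda>z. base_regulariser z ^ Suc n"
  have g: "?g \<in> H0_infinity \<phi>" by (rule base_regulariser_H0) simp
  have "calc ?g o\<^sub>L ((id_blinfun - shift_inverse A 1) o\<^sub>L shift_inverse A 2) =
    (calc ?g o\<^sub>L (id_blinfun - 1 *\<^sub>R shift_inverse A (of_real 1))) o\<^sub>L shift_inverse A (of_real 2)"
    by (simp add: blinfun_compose_assoc)
  also have "\<dots> = calc (\<lambda>z. ?g z * (z / (of_real 1 + z)) / (of_real 2 + z))"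
    using g by (simp only: calc_ratio calc_shift_inverse_pos H0_ratio zero_less_one zero_less_numeral)
  also have "\<dots> = calc (\<lambda>z. base_regulariser z ^ Suc (Suc n))"
    by (rule calc_cong) (simp add: base_regulariser_def mult_ac)
  finally show ?case using Suc by simp
qed

lemma shift_inverse_injective:
  assumes "- \<mu> \<in> resolvent_set A" "shift_inverse A \<mu> x = 0"
  shows "x = 0"
proof -
  have "resolvent A (- \<mu>) x = 0" using assms(2) by (simp add: shift_inverse_def blinfun.minus_left)
  then have "(0, (- \<mu>) *\<^sub>C 0 - x) \<in> A"
    using resolvent_iff[OF assms(1), of 0 x] by simp
  moreover have "(0, 0) \<in> A" "single_valued A" using linear by (auto simp: linear_operator_def)
  ultimately have "0 = (- \<mu>) *\<^sub>C 0 - x" using single_valuedD[of A 0 0] by blast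
  then show "x = 0" by simp
qed

text \<open>By the residue computation this operator is a power of A (1 + A)^-1 (2 + A)^-1. The
  factor 1 - (1 + A)^-1 = A (1 + A)^-1 has the same kernel as A, and this is where injectivity of A
  enters.\<close>

lemma inj_calc_base_regulariser:
  assumes "injective_operator A"
  shows "inj (blinfun_apply (calc (\<lambda>z. base_regulariser z ^ Suc n)))"
proof -
  have neg: "- 1 \<in> resolvent_set A" "- 2 \<in> resolvent_set A"
    using neg_resolvent_set[of 1] neg_resolvent_set[of 2] by auto
  have N: "x = 0" if "(id_blinfun - shift_inverse A 1) x = 0" for x
  proof -
    have "resolvent A (- 1) (- x) = x" using that
      by (simp add: shift_inverse_def blinfun.add_left blinfun.minus_right add_eq_0_iff)
    then have "(x, (- 1) *\<^sub>C x - (- x)) \<in> A" using resolvent_iff[OF neg(1), of x "- x"] by simp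
    then have "(x, 0) \<in> A" by simp
    moreover have "(0, 0) \<in> A" using linear by (auto simp: linear_operator_def)
    ultimately show "x = 0" using assms single_valuedD[of "A\<inverse>" 0 x 0] by (simp add: injective_operator_def)
  qed
  define B where "B = (id_blinfun - shift_inverse A 1) o\<^sub>L shift_inverse A 2"
  have B: "x = 0" if "B x = 0" for x
    using N[of "shift_inverse A 2 x"] shift_inverse_injective[OF neg(2)] that by (simp add: B_def)
  have B0: "op_power B k x = 0 \<Longrightarrow> x = 0" for k x
  proof (induction k arbitrary: x)
    case (Suc k)
    then show ?case using B[of x] by simp
  qed simp
  have "inj (blinfun_apply (op_power B (Suc n)))"
  proof (rule injI)
    fix x y assume "op_power B (Suc n) x = op_power B (Suc n) y"
    then have "op_power B (Suc n) (x - y) = 0" by (simp only: blinfun.diff_right) simp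
    then show "x = y" using B0[of "Suc n" "x - y"] by simp
  qed
  then show ?thesis by (simp only: calc_base_regulariser_power B_def)
qed

end


section \<open>Arbitrary nonnegative exponents\<close>

definition inv_power :: "'a::complex_banach oper \<Rightarrow> real \<Rightarrow> 'a \<Rightarrow>\<^sub>L 'a" where
  "inv_power A \<sigma> = (if frac \<sigma> = 0 then id_blinfun else inv_power_op A (frac \<sigma>)) o\<^sub>L
     op_power (shift_inverse A 1) (nat \<lfloor>\<sigma>\<rfloor>)"

text \<open>The integer power stands on the left, so that a resolvent composed from the left meets
  it first and the expansion in \<open>shift_inverse_comp_power\<close> applies. A vanishing
  fractional part is treated separately because the integral converges only for exponents strictly
  between 0 and 1.\<close>

definition ratio_power :: "'a::complex_banach oper \<Rightarrow> real \<Rightarrow> 'a \<Rightarrow>\<^sub>L 'a" where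
  "ratio_power A \<sigma> = op_power (id_blinfun - shift_inverse A 1) (nat \<lfloor>\<sigma>\<rfloor>) o\<^sub>L
     (if frac \<sigma> = 0 then id_blinfun else ratio_power_op A (frac \<sigma>))"

lemma frac_cases: "frac (\<sigma>::real) = 0 \<or> 0 < frac \<sigma> \<and> frac \<sigma> < 1"
  using frac_ge_0[of \<sigma>] frac_lt_1[of \<sigma>] by linarith

lemma frac_plus_nat_floor: "\<sigma> \<ge> 0 \<Longrightarrow> frac \<sigma> + real (nat \<lfloor>\<sigma>\<rfloor>) = (\<sigma>::real)"
  by (simp add: frac_def)

context sector_calculus
begin

lemma powers_clinear: "inv_power A \<sigma> \<in> bounded_clinear_ops" "ratio_power A \<sigma> \<in> bounded_clinear_ops"
  unfolding inv_power_def ratio_power_def using frac_cases[of \<sigma>] shift_inverse_clinear[of 1]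
  by (auto intro!: bounded_clinear_ops_intros op_power_clinear inv_power_op_clinear ratio_power_op_clinear)

lemma calc_op_power_inverse:
  assumes g: "g \<in> H0_infinity \<phi>"
  shows "(\<lambda>z. g z / (1 + z) ^ k) \<in> H0_infinity \<phi> \<and>
    calc g o\<^sub>L op_power (shift_inverse A 1) k = calc (\<lambda>z. g z / (1 + z) ^ k)"
proof (induction k)
  case 0
  then show ?case using g by simp
next
  case (Suc k)
  have "(\<lambda>z. g z / (1 + z) ^ k / (of_real 1 + z)) \<in> H0_infinity \<phi>"
    using Suc by (intro H0_div_pos) auto
  moreover have "calc g o\<^sub>L op_power (shift_inverse A 1) (Suc k) = calc (\<lambda>z. g z / (1 + z) ^ k / (of_real 1 + z))"
    using Suc calc_shift_inverse_pos[of "\<lambda>z. g z / (1 + z) ^ k" 1] by (simp flip: blinfun_compose_assoc)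
  ultimately show ?case by (simp add: mult.commute)
qed

lemma calc_op_power_ratio:
  assumes g: "g \<in> H0_infinity \<phi>"
  shows "(\<lambda>z. g z * (z / (1 + z)) ^ k) \<in> H0_infinity \<phi> \<and>
    calc g o\<^sub>L op_power (id_blinfun - shift_inverse A 1) k = calc (\<lambda>z. g z * (z / (1 + z)) ^ k)"
proof (induction k)
  case 0
  then show ?case using g by simp
next
  case (Suc k)
  have "(\<lambda>z. g z * (z / (1 + z)) ^ k * (z / (of_real 1 + z))) \<in> H0_infinity \<phi>"
    using Suc by (intro H0_ratio) auto
  moreover have "calc g o\<^sub>L op_power (id_blinfun - shift_inverse A 1) (Suc k) =
      calc (\<lambda>z. g z * (z / (1 + z)) ^ k * (z / (of_real 1 + z)))"
    using Suc calc_ratio[of "\<lambda>z. g z * (z / (1 + z)) ^ k" 1] by (simp flip: blinfun_compose_assoc)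
  ultimately show ?case by (simp add: mult_ac)
qed

lemma calc_inv_power:
  assumes g: "g \<in> H0_infinity \<phi>" and "\<sigma> \<ge> 0"
  shows "calc g o\<^sub>L inv_power A \<sigma> = calc (\<lambda>z. g z * (1 + z) powr (- of_real \<sigma>))"
proof -
  define s where "s = frac \<sigma>"
  define k where "k = nat \<lfloor>\<sigma>\<rfloor>"
  have sk: "\<sigma> = s + real k" using frac_plus_nat_floor[OF assms(2)] by (simp add: s_def k_def)
  have "s \<ge> 0" by (simp add: s_def)
  define g1 where "g1 z = g z * (1 + z) powr (- of_real s)" for z
  have g1: "g1 \<in> H0_infinity \<phi>" unfolding g1_def[abs_def] by (rule H0_inv_power[OF g \<open>s \<ge> 0\<close>])
  have "calc g o\<^sub>L (if frac \<sigma> = 0 then id_blinfun else inv_power_op A (frac \<sigma>)) = calc g1"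
  proof (cases "s = 0")
    case True
    have "calc g1 = calc g" by (rule calc_cong) (simp add: g1_def True sector_one_plus(2))
    then show ?thesis using True by (simp add: s_def)
  next
    case False
    then show ?thesis using calc_inv_power_op[OF g, of s] frac_cases[of \<sigma>] by (auto simp: s_def g1_def[abs_def])
  qed
  then have "calc g o\<^sub>L inv_power A \<sigma> = calc g1 o\<^sub>L op_power (shift_inverse A 1) k"
    by (simp only: inv_power_def k_def flip: blinfun_compose_assoc)
  also have "\<dots> = calc (\<lambda>z. g1 z / (1 + z) ^ k)" using calc_op_power_inverse[OF g1] by blast
  also have "\<dots> = calc (\<lambda>z. g z * (1 + z) powr (- of_real \<sigma>))"
    by (rule calc_cong) (simp add: g1_def sk powr_minus_add_nat sector_one_plus(2) del: of_real_add)
  finally show ?thesis .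
qed

lemma calc_ratio_power:
  assumes g: "g \<in> H0_infinity \<phi>" and "\<sigma> \<ge> 0"
  shows "calc g o\<^sub>L ratio_power A \<sigma> = calc (\<lambda>z. g z * (z / (1 + z)) powr (of_real \<sigma>))"
proof -
  define s where "s = frac \<sigma>"
  define k where "k = nat \<lfloor>\<sigma>\<rfloor>"
  have sk: "\<sigma> = s + real k" using frac_plus_nat_floor[OF assms(2)] by (simp add: s_def k_def)
  define g1 where "g1 z = g z * (z / (1 + z)) ^ k" for z
  have g1: "g1 \<in> H0_infinity \<phi>" "calc g o\<^sub>L op_power (id_blinfun - shift_inverse A 1) k = calc g1"
    using calc_op_power_ratio[OF g] by (simp_all add: g1_def[abs_def])
  have nz: "z / (1 + z) \<noteq> 0" if "z \<in> sector \<phi>" for z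
    using that sector_one_plus(2)[OF that] by (auto simp: sector_def)
  have "calc g o\<^sub>L ratio_power A \<sigma> = calc g1 o\<^sub>L (if frac \<sigma> = 0 then id_blinfun else ratio_power_op A (frac \<sigma>))"
    by (simp only: ratio_power_def g1(2)[symmetric] k_def flip: blinfun_compose_assoc)
  also have "\<dots> = calc (\<lambda>z. g1 z * (z / (1 + z)) powr (of_real s))"
  proof (cases "s = 0")
    case True
    have "calc (\<lambda>z. g1 z * (z / (1 + z)) powr (of_real s)) = calc g1"
      by (rule calc_cong) (simp add: True nz del: divide_eq_0_iff)
    then show ?thesis using True by (simp add: s_def)
  next
    case False
    then show ?thesis using calc_ratio_power_op[OF g1(1), of s] frac_cases[of \<sigma>] by (auto simp: s_def)
  qed
  also have "\<dots> = calc (\<lambda>z. g z * (z / (1 + z)) powr (of_real \<sigma>))"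
    using nz by (intro calc_cong) (simp add: g1_def sk powr_add_nat del: of_real_add)
  finally show ?thesis .
qed

text \<open>For \<bar>z\<bar> \<ge> 1 the factor z^(-\<tau>) is at most 1 in modulus, and for
  \<bar>z\<bar> \<le> 1 it is dominated by z^(-\<sigma>). Thus every intermediate step of dividing
  by z^\<sigma> in pieces stays in the elementary class.\<close>

lemma H0_neg_power_interpolate:
  assumes g: "g \<in> H0_infinity \<phi>" and g\<sigma>: "(\<lambda>z. g z * z powr (- of_real \<sigma>)) \<in> H0_infinity \<phi>"
    and \<tau>: "0 \<le> \<tau>" "\<tau> \<le> \<sigma>"
  shows "(\<lambda>z. g z * z powr (- of_real \<tau>)) \<in> H0_infinity \<phi>"
proof -
  obtain C1 s1 where 1: "C1 \<ge> 0" "s1 > 0"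
    "\<And>u t. \<bar>t\<bar> < \<phi> \<Longrightarrow> cmod (g (exp (Complex u t))) \<le> C1 * exp (- s1 * \<bar>u\<bar>)"
    using H0_infinity_bound[OF g pos(2,4)] by blast
  obtain C2 s2 where 2: "C2 \<ge> 0" "s2 > 0"
    "\<And>u t. \<bar>t\<bar> < \<phi> \<Longrightarrow> cmod (g (exp (Complex u t)) * exp (Complex u t) powr (- of_real \<sigma>)) \<le> C2 * exp (- s2 * \<bar>u\<bar>)"
    using H0_infinity_bound[OF g\<sigma> pos(2,4)] by blast
  have norm: "cmod (g (exp (Complex u t)) * exp (Complex u t) powr (- of_real \<tau>)) = cmod (g (exp (Complex u t))) * exp (- \<tau> * u)" for u t \<tau>
    using norm_powr_le[of "exp (Complex u t)" "- \<tau>"] by (simp add: norm_mult powr_def)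
  show ?thesis
  proof (rule H0_infinityI)
    show "(\<lambda>z. g z * z powr (- of_real \<tau>)) holomorphic_on sector \<phi>"
      using g sector_not_nonpos[OF _ pos(2,4)] by (intro holomorphic_intros) (auto simp: H0_infinity_def)
    show "min s1 s2 > 0" using 1 2 by simp
    fix u t :: real assume t: "\<bar>t\<bar> < \<phi>"
    have m: "C1 * exp (- s1 * \<bar>u\<bar>) \<le> C1 * exp (- min s1 s2 * \<bar>u\<bar>)" "C2 * exp (- s2 * \<bar>u\<bar>) \<le> C2 * exp (- min s1 s2 * \<bar>u\<bar>)"
      using 1(1) 2(1) by (auto intro!: mult_left_mono mult_right_mono)
    have "cmod (g (exp (Complex u t))) * exp (- \<tau> * u) \<le> C1 * exp (- min s1 s2 * \<bar>u\<bar>) + C2 * exp (- min s1 s2 * \<bar>u\<bar>)"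
    proof (cases "u \<ge> 0")
      case True
      then have "exp (- \<tau> * u) \<le> 1" using \<tau> by simp
      then have "cmod (g (exp (Complex u t))) * exp (- \<tau> * u) \<le> cmod (g (exp (Complex u t))) * 1"
        by (intro mult_left_mono) auto
      also have "\<dots> \<le> C1 * exp (- min s1 s2 * \<bar>u\<bar>)" using 1(3)[OF t, of u] m(1) by simp
      also have "\<dots> \<le> \<dots> + C2 * exp (- min s1 s2 * \<bar>u\<bar>)" using 2(1) by simp
      finally show ?thesis .
    next
      case False
      then have "exp (- \<tau> * u) \<le> exp (- \<sigma> * u)" using \<tau> by (simp add: mult_right_mono_neg)
      then have "cmod (g (exp (Complex u t))) * exp (- \<tau> * u) \<le> cmod (g (exp (Complex u t))) * exp (- \<sigma> * u)"
        by (intro mult_left_mono) auto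
      also have "\<dots> \<le> C2 * exp (- min s1 s2 * \<bar>u\<bar>)" using 2(3)[OF t, of u] m(2) norm[of u t \<sigma>] by simp
      also have "\<dots> \<le> C1 * exp (- min s1 s2 * \<bar>u\<bar>) + \<dots>" using 1(1) by simp
      finally show ?thesis .
    qed
    then show "cmod (g (exp (Complex u t)) * exp (Complex u t) powr (- of_real \<tau>)) \<le> (C1 + C2) * exp (- min s1 s2 * \<bar>u\<bar>)"
      unfolding norm by (simp only: distrib_right)
  qed
qed

text \<open>Counterpart of \<open>calc_inv_power_op\<close> in which the calculus is that of 1 + A,
  so the power is one of z itself. Since z^(-s) is singular at 0, the decay of g(z) z^(-s) replaces
  that of g. The decay of K is a hypothesis, because sectoriality alone does not give it as v tends
  to minus infinity.\<close>

lemma calc_neg_power_integral: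
  assumes g: "g \<in> H0_infinity \<phi>" and gs: "(\<lambda>z. g z * z powr (- of_real s)) \<in> H0_infinity \<phi>"
    and s: "0 < s" "s < 1"
    and K: "\<And>v. K v = exp ((1 - s) * v) *\<^sub>R shift_inverse A (of_real (exp v))"
    and Kc: "continuous_on UNIV K" and Kb: "\<And>v. norm (K v) \<le> C * exp (- min s (1 - s) * \<bar>v\<bar>)"
  shows "calc g o\<^sub>L integral UNIV K = frac_const s *\<^sub>C calc (\<lambda>z. g z * z powr (- of_real s))"
proof -
  define b where "b = min s (1 - s)"
  have "b > 0" using s by (simp add: b_def)
  obtain D q where D: "D \<ge> 0" "q > 0"
    "\<And>u t. \<bar>t\<bar> < \<phi> \<Longrightarrow> cmod (g (exp (Complex u t)) * exp (Complex u t) powr (- of_real s)) \<le> D * exp (- q * \<bar>u\<bar>)"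
    using H0_infinity_bound[OF gs pos(2,4)] by blast
  \<comment> \<open>The kernel decays in \<bar>v - u\<bar>, not in \<bar>v\<bar>. Halving the rate
    leaves enough decay in u to pass from \<bar>v - u\<bar> to \<bar>v\<bar> by the triangle
    inequality and still keep a decaying factor in u.\<close>
  define a where "a = min b q / 2"
  have a: "a > 0" "2 * a \<le> b" "2 * a \<le> q" using \<open>b > 0\<close> D by (auto simp: a_def)
  have "C \<ge> 0" using order_trans[OF norm_ge_zero Kb[of 0]] by simp
  define \<kappa> where "\<kappa> v z = of_real (exp ((1 - s) * v)) / (of_real (exp v) + z)" for v and z :: complex
  have "calc g o\<^sub>L integral UNIV K = calc (\<lambda>z. integral UNIV (\<lambda>v. \<kappa> v z) * g z)"
  proof (rule calc_comp_integral[OF g Kc _ a(1)])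
    show "norm (K v) \<le> C * exp (- a * \<bar>v\<bar>)" for v
    proof -
      have "norm (K v) \<le> C * exp (- b * \<bar>v\<bar>)" using Kb[of v] by (simp add: b_def)
      also have "\<dots> \<le> C * exp (- a * \<bar>v\<bar>)"
        using a \<open>C \<ge> 0\<close> by (intro mult_left_mono) (auto intro!: mult_right_mono)
      finally show ?thesis .
    qed
    show "calc g o\<^sub>L K v = calc (\<lambda>z. \<kappa> v z * g z)" for v
    proof -
      have "calc g o\<^sub>L K v = of_real (exp ((1 - s) * v)) *\<^sub>C calc (\<lambda>z. g z / (of_real (exp v) + z))"
        by (simp only: K blinfun_compose_simps calc_shift_inverse_pos[OF g exp_gt_zero] scaleC_of_real)
      also have "\<dots> = calc (\<lambda>z. of_real (exp ((1 - s) * v)) * (g z / (of_real (exp v) + z)))"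
        by (rule calc_scale[symmetric, OF H0_div_pos[OF g exp_gt_zero]])
      finally show ?thesis by (simp add: \<kappa>_def)
    qed
    fix t assume t: "\<bar>t\<bar> = \<theta>"
    have nz: "of_real (exp v) + exp (Complex u t) \<noteq> 0" for u v
      using sector_add_nonneg_bounds(2)[OF ray_sector[OF t] pos(2) angles(3), of "exp v" u] by simp
    show "continuous_on UNIV (\<lambda>(v, u). \<kappa> v (exp (Complex u t)))"
      unfolding \<kappa>_def case_prod_beta using nz by (intro continuous_intros continuous_on_Complex) auto
    fix u v
    define z where "z = exp (Complex u t)"
    have zn: "cmod z = exp u" by (simp add: z_def)
    note b = sector_add_nonneg_bounds[OF ray_sector[OF t, of u] pos(2) angles(3) less_imp_le[OF exp_gt_zero[of v]], folded z_def, unfolded zn]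
    have gz: "cmod (g z) * exp (- s * u) \<le> D * exp (- q * \<bar>u\<bar>)"
      using D(3)[of t u] t angles norm_powr_le[of z "- s"] by (simp add: z_def norm_mult powr_def)
    have "cmod (\<kappa> v z) = exp ((1 - s) * v) / cmod (of_real (exp v) + z)"
      unfolding \<kappa>_def norm_divide norm_of_real by simp
    also have "\<dots> \<le> exp ((1 - s) * v) / (cos (\<phi> / 2) * (exp v + exp u))"
      using b by (intro divide_left_mono mult_pos_pos add_pos_pos) (auto simp only: zero_less_norm_iff exp_gt_zero exp_ge_zero)
    also have "\<dots> = (1 / cos (\<phi> / 2)) * (exp ((1 - s) * v) / (exp v + exp u))" by simp
    also have "\<dots> \<le> (1 / cos (\<phi> / 2)) * (exp (- s * u) * exp (- b * \<bar>v - u\<bar>))"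
      using b(1) frac_kernel_shift_le[OF s, of v u] by (intro mult_left_mono) (auto simp: b_def)
    finally have "cmod (\<kappa> v z) * cmod (g z) \<le> (1 / cos (\<phi> / 2)) * (exp (- s * u) * exp (- b * \<bar>v - u\<bar>)) * cmod (g z)"
      by (rule mult_right_mono) simp
    also have "\<dots> = (1 / cos (\<phi> / 2)) * exp (- b * \<bar>v - u\<bar>) * (cmod (g z) * exp (- s * u))" by simp
    also have "\<dots> \<le> (1 / cos (\<phi> / 2)) * exp (- b * \<bar>v - u\<bar>) * (D * exp (- q * \<bar>u\<bar>))"
      using b(1) gz by (intro mult_left_mono) auto
    also have "\<dots> = (D / cos (\<phi> / 2)) * exp (- b * \<bar>v - u\<bar> + - q * \<bar>u\<bar>)" unfolding exp_add by simp
    also have "\<dots> \<le> (D / cos (\<phi> / 2)) * exp (- a * \<bar>v\<bar> + - a * \<bar>u\<bar>)"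
    proof -
      have "a * \<bar>v\<bar> \<le> a * (\<bar>v - u\<bar> + \<bar>u\<bar>)" using a by (intro mult_left_mono) auto
      moreover have "2 * a * \<bar>u\<bar> \<le> q * \<bar>u\<bar>" using a by (intro mult_right_mono) auto
      moreover have "a * \<bar>v - u\<bar> \<le> b * \<bar>v - u\<bar>" using a by (intro mult_right_mono) auto
      ultimately have "- b * \<bar>v - u\<bar> + - q * \<bar>u\<bar> \<le> - a * \<bar>v\<bar> + - a * \<bar>u\<bar>" by (simp add: algebra_simps)
      then show ?thesis using D(1) b(1) by (intro mult_left_mono) auto
    qed
    also have "\<dots> = D / cos (\<phi> / 2) * exp (- a * \<bar>v\<bar>) * exp (- a * \<bar>u\<bar>)" unfolding exp_add by simp
    finally show "cmod (\<kappa> v (exp (Complex u t)) * g (exp (Complex u t))) \<le> D / cos (\<phi> / 2) * exp (- a * \<bar>v\<bar>) * exp (- a * \<bar>u\<bar>)"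
      by (simp only: norm_mult z_def)
  qed
  also have "\<dots> = calc (\<lambda>z. frac_const s * (g z * z powr (- of_real s)))"
  proof (rule calc_cong)
    fix z assume "z \<in> sector \<phi>"
    then have z: "z \<noteq> 0" "\<bar>Arg z\<bar> < pi" using angles(3) by (auto simp: sector_def)
    show "integral UNIV (\<lambda>v. \<kappa> v z) * g z = frac_const s * (g z * z powr (- of_real s))"
      using frac_integral[OF s z] by (simp add: \<kappa>_def[abs_def])
  qed
  also have "\<dots> = frac_const s *\<^sub>C calc (\<lambda>z. g z * z powr (- of_real s))"
    by (rule calc_scale[OF gs])
  finally show ?thesis .
qed

text \<open>With 0 in the resolvent set one may divide by z itself. Each intermediate quotient must
  be elementary, hence the hypothesis for all j up to k.\<close>

lemma calc_op_power_zero: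
  assumes "0 \<in> resolvent_set A" and g: "\<And>j. j \<le> k \<Longrightarrow> (\<lambda>z. g z / z ^ j) \<in> H0_infinity \<phi>"
  shows "calc g o\<^sub>L op_power (shift_inverse A 0) k = calc (\<lambda>z. g z / z ^ k)"
  using g
proof (induction k)
  case (Suc k)
  have "(\<lambda>z. g z / z ^ k / (of_real 0 + z)) \<in> H0_infinity \<phi>"
    using Suc.prems[of "Suc k"] by (simp add: mult.commute)
  then have "calc (\<lambda>z. g z / z ^ k) o\<^sub>L shift_inverse A (of_real 0) = calc (\<lambda>z. g z / z ^ k / (of_real 0 + z))"
    using Suc.prems[of k] assms(1) by (intro calc_shift_inverse) auto
  then show ?case using Suc by (simp add: mult.commute flip: blinfun_compose_assoc)
qed simp

end

section \<open>Identification with the fractional powers of the calculus\<close>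

lemma shift_inverse_one_plus: "shift_inverse (one_plus_op A) r = shift_inverse A (r + 1)"
  by (simp add: shift_inverse_def resolvent_one_plus)

lemma sectorial_imp_calculus:
  assumes "sectorial_of_angle \<omega> A"
  obtains \<theta> \<phi> where "sector_calculus A \<omega> \<theta> \<phi>"
proof -
  have "0 < \<omega>" "\<omega> < pi" using assms by (auto simp: sectorial_of_angle_def)
  then have "sector_calculus A \<omega> ((2 * \<omega> + pi) / 3) ((\<omega> + 2 * pi) / 3)"
    using assms by unfold_locales auto
  then show ?thesis by (rule that)
qed

text \<open>\<open>inv_power A\<close> is an integral of resolvents of A, whereas the calculus is
  that of 1 + A with the function z^(-\<sigma>). The decay of the kernel is taken from A, the
  regularisation from 1 + A. The angles and g stay arbitrary because membership in the power only
  asserts that some exist.\<close>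

lemma calc_neg_power:
  fixes A :: "'a::complex_banach oper"
  assumes A: "sectorial_of_angle \<omega>0 A" and calc: "sector_calculus (one_plus_op A) \<omega> \<theta> \<phi>"
    and g: "g \<in> H0_infinity \<phi>" "(\<lambda>z. g z * z powr (- of_real \<sigma>)) \<in> H0_infinity \<phi>" and "\<sigma> \<ge> 0"
  shows "elementary_calculus \<theta> (one_plus_op A) g o\<^sub>L inv_power A \<sigma> =
    elementary_calculus \<theta> (one_plus_op A) (\<lambda>z. g z * z powr (- of_real \<sigma>))"
proof -
  interpret A1: sector_calculus "one_plus_op A" \<omega> \<theta> \<phi> by fact
  obtain \<theta>0 \<phi>0 where "sector_calculus A \<omega>0 \<theta>0 \<phi>0" using sectorial_imp_calculus[OF A] .
  then interpret A: sector_calculus A \<omega>0 \<theta>0 \<phi>0 .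
  define s where "s = frac \<sigma>"
  define k where "k = nat \<lfloor>\<sigma>\<rfloor>"
  have sk: "\<sigma> = s + real k" using frac_plus_nat_floor[OF \<open>\<sigma> \<ge> 0\<close>] by (simp add: s_def k_def)
  have "s \<ge> 0" by (simp add: s_def)
  define g1 where "g1 z = g z * z powr (- of_real s)" for z
  have interp: "(\<lambda>z. g z * z powr (- of_real (s + real j))) \<in> H0_infinity \<phi>" if "j \<le> k" for j
    using that \<open>s \<ge> 0\<close> by (intro A1.H0_neg_power_interpolate[OF g]) (auto simp: sk)
  have nz: "z \<noteq> 0" if "z \<in> sector \<phi>" for z using that by (auto simp: sector_def)
  have H0_cong: "h \<in> H0_infinity \<phi>" if "h' \<in> H0_infinity \<phi>" "\<And>z. z \<in> sector \<phi> \<Longrightarrow> h' z = h z" for h h'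
  proof -
    have "h holomorphic_on sector \<phi>"
      using that holomorphic_transform[of h' "sector \<phi>" h] by (auto simp: H0_infinity_def)
    then show ?thesis using that by (auto simp: H0_infinity_def)
  qed
  have g1j: "(\<lambda>z. g1 z / z ^ j) \<in> H0_infinity \<phi>" if "j \<le> k" for j
    by (rule H0_cong[OF interp[OF that]]) (simp add: g1_def powr_minus_add_nat nz del: of_real_add)
  have "A1.calc g o\<^sub>L (if frac \<sigma> = 0 then id_blinfun else inv_power_op A (frac \<sigma>)) = A1.calc g1"
  proof (cases "s = 0")
    case True
    have "A1.calc g1 = A1.calc g" by (rule A1.calc_cong) (simp add: g1_def True nz)
    then show ?thesis using True by (simp add: s_def)
  next
    case False
    then have s: "0 < s" "s < 1" using frac_cases[of \<sigma>] by (auto simp: s_def)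
    obtain C where C: "\<And>v. norm (inv_power_kernel A s v) \<le> C * exp (- min s (1 - s) * \<bar>v\<bar>)"
      using A.inv_power_kernel_props(2)[OF s] by blast
    have "g1 \<in> H0_infinity \<phi>" using g1j[of 0] by simp
    then have g1': "(\<lambda>z. g z * z powr (- of_real s)) \<in> H0_infinity \<phi>" by (simp add: g1_def[abs_def])
    have "A1.calc g o\<^sub>L integral UNIV (inv_power_kernel A s) = frac_const s *\<^sub>C A1.calc g1"
      unfolding g1_def[abs_def]
      by (rule A1.calc_neg_power_integral[OF g(1) g1' s _ A.inv_power_kernel_props(1)[OF s] C])
        (simp add: inv_power_kernel_def shift_inverse_one_plus)
    then show ?thesis
      using False frac_const_nonzero[OF s]
      by (simp add: inv_power_op_def A1.calc_comp_scaleC[OF g(1)] scaleC_scaleC flip: s_def)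
  qed
  then have "A1.calc g o\<^sub>L inv_power A \<sigma> = A1.calc g1 o\<^sub>L op_power (shift_inverse (one_plus_op A) 0) k"
    by (simp only: inv_power_def k_def shift_inverse_one_plus add_0 flip: blinfun_compose_assoc)
  also have "\<dots> = A1.calc (\<lambda>z. g1 z / z ^ k)"
    using A.neg_resolvent_set[of 1] g1j by (intro A1.calc_op_power_zero) (auto simp: resolvent_one_plus)
  also have "\<dots> = A1.calc (\<lambda>z. g z * z powr (- of_real \<sigma>))"
    by (rule A1.calc_cong) (simp add: g1_def sk powr_minus_add_nat nz del: of_real_add)
  finally show ?thesis .
qed

text \<open>In one direction an unknown regulariser is given, and injectivity of its operator
  identifies y. In the other a power of \<open>base_regulariser\<close> with exponent above \<sigma>
  is exhibited; it works for every x, so the domain is the whole space.\<close>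

lemma fractional_power_one_plus_eq:
  fixes A :: "'a::complex_banach oper"
  assumes A: "sectorial_of_angle \<omega>0 A" and "\<sigma> \<ge> 0"
  shows "fractional_power (one_plus_op A) (- \<sigma>) = bounded_graph (inv_power A \<sigma>)"
proof -
  have "(x, y) \<in> fractional_power (one_plus_op A) (- \<sigma>) \<longleftrightarrow> y = inv_power A \<sigma> x" for x y
  proof
    assume "(x, y) \<in> fractional_power (one_plus_op A) (- \<sigma>)"
    then obtain \<omega> \<theta> \<phi> e where e: "sectorial_of_angle \<omega> (one_plus_op A)" "\<omega> < \<theta>" "\<theta> < \<phi>" "\<phi> < pi"
      "e \<in> H0_infinity \<phi>" "(\<lambda>z. e z * z powr (- of_real \<sigma>)) \<in> H0_infinity \<phi>"
      "inj (blinfun_apply (elementary_calculus \<theta> (one_plus_op A) e))"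
      "elementary_calculus \<theta> (one_plus_op A) e y = elementary_calculus \<theta> (one_plus_op A) (\<lambda>z. e z * z powr (- of_real \<sigma>)) x"
      by (auto simp: fractional_power_def functional_calculus_def)
    then have "sector_calculus (one_plus_op A) \<omega> \<theta> \<phi>" by unfold_locales
    from calc_neg_power[OF A this e(5,6) \<open>\<sigma> \<ge> 0\<close>]
    have "elementary_calculus \<theta> (one_plus_op A) e y = elementary_calculus \<theta> (one_plus_op A) e (inv_power A \<sigma> x)"
      unfolding e(8) by (metis blinfun_apply_blinfun_compose)
    then show "y = inv_power A \<sigma> x" using e(7) by (simp add: inj_eq)
  next
    assume y: "y = inv_power A \<sigma> x"
    obtain \<theta> \<phi> where "sector_calculus (one_plus_op A) \<omega>0 \<theta> \<phi>"
      using sectorial_imp_calculus[OF sectorial_one_plus[OF A]] .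
    then interpret A1: sector_calculus "one_plus_op A" \<omega>0 \<theta> \<phi> .
    obtain \<theta>0 \<phi>0 where "sector_calculus A \<omega>0 \<theta>0 \<phi>0" using sectorial_imp_calculus[OF A] .
    then interpret A: sector_calculus A \<omega>0 \<theta>0 \<phi>0 .
    have "injective_operator (one_plus_op A)"
      unfolding injective_operator_def
    proof (rule single_valuedI)
      fix y x x' assume "(y, x) \<in> (one_plus_op A)\<inverse>" "(y, x') \<in> (one_plus_op A)\<inverse>"
      moreover have "(u, v) \<in> one_plus_op A \<Longrightarrow> (u, v - u) \<in> A" for u v by (auto simp: one_plus_op_def)
      ultimately have "(x, y - x) \<in> A" "(x', y - x') \<in> A" by auto
      moreover have m1: "- 1 \<in> resolvent_set A" using A.neg_resolvent_set[of 1] by simp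
      ultimately show "x = x'"
        using resolvent_iff[OF m1, of x "- y"] resolvent_iff[OF m1, of x' "- y"] by simp
    qed
    note inj' = A1.inj_calc_base_regulariser[OF this, of "nat \<lfloor>\<sigma>\<rfloor>"]
    define e where "e = (\<lambda>z. base_regulariser z ^ Suc (nat \<lfloor>\<sigma>\<rfloor>))"
    note inj = inj'[folded e_def]
    have "\<bar>- \<sigma>\<bar> < real (Suc (nat \<lfloor>\<sigma>\<rfloor>))" using \<open>\<sigma> \<ge> 0\<close> by simp linarith
    from A1.base_regulariser_power[OF this]
    have e: "e \<in> H0_infinity \<phi>" "(\<lambda>z. e z * z powr (- of_real \<sigma>)) \<in> H0_infinity \<phi>"
      using A1.base_regulariser_H0[of "Suc (nat \<lfloor>\<sigma>\<rfloor>)"] by (simp_all add: e_def)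
    have "elementary_calculus \<theta> (one_plus_op A) e y = elementary_calculus \<theta> (one_plus_op A) (\<lambda>z. e z * z powr (- of_real \<sigma>)) x"
      using calc_neg_power[OF A A1.sector_calculus_axioms e \<open>\<sigma> \<ge> 0\<close>] unfolding y by (metis blinfun_apply_blinfun_compose)
    then show "(x, y) \<in> fractional_power (one_plus_op A) (- \<sigma>)"
      unfolding fractional_power_def functional_calculus_def
      using A1.sec A1.angles e inj by auto
  qed
  then show ?thesis by (auto simp: bounded_graph_def)
qed

text \<open>This shows both that (1 + A)^(-\<sigma>) maps into the domain of A^\<sigma> and what the
  product is, without a description of that domain. The multiplication rules, applied to e and to e
  z^\<sigma>, express both sides as the elementary calculus of e (z / (1 + z))^\<sigma>.\<close>

lemma fractional_power_inv_power_iff: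
  fixes A :: "'a::complex_banach oper"
  assumes A: "sectorial_of_angle \<omega>0 A" "injective_operator A" and "\<sigma> \<ge> 0"
  shows "(inv_power A \<sigma> x, y) \<in> fractional_power A \<sigma> \<longleftrightarrow> y = ratio_power A \<sigma> x"
proof -
  have key: "elementary_calculus \<theta> A e (ratio_power A \<sigma> x) =
      elementary_calculus \<theta> A (\<lambda>z. e z * z powr (of_real \<sigma>)) (inv_power A \<sigma> x)"
    if c: "sector_calculus A \<omega> \<theta> \<phi>" and e: "e \<in> H0_infinity \<phi>" "(\<lambda>z. e z * z powr (of_real \<sigma>)) \<in> H0_infinity \<phi>"
    for \<omega> \<theta> \<phi> e
  proof -
    interpret sector_calculus A \<omega> \<theta> \<phi> by fact
    have "calc e o\<^sub>L ratio_power A \<sigma> = calc (\<lambda>z. e z * (z / (1 + z)) powr (of_real \<sigma>))"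
      by (rule calc_ratio_power[OF e(1) \<open>\<sigma> \<ge> 0\<close>])
    also have "\<dots> = calc (\<lambda>z. (e z * z powr (of_real \<sigma>)) * (1 + z) powr (- of_real \<sigma>))"
    proof (rule calc_cong)
      fix z assume "z \<in> sector \<phi>"
      then have "z \<in> sector pi" using pos by (auto simp: sector_def)
      then show "e z * (z / (1 + z)) powr (of_real \<sigma>) = e z * z powr (of_real \<sigma>) * (1 + z) powr (- of_real \<sigma>)"
        by (simp add: ratio_powr)
    qed
    also have "\<dots> = calc (\<lambda>z. e z * z powr (of_real \<sigma>)) o\<^sub>L inv_power A \<sigma>"
      by (rule calc_inv_power[symmetric, OF e(2) \<open>\<sigma> \<ge> 0\<close>])
    finally show ?thesis by (metis blinfun_apply_blinfun_compose)
  qed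
  show ?thesis
  proof
    assume "(inv_power A \<sigma> x, y) \<in> fractional_power A \<sigma>"
    then obtain \<omega> \<theta> \<phi> e where e: "sectorial_of_angle \<omega> A" "\<omega> < \<theta>" "\<theta> < \<phi>" "\<phi> < pi"
      "e \<in> H0_infinity \<phi>" "(\<lambda>z. e z * z powr (of_real \<sigma>)) \<in> H0_infinity \<phi>"
      "inj (blinfun_apply (elementary_calculus \<theta> A e))"
      "elementary_calculus \<theta> A e y = elementary_calculus \<theta> A (\<lambda>z. e z * z powr (of_real \<sigma>)) (inv_power A \<sigma> x)"
      by (auto simp: fractional_power_def functional_calculus_def)
    then have "sector_calculus A \<omega> \<theta> \<phi>" by unfold_locales
    from key[OF this e(5,6)] have "elementary_calculus \<theta> A e y = elementary_calculus \<theta> A e (ratio_power A \<sigma> x)"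
      using e(8) by simp
    then show "y = ratio_power A \<sigma> x" using e(7) by (simp add: inj_eq)
  next
    assume y: "y = ratio_power A \<sigma> x"
    obtain \<theta> \<phi> where "sector_calculus A \<omega>0 \<theta> \<phi>" using sectorial_imp_calculus[OF A(1)] .
    then interpret sector_calculus A \<omega>0 \<theta> \<phi> .
    define e where "e = (\<lambda>z. base_regulariser z ^ Suc (nat \<lfloor>\<sigma>\<rfloor>))"
    have "\<bar>\<sigma>\<bar> < real (Suc (nat \<lfloor>\<sigma>\<rfloor>))" using \<open>\<sigma> \<ge> 0\<close> by simp linarith
    from base_regulariser_power[OF this]
    have e: "e \<in> H0_infinity \<phi>" "(\<lambda>z. e z * z powr (of_real \<sigma>)) \<in> H0_infinity \<phi>"
      using base_regulariser_H0[of "Suc (nat \<lfloor>\<sigma>\<rfloor>)"] by (simp_all add: e_def)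
    note inj = inj_calc_base_regulariser[OF A(2), of "nat \<lfloor>\<sigma>\<rfloor>", folded e_def]
    show "(inv_power A \<sigma> x, y) \<in> fractional_power A \<sigma>"
      unfolding fractional_power_def functional_calculus_def y
      using sec angles e inj key[OF sector_calculus_axioms e] by auto
  qed
qed


section \<open>Laplace transforms along rays\<close>

text \<open>With t = exp u the left side is exp (- c t) dt written in du. The two-sided bound brings
  Laplace integrals within reach of the lemmas on line integrals; for u \<ge> 0 it rests on y^2 / 2
  \<le> exp y at y = c exp u.\<close>

lemma double_exp_le:
  fixes c u :: real
  assumes "c > 0"
  shows "exp u * exp (- c * exp u) \<le> (1 + 2 / c\<^sup>2) * exp (- \<bar>u\<bar>)"
proof (cases "u \<ge> 0")
  case True
  have "(c * exp u)\<^sup>2 / 2 \<le> exp (c * exp u)"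
    using exp_lower_Taylor_quadratic[of "c * exp u"] assms by (smt (verit) exp_gt_zero mult_pos_pos)
  then have "(exp u)\<^sup>2 * exp (- c * exp u) \<le> 2 / c\<^sup>2"
    using assms by (simp add: exp_minus field_simps power_mult_distrib)
  then have "(exp u)\<^sup>2 * exp (- c * exp u) * exp (- u) \<le> (1 + 2 / c\<^sup>2) * exp (- u)"
    by (intro mult_right_mono) auto
  moreover have "(exp u)\<^sup>2 * exp (- c * exp u) * exp (- u) = exp u * exp (- c * exp u)"
    by (simp add: power2_eq_square exp_minus)
  ultimately have "exp u * exp (- c * exp u) \<le> (1 + 2 / c\<^sup>2) * exp (- u)" by (simp only:)
  then show ?thesis using True by simp
next
  case False
  have "exp u * exp (- c * exp u) \<le> exp u * 1"
    using assms by (intro mult_left_mono) auto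
  also have "\<dots> \<le> (1 + 2 / c\<^sup>2) * exp u" by (simp add: algebra_simps)
  finally show ?thesis using False by simp
qed

lemma double_exp_integral:
  fixes c :: real
  assumes "c > 0"
  shows "((\<lambda>u. exp u * exp (- c * exp u)) has_integral 1 / c) UNIV"
proof -
  have "((\<lambda>u. exp u * exp (- c * exp u)) has_integral (0 - (- 1 / c))) UNIV"
  proof (rule has_integral_line_FTC[of "{}" "\<lambda>u. - exp (- c * exp u) / c"])
    show "((\<lambda>u. - exp (- c * exp u) / c) has_vector_derivative exp x * exp (- c * exp x)) (at x)" for x
      unfolding has_real_derivative_iff_has_vector_derivative[symmetric]
      using assms by (auto intro!: derivative_eq_intros)
    show "((\<lambda>u. - exp (- c * exp u) / c) \<longlongrightarrow> 0) at_top" using assms by real_asymp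
    have "((\<lambda>u. - exp (- c * exp u) / c) \<longlongrightarrow> - exp (- c * 0) / c) at_bot"
      using assms by (intro tendsto_intros exp_at_bot) auto
    then show "((\<lambda>u. - exp (- c * exp u) / c) \<longlongrightarrow> - 1 / c) at_bot" by simp
  qed (use assms in \<open>auto intro!: continuous_intros\<close>)
  then show ?thesis by simp
qed

text \<open>The pointwise bound feeds the lemmas on line integrals; the bound on the integral keeps
  the exact value 1 / c, which is what the estimates of transforms use.\<close>

lemma double_exp_integrable:
  fixes f :: "real \<Rightarrow> 'b::banach"
  assumes f: "continuous_on UNIV f" and "c > 0" "K \<ge> 0"
    and bound: "\<And>u. norm (f u) \<le> K * (exp u * exp (- c * exp u))"
  shows "norm (f u) \<le> K * (1 + 2 / c\<^sup>2) * exp (- 1 * \<bar>u\<bar>)"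
    and "f integrable_on UNIV" and "norm (integral UNIV f) \<le> K / c"
proof -
  show dec: "norm (f u) \<le> K * (1 + 2 / c\<^sup>2) * exp (- 1 * \<bar>u\<bar>)" for u
    using mult_left_mono[OF double_exp_le[OF \<open>c > 0\<close>, of u] \<open>K \<ge> 0\<close>] bound[of u] by simp
  show i: "f integrable_on UNIV"
    by (rule exp_decay_integrable0(1)[OF f _ dec]) simp
  have "((\<lambda>u. K * (exp u * exp (- c * exp u))) has_integral K * (1 / c)) UNIV"
    by (rule has_integral_mult_right[OF double_exp_integral[OF \<open>c > 0\<close>]])
  from integral_norm_bound_integral[OF i has_integral_integrable[OF this] bound] integral_unique[OF this]
  show "norm (integral UNIV f) \<le> K / c" by simp
qed

definition ray_kernel :: "real \<Rightarrow> (real \<Rightarrow> complex) \<Rightarrow> complex \<Rightarrow> real \<Rightarrow> complex" where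
  "ray_kernel \<tau> h \<mu> u = exp (Complex u \<tau>) * exp (- \<mu> * exp (Complex u \<tau>)) * h u"

text \<open>
  In terms of \<open>z = exp (u + \<i>\<tau>)\<close> this is the Laplace transform along the ray of angle \<open>\<tau>\<close>,
  with \<open>h u\<close> the value at \<open>z\<close> of the transformed function.
\<close>

definition ray_laplace :: "real \<Rightarrow> (real \<Rightarrow> complex) \<Rightarrow> complex \<Rightarrow> complex" where
  "ray_laplace \<tau> h \<mu> = integral UNIV (ray_kernel \<tau> h \<mu>)"

lemma exp_Complex_cis: "exp (Complex u \<tau>) = of_real (exp u) * cis \<tau>"
  by (simp add: complex_eq_iff Re_exp Im_exp)

lemma Re_mult_exp_Complex: "Re (\<mu> * exp (Complex u \<tau>)) = exp u * Re (\<mu> * cis \<tau>)"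
  by (simp add: exp_Complex_cis algebra_simps)

lemma norm_ray_kernel_le:
  assumes "cmod (h u) \<le> M * exp (a * exp u)" "Re (\<mu> * cis \<tau>) \<ge> a + c" "M \<ge> 0"
  shows "cmod (ray_kernel \<tau> h \<mu> u) \<le> M * (exp u * exp (- c * exp u))"
proof -
  have "cmod (ray_kernel \<tau> h \<mu> u) = exp u * exp (- (exp u * Re (\<mu> * cis \<tau>))) * cmod (h u)"
    unfolding ray_kernel_def norm_mult norm_exp_eq_Re using Re_mult_exp_Complex[of \<mu> u \<tau>] by simp
  also have "\<dots> \<le> exp u * exp (- (exp u * (a + c))) * (M * exp (a * exp u))"
    using assms by (intro mult_mono) auto
  also have "\<dots> = M * (exp u * (exp (- (exp u * (a + c))) * exp (a * exp u)))" by simp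
  also have "exp (- (exp u * (a + c))) * exp (a * exp u) = exp (- c * exp u)"
    unfolding mult_exp_exp by (simp add: algebra_simps)
  finally show ?thesis .
qed

lemma continuous_on_ray_kernel:
  "continuous_on UNIV h \<Longrightarrow> continuous_on UNIV (ray_kernel \<tau> h \<mu>)"
  unfolding ray_kernel_def[abs_def] by (intro continuous_intros continuous_on_Complex)

lemma ray_kernel_integrable:
  assumes "continuous_on UNIV h" "\<And>u. cmod (h u) \<le> M * exp (a * exp u)" "Re (\<mu> * cis \<tau>) > a" "M \<ge> 0"
  shows "ray_kernel \<tau> h \<mu> integrable_on UNIV" and "cmod (ray_laplace \<tau> h \<mu>) \<le> M / (Re (\<mu> * cis \<tau>) - a)"
proof -
  define c where "c = Re (\<mu> * cis \<tau>) - a"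
  have c: "c > 0" "Re (\<mu> * cis \<tau>) \<ge> a + c" using assms(3) by (auto simp: c_def)
  note b = norm_ray_kernel_le[OF assms(2) c(2) assms(4)]
  show "ray_kernel \<tau> h \<mu> integrable_on UNIV" "cmod (ray_laplace \<tau> h \<mu>) \<le> M / (Re (\<mu> * cis \<tau>) - a)"
    using double_exp_integrable(2,3)[OF continuous_on_ray_kernel[OF assms(1)] c(1) assms(4) b]
    unfolding ray_laplace_def c_def[symmetric] by blast+
qed

lemma ray_half_plane: "convex {\<mu>. a < Re (\<mu> * cis \<tau>)}" "open {\<mu>. a < Re (\<mu> * cis \<tau>)}"
proof -
  have "{\<mu>. a < Re (\<mu> * cis \<tau>)} = {\<mu>. inner (cnj (cis \<tau>)) \<mu> > a}"
    by (auto simp: inner_complex_def algebra_simps)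
  then show "convex {\<mu>. a < Re (\<mu> * cis \<tau>)}" "open {\<mu>. a < Re (\<mu> * cis \<tau>)}"
    using convex_halfspace_gt[of a "cnj (cis \<tau>)"] open_halfspace_gt[of a "cnj (cis \<tau>)"] by auto
qed

text \<open>The truncated integrals are holomorphic by differentiation under the integral sign, and
  they converge uniformly on small discs.\<close>

lemma ray_laplace_holomorphic:
  assumes h: "continuous_on UNIV h" "\<And>u. cmod (h u) \<le> M * exp (a * exp u)" "M \<ge> 0"
  shows "ray_laplace \<tau> h holomorphic_on {\<mu>. a < Re (\<mu> * cis \<tau>)}" (is "_ holomorphic_on ?S")
proof (rule holomorphic_uniform_sequence[OF ray_half_plane(2)])
  have cont: "continuous_on (UNIV \<times> T) (\<lambda>(\<mu>, u). ray_kernel \<tau> h \<mu> u)" for T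
    unfolding ray_kernel_def case_prod_beta
    by (intro continuous_intros continuous_on_Complex continuous_on_compose2[OF h(1)]) auto
  show "(\<lambda>\<mu>. integral {- real n..real n} (ray_kernel \<tau> h \<mu>)) holomorphic_on ?S" for n
  proof -
    have "(\<lambda>\<mu>. integral (cbox (- real n) (real n)) (ray_kernel \<tau> h \<mu>)) holomorphic_on ?S"
    proof (rule leibniz_rule_holomorphic[OF _ _ _ ray_half_plane(1)])
      show "((\<lambda>\<mu>. ray_kernel \<tau> h \<mu> u) has_field_derivative (- exp (Complex u \<tau>)) * ray_kernel \<tau> h \<mu> u) (at \<mu> within ?S)" for \<mu> u
        unfolding ray_kernel_def by (auto intro!: derivative_eq_intros)
      show "ray_kernel \<tau> h \<mu> integrable_on cbox (- real n) (real n)" for \<mu>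
        by (rule integrable_continuous) (rule continuous_on_subset[OF continuous_on_ray_kernel[OF h(1)]], simp)
      have "continuous_on (UNIV \<times> cbox (- real n) (real n)) (\<lambda>p. (- exp (Complex (snd p) \<tau>)) * (\<lambda>(\<mu>, u). ray_kernel \<tau> h \<mu> u) p)"
        by (intro continuous_on_mult cont continuous_intros continuous_on_Complex)
      then show "continuous_on (?S \<times> cbox (- real n) (real n)) (\<lambda>(\<mu>, u). (- exp (Complex u \<tau>)) * ray_kernel \<tau> h \<mu> u)"
        by (rule continuous_on_subset[THEN continuous_on_eq]) (auto simp: case_prod_beta)
    qed
    then show ?thesis by simp
  qed
  fix \<mu> assume "\<mu> \<in> ?S"
  \<comment> \<open>Half the distance to the boundary line, so that on the disc of radius
    \<open>c\<close> the kernel still decays at rate \<open>c\<close>.\<close>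
  define c where "c = (Re (\<mu> * cis \<tau>) - a) / 2"
  have c: "c > 0" "Re (\<mu> * cis \<tau>) = a + 2 * c" using \<open>\<mu> \<in> ?S\<close> by (auto simp: c_def field_simps)
  have ge: "Re (\<nu> * cis \<tau>) \<ge> a + c" if "\<nu> \<in> cball \<mu> c" for \<nu>
  proof -
    have "Re ((\<mu> - \<nu>) * cis \<tau>) \<le> cmod ((\<mu> - \<nu>) * cis \<tau>)" by (rule complex_Re_le_cmod)
    also have "\<dots> \<le> c" using that by (simp add: norm_mult dist_norm)
    finally show ?thesis using c(2) by (simp add: left_diff_distrib)
  qed
  have "uniform_limit (cball \<mu> c) (\<lambda>n \<nu>. integral {- real n..real n} (ray_kernel \<tau> h \<nu>)) (\<lambda>\<nu>. integral UNIV (ray_kernel \<tau> h \<nu>)) sequentially"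
  proof (rule line_integral_uniform_limit[OF continuous_on_ray_kernel[OF h(1)]])
    show "cmod (ray_kernel \<tau> h \<nu> u) \<le> M * (1 + 2 / c\<^sup>2) * exp (- 1 * \<bar>u\<bar>)" if "\<nu> \<in> cball \<mu> c" for \<nu> u
      by (rule double_exp_integrable(1)[OF continuous_on_ray_kernel[OF h(1)] c(1) h(3)])
        (rule norm_ray_kernel_le[OF h(2) ge[OF that] h(3)])
  qed simp
  moreover have "cball \<mu> c \<subseteq> ?S" using ge c by force
  ultimately show "\<exists>d>0. cball \<mu> d \<subseteq> ?S \<and> uniform_limit (cball \<mu> d) (\<lambda>n \<nu>. integral {- real n..real n} (ray_kernel \<tau> h \<nu>)) (ray_laplace \<tau> h) sequentially"
    using c(1) by (auto simp: ray_laplace_def[abs_def])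
qed

text \<open>Models the scalar function \<phi> (F z y) obtained from the analytic part F of a
  semigroup by a functional \<phi> and a vector y.\<close>

locale analytic_exp_bounded =
  fixes s :: "complex \<Rightarrow> complex" and \<theta> M w :: real
  assumes \<theta>: "0 < \<theta>" "\<theta> \<le> pi" and hol: "s holomorphic_on sector \<theta>"
    and bound: "\<And>z. z \<in> sector \<theta> \<Longrightarrow> cmod (s z) \<le> M * exp (w * cmod z)"
    and w: "w \<ge> 0" and M: "M \<ge> 0"
begin

definition ray_value :: "real \<Rightarrow> real \<Rightarrow> complex" where
  "ray_value \<tau> u = s (exp (Complex u \<tau>))"

lemma ray_sector: "\<bar>\<tau>\<bar> < \<theta> \<Longrightarrow> exp (Complex u \<tau>) \<in> sector \<theta>"
  using \<theta> by (subst exp_in_sector_iff) auto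

lemma ray_value_props:
  assumes "\<bar>\<tau>\<bar> < \<theta>"
  shows "continuous_on UNIV (ray_value \<tau>)" "cmod (ray_value \<tau> u) \<le> M * exp (w * exp u)"
proof -
  show "continuous_on UNIV (ray_value \<tau>)"
    unfolding ray_value_def[abs_def] using ray_sector[OF assms]
    by (intro continuous_on_compose2[OF holomorphic_on_imp_continuous_on[OF hol]] continuous_intros continuous_on_Complex) auto
  show "cmod (ray_value \<tau> u) \<le> M * exp (w * exp u)"
    using bound[OF ray_sector[OF assms, of u]] by (simp add: ray_value_def)
qed

lemma cos_mono_angle: "\<bar>t\<bar> \<le> \<psi> \<Longrightarrow> \<psi> \<le> pi \<Longrightarrow> cos \<psi> \<le> cos t"
  using cos_monotone_0_pi_le[of "\<bar>t\<bar>" \<psi>] by simp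

text \<open>Among the angles between 0 and \<tau> the cosine is smallest at \<tau>, so the condition
  at \<tau> makes exp (- x z) beat the growth of s on all rays in between.\<close>

lemma ray_laplace_rotate:
  assumes \<tau>: "\<bar>\<tau>\<bar> < \<theta>" and x: "x * cos \<tau> > w" "x \<ge> 0"
  shows "ray_laplace \<tau> (ray_value \<tau>) (of_real x) = ray_laplace 0 (ray_value 0) (of_real x)"
proof -
  define G where "G \<xi> = exp \<xi> * exp (- of_real x * exp \<xi>) * s (exp \<xi>)" for \<xi>
  have sect: "exp \<xi> \<in> sector \<theta>" if "\<bar>Im \<xi>\<bar> < \<theta>" for \<xi>
    using ray_sector[OF that, of "Re \<xi>"] by simp
  define c where "c = x * cos \<tau> - w"
  have "c > 0" using x by (simp add: c_def)
  have strip: "integral UNIV (\<lambda>u. G (Complex u l)) = integral UNIV (\<lambda>u. G (Complex u h))"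
    if lh: "l < h" "\<bar>l\<bar> \<le> \<bar>\<tau>\<bar>" "\<bar>h\<bar> \<le> \<bar>\<tau>\<bar>" for l h
  proof -
    have "integral UNIV (\<lambda>u. G (Complex u l)) - integral UNIV (\<lambda>u. G (Complex u h)) = 2 * pi * \<i> * (\<Sum>p\<in>{}. residue G p)"
    proof (rule strip_residue[where l' = "- \<theta>" and h' = \<theta> and a = 1 and B = 0 and K = "M * (1 + 2 / c\<^sup>2)"])
      have "(s \<circ> exp) holomorphic_on {\<xi>. - \<theta> < Im \<xi> \<and> Im \<xi> < \<theta>}"
        by (rule holomorphic_on_compose_gen[OF holomorphic_on_exp hol]) (auto intro: sect)
      then show "G holomorphic_on {\<xi>. - \<theta> < Im \<xi> \<and> Im \<xi> < \<theta>} - {}"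
        unfolding G_def[abs_def] o_def by (intro holomorphic_intros) auto
      fix \<xi> assume "l \<le> Im \<xi>" "Im \<xi> \<le> h"
      then have im: "\<bar>Im \<xi>\<bar> \<le> \<bar>\<tau>\<bar>" using lh by linarith
      define e where "e = exp (Re \<xi>)"
      have "cmod (G \<xi>) = e * exp (- (x * (e * cos (Im \<xi>)))) * cmod (s (exp \<xi>))"
        by (simp add: G_def norm_mult Re_exp e_def)
      also have "\<dots> \<le> e * exp (- (x * (e * cos \<tau>))) * (M * exp (w * e))"
      proof (intro mult_mono)
        have "cos \<tau> \<le> cos (Im \<xi>)" using cos_mono_angle[OF im] \<tau> \<theta> by simp
        then have "x * (e * cos \<tau>) \<le> x * (e * cos (Im \<xi>))"
          using x(2) by (intro mult_left_mono) (auto simp: e_def)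
        then show "exp (- (x * (e * cos (Im \<xi>)))) \<le> exp (- (x * (e * cos \<tau>)))" by simp
        show "cmod (s (exp \<xi>)) \<le> M * exp (w * e)"
          using bound[OF sect] im \<tau> by (simp add: e_def)
      qed (use M in \<open>auto simp: e_def\<close>)
      also have "\<dots> = M * (e * (exp (- (x * (e * cos \<tau>))) * exp (w * e)))" by simp
      also have "exp (- (x * (e * cos \<tau>))) * exp (w * e) = exp (- c * e)"
        unfolding mult_exp_exp c_def by (simp add: algebra_simps)
      also have "M * (e * exp (- c * e)) \<le> M * ((1 + 2 / c\<^sup>2) * exp (- \<bar>Re \<xi>\<bar>))"
        using double_exp_le[OF \<open>c > 0\<close>, of "Re \<xi>"] M by (intro mult_left_mono) (auto simp: e_def)
      finally show "cmod (G \<xi>) \<le> M * (1 + 2 / c\<^sup>2) * exp (- 1 * \<bar>Re \<xi>\<bar>)" by simp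
    qed (use lh \<tau> in auto)
    then show ?thesis by simp
  qed
  have "integral UNIV (\<lambda>u. G (Complex u \<tau>)) = integral UNIV (\<lambda>u. G (Complex u 0))"
    using strip[of 0 \<tau>] strip[of \<tau> 0] by (cases \<tau> "0::real" rule: linorder_cases) auto
  then show ?thesis
    by (simp add: ray_laplace_def ray_kernel_def[abs_def] ray_value_def G_def)
qed

text \<open>For z = exp (u + i \<tau>) this is s(z) exp (p (t - z)) / (z - t) dz in terms of du:
  Cauchy's integrand at t with a factor equal to 1 at z = t. The factor makes the integral over an
  unbounded sector converge, and as exp (p t) exp (- p z) it contains the Laplace kernel at
  p.\<close>

definition cauchy_kernel :: "real \<Rightarrow> complex \<Rightarrow> real \<Rightarrow> real \<Rightarrow> complex" where
  "cauchy_kernel \<tau> p t u = exp (Complex u \<tau>) * s (exp (Complex u \<tau>)) *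
     exp (p * (of_real t - exp (Complex u \<tau>))) / (exp (Complex u \<tau>) - of_real t)"

text \<open>In logarithmic coordinates the only pole between the two rays is ln t. A single real
  parameter W with W cos \<psi> > w gives decay on both rays at once.\<close>

lemma cauchy_ray_formula:
  assumes \<psi>: "0 < \<psi>" "\<psi> < \<theta>" "\<psi> < pi / 2" and W: "W * cos \<psi> > w" "W \<ge> 0" and t: "t > 0"
  shows "integral UNIV (cauchy_kernel (- \<psi>) (of_real W) t) - integral UNIV (cauchy_kernel \<psi> (of_real W) t) =
    2 * pi * \<i> * s (of_real t)"
proof -
  define F where "F \<xi> = exp \<xi> * s (exp \<xi>) * exp (of_real W * (of_real t - exp \<xi>))" for \<xi>
  define S where "S = {\<xi>. - \<theta> < Im \<xi> \<and> Im \<xi> < \<theta>}"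
  define p where "p = complex_of_real (ln t)"
  have ep: "exp p = of_real t" using t by (simp add: p_def exp_of_real)
  have sect: "exp \<xi> \<in> sector \<theta>" if "\<bar>Im \<xi>\<bar> < \<theta>" for \<xi>
    using ray_sector[OF that, of "Re \<xi>"] by simp
  have "open S" by (simp add: S_def open_Collect_conj open_halfspace_Im_gt open_halfspace_Im_lt)
  have "(s \<circ> exp) holomorphic_on S"
    by (rule holomorphic_on_compose_gen[OF holomorphic_on_exp hol]) (auto simp: S_def intro: sect)
  then have F: "F holomorphic_on S"
    unfolding F_def[abs_def] o_def by (intro holomorphic_intros) auto
  have nz: "exp \<xi> - of_real t \<noteq> 0" if "\<xi> \<in> S" "\<xi> \<noteq> p" for \<xi>
  proof
    assume "exp \<xi> - of_real t = 0"
    then have "exp \<xi> = exp p" using ep by simp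
    moreover have "Ln (exp \<xi>) = \<xi>" using that(1) \<theta> by (intro Ln_exp) (auto simp: S_def)
    moreover have "Ln (exp p) = p" by (rule Ln_exp) (auto simp: p_def)
    ultimately have "\<xi> = p" by metis
    with that show False by simp
  qed
  define c where "c = W * cos \<psi> - w"
  have "c > 0" using W by (simp add: c_def)
  have res: "residue (\<lambda>\<xi>. F \<xi> / (exp \<xi> - of_real t)) p = s (of_real t)"
  proof -
    have "residue (\<lambda>\<xi>. F \<xi> / (exp \<xi> - of_real t)) p = F p / exp p"
      by (rule residue_quotient[OF \<open>open S\<close> _ F])
        (use nz ep \<theta> in \<open>auto intro!: holomorphic_intros derivative_eq_intros simp: S_def p_def\<close>)
    then show ?thesis using t by (simp add: F_def ep)
  qed
  have "integral UNIV (\<lambda>u. F (Complex u (- \<psi>)) / (exp (Complex u (- \<psi>)) - of_real t)) -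
      integral UNIV (\<lambda>u. F (Complex u \<psi>) / (exp (Complex u \<psi>) - of_real t)) =
    2 * pi * \<i> * (\<Sum>q\<in>{p}. residue (\<lambda>\<xi>. F \<xi> / (exp \<xi> - of_real t)) q)"
  proof (rule strip_residue[where l' = "- \<theta>" and h' = \<theta> and a = 1 and B = "\<bar>ln t\<bar> + 1"
        and K = "2 / t * (exp (W * t) * (M * (1 + 2 / c\<^sup>2)))"])
    show "(\<lambda>\<xi>. F \<xi> / (exp \<xi> - of_real t)) holomorphic_on {\<xi>. - \<theta> < Im \<xi> \<and> Im \<xi> < \<theta>} - {p}"
      unfolding S_def[symmetric] using nz F by (intro holomorphic_intros) (auto intro: holomorphic_on_subset)
    fix \<xi> assume im: "- \<psi> \<le> Im \<xi>" "Im \<xi> \<le> \<psi>" and re: "\<bar>ln t\<bar> + 1 \<le> \<bar>Re \<xi>\<bar>"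
    define e where "e = exp (Re \<xi>)"
    \<comment> \<open>At distance 1 from ln t the modulus differs from t by a factor of at least exp
      1, which exceeds 2.\<close>
    have "t / 2 \<le> \<bar>e - t\<bar>"
    proof -
      have "2 \<le> exp (1::real)" using exp_ge_add_one_self[of "1::real"] by simp
      consider "Re \<xi> \<ge> ln t + 1" | "Re \<xi> \<le> ln t - 1" using re by linarith
      then show ?thesis
      proof cases
        case 1
        have "t * 2 \<le> t * exp 1" using \<open>2 \<le> exp 1\<close> t by (intro mult_left_mono) auto
        also have "\<dots> = exp (ln t + 1)" using t by (simp add: exp_add)
        also have "\<dots> \<le> e" using 1 by (simp add: e_def)
        finally show ?thesis using t by simp
      next
        case 2
        have "e * 2 \<le> e * exp 1" using \<open>2 \<le> exp 1\<close> by (intro mult_left_mono) (auto simp: e_def)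
        also have "\<dots> = exp (Re \<xi> + 1)" by (simp add: exp_add e_def)
        also have "\<dots> \<le> exp (ln t)" using 2 by simp
        also have "\<dots> = t" using t by simp
        finally show ?thesis by linarith
      qed
    qed
    also have "\<bar>e - t\<bar> \<le> cmod (exp \<xi> - of_real t)"
      using norm_triangle_ineq3[of "exp \<xi>" "of_real t"] t by (simp add: e_def)
    finally have den: "t / 2 \<le> cmod (exp \<xi> - of_real t)" .
    have "cmod (F \<xi>) = e * cmod (s (exp \<xi>)) * exp (W * (t - e * cos (Im \<xi>)))"
      by (simp add: F_def norm_mult Re_exp e_def)
    also have "\<dots> \<le> e * (M * exp (w * e)) * exp (W * (t - e * cos \<psi>))"
    proof (intro mult_mono)
      have "cos \<psi> \<le> cos (Im \<xi>)" using cos_mono_angle[of "Im \<xi>" \<psi>] im \<psi> \<theta> by simp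
      then have "W * (e * cos \<psi>) \<le> W * (e * cos (Im \<xi>))"
        using W(2) by (intro mult_left_mono) (auto simp: e_def)
      then show "exp (W * (t - e * cos (Im \<xi>))) \<le> exp (W * (t - e * cos \<psi>))" by (simp add: algebra_simps)
      show "cmod (s (exp \<xi>)) \<le> M * exp (w * e)"
        using bound[OF sect] im \<psi> by (simp add: e_def)
    qed (use M in \<open>auto simp: e_def\<close>)
    also have "\<dots> = M * (e * (exp (w * e) * exp (W * (t - e * cos \<psi>))))" by simp
    also have "exp (w * e) * exp (W * (t - e * cos \<psi>)) = exp (W * t) * exp (- c * e)"
      unfolding mult_exp_exp c_def by (simp add: algebra_simps)
    also have "M * (e * (exp (W * t) * exp (- c * e))) = exp (W * t) * (M * (e * exp (- c * e)))" by simp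
    also have "\<dots> \<le> exp (W * t) * (M * ((1 + 2 / c\<^sup>2) * exp (- \<bar>Re \<xi>\<bar>)))"
      using double_exp_le[OF \<open>c > 0\<close>, of "Re \<xi>"] M by (intro mult_left_mono) (auto simp: e_def)
    finally have num: "cmod (F \<xi>) \<le> exp (W * t) * (M * ((1 + 2 / c\<^sup>2) * exp (- \<bar>Re \<xi>\<bar>)))" .
    have "cmod (F \<xi> / (exp \<xi> - of_real t)) \<le> exp (W * t) * (M * ((1 + 2 / c\<^sup>2) * exp (- \<bar>Re \<xi>\<bar>))) / (t / 2)"
      unfolding norm_divide using num den t M by (intro frac_le) auto
    then show "cmod (F \<xi> / (exp \<xi> - of_real t)) \<le> 2 / t * (exp (W * t) * (M * (1 + 2 / c\<^sup>2))) * exp (- 1 * \<bar>Re \<xi>\<bar>)"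
      by (simp only: mult_ac divide_divide_eq_right times_divide_eq_left times_divide_eq_right mult_minus_left mult_1)
  qed (use \<psi> in \<open>auto simp: p_def\<close>)
  then have "integral UNIV (\<lambda>u. F (Complex u (- \<psi>)) / (exp (Complex u (- \<psi>)) - of_real t)) -
      integral UNIV (\<lambda>u. F (Complex u \<psi>) / (exp (Complex u \<psi>) - of_real t)) = 2 * pi * \<i> * s (of_real t)"
    by (simp add: res)
  then show ?thesis unfolding cauchy_kernel_def[abs_def] F_def .
qed

text \<open>The left side is the distance of t from the line through the ray, seen by rotating the
  ray onto the real axis.\<close>

lemma ray_distance:
  fixes t :: real
  assumes "t > 0"
  shows "t * \<bar>sin \<tau>\<bar> \<le> cmod (exp (Complex u \<tau>) - of_real t)"
proof -
  have "\<bar>Im ((exp (Complex u \<tau>) - of_real t) * cis (- \<tau>))\<bar> \<le> cmod ((exp (Complex u \<tau>) - of_real t) * cis (- \<tau>))"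
    by (rule abs_Im_le_cmod)
  also have "\<dots> = cmod (exp (Complex u \<tau>) - of_real t)" by (simp add: norm_mult)
  also have "(exp (Complex u \<tau>) - of_real t) * cis (- \<tau>) = of_real (exp u) - of_real t * cis (- \<tau>)"
    by (simp add: exp_Complex_cis algebra_simps cis_mult)
  also have "\<bar>Im (of_real (exp u) - of_real t * cis (- \<tau>))\<bar> = t * \<bar>sin \<tau>\<bar>"
    using assms by (simp add: abs_mult)
  finally show ?thesis .
qed

text \<open>The derivative of the Cauchy kernel in p loses the denominator z - t and is minus exp (p
  t) times the Laplace kernel. Moving p away from q therefore costs a contour integral of exp (\<mu>
  t) times the ray transform. The gain is that on a single ray p may have negative real part, which
  makes the remaining Cauchy integral of order exp (Re p t).\<close>

lemma cauchy_kernel_split: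
  assumes \<tau>: "\<bar>\<tau>\<bar> < \<theta>" "\<tau> \<noteq> 0" and p: "Re (p * cis \<tau>) \<ge> w + 1" and q: "Re (q * cis \<tau>) \<ge> w + 1" and t: "t > 0"
  shows "cmod (integral UNIV (cauchy_kernel \<tau> p t)) \<le> M * exp (Re p * t) / (t * \<bar>sin \<tau>\<bar>)"
    and "integral UNIV (cauchy_kernel \<tau> q t) - integral UNIV (cauchy_kernel \<tau> p t) =
      contour_integral (linepath q p) (\<lambda>\<mu>. exp (\<mu> * of_real t) * ray_laplace \<tau> (ray_value \<tau>) \<mu>)"
proof -
  have "- pi < \<tau>" "\<tau> < pi" using \<tau>(1) \<theta>(2) by linarith+
  then have sin: "\<bar>sin \<tau>\<bar> > 0" using \<tau>(2) sin_eq_0_pi[of \<tau>] by auto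
  have zt: "exp (Complex u \<tau>) - of_real t \<noteq> 0" for u
    using ray_distance[OF t, of \<tau> u] mult_pos_pos[OF t sin] by auto
  have ex: "exp (r * (of_real t - z)) = exp (r * of_real t) * exp (- r * z)" for r z :: complex
    unfolding mult_exp_exp by (simp add: algebra_simps)
  have ck: "cauchy_kernel \<tau> r t u = exp (r * of_real t) * ray_kernel \<tau> (ray_value \<tau>) r u / (exp (Complex u \<tau>) - of_real t)" for r u
    unfolding cauchy_kernel_def ray_kernel_def ray_value_def ex by (simp add: mult_ac)
  have rk: "cmod (ray_kernel \<tau> (ray_value \<tau>) r u) \<le> M * (exp u * exp (- 1 * exp u))" if "Re (r * cis \<tau>) \<ge> w + 1" for r u
    by (rule norm_ray_kernel_le[where a = w and c = 1 and h = "ray_value \<tau>" and \<tau> = \<tau>, OF ray_value_props(2)[OF \<tau>(1)] that M])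
  have cc: "continuous_on UNIV (cauchy_kernel \<tau> r t)" for r
    unfolding ck[abs_def] using zt
    by (intro continuous_intros continuous_on_Complex continuous_on_ray_kernel ray_value_props(1)[OF \<tau>(1)]) auto
  have cb: "cmod (cauchy_kernel \<tau> r t u) \<le> (M * exp (Re r * t) / (t * \<bar>sin \<tau>\<bar>)) * (exp u * exp (- 1 * exp u))"
    if "Re (r * cis \<tau>) \<ge> w + 1" for r u
  proof -
    have "cmod (cauchy_kernel \<tau> r t u) = exp (Re r * t) * cmod (ray_kernel \<tau> (ray_value \<tau>) r u) / cmod (exp (Complex u \<tau>) - of_real t)"
      by (simp add: ck norm_mult norm_divide)
    also have "\<dots> \<le> exp (Re r * t) * (M * (exp u * exp (- 1 * exp u))) / (t * \<bar>sin \<tau>\<bar>)"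
      using rk[OF that, of u] ray_distance[OF t, of \<tau> u] t sin M by (intro frac_le mult_left_mono mult_pos_pos) auto
    finally show ?thesis by (simp add: mult_ac)
  qed
  have K: "M * exp (Re r * t) / (t * \<bar>sin \<tau>\<bar>) \<ge> 0" for r using M t sin by simp
  show "cmod (integral UNIV (cauchy_kernel \<tau> p t)) \<le> M * exp (Re p * t) / (t * \<bar>sin \<tau>\<bar>)"
    using double_exp_integrable(3)[OF cc _ K cb[OF p]] by simp
  have ci: "cauchy_kernel \<tau> r t integrable_on UNIV" if "Re (r * cis \<tau>) \<ge> w + 1" for r
    using double_exp_integrable(2)[OF cc _ K cb[OF that]] by simp
  define \<mu> where "\<mu> x = linepath q p x" for x
  have \<mu>: "Re (\<mu> x * cis \<tau>) \<ge> w + 1" if "x \<in> {0..1}" for x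
  proof -
    have "Re (\<mu> x * cis \<tau>) = (1 - x) * Re (q * cis \<tau>) + x * Re (p * cis \<tau>)"
      by (simp add: \<mu>_def linepath_def algebra_simps)
    also have "\<dots> \<ge> (1 - x) * (w + 1) + x * (w + 1)" using that p q by (intro add_mono mult_left_mono) auto
    finally show ?thesis by (simp add: algebra_simps)
  qed
  define f where "f x u = exp (\<mu> x * of_real t) * ray_kernel \<tau> (ray_value \<tau>) (\<mu> x) u * (p - q)" for x u
  define L where "L = max (Re p) (Re q)"
  have inner: "integral {0..1} (\<lambda>x. f x u) = cauchy_kernel \<tau> q t u - cauchy_kernel \<tau> p t u" for u
  proof -
    define z where "z = exp (Complex u \<tau>)"
    have nz: "of_real t - z \<noteq> 0" using zt[of u] by (auto simp: z_def)
    \<comment> \<open>Primitive of \<open>f x u\<close> in x: integrating exp (\<mu> (t - z)) over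
      the segment restores the denominator t - z.\<close>
    define Fp where "Fp x = z * s z * exp (\<mu> x * (of_real t - z)) / (of_real t - z)" for x
    have d: "(\<mu> has_vector_derivative (p - q)) (at x within {0..1})" for x
      unfolding \<mu>_def by (rule has_vector_derivative_linepath_within)
    have "(Fp has_vector_derivative f x u) (at x within {0..1})" for x
    proof -
      have "((\<lambda>\<nu>. z * s z * exp (\<nu> * (of_real t - z)) / (of_real t - z)) has_field_derivative
          z * s z * exp (\<mu> x * (of_real t - z))) (at (\<mu> x))"
        using nz by (auto intro!: derivative_eq_intros)
      from field_vector_diff_chain_within[OF d has_field_derivative_at_within[OF this]]
      have "(Fp has_vector_derivative (p - q) * (z * s z * exp (\<mu> x * (of_real t - z)))) (at x within {0..1})"
        by (simp add: o_def Fp_def[abs_def])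
      moreover have "(p - q) * (z * s z * exp (\<mu> x * (of_real t - z))) = f x u"
        unfolding f_def ray_kernel_def ray_value_def z_def[symmetric] ex by (simp add: mult_ac)
      ultimately show ?thesis by simp
    qed
    then have "((\<lambda>x. f x u) has_integral (Fp 1 - Fp 0)) {0..1}"
      by (intro fundamental_theorem_of_calculus) auto
    then have "integral {0..1} (\<lambda>x. f x u) = Fp 1 - Fp 0" by (rule integral_unique)
    also have "Fp 1 - Fp 0 = cauchy_kernel \<tau> q t u - cauchy_kernel \<tau> p t u"
    proof -
      have "a / (of_real t - z) = - (a / (z - of_real t))" for a
        by (metis minus_diff_eq minus_divide_right)
      then show ?thesis
        by (simp add: Fp_def \<mu>_def linepath_0' linepath_1' cauchy_kernel_def z_def)
    qed
    finally show ?thesis .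
  qed
  have "contour_integral (linepath q p) (\<lambda>\<mu>. exp (\<mu> * of_real t) * ray_laplace \<tau> (ray_value \<tau>) \<mu>) =
      integral {0..1} (\<lambda>x. integral UNIV (f x))"
  proof -
    have "exp (\<mu> x * of_real t) * ray_laplace \<tau> (ray_value \<tau>) (\<mu> x) * (p - q) = integral UNIV (f x)" for x
      by (simp only: f_def[abs_def] ray_laplace_def integral_mult_right integral_mult_left)
    then show ?thesis by (simp add: contour_integral_integral \<mu>_def)
  qed
  also have "\<dots> = integral UNIV (\<lambda>u. integral {0..1} (\<lambda>x. f x u))"
  proof (rule line_integral_swap_interval)
    have 1: "continuous_on ({0..1} \<times> UNIV) (\<lambda>z. ray_value \<tau> (snd z))"
      by (rule continuous_on_compose2[OF ray_value_props(1)[OF \<tau>(1)]]) (auto intro!: continuous_intros)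
    show "continuous_on ({0..1} \<times> UNIV) (\<lambda>(x, u). f x u)"
      unfolding f_def ray_kernel_def case_prod_beta \<mu>_def linepath_def
      by (intro continuous_intros continuous_on_Complex 1)
    fix x u assume x: "x \<in> {0..1::real}"
    have "Re (\<mu> x) \<le> L"
    proof -
      have "Re (\<mu> x) = (1 - x) * Re q + x * Re p" by (simp add: \<mu>_def linepath_def)
      also have "\<dots> \<le> (1 - x) * L + x * L" using x by (intro add_mono mult_left_mono) (auto simp: L_def)
      finally show ?thesis by (simp add: algebra_simps)
    qed
    then have "cmod (f x u) \<le> exp (L * t) * (M * (exp u * exp (- 1 * exp u))) * cmod (p - q)"
      unfolding f_def norm_mult using rk[OF \<mu>[OF x], of u] t M by (intro mult_mono) (auto simp: mult_right_mono)
    also have "\<dots> \<le> exp (L * t) * (M * ((1 + 2 / 1\<^sup>2) * exp (- \<bar>u\<bar>))) * cmod (p - q)"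
      using double_exp_le[of 1 u] M by (intro mult_left_mono mult_right_mono) auto
    finally show "cmod (f x u) \<le> (exp (L * t) * (M * 3) * cmod (p - q)) * exp (- 1 * \<bar>u\<bar>)" by (simp add: mult_ac)
  qed auto
  also have "\<dots> = integral UNIV (cauchy_kernel \<tau> q t) - integral UNIV (cauchy_kernel \<tau> p t)"
    unfolding inner by (rule integral_diff[OF ci[OF q] ci[OF p]])
  finally show "integral UNIV (cauchy_kernel \<tau> q t) - integral UNIV (cauchy_kernel \<tau> p t) =
      contour_integral (linepath q p) (\<lambda>\<mu>. exp (\<mu> * of_real t) * ray_laplace \<tau> (ray_value \<tau>) \<mu>)" by simp
qed

end


section \<open>Contour representation of asymptotically analytic functions\<close>

context analytic_exp_bounded
begin

text \<open>At large real x the function \<rho> is the transform of f, the ray for s may be rotated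
  to angle \<tau>, and f - s accounts for the rest, with a transform holomorphic in Re \<mu> > -
  \<omega>. All terms are holomorphic on an intersection of half-planes, which is convex and hence
  connected, so the identity extends.\<close>

lemma transform_continuation:
  fixes f :: "real \<Rightarrow> complex"
  assumes \<tau>: "\<bar>\<tau>\<bar> < \<theta>" "\<bar>\<tau>\<bar> < pi / 2"
    and f: "continuous_on UNIV (\<lambda>u. f (exp u))" "\<And>t. t > 0 \<Longrightarrow> cmod (f t - s (of_real t)) \<le> M * exp (- \<omega> * t)"
    and \<delta>: "0 < \<delta>" "\<delta> \<le> \<omega>" and "Y' > 0"
    and \<rho>: "\<rho> holomorphic_on {\<mu>. w < Re (\<mu> * cis \<tau>) \<and> - \<delta> < Re \<mu> \<and> \<bar>Im \<mu>\<bar> < Y'}"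
    and lap: "\<And>x. x \<ge> x0 \<Longrightarrow> \<rho> (of_real x) = ray_laplace 0 (\<lambda>u. f (exp u)) (of_real x)"
    and \<mu>: "w < Re (\<mu> * cis \<tau>)" "- \<delta> < Re \<mu>" "\<bar>Im \<mu>\<bar> < Y'"
  shows "\<rho> \<mu> = ray_laplace \<tau> (ray_value \<tau>) \<mu> + ray_laplace 0 (\<lambda>u. f (exp u) - s (of_real (exp u))) \<mu>"
proof -
  define h where "h u = f (exp u) - s (of_real (exp u))" for u
  have rv0: "ray_value 0 = (\<lambda>u. s (of_real (exp u)))"
    by (simp add: ray_value_def[abs_def] exp_Complex_cis)
  have \<theta>0: "\<bar>0\<bar> < \<theta>" using \<theta> by simp
  have h: "continuous_on UNIV h" "cmod (h u) \<le> M * exp (- \<omega> * exp u)" for u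
    unfolding h_def[abs_def] using ray_value_props(1)[OF \<theta>0] f by (auto simp: rv0 intro!: continuous_intros)
  define D where "D = {\<mu>. w < Re (\<mu> * cis \<tau>) \<and> - \<delta> < Re \<mu> \<and> \<bar>Im \<mu>\<bar> < Y'}"
  have D: "D = {\<mu>. w < Re (\<mu> * cis \<tau>)} \<inter> {\<mu>. - \<delta> < Re \<mu>} \<inter> {\<mu>. Im \<mu> < Y'} \<inter> {\<mu>. - Y' < Im \<mu>}"
    by (auto simp: D_def)
  have "convex D" "open D"
    unfolding D by (intro convex_Int open_Int ray_half_plane convex_halfspace_Re_gt convex_halfspace_Im_lt convex_halfspace_Im_gt
      open_halfspace_Re_gt open_halfspace_Im_lt open_halfspace_Im_gt)+
  define d where "d \<mu> = \<rho> \<mu> - ray_laplace \<tau> (ray_value \<tau>) \<mu> - ray_laplace 0 h \<mu>" for \<mu>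
  have "d holomorphic_on D"
  proof -
    have "ray_laplace \<tau> (ray_value \<tau>) holomorphic_on D"
      by (rule holomorphic_on_subset[OF ray_laplace_holomorphic[OF ray_value_props[OF \<tau>(1)] M]]) (auto simp: D_def)
    moreover have "ray_laplace 0 h holomorphic_on D"
      by (rule holomorphic_on_subset[OF ray_laplace_holomorphic[OF h M]]) (use \<delta> in \<open>auto simp: D_def\<close>)
    ultimately show ?thesis unfolding d_def[abs_def] using \<rho> by (intro holomorphic_intros) (auto simp: D_def)
  qed
  have c: "cos \<tau> > 0" using \<tau>(2) by (intro cos_gt_zero_pi) auto
  \<comment> \<open>To the right of this point all transforms converge, on the rotated ray as
    well.\<close>
  define x1 where "x1 = max (max x0 1) (max ((w + 1) / cos \<tau>) (w + 1))"
  have x1: "x \<ge> x0 \<and> x > 0 \<and> x * cos \<tau> > w \<and> x > w" if "x > x1" for x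
  proof -
    have "x > (w + 1) / cos \<tau>" using that by (simp add: x1_def)
    then have "x * cos \<tau> > w + 1" using c by (simp add: field_simps)
    then show ?thesis using that by (auto simp: x1_def)
  qed
  have d0: "d (of_real x) = 0" if "x > x1" for x
  proof -
    note x = x1[OF that]
    have "ray_laplace \<tau> (ray_value \<tau>) (of_real x) = ray_laplace 0 (ray_value 0) (of_real x)"
      by (rule ray_laplace_rotate[OF \<tau>(1)]) (use x in auto)
    moreover have "ray_laplace 0 (\<lambda>u. f (exp u)) (of_real x) = ray_laplace 0 (ray_value 0) (of_real x) + ray_laplace 0 h (of_real x)"
    proof -
      have i1: "ray_kernel 0 (ray_value 0) (of_real x) integrable_on UNIV"
        by (rule ray_kernel_integrable(1)[OF ray_value_props[OF \<theta>0] _ M]) (use x in auto)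
      have i2: "ray_kernel 0 h (of_real x) integrable_on UNIV"
        by (rule ray_kernel_integrable(1)[OF h _ M]) (use x \<delta> in auto)
      have "ray_kernel 0 (\<lambda>u. f (exp u)) (of_real x) = (\<lambda>u. ray_kernel 0 (ray_value 0) (of_real x) u + ray_kernel 0 h (of_real x) u)"
        by (simp add: fun_eq_iff ray_kernel_def h_def rv0 algebra_simps)
      then show ?thesis unfolding ray_laplace_def by (simp add: integral_add[OF i1 i2])
    qed
    ultimately show ?thesis using lap[of x] x by (simp add: d_def)
  qed
  have "d \<mu> = 0"
  proof (rule analytic_continuation[OF \<open>d holomorphic_on D\<close> \<open>open D\<close> convex_connected[OF \<open>convex D\<close>]])
    show "of_real ` {x1<..} \<subseteq> D"
      using x1 \<delta> \<open>Y' > 0\<close> by (force simp: D_def)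
    show "complex_of_real (x1 + 1) \<in> D"
      using x1[of "x1 + 1"] \<delta> \<open>Y' > 0\<close> by (simp add: D_def del: of_real_add)
    show "complex_of_real (x1 + 1) islimpt of_real ` {x1<..}"
      unfolding islimpt_approachable
    proof (intro allI impI bexI conjI)
      fix e :: real assume "e > 0"
      have "complex_of_real (x1 + 1 + e / 2) - complex_of_real (x1 + 1) = of_real (e / 2)"
        by simp
      then show "dist (complex_of_real (x1 + 1 + e / 2)) (complex_of_real (x1 + 1)) < e"
        using \<open>e > 0\<close> unfolding dist_norm by (simp only: norm_of_real)
      show "complex_of_real (x1 + 1 + e / 2) \<noteq> complex_of_real (x1 + 1)"
        using \<open>e > 0\<close> unfolding of_real_eq_iff by simp
      show "complex_of_real (x1 + 1 + e / 2) \<in> of_real ` {x1<..}" using \<open>e > 0\<close> by (intro imageI) simp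
    qed
    show "\<mu> \<in> D" using \<mu> by (simp add: D_def)
  qed (use d0 in auto)
  then show ?thesis unfolding d_def h_def[abs_def] by (simp only: diff_diff_eq right_minus_eq)
qed

text \<open>At the real point W Cauchy's formula uses both rays. On the ray of angle - \<psi> the
  parameter is then moved to the upper endpoint, on the ray of angle \<psi> to the lower one; there
  Y sin \<psi> makes up for the negative real part. The three terms of the constant belong to the
  two remaining Cauchy integrals, to the transform of f - s, and to f - s itself.\<close>

lemma contour_representation:
  fixes f :: "real \<Rightarrow> complex"
  assumes \<psi>: "0 < \<psi>" "\<psi> < \<theta>" "\<psi> < pi / 2"
    and f: "continuous_on UNIV (\<lambda>u. f (exp u))" "\<And>t. t > 0 \<Longrightarrow> cmod (f t - s (of_real t)) \<le> M * exp (- \<omega> * t)"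
    and W: "W * cos \<psi> \<ge> w + 1" "W \<ge> 0"
    and \<epsilon>: "0 < \<epsilon>" "\<epsilon> < \<delta>" "\<delta> \<le> \<omega>" and Y: "0 < Y" "Y < Y'" "Y * sin \<psi> - \<epsilon> * cos \<psi> \<ge> w + 1"
    and \<rho>: "\<And>\<tau>. \<bar>\<tau>\<bar> = \<psi> \<Longrightarrow> \<rho> holomorphic_on {\<mu>. w < Re (\<mu> * cis \<tau>) \<and> - \<delta> < Re \<mu> \<and> \<bar>Im \<mu>\<bar> < Y'}"
    and lap: "\<And>x. x \<ge> x0 \<Longrightarrow> \<rho> (of_real x) = ray_laplace 0 (\<lambda>u. f (exp u)) (of_real x)"
    and t: "t \<ge> 1"
  shows "cmod (2 * complex_of_real pi * \<i> * f t -
      contour_integral (linepath (Complex (- \<epsilon>) (- Y)) (of_real W) +++ linepath (of_real W) (Complex (- \<epsilon>) Y)) (\<lambda>\<mu>. exp (\<mu> * of_real t) * \<rho> \<mu>))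
    \<le> (2 / sin \<psi> + 2 * Y / (\<omega> - \<epsilon>) + 2 * pi) * M * exp (- \<epsilon> * t)"
proof -
  define p where "p = Complex (- \<epsilon>) Y"
  define p' where "p' = Complex (- \<epsilon>) (- Y)"
  define q where "q = complex_of_real W"
  define h where "h u = f (exp u) - s (of_real (exp u))" for u
  define U where "U \<mu> = exp (\<mu> * of_real t) * ray_laplace 0 h \<mu>" for \<mu>
  define R where "R \<mu> = exp (\<mu> * of_real t) * \<rho> \<mu>" for \<mu>
  have c: "cos \<psi> > 0" using \<psi> by (intro cos_gt_zero) auto
  have sin: "sin \<psi> > 0" using \<psi> by (intro sin_gt_zero) auto
  have \<theta>0: "\<bar>0\<bar> < \<theta>" using \<theta> by simp
  have rv0: "ray_value 0 = (\<lambda>u. s (of_real (exp u)))"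
    by (simp add: ray_value_def[abs_def] exp_Complex_cis)
  have h: "continuous_on UNIV h" "cmod (h u) \<le> M * exp (- \<omega> * exp u)" for u
    unfolding h_def[abs_def] using ray_value_props(1)[OF \<theta>0] f by (auto simp: rv0 intro!: continuous_intros)
  have U_hol: "U holomorphic_on {\<mu>. - \<omega> < Re \<mu>}"
    unfolding U_def[abs_def] using ray_laplace_holomorphic[OF h M, of 0] by (intro holomorphic_intros) auto
  have U_bound: "cmod (U \<mu>) \<le> exp (- \<epsilon> * t) * (M / (\<omega> - \<epsilon>))" if "Re \<mu> = - \<epsilon>" for \<mu>
  proof -
    have "cmod (ray_laplace 0 h \<mu>) \<le> M / (\<omega> - \<epsilon>)"
      using ray_kernel_integrable(2)[OF h, of \<mu> 0] M that \<epsilon> by (simp add: algebra_simps)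
    from mult_left_mono[OF this, of "exp (- (\<epsilon> * t))"] show ?thesis using that by (simp add: U_def norm_mult)
  qed
  \<comment> \<open>Each of the three conditions defines a convex set containing both endpoints of
    the segment.\<close>
  have seg: "w + 1 \<le> Re (\<mu> * cis \<tau>) \<and> - \<epsilon> \<le> Re \<mu> \<and> \<bar>Im \<mu>\<bar> \<le> Y"
    if "\<mu> \<in> closed_segment q r" "r = p \<and> \<tau> = - \<psi> \<or> r = p' \<and> \<tau> = \<psi>" for \<mu> r \<tau>
  proof -
    from that(1) obtain v where v: "0 \<le> v" "v \<le> 1" "\<mu> = (1 - v) *\<^sub>R q + v *\<^sub>R r"
      by (auto simp: closed_segment_def)
    have "Re (q * cis \<tau>) \<ge> w + 1" using W(1) that(2) by (auto simp: q_def)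
    moreover have "Re (r * cis \<tau>) \<ge> w + 1" using Y(3) that(2) by (auto simp: p_def p'_def algebra_simps)
    ultimately have ge: "(1 - v) * Re (q * cis \<tau>) + v * Re (r * cis \<tau>) \<ge> (1 - v) * (w + 1) + v * (w + 1)"
      using v by (intro add_mono mult_left_mono) auto
    have "Re (\<mu> * cis \<tau>) = (1 - v) * Re (q * cis \<tau>) + v * Re (r * cis \<tau>)"
      by (simp add: v algebra_simps)
    also have "\<dots> \<ge> (1 - v) * (w + 1) + v * (w + 1)" by (rule ge)
    also have "(1 - v) * (w + 1) + v * (w + 1) = w + 1" by (simp add: algebra_simps)
    finally have 1: "w + 1 \<le> Re (\<mu> * cis \<tau>)" .
    have "Re \<mu> = (1 - v) * W + v * (- \<epsilon>)" using that(2) by (auto simp: v q_def p_def p'_def)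
    moreover have "(1 - v) * W \<ge> 0" "v * \<epsilon> \<le> 1 * \<epsilon>" using v W(2) \<epsilon> by (auto intro!: mult_right_mono)
    ultimately have 2: "- \<epsilon> \<le> Re \<mu>" by simp
    have "\<bar>Im \<mu>\<bar> = v * Y" using that(2) v Y(1) by (auto simp: v q_def p_def p'_def abs_mult)
    moreover have "v * Y \<le> 1 * Y" using v Y(1) by (intro mult_right_mono) auto
    ultimately show ?thesis using 1 2 by simp
  qed
  have part: "contour_integral (linepath q r) (\<lambda>\<mu>. exp (\<mu> * of_real t) * ray_laplace \<tau> (ray_value \<tau>) \<mu>) =
      contour_integral (linepath q r) R - contour_integral (linepath q r) U"
    and intR: "R contour_integrable_on linepath q r" and intU: "U contour_integrable_on linepath q r"
    if r: "r = p \<and> \<tau> = - \<psi> \<or> r = p' \<and> \<tau> = \<psi>" for r \<tau>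
  proof -
    have \<tau>: "\<bar>\<tau>\<bar> = \<psi>" "\<bar>\<tau>\<bar> < \<theta>" "\<bar>\<tau>\<bar> < pi / 2" using r \<psi> by auto
    have sub: "closed_segment q r \<subseteq> {\<mu>. w < Re (\<mu> * cis \<tau>) \<and> - \<delta> < Re \<mu> \<and> \<bar>Im \<mu>\<bar> < Y'}"
      using seg[OF _ r] \<epsilon> Y by force
    show iR: "R contour_integrable_on linepath q r"
      unfolding R_def[abs_def]
      by (intro contour_integrable_continuous_linepath continuous_intros
          continuous_on_subset[OF holomorphic_on_imp_continuous_on[OF \<rho>[OF \<tau>(1)]] sub])
    show iU: "U contour_integrable_on linepath q r"
      by (intro contour_integrable_continuous_linepath continuous_on_subset[OF holomorphic_on_imp_continuous_on[OF U_hol]])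
        (use sub \<epsilon> in force)
    have "contour_integral (linepath q r) (\<lambda>\<mu>. exp (\<mu> * of_real t) * ray_laplace \<tau> (ray_value \<tau>) \<mu>) =
        contour_integral (linepath q r) (\<lambda>\<mu>. R \<mu> - U \<mu>)"
    proof (rule contour_integral_eq)
      fix \<mu> assume "\<mu> \<in> path_image (linepath q r)"
      then have m: "w < Re (\<mu> * cis \<tau>)" "- \<delta> < Re \<mu>" "\<bar>Im \<mu>\<bar> < Y'" using sub by auto
      have "\<rho> \<mu> = ray_laplace \<tau> (ray_value \<tau>) \<mu> + ray_laplace 0 (\<lambda>u. f (exp u) - s (of_real (exp u))) \<mu>"
        by (rule transform_continuation[OF \<tau>(2,3) f _ \<epsilon>(3) _ \<rho>[OF \<tau>(1)] lap m]) (use \<epsilon> Y in auto)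
      then show "exp (\<mu> * of_real t) * ray_laplace \<tau> (ray_value \<tau>) \<mu> = R \<mu> - U \<mu>"
        by (simp add: R_def U_def h_def[abs_def] algebra_simps)
    qed
    also have "\<dots> = contour_integral (linepath q r) R - contour_integral (linepath q r) U"
      by (rule contour_integral_diff[OF iR iU])
    finally show "contour_integral (linepath q r) (\<lambda>\<mu>. exp (\<mu> * of_real t) * ray_laplace \<tau> (ray_value \<tau>) \<mu>) =
      contour_integral (linepath q r) R - contour_integral (linepath q r) U" .
  qed
  have qc: "Re (q * cis (- \<psi>)) \<ge> w + 1" "Re (q * cis \<psi>) \<ge> w + 1" using W(1) by (auto simp: q_def)
  have pc: "Re (p * cis (- \<psi>)) \<ge> w + 1" "Re (p' * cis \<psi>) \<ge> w + 1" using Y(3) by (auto simp: p_def p'_def algebra_simps)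
  have angles: "\<bar>- \<psi>\<bar> < \<theta>" "- \<psi> \<noteq> 0" "\<bar>\<psi>\<bar> < \<theta>" "\<psi> \<noteq> 0" using \<psi> by auto
  have t0: "t > 0" using t by simp
  define r1 where "r1 = integral UNIV (cauchy_kernel (- \<psi>) p t)"
  define r2 where "r2 = integral UNIV (cauchy_kernel \<psi> p' t)"
  have rb: "cmod r1 \<le> M * exp (- \<epsilon> * t) / sin \<psi>" "cmod r2 \<le> M * exp (- \<epsilon> * t) / sin \<psi>"
  proof -
    have le: "M * exp (- \<epsilon> * t) / (t * sin \<psi>) \<le> M * exp (- \<epsilon> * t) / sin \<psi>"
    proof (intro divide_left_mono)
      show "sin \<psi> \<le> t * sin \<psi>" using t sin by simp
    qed (use M sin t0 in auto)
    have "cmod r1 \<le> M * exp (- \<epsilon> * t) / (t * sin \<psi>)" "cmod r2 \<le> M * exp (- \<epsilon> * t) / (t * sin \<psi>)"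
      using cauchy_kernel_split(1)[OF angles(1,2) pc(1) qc(1) t0] cauchy_kernel_split(1)[OF angles(3,4) pc(2) qc(2) t0] sin
      by (simp_all add: r1_def r2_def p_def p'_def)
    then show "cmod r1 \<le> M * exp (- \<epsilon> * t) / sin \<psi>" "cmod r2 \<le> M * exp (- \<epsilon> * t) / sin \<psi>"
      using le by linarith+
  qed
  have "2 * pi * \<i> * s (of_real t) = integral UNIV (cauchy_kernel (- \<psi>) q t) - integral UNIV (cauchy_kernel \<psi> q t)"
    unfolding q_def by (rule cauchy_ray_formula[symmetric, OF \<psi>]) (use W t0 in auto)
  also have "integral UNIV (cauchy_kernel (- \<psi>) q t) = contour_integral (linepath q p) R - contour_integral (linepath q p) U + r1"
    using cauchy_kernel_split(2)[OF angles(1,2) pc(1) qc(1) t0] part[of p "- \<psi>"] by (simp add: r1_def algebra_simps)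
  also have "integral UNIV (cauchy_kernel \<psi> q t) = contour_integral (linepath q p') R - contour_integral (linepath q p') U + r2"
    using cauchy_kernel_split(2)[OF angles(3,4) pc(2) qc(2) t0] part[of p' \<psi>] by (simp add: r2_def algebra_simps)
  finally have S: "2 * complex_of_real pi * \<i> * s (of_real t) =
      (contour_integral (linepath q p) R - contour_integral (linepath q p') R) -
      (contour_integral (linepath q p) U - contour_integral (linepath q p') U) + (r1 - r2)" by simp
  have rev: "contour_integral (linepath q p') g = - contour_integral (linepath p' q) g" for g
    using contour_integral_reversepath[of "linepath p' q" g] by simp
  have RJ: "contour_integral (linepath p' q +++ linepath q p) R = contour_integral (linepath q p) R - contour_integral (linepath q p') R"
  proof -
    have "R contour_integrable_on linepath p' q"
      using contour_integrable_reversepath[OF _ intR[of p' \<psi>]] by simp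
    then show ?thesis using intR[of p "- \<psi>"] by (simp add: rev)
  qed
  \<comment> \<open>The transform of f - s is holomorphic to the right of - \<omega>, so its
    integral over the path through W equals that over the vertical segment, where exp (\<mu> t) has
    modulus exp (- \<epsilon> t).\<close>
  have UJ: "contour_integral (linepath q p) U - contour_integral (linepath q p') U = contour_integral (linepath p' p) U"
  proof -
    have "closed_segment p' p \<subseteq> {\<mu>. - \<omega> < Re \<mu>}"
      using \<epsilon> by (auto simp: closed_segment_same_Re p_def p'_def)
    moreover have "closed_segment q p \<subseteq> {\<mu>. - \<omega> < Re \<mu>}" "closed_segment q p' \<subseteq> {\<mu>. - \<omega> < Re \<mu>}"
      using seg[of _ p "- \<psi>"] seg[of _ p' \<psi>] \<epsilon> by force+
    ultimately have path: "path_image (linepath p' q +++ linepath q p +++ linepath p p') \<subseteq> {\<mu>. - \<omega> < Re \<mu>}"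
      by (simp add: path_image_join closed_segment_commute)
    have "(U has_contour_integral 0) (linepath p' q +++ linepath q p +++ linepath p p')"
      by (rule Cauchy_theorem_convex_simple[OF U_hol convex_halfspace_Re_gt _ path]) auto
    then have 0: "contour_integral (linepath p' q +++ linepath q p +++ linepath p p') U = 0"
      by (rule contour_integral_unique)
    have int: "U contour_integrable_on linepath a b" if "closed_segment a b \<subseteq> {\<mu>. - \<omega> < Re \<mu>}" for a b
      by (intro contour_integrable_continuous_linepath continuous_on_subset[OF holomorphic_on_imp_continuous_on[OF U_hol]] that)
    have "U contour_integrable_on linepath p' q" "U contour_integrable_on linepath q p" "U contour_integrable_on linepath p p'"
      using path by (auto intro!: int simp: path_image_join)
    then have "contour_integral (linepath p' q) U + (contour_integral (linepath q p) U + contour_integral (linepath p p') U) = 0"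
      using 0 by simp
    moreover have "contour_integral (linepath p p') U = - contour_integral (linepath p' p) U"
      using contour_integral_reversepath[of "linepath p' p" U] by simp
    ultimately show ?thesis by (simp add: rev algebra_simps)
  qed
  have UB: "cmod (contour_integral (linepath p' p) U) \<le> exp (- \<epsilon> * t) * (M / (\<omega> - \<epsilon>)) * (2 * Y)"
  proof -
    have re: "\<mu> \<in> closed_segment p' p \<Longrightarrow> Re \<mu> = - \<epsilon>" for \<mu>
      by (auto simp: closed_segment_same_Re p_def p'_def)
    have "U contour_integrable_on linepath p' p"
      by (intro contour_integrable_continuous_linepath continuous_on_subset[OF holomorphic_on_imp_continuous_on[OF U_hol]])
        (use re \<epsilon> in force)
    then have "cmod (contour_integral (linepath p' p) U) \<le> exp (- \<epsilon> * t) * (M / (\<omega> - \<epsilon>)) * cmod (p - p')"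
      by (rule contour_integral_bound_linepath) (use U_bound re M \<epsilon> in auto)
    also have "p - p' = \<i> * of_real (2 * Y)" by (simp add: p_def p'_def complex_eq_iff)
    also have "cmod (\<i> * of_real (2 * Y)) = 2 * Y" using Y(1) unfolding norm_mult norm_of_real by simp
    finally show ?thesis .
  qed
  have "2 * complex_of_real pi * \<i> * f t - contour_integral (linepath p' q +++ linepath q p) R =
      2 * complex_of_real pi * \<i> * (f t - s (of_real t)) - contour_integral (linepath p' p) U + (r1 - r2)"
    using S unfolding RJ UJ by (simp add: algebra_simps)
  also have "cmod \<dots> \<le> cmod (2 * complex_of_real pi * \<i> * (f t - s (of_real t))) + cmod (contour_integral (linepath p' p) U) + (cmod r1 + cmod r2)"
    by (intro order_trans[OF norm_triangle_ineq] add_mono norm_triangle_ineq4)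
  also have "\<dots> \<le> 2 * pi * (M * exp (- \<epsilon> * t)) + exp (- \<epsilon> * t) * (M / (\<omega> - \<epsilon>)) * (2 * Y) +
      (M * exp (- \<epsilon> * t) / sin \<psi> + M * exp (- \<epsilon> * t) / sin \<psi>)"
  proof (intro add_mono UB rb)
    have "cmod (f t - s (of_real t)) \<le> M * exp (- \<omega> * t)" by (rule f(2)[OF t0])
    also have "\<dots> \<le> M * exp (- \<epsilon> * t)" using \<epsilon> t0 M by (intro mult_left_mono) auto
    finally show "cmod (2 * complex_of_real pi * \<i> * (f t - s (of_real t))) \<le> 2 * pi * (M * exp (- \<epsilon> * t))"
      by (simp add: norm_mult)
  qed
  also have "\<dots> = (2 / sin \<psi> + 2 * Y / (\<omega> - \<epsilon>) + 2 * pi) * M * exp (- \<epsilon> * t)"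
    unfolding divide_inverse by (simp add: distrib_right)
  finally show ?thesis by (simp add: p_def p'_def q_def R_def[abs_def])
qed

end


section \<open>Deformation to a contour tangent to the imaginary axis\<close>

text \<open>A convex power lies above its tangent at 1. This places the straight segments of the
  original path to the right of the curve.\<close>

lemma Bernoulli_powr:
  fixes u \<alpha> :: real
  assumes "0 \<le> u" "\<alpha> \<ge> 1"
  shows "1 + \<alpha> * (u - 1) \<le> u powr \<alpha>"
proof (cases "u = 0")
  case False
  then have u: "u > 0" using assms by simp
  have "(u powr \<alpha>) powr (1 / \<alpha>) * 1 powr (1 - 1 / \<alpha>) \<le> 1 / \<alpha> * u powr \<alpha> + (1 - 1 / \<alpha>) * 1"
    by (rule Youngs_inequality_0) (use assms u in auto)
  then have "u \<le> 1 / \<alpha> * u powr \<alpha> + (1 - 1 / \<alpha>)"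
    using u assms by (simp add: powr_powr)
  from mult_left_mono[OF this, of \<alpha>] show ?thesis using assms by (simp add: algebra_simps)
qed (use assms in simp)

text \<open>The constant is the maximum of exp (- \<epsilon> v) (1 + v)^m over v > - 1, attained at
  1 + v = m / \<epsilon>. The exponential is traded for a power because the resulting weight has an
  explicit primitive.\<close>

lemma exp_neg_le_powr:
  fixes m \<epsilon> v :: real
  assumes "m > 0" "\<epsilon> > 0" "v \<ge> 0"
  shows "exp (- \<epsilon> * v) \<le> exp (\<epsilon> - m + m * ln (m / \<epsilon>)) * (1 + v) powr (- m)"
proof -
  have "ln ((1 + v) * \<epsilon> / m) \<le> (1 + v) * \<epsilon> / m - 1"
    using assms by (intro ln_le_minus_one) auto
  moreover have "ln ((1 + v) * \<epsilon> / m) = ln (1 + v) - ln (m / \<epsilon>)"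
    using assms by (simp add: ln_mult ln_div)
  ultimately have "m * ln (1 + v) \<le> m * ((1 + v) * \<epsilon> / m - 1 + ln (m / \<epsilon>))"
    using assms by (intro mult_left_mono) auto
  also have "\<dots> = (1 + v) * \<epsilon> - m + m * ln (m / \<epsilon>)" using assms by (simp add: field_simps)
  finally have "- \<epsilon> * v \<le> (\<epsilon> - m + m * ln (m / \<epsilon>)) + - m * ln (1 + v)" by (simp add: algebra_simps)
  then have "exp (- \<epsilon> * v) \<le> exp ((\<epsilon> - m + m * ln (m / \<epsilon>)) + - m * ln (1 + v))" by simp
  also have "\<dots> = exp (\<epsilon> - m + m * ln (m / \<epsilon>)) * (1 + v) powr (- m)"
    using assms by (simp only: exp_add) (simp add: powr_def)
  finally show ?thesis .
qed

text \<open>The primitive is \<open>u \<mapsto> u\<^sup>\<beta> (1 + t u\<^sup>\<alpha>)\<^sup>-\<^sup>\<beta>\<^sup>/\<^sup>\<alpha> / \<beta>\<close>.\<close>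

lemma has_integral_powr_weight:
  fixes \<alpha> \<beta> t :: real
  assumes "\<alpha> > 0" "\<beta> > 0" "t > 0"
  shows "((\<lambda>u. u powr (\<beta> - 1) * (1 + t * u powr \<alpha>) powr (- (\<beta> / \<alpha> + 1))) has_integral
    (1 + t) powr (- (\<beta> / \<alpha>)) / \<beta>) {0..1}"
proof -
  define G where "G u = u powr \<beta> * (1 + t * u powr \<alpha>) powr (- (\<beta> / \<alpha>)) / \<beta>" for u
  have "((\<lambda>u. u powr (\<beta> - 1) * (1 + t * u powr \<alpha>) powr (- (\<beta> / \<alpha> + 1))) has_integral G 1 - G 0) {0..1}"
  proof (rule fundamental_theorem_of_calculus_interior)
    have p: "1 + t * u powr \<alpha> > 0" for u using assms by (intro add_pos_nonneg) auto
    then have p': "1 + t * u powr \<alpha> \<noteq> 0" for u by (metis less_irrefl)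
    show "continuous_on {0..1} G"
      unfolding G_def[abs_def] using assms p p'
      by (intro continuous_intros continuous_on_powr') (auto intro: less_imp_le)
    fix u :: real assume u: "u \<in> {0<..<1}"
    define q where "q = 1 + t * u powr \<alpha>"
    have q: "q > 0" using p by (simp add: q_def)
    have "(G has_real_derivative (\<beta> * u powr (\<beta> - 1) * q powr (- (\<beta> / \<alpha>)) +
        u powr \<beta> * ((- (\<beta> / \<alpha>)) * q powr (- (\<beta> / \<alpha>) - 1) * (t * (\<alpha> * u powr (\<alpha> - 1))))) / \<beta>) (at u)"
      unfolding G_def[abs_def] q_def using u p[of u] assms
      by (auto intro!: derivative_eq_intros simp: powr_diff)
    also have "(\<beta> * u powr (\<beta> - 1) * q powr (- (\<beta> / \<alpha>)) +
        u powr \<beta> * ((- (\<beta> / \<alpha>)) * q powr (- (\<beta> / \<alpha>) - 1) * (t * (\<alpha> * u powr (\<alpha> - 1))))) / \<beta> =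
      u powr (\<beta> - 1) * q powr (- (\<beta> / \<alpha> + 1))"
    proof -
      have 1: "q powr (- (\<beta> / \<alpha>)) = q powr (- (\<beta> / \<alpha> + 1)) * q"
        using q powr_add[of q "- (\<beta> / \<alpha> + 1)" 1] by simp
      have 3: "- (\<beta> / \<alpha>) - 1 = - (\<beta> / \<alpha> + 1)" by simp
      have 2: "u powr \<beta> * u powr (\<alpha> - 1) = u powr (\<beta> - 1) * u powr \<alpha>"
        unfolding powr_add[symmetric] by (rule arg_cong[where f = "\<lambda>x. u powr x"]) simp
      have "(\<beta> * u powr (\<beta> - 1) * q powr (- (\<beta> / \<alpha>)) +
        u powr \<beta> * ((- (\<beta> / \<alpha>)) * q powr (- (\<beta> / \<alpha>) - 1) * (t * (\<alpha> * u powr (\<alpha> - 1))))) / \<beta> =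
        u powr (\<beta> - 1) * q powr (- (\<beta> / \<alpha>)) - t * (u powr \<beta> * u powr (\<alpha> - 1)) * q powr (- (\<beta> / \<alpha>) - 1)"
        using assms by (simp add: field_simps)
      also have "\<dots> = u powr (\<beta> - 1) * q powr (- (\<beta> / \<alpha> + 1)) * (q - t * u powr \<alpha>)"
        unfolding 1 2 3 by algebra
      also have "q - t * u powr \<alpha> = 1" by (simp add: q_def)
      finally show ?thesis by simp
    qed
    finally show "(G has_vector_derivative u powr (\<beta> - 1) * (1 + t * u powr \<alpha>) powr (- (\<beta> / \<alpha> + 1))) (at u)"
      by (simp add: q_def has_real_derivative_iff_has_vector_derivative)
  qed simp
  then show ?thesis by (simp add: G_def)
qed

text \<open>One half of the path, from b > 0 at u = 0 to - \<epsilon> + i Y at u = 1; the other half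
  has - Y for Y. As a function of y = Y u the real part is b minus a multiple of
  \<bar>y\<bar>^\<alpha>, the shape of the region where the resolvent is controlled.\<close>

definition curve :: "real \<Rightarrow> real \<Rightarrow> real \<Rightarrow> real \<Rightarrow> real \<Rightarrow> complex" where
  "curve \<alpha> \<epsilon> b Y u = Complex (b - (b + \<epsilon>) * u powr \<alpha>) (Y * u)"

lemma curve_derivative:
  assumes "u > 0"
  shows "(curve \<alpha> \<epsilon> b Y has_vector_derivative Complex (- ((b + \<epsilon>) * (\<alpha> * u powr (\<alpha> - 1)))) Y) (at u)"
proof -
  have "((\<lambda>u. b - (b + \<epsilon>) * u powr \<alpha>) has_real_derivative - ((b + \<epsilon>) * (\<alpha> * u powr (\<alpha> - 1)))) (at u)"
    using assms by (auto intro!: derivative_eq_intros simp: powr_diff)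
  moreover have "((\<lambda>u. Y * u) has_real_derivative Y) (at u)"
    by (auto intro!: derivative_eq_intros)
  ultimately show ?thesis
    unfolding curve_def[abs_def] Complex_eq
    by (intro has_vector_derivative_add has_vector_derivative_mult_right has_vector_derivative_of_real)
qed

lemma continuous_on_curve: "\<alpha> > 0 \<Longrightarrow> continuous_on {0..1} (curve \<alpha> \<epsilon> b Y)"
  unfolding curve_def[abs_def] by (intro continuous_on_Complex continuous_intros continuous_on_powr') auto

lemma valid_path_curve:
  assumes "\<alpha> > 0"
  shows "valid_path (curve \<alpha> \<epsilon> b Y)"
  unfolding valid_path_def piecewise_C1_differentiable_on_def
proof (intro conjI exI[of _ "{0}"])
  show "curve \<alpha> \<epsilon> b Y C1_differentiable_on {0..1} - {0}"
    unfolding C1_differentiable_on_def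
    by (intro exI[of _ "\<lambda>u. Complex (- ((b + \<epsilon>) * (\<alpha> * u powr (\<alpha> - 1)))) Y"] conjI ballI curve_derivative
        continuous_on_Complex continuous_intros) auto
qed (use continuous_on_curve[OF assms] in auto)

lemma curve_endpoints: "pathstart (curve \<alpha> \<epsilon> b Y) = of_real b" "pathfinish (curve \<alpha> \<epsilon> b Y) = Complex (- \<epsilon>) Y"
  by (simp_all add: pathstart_def pathfinish_def curve_def complex_eq_iff)

text \<open>A straight-line homotopy: at equal parameters the two paths have equal imaginary parts,
  so it moves points along horizontal segments, which lie in E. The condition on W keeps the
  polygonal path to the right of the curve by Bernoulli's inequality.\<close>

lemma contour_deformation:
  assumes \<alpha>: "\<alpha> \<ge> 1" and b: "\<epsilon> > 0" "b > 0" and W: "W + \<epsilon> \<ge> \<alpha> * (b + \<epsilon>)"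
    and F: "F holomorphic_on E" "open E"
    and E: "\<And>x y u. 0 \<le> u \<Longrightarrow> u \<le> 1 \<Longrightarrow> b - (b + \<epsilon>) * u powr \<alpha> \<le> x \<Longrightarrow> \<bar>y\<bar> = Y * u \<Longrightarrow> Complex x y \<in> E"
    and "Y > 0"
  shows "F contour_integrable_on curve \<alpha> \<epsilon> b Y" "F contour_integrable_on curve \<alpha> \<epsilon> b (- Y)"
    and "contour_integral (linepath (Complex (- \<epsilon>) (- Y)) (of_real W) +++ linepath (of_real W) (Complex (- \<epsilon>) Y)) F =
      contour_integral (curve \<alpha> \<epsilon> b Y) F - contour_integral (curve \<alpha> \<epsilon> b (- Y)) F"
proof -
  have \<alpha>0: "\<alpha> > 0" using \<alpha> by simp
  note vp = valid_path_curve[OF \<alpha>0, of \<epsilon> b]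
  have img: "path_image (curve \<alpha> \<epsilon> b y) \<subseteq> E" if "\<bar>y\<bar> = Y" for y
  proof -
    have "Complex (b - (b + \<epsilon>) * u powr \<alpha>) (y * u) \<in> E" if "0 \<le> u" "u \<le> 1" for u
      by (rule E[OF that]) (use that \<open>\<bar>y\<bar> = Y\<close> in \<open>simp_all add: abs_mult\<close>)
    then show ?thesis by (auto simp: path_image_def curve_def)
  qed
  show i: "F contour_integrable_on curve \<alpha> \<epsilon> b Y" "F contour_integrable_on curve \<alpha> \<epsilon> b (- Y)"
    using img[of Y] img[of "- Y"] \<open>Y > 0\<close>
    by (intro contour_integrable_holomorphic_simple[OF F vp]; simp)+
  define g where "g = linepath (Complex (- \<epsilon>) (- Y)) (of_real W) +++ linepath (of_real W) (Complex (- \<epsilon>) Y)"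
  define h where "h = reversepath (curve \<alpha> \<epsilon> b (- Y)) +++ curve \<alpha> \<epsilon> b Y"
  have line_ge: "b - (b + \<epsilon>) * v powr \<alpha> \<le> (1 - v) * W + v * (- \<epsilon>)" if "0 \<le> v" "v \<le> 1" for v
  proof -
    have "(b + \<epsilon>) * (1 + \<alpha> * (v - 1)) \<le> (b + \<epsilon>) * v powr \<alpha>"
      using Bernoulli_powr[OF that(1) \<alpha>] b by (intro mult_left_mono) auto
    moreover have "(1 - v) * (\<alpha> * (b + \<epsilon>)) \<le> (1 - v) * (W + \<epsilon>)" using W that by (intro mult_left_mono) auto
    ultimately show ?thesis by (simp add: algebra_simps)
  qed
  have seg: "closed_segment (Complex x1 y) (Complex x2 y) \<subseteq> E"
    if v: "0 \<le> v" "v \<le> 1" "\<bar>y\<bar> = Y * v" and x: "b - (b + \<epsilon>) * v powr \<alpha> \<le> x1" "b - (b + \<epsilon>) * v powr \<alpha> \<le> x2" for x1 x2 y v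
  proof
    fix z assume "z \<in> closed_segment (Complex x1 y) (Complex x2 y)"
    then have "Im z = y" "Re z \<in> closed_segment x1 x2" by (auto simp: closed_segment_same_Im)
    then have "b - (b + \<epsilon>) * v powr \<alpha> \<le> Re z" using x by (auto simp: closed_segment_eq_real_ivl split: if_splits)
    then have "Complex (Re z) (Im z) \<in> E" using v \<open>Im z = y\<close> by (intro E[of v]) auto
    then show "z \<in> E" by simp
  qed
  have vg: "valid_path g" by (simp add: g_def)
  have vh: "valid_path h" unfolding h_def
    by (intro valid_path_join vp valid_path_imp_reverse) (simp add: curve_endpoints)
  have "homotopic_paths E g h"
  proof (rule homotopic_paths_linear)
    fix t :: real assume t: "t \<in> {0..1}"
    show "closed_segment (g t) (h t) \<subseteq> E"
    proof (cases "t \<le> 1 / 2")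
      case True
      \<comment> \<open>Both paths approach the real axis in their first half, so the parameter of
        the curve runs backwards.\<close>
      define v where "v = 1 - 2 * t"
      have v: "0 \<le> v" "v \<le> 1" using True t by (auto simp: v_def)
      have "g t = Complex ((1 - v) * W + v * (- \<epsilon>)) (- Y * v)"
        using True by (simp add: g_def joinpaths_def linepath_def v_def complex_eq_iff algebra_simps)
      moreover have "h t = Complex (b - (b + \<epsilon>) * v powr \<alpha>) (- Y * v)"
        using True by (simp add: h_def joinpaths_def reversepath_def curve_def v_def)
      ultimately show ?thesis
        using line_ge[OF v] v \<open>Y > 0\<close> by (simp only:) (rule seg[OF v]; simp add: abs_mult)
    next
      case False
      define v where "v = 2 * t - 1"
      have v: "0 \<le> v" "v \<le> 1" using False t by (auto simp: v_def)
      have "g t = Complex ((1 - v) * W + v * (- \<epsilon>)) (Y * v)"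
        using False by (simp add: g_def joinpaths_def linepath_def v_def complex_eq_iff algebra_simps)
      moreover have "h t = Complex (b - (b + \<epsilon>) * v powr \<alpha>) (Y * v)"
        using False by (simp add: h_def joinpaths_def curve_def v_def)
      ultimately show ?thesis
        using line_ge[OF v] v \<open>Y > 0\<close> by (simp only:) (rule seg[OF v]; simp add: abs_mult)
    qed
  qed (use vg vh in \<open>auto simp: valid_path_imp_path g_def h_def curve_endpoints\<close>)
  from Cauchy_theorem_homotopic_paths[OF this F(2,1) vg vh]
  have "contour_integral g F = contour_integral h F" .
  also have "\<dots> = contour_integral (reversepath (curve \<alpha> \<epsilon> b (- Y))) F + contour_integral (curve \<alpha> \<epsilon> b Y) F"
    unfolding h_def by (intro contour_integral_join contour_integrable_reversepath vp i valid_path_imp_reverse)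
  also have "\<dots> = contour_integral (curve \<alpha> \<epsilon> b Y) F - contour_integral (curve \<alpha> \<epsilon> b (- Y)) F"
    by (simp add: contour_integral_reversepath[OF vp])
  finally show "contour_integral (linepath (Complex (- \<epsilon>) (- Y)) (of_real W) +++ linepath (of_real W) (Complex (- \<epsilon>) Y)) F =
      contour_integral (curve \<alpha> \<epsilon> b Y) F - contour_integral (curve \<alpha> \<epsilon> b (- Y)) F"
    by (simp add: g_def)
qed

text \<open>The sign of \<beta> - 1 decides which estimate of the modulus is needed: from below by
  \<bar>Y\<bar> u if \<beta> \<le> 1, from above by a multiple of \<open>max u (1 / t)\<close>
  otherwise. The 1 / t stems from the point \<epsilon> / t where the curve starts and is responsible
  for the extra term.\<close>

lemma curve_norm_powr_le:
  assumes \<alpha>: "\<alpha> \<ge> 1" and \<epsilon>: "\<epsilon> > 0" and "Y \<noteq> 0" and t: "t \<ge> 1" and u: "0 < u" "u < 1"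
  shows "cmod (curve \<alpha> \<epsilon> (\<epsilon> / t) Y u) powr (\<beta> - 1) \<le>
    (\<bar>Y\<bar> powr (\<beta> - 1) + (2 * (\<bar>Y\<bar> + 2 * \<epsilon>)) powr (\<beta> - 1)) * (u powr (\<beta> - 1) + (if \<beta> > 1 then t powr (- (\<beta> - 1)) else 0))"
proof (cases "\<beta> > 1")
  case False
  have "\<bar>Y\<bar> * u \<le> cmod (curve \<alpha> \<epsilon> (\<epsilon> / t) Y u)"
    using abs_Im_le_cmod[of "curve \<alpha> \<epsilon> (\<epsilon> / t) Y u"] u by (simp add: curve_def abs_mult)
  then have "cmod (curve \<alpha> \<epsilon> (\<epsilon> / t) Y u) powr (\<beta> - 1) \<le> (\<bar>Y\<bar> * u) powr (\<beta> - 1)"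
    using False u \<open>Y \<noteq> 0\<close> by (intro powr_mono2') auto
  also have "\<dots> = \<bar>Y\<bar> powr (\<beta> - 1) * u powr (\<beta> - 1)" using u by (simp add: powr_mult)
  also have "\<dots> \<le> (\<bar>Y\<bar> powr (\<beta> - 1) + (2 * (\<bar>Y\<bar> + 2 * \<epsilon>)) powr (\<beta> - 1)) * u powr (\<beta> - 1)"
    by (intro mult_right_mono) auto
  finally show ?thesis using False by simp
next
  case True
  define a where "a = \<bar>Y\<bar> + 2 * \<epsilon>"
  have a: "a > 0" "\<epsilon> \<le> a" using \<epsilon> by (auto simp: a_def)
  have ub: "u powr \<alpha> \<le> u" using u \<alpha> powr_mono'[of 1 \<alpha> u] by simp
  have tb: "0 < \<epsilon> / t" "\<epsilon> / t \<le> \<epsilon>" using t \<epsilon> by (auto simp: field_simps)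
  have "cmod (curve \<alpha> \<epsilon> (\<epsilon> / t) Y u) \<le> \<bar>Re (curve \<alpha> \<epsilon> (\<epsilon> / t) Y u)\<bar> + \<bar>Im (curve \<alpha> \<epsilon> (\<epsilon> / t) Y u)\<bar>"
    by (rule cmod_le)
  also have "\<dots> \<le> (\<epsilon> / t + 2 * \<epsilon> * u) + \<bar>Y\<bar> * u"
  proof (intro add_mono)
    have "(\<epsilon> / t + \<epsilon>) * u powr \<alpha> \<le> (2 * \<epsilon>) * u" using tb ub \<epsilon> by (intro mult_mono) auto
    moreover have "(\<epsilon> / t + \<epsilon>) * u powr \<alpha> \<ge> 0" using tb \<epsilon> by simp
    moreover have "Re (curve \<alpha> \<epsilon> (\<epsilon> / t) Y u) = \<epsilon> / t - (\<epsilon> / t + \<epsilon>) * u powr \<alpha>"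
      by (simp add: curve_def)
    ultimately show "\<bar>Re (curve \<alpha> \<epsilon> (\<epsilon> / t) Y u)\<bar> \<le> \<epsilon> / t + 2 * \<epsilon> * u"
      using tb by linarith
    show "\<bar>Im (curve \<alpha> \<epsilon> (\<epsilon> / t) Y u)\<bar> \<le> \<bar>Y\<bar> * u" using u by (simp add: curve_def abs_mult)
  qed
  also have "\<dots> = \<epsilon> * (1 / t) + a * u" by (simp add: a_def algebra_simps)
  also have "\<dots> \<le> a * (1 / t) + a * u" using a t by (intro add_right_mono mult_right_mono) auto
  also have "\<dots> \<le> 2 * a * max u (1 / t)"
  proof -
    have "a * (1 / t) \<le> a * max u (1 / t)" "a * u \<le> a * max u (1 / t)"
      using a by (intro mult_left_mono; simp)+
    then show ?thesis by linarith
  qed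
  finally have "cmod (curve \<alpha> \<epsilon> (\<epsilon> / t) Y u) powr (\<beta> - 1) \<le> (2 * a * max u (1 / t)) powr (\<beta> - 1)"
    using True by (intro powr_mono2) auto
  also have "\<dots> = (2 * a) powr (\<beta> - 1) * (max u (1 / t)) powr (\<beta> - 1)"
    using a u by (simp add: powr_mult)
  also have "(max u (1 / t)) powr (\<beta> - 1) \<le> u powr (\<beta> - 1) + (1 / t) powr (\<beta> - 1)"
    by (auto simp: max_def)
  also have "(1 / t) powr (\<beta> - 1) = t powr (- (\<beta> - 1))" using t
    by (simp only: powr_minus_divide) (simp add: powr_divide)
  also have "(2 * a) powr (\<beta> - 1) * (u powr (\<beta> - 1) + t powr (- (\<beta> - 1))) \<le>
      (\<bar>Y\<bar> powr (\<beta> - 1) + (2 * a) powr (\<beta> - 1)) * (u powr (\<beta> - 1) + t powr (- (\<beta> - 1)))"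
    by (intro mult_right_mono) auto
  finally show ?thesis using True by (simp add: a_def mult_left_mono)
qed

text \<open>On the curve t Re \<mu> = \<epsilon> - \<epsilon> (1 + t) u^\<alpha>, so the shift by
  \<epsilon> / t costs only the constant exp \<epsilon>, and u^(\<beta> - 1) exp (- \<epsilon> t
  u^\<alpha>) integrates to the order t^(- \<beta> / \<alpha>). The constant is chosen before t, N
  and F, which makes the bound uniform over functionals and vectors.\<close>

lemma curve_integral_bound:
  assumes \<alpha>: "\<alpha> \<ge> 1" and \<beta>: "\<beta> > 0" and \<epsilon>: "\<epsilon> > 0" and Y: "Y \<noteq> 0"
  shows "\<exists>C\<ge>0. \<forall>t N F. t \<ge> 1 \<and> N \<ge> 0 \<and> F contour_integrable_on curve \<alpha> \<epsilon> (\<epsilon> / t) Y \<and>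
    (\<forall>u. 0 < u \<and> u < 1 \<longrightarrow> cmod (F (curve \<alpha> \<epsilon> (\<epsilon> / t) Y u)) \<le>
        N * cmod (curve \<alpha> \<epsilon> (\<epsilon> / t) Y u) powr (\<beta> - 1) * exp (t * Re (curve \<alpha> \<epsilon> (\<epsilon> / t) Y u))) \<longrightarrow>
    cmod (contour_integral (curve \<alpha> \<epsilon> (\<epsilon> / t) Y) F) \<le> C * N * t powr (- (\<beta> / \<alpha>))"
proof -
  define L where "L = 2 * \<epsilon> * \<alpha> + \<bar>Y\<bar>"
  define P where "P = \<bar>Y\<bar> powr (\<beta> - 1) + (2 * (\<bar>Y\<bar> + 2 * \<epsilon>)) powr (\<beta> - 1)"
  define c where "c m = exp (\<epsilon> - m + m * ln (m / \<epsilon>))" for m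
  \<comment> \<open>The exponents for which \<open>has_integral_powr_weight\<close> has its
    primitive, with \<beta> and with 1 in the place of \<beta>; the second serves the extra term of
    \<open>curve_norm_powr_le\<close>.\<close>
  define m1 where "m1 = \<beta> / \<alpha> + 1"
  define m2 where "m2 = 1 / \<alpha> + 1"
  have m: "m1 > 0" "m2 > 0" using \<alpha> \<beta> by (auto simp: m1_def m2_def add_pos_pos)
  have L: "L \<ge> 0" using \<epsilon> \<alpha> by (simp add: L_def)
  have P: "P \<ge> 0" by (simp add: P_def)
  define C where "C = P * exp \<epsilon> * L * (c m1 / \<beta> + c m2)"
  have C: "C \<ge> 0" using P L \<beta> by (simp add: C_def c_def)
  show ?thesis
  proof (intro exI[of _ C] conjI allI impI C, elim conjE)
    fix t N :: real and F :: "complex \<Rightarrow> complex"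
    assume t: "t \<ge> 1" and N: "N \<ge> 0" and Fi: "F contour_integrable_on curve \<alpha> \<epsilon> (\<epsilon> / t) Y"
      and Fb: "\<forall>u. 0 < u \<and> u < 1 \<longrightarrow> cmod (F (curve \<alpha> \<epsilon> (\<epsilon> / t) Y u)) \<le>
        N * cmod (curve \<alpha> \<epsilon> (\<epsilon> / t) Y u) powr (\<beta> - 1) * exp (t * Re (curve \<alpha> \<epsilon> (\<epsilon> / t) Y u))"
    define E where "E = (if \<beta> > 1 then t powr (- (\<beta> - 1)) else 0)"
    have E: "E \<ge> 0" by (simp add: E_def)
    define b where "b = \<epsilon> / t"
    have b: "0 < b" "b \<le> \<epsilon>" "t * b = \<epsilon>" using t \<epsilon> by (auto simp: b_def field_simps)
    define \<gamma> where "\<gamma> = curve \<alpha> \<epsilon> b Y"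
    define A1 where "A1 u = u powr (\<beta> - 1) * (1 + t * u powr \<alpha>) powr (- m1)" for u
    define A2 where "A2 u = u powr (1 - 1) * (1 + t * u powr \<alpha>) powr (- m2)" for u
    have I1: "(A1 has_integral (1 + t) powr (- (\<beta> / \<alpha>)) / \<beta>) {0..1}"
      unfolding A1_def[abs_def] m1_def by (rule has_integral_powr_weight) (use \<alpha> \<beta> t in auto)
    have I2: "(A2 has_integral (1 + t) powr (- (1 / \<alpha>)) / 1) {0..1}"
      unfolding A2_def[abs_def] m2_def by (rule has_integral_powr_weight) (use \<alpha> t in auto)
    define G where "G u = N * P * exp \<epsilon> * L * (c m1 * A1 u + E * c m2 * A2 u)" for u
    have IG: "(G has_integral N * P * exp \<epsilon> * L * (c m1 * ((1 + t) powr (- (\<beta> / \<alpha>)) / \<beta>) + E * c m2 * ((1 + t) powr (- (1 / \<alpha>)) / 1))) {0..1}"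
      unfolding G_def[abs_def] by (intro has_integral_mult_right has_integral_add I1 I2)
    have pw: "cmod (F (\<gamma> u) * vector_derivative \<gamma> (at u)) \<le> G u" if u: "u \<in> {0<..<1}" for u
    proof -
      have u': "0 < u" "u < 1" using u by auto
      have "vector_derivative \<gamma> (at u) = Complex (- ((b + \<epsilon>) * (\<alpha> * u powr (\<alpha> - 1)))) Y"
        unfolding \<gamma>_def by (rule vector_derivative_at[OF curve_derivative[OF u'(1)]])
      then have "cmod (vector_derivative \<gamma> (at u)) \<le> \<bar>- ((b + \<epsilon>) * (\<alpha> * u powr (\<alpha> - 1)))\<bar> + \<bar>Y\<bar>"
        using cmod_le[of "Complex (- ((b + \<epsilon>) * (\<alpha> * u powr (\<alpha> - 1)))) Y"] by simp
      also have "\<bar>- ((b + \<epsilon>) * (\<alpha> * u powr (\<alpha> - 1)))\<bar> = (b + \<epsilon>) * (\<alpha> * u powr (\<alpha> - 1))"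
        using b \<epsilon> \<alpha> by (simp add: abs_mult)
      also have "(b + \<epsilon>) * (\<alpha> * u powr (\<alpha> - 1)) \<le> (2 * \<epsilon>) * (\<alpha> * 1)"
        using b \<epsilon> \<alpha> u' by (intro mult_mono powr_le1) auto
      finally have vd: "cmod (vector_derivative \<gamma> (at u)) \<le> L" by (simp add: L_def)
      define v where "v = t * u powr \<alpha>"
      have v: "v \<ge> 0" using t by (simp add: v_def)
      have "t * Re (\<gamma> u) = \<epsilon> - (\<epsilon> + \<epsilon> * t) * u powr \<alpha>"
        using b(3) by (simp add: \<gamma>_def curve_def algebra_simps)
      also have "\<dots> \<le> \<epsilon> + - \<epsilon> * v" using \<epsilon> by (simp add: v_def algebra_simps)
      finally have re: "exp (t * Re (\<gamma> u)) \<le> exp \<epsilon> * exp (- \<epsilon> * v)" by (simp add: mult_exp_exp)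
      have "cmod (F (\<gamma> u)) \<le> N * cmod (\<gamma> u) powr (\<beta> - 1) * exp (t * Re (\<gamma> u))"
        using Fb u' by (simp add: \<gamma>_def b_def)
      also have "\<dots> \<le> N * (P * (u powr (\<beta> - 1) + E)) * (exp \<epsilon> * exp (- \<epsilon> * v))"
        using curve_norm_powr_le[OF \<alpha> \<epsilon> Y t u', of \<beta>] N P E re
        by (intro mult_mono mult_left_mono) (auto simp: \<gamma>_def b_def P_def E_def)
      also have "\<dots> = N * P * exp \<epsilon> * (u powr (\<beta> - 1) * exp (- \<epsilon> * v) + E * exp (- \<epsilon> * v))"
        by (simp add: algebra_simps)
      also have "\<dots> \<le> N * P * exp \<epsilon> * (u powr (\<beta> - 1) * (c m1 * (1 + v) powr (- m1)) + E * (c m2 * (1 + v) powr (- m2)))"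
        using exp_neg_le_powr[OF m(1) \<epsilon> v] exp_neg_le_powr[OF m(2) \<epsilon> v] N P E
        by (intro mult_left_mono add_mono) (auto simp: c_def)
      also have "\<dots> = N * P * exp \<epsilon> * (c m1 * A1 u + E * c m2 * A2 u)"
        using u' by (simp add: A1_def A2_def v_def mult_ac)
      finally have "cmod (F (\<gamma> u)) * cmod (vector_derivative \<gamma> (at u)) \<le> N * P * exp \<epsilon> * (c m1 * A1 u + E * c m2 * A2 u) * L"
        using vd L by (intro mult_mono) (auto intro: order_trans[OF norm_ge_zero])
      then show ?thesis by (simp add: norm_mult G_def mult_ac)
    qed
    have fi: "(\<lambda>u. F (\<gamma> u) * vector_derivative \<gamma> (at u)) integrable_on {0..1}"
      using Fi by (simp add: contour_integrable_on \<gamma>_def b_def)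
    have "cmod (contour_integral \<gamma> F) = cmod (integral {0<..<1} (\<lambda>u. F (\<gamma> u) * vector_derivative \<gamma> (at u)))"
      by (simp add: contour_integral_integral integral_open_interval_real)
    also have "\<dots> \<le> integral {0<..<1} G"
      using fi IG pw by (intro integral_norm_bound_integral) (auto simp: integrable_on_open_interval_real)
    also have "\<dots> = N * P * exp \<epsilon> * L * (c m1 * ((1 + t) powr (- (\<beta> / \<alpha>)) / \<beta>) + E * c m2 * ((1 + t) powr (- (1 / \<alpha>)) / 1))"
      using integral_unique[OF IG] by (simp add: integral_open_interval_real)
    also have "\<dots> \<le> N * P * exp \<epsilon> * L * (c m1 * (t powr (- (\<beta> / \<alpha>)) / \<beta>) + c m2 * t powr (- (\<beta> / \<alpha>)))"
    proof (intro mult_left_mono add_mono)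
      show "(1 + t) powr (- (\<beta> / \<alpha>)) / \<beta> \<le> t powr (- (\<beta> / \<alpha>)) / \<beta>"
        using t \<alpha> \<beta> by (intro divide_right_mono powr_mono2') auto
      show "E * c m2 * ((1 + t) powr (- (1 / \<alpha>)) / 1) \<le> c m2 * t powr (- (\<beta> / \<alpha>))"
      \<comment> \<open>The extra term is of order t^(-(\<beta> - 1) - 1 / \<alpha>), which is at
        most t^(- \<beta> / \<alpha>) because (\<beta> - 1) / \<alpha> \<le> \<beta> - 1.\<close>
      proof (cases "\<beta> > 1")
        case True
        have "E * (1 + t) powr (- (1 / \<alpha>)) \<le> t powr (- (\<beta> - 1)) * t powr (- (1 / \<alpha>))"
          using True t \<alpha> by (auto simp: E_def intro!: mult_left_mono powr_mono2')
        also have "\<dots> = t powr (- (\<beta> - 1) - 1 / \<alpha>)" by (simp flip: powr_add)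
        also have "\<dots> \<le> t powr (- (\<beta> / \<alpha>))"
        proof (intro powr_mono t)
          have "(\<beta> - 1) / \<alpha> \<le> (\<beta> - 1) / 1" using True \<alpha> by (intro divide_left_mono) auto
          then show "- (\<beta> - 1) - 1 / \<alpha> \<le> - (\<beta> / \<alpha>)" by (simp add: diff_divide_distrib)
        qed
        finally have "c m2 * (E * (1 + t) powr (- (1 / \<alpha>))) \<le> c m2 * t powr (- (\<beta> / \<alpha>))"
          by (intro mult_left_mono) (auto simp: c_def)
        then show ?thesis by (simp add: mult_ac)
      qed (simp add: E_def c_def)
    qed (use N P L in \<open>auto simp: c_def\<close>)
    also have "\<dots> = C * N * t powr (- (\<beta> / \<alpha>))" by (simp add: C_def algebra_simps)
    finally show "cmod (contour_integral (curve \<alpha> \<epsilon> (\<epsilon> / t) Y) F) \<le> C * N * t powr (- (\<beta> / \<alpha>))"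
      by (simp add: \<gamma>_def b_def)
  qed
qed


section \<open>Semigroups and resolvents\<close>

lemma C0_semigroupD:
  assumes "C0_semigroup T"
  shows "t \<ge> 0 \<Longrightarrow> T t \<in> bounded_clinear_ops" "T 0 = id_blinfun"
    "r \<ge> 0 \<Longrightarrow> t \<ge> 0 \<Longrightarrow> T (r + t) x = T r (T t x)" "continuous_on {0..} (\<lambda>t. T t x)"
  using assms by (auto simp: C0_semigroup_def)

text \<open>The generator only provides a right derivative at 0. Applying T t gives the right
  derivative at t; for the left one T (t - h) is factored out, which uses the bound on T over (0, t]
  and strong continuity at t.\<close>

lemma semigroup_orbit_derivative:
  fixes T :: "real \<Rightarrow> 'a::complex_banach \<Rightarrow>\<^sub>L 'a"
  assumes T: "C0_semigroup T" and bound: "\<And>t. t > 0 \<Longrightarrow> norm (T t) \<le> M * exp (w * t)" and w: "w \<ge> 0"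
    and z: "(z, v) \<in> generator T" and t: "t > 0"
  shows "((\<lambda>t. T t z) has_vector_derivative T t v) (at t)"
  unfolding has_vector_derivative_def has_derivative_at
proof
  note TD = C0_semigroupD[OF T]
  show "bounded_linear (\<lambda>h. h *\<^sub>R T t v)" by (rule bounded_linear_scaleR_left)
  define d where "d h = norm ((T h z - z) /\<^sub>R h - v)" for h
  have d: "(d \<longlongrightarrow> 0) (at_right 0)"
    using z unfolding d_def generator_def by (auto intro: tendsto_norm_zero LIM_zero)
  have M: "M \<ge> 0"
    using order_trans[OF norm_ge_zero bound[OF t]] by (simp add: zero_le_mult_iff)
  have M': "norm (T r y) \<le> M * exp (w * t) * norm y" if "0 < r" "r \<le> t" for r y
  proof -
    have "norm (T r y) \<le> norm (T r) * norm y" by (rule norm_blinfun)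
    also have "\<dots> \<le> (M * exp (w * r)) * norm y" by (intro mult_right_mono bound that) auto
    also have "\<dots> \<le> (M * exp (w * t)) * norm y"
      using that w M by (intro mult_right_mono mult_left_mono) (auto intro: mult_left_mono)
    finally show ?thesis .
  qed
  define e where "e h = norm (T (t + h) z - T t z - h *\<^sub>R T t v) / norm h" for h
  have right: "(e \<longlongrightarrow> 0) (at_right 0)"
  proof (rule Lim_null_comparison)
    show "eventually (\<lambda>h. norm (e h) \<le> M * exp (w * t) * d h) (at_right 0)"
      unfolding eventually_at_filter
    proof (intro always_eventually allI impI)
      fix h :: real assume "h \<noteq> 0" "h \<in> {0<..}"
      then have h: "h > 0" by simp
      have "T (t + h) z - T t z - h *\<^sub>R T t v = h *\<^sub>R T t ((T h z - z) /\<^sub>R h - v)"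
        using TD(3)[of t h z] h t by (simp add: blinfun.diff_right blinfun.scaleR_right scaleR_diff_right)
      then have "e h = norm (T t ((T h z - z) /\<^sub>R h - v))" using h by (simp add: e_def)
      then show "norm (e h) \<le> M * exp (w * t) * d h"
        using M'[OF t order_refl] by (simp add: d_def)
    qed
    show "((\<lambda>h. M * exp (w * t) * d h) \<longlongrightarrow> 0) (at_right 0)"
      by (rule tendsto_mult_right_zero[OF d])
  qed
  have left: "((\<lambda>h. e (- h)) \<longlongrightarrow> 0) (at_right 0)"
  proof (rule Lim_null_comparison)
    have "eventually (\<lambda>h. 0 < h \<and> h < t) (at_right (0::real))"
      using t by (auto simp: eventually_at_right intro!: exI[of _ t])
    then show "eventually (\<lambda>h. norm (e (- h)) \<le> M * exp (w * t) * d h + norm (T t v - T (t - h) v)) (at_right 0)"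
    proof eventually_elim
      case (elim h)
      have "T t z = T (t - h) (T h z)" using TD(3)[of "t - h" h z] elim by simp
      then have "T (t - h) z - T t z + h *\<^sub>R T t v =
          h *\<^sub>R ((T t v - T (t - h) v) - T (t - h) ((T h z - z) /\<^sub>R h - v))"
        using elim by (simp add: blinfun.diff_right blinfun.scaleR_right scaleR_diff_right)
      then have "e (- h) = norm ((T t v - T (t - h) v) - T (t - h) ((T h z - z) /\<^sub>R h - v))"
        using elim by (simp add: e_def)
      also have "\<dots> \<le> norm (T t v - T (t - h) v) + norm (T (t - h) ((T h z - z) /\<^sub>R h - v))"
        by (rule norm_triangle_ineq4)
      also have "\<dots> \<le> norm (T t v - T (t - h) v) + M * exp (w * t) * d h"
        unfolding d_def using elim by (intro add_left_mono M') auto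
      finally show ?case by (simp add: e_def)
    qed
    have "isCont (\<lambda>t. T t v) t"
      using continuous_on_interior[OF TD(4)[of v], of t] t by (simp add: interior_real_atLeast)
    then have "((\<lambda>h. T (t - h) v) \<longlongrightarrow> T (t - 0) v) (at 0)"
      by (intro isCont_tendsto_compose[of _ "\<lambda>t. T t v"] tendsto_intros) simp
    from tendsto_within_subset[OF this subset_UNIV, of "{0<..}"]
    have "((\<lambda>h. T (t - h) v) \<longlongrightarrow> T t v) (at_right 0)" by (simp only: diff_zero)
    then have "((\<lambda>h. norm (T t v - T (t - h) v)) \<longlongrightarrow> norm (T t v - T t v)) (at_right 0)"
      by (intro tendsto_norm tendsto_diff tendsto_const)
    then show "((\<lambda>h. M * exp (w * t) * d h + norm (T t v - T (t - h) v)) \<longlongrightarrow> 0) (at_right 0)"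
      using tendsto_add[OF tendsto_mult_right_zero[OF d, of "M * exp (w * t)"]] by fastforce
  qed
  have "(e \<longlongrightarrow> 0) (at_left 0)"
    using left by (simp add: filterlim_at_left_to_right)
  then have "(e \<longlongrightarrow> 0) (at 0)" using right by (rule filterlim_split_at)
  then show "(\<lambda>h. norm (T (t + h) z - T t z - h *\<^sub>R T t v) / norm h) \<midarrow>0\<rightarrow> 0"
    by (simp add: e_def[abs_def])
qed

lemma shift_inverse_graph:
  assumes "linear_operator A" "- \<mu> \<in> resolvent_set A"
  shows "(shift_inverse A \<mu> y, y - \<mu> *\<^sub>C shift_inverse A \<mu> y) \<in> A"
proof -
  define u where "u = resolvent A (- \<mu>) y"
  have "(u, (- \<mu>) *\<^sub>C u - y) \<in> A" using resolvent_iff[OF assms(2), of u y] by (simp add: u_def)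
  then have "((- 1) *\<^sub>C u, (- 1) *\<^sub>C ((- \<mu>) *\<^sub>C u - y)) \<in> A"
    using assms(1) by (simp only: linear_operator_def)
  then show ?thesis
    by (simp add: shift_inverse_def u_def blinfun.minus_left scaleC_diff add.commute)
qed

text \<open>For z = (x + A)^-1 y the generator maps z to x z - y, so with t = exp u the integrand is
  the derivative of - exp (- x t) \<phi> (T t z). The transform is the difference of the limits of
  this primitive.\<close>

lemma semigroup_laplace:
  fixes T :: "real \<Rightarrow> 'a::complex_banach \<Rightarrow>\<^sub>L 'a"
  assumes T: "C0_semigroup T" and bound: "\<And>t. t > 0 \<Longrightarrow> norm (T t) \<le> M * exp (w * t)" and w: "w \<ge> 0"
    and gen: "generator T = minus_op A" and A: "linear_operator A"
    and x: "x > w" "- complex_of_real x \<in> resolvent_set A" and \<phi>: "contractive_functional \<phi>"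
  shows "\<phi> (shift_inverse A (of_real x) y) = ray_laplace 0 (\<lambda>u. \<phi> (T (exp u) y)) (of_real x)"
proof -
  note TD = C0_semigroupD[OF T] and \<phi>D = contractive_functionalD[OF \<phi>]
  define z where "z = shift_inverse A (of_real x) y"
  have "(z, y - x *\<^sub>R z) \<in> A"
    using shift_inverse_graph[OF A x(2), of y] by (simp add: z_def scaleC_of_real)
  then have "(z, - (y - x *\<^sub>R z)) \<in> minus_op A" unfolding minus_op_def by blast
  then have z: "(z, x *\<^sub>R z - y) \<in> generator T" by (simp add: gen)
  define G where "G u = - (exp (- x * exp u) *\<^sub>R \<phi> (T (exp u) z))" for u
  have "(ray_kernel 0 (\<lambda>u. \<phi> (T (exp u) y)) (of_real x) has_integral (0 - (- \<phi> z))) UNIV"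
  proof (rule has_integral_line_FTC[of "{}" G])
    show deriv: "(G has_vector_derivative ray_kernel 0 (\<lambda>u. \<phi> (T (exp u) y)) (of_real x) u) (at u)" for u
    proof -
      have "((\<lambda>u. T (exp u) z) has_vector_derivative exp u *\<^sub>R T (exp u) (x *\<^sub>R z - y)) (at u)"
        using vector_diff_chain_at[OF _ semigroup_orbit_derivative[OF T bound w z], of exp "exp u" u]
        by (simp add: o_def has_real_derivative_iff_has_vector_derivative[symmetric])
      then have 1: "((\<lambda>u. \<phi> (T (exp u) z)) has_vector_derivative \<phi> (exp u *\<^sub>R T (exp u) (x *\<^sub>R z - y))) (at u)"
        by (rule bounded_linear.has_vector_derivative[OF \<phi>D(4)])
      have 2: "((\<lambda>u. exp (- x * exp u)) has_real_derivative - x * exp u * exp (- x * exp u)) (at u)"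
        by (auto intro!: derivative_eq_intros)
      have "(G has_vector_derivative - (exp (- x * exp u) *\<^sub>R \<phi> (exp u *\<^sub>R T (exp u) (x *\<^sub>R z - y)) +
          (- x * exp u * exp (- x * exp u)) *\<^sub>R \<phi> (T (exp u) z))) (at u)"
        unfolding G_def[abs_def] by (intro has_vector_derivative_minus has_vector_derivative_scaleR 1 2)
      moreover have "- (exp (- x * exp u) *\<^sub>R \<phi> (exp u *\<^sub>R T (exp u) (x *\<^sub>R z - y)) +
          (- x * exp u * exp (- x * exp u)) *\<^sub>R \<phi> (T (exp u) z)) = ray_kernel 0 (\<lambda>u. \<phi> (T (exp u) y)) (of_real x) u"
      proof -
        have e: "exp (Complex u 0) = of_real (exp u)" by (simp add: complex_eq_iff Re_exp Im_exp)
        have "exp (- (complex_of_real x * of_real (exp u))) = of_real (exp (- x * exp u))"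
          using exp_of_real[of "- x * exp u"] by simp
        then show ?thesis
          unfolding ray_kernel_def e
          by (simp add: \<phi>D blinfun.diff_right blinfun.scaleR_right scaleR_conv_of_real algebra_simps)
      qed
      ultimately show ?thesis by (simp only:)
    qed
    show "continuous_on UNIV G"
      by (intro continuous_at_imp_continuous_on ballI has_vector_derivative_continuous[OF deriv])
  next
    have lim: "((\<lambda>u. M * norm z * exp ((w - x) * exp u)) \<longlongrightarrow> 0) at_top"
      using x(1) by real_asymp
    have "norm (G u) \<le> M * norm z * exp ((w - x) * exp u)" for u
    proof -
      have "norm (G u) = exp (- x * exp u) * cmod (\<phi> (T (exp u) z))" by (simp add: G_def)
      also have "cmod (\<phi> (T (exp u) z)) \<le> norm (T (exp u)) * norm z"
        by (rule order_trans[OF \<phi>D(3) norm_blinfun])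
      also have "\<dots> \<le> M * exp (w * exp u) * norm z" by (intro mult_right_mono bound) auto
      finally have "norm (G u) \<le> M * norm z * (exp (- x * exp u) * exp (w * exp u))"
        by (simp add: mult_ac mult_left_mono)
      then show ?thesis unfolding mult_exp_exp by (simp add: algebra_simps)
    qed
    then show "(G \<longlongrightarrow> 0) at_top"
      by (intro Lim_null_comparison[OF _ lim] always_eventually allI)
  next
    have "((\<lambda>t. T t z) \<longlongrightarrow> T 0 z) (at_right 0)"
      using TD(4)[of z] unfolding continuous_on_def
      by (rule tendsto_within_subset[OF bspec[of _ _ 0]]) auto
    moreover have "filterlim (exp :: real \<Rightarrow> real) (at_right 0) at_bot" by real_asymp
    ultimately have "((\<lambda>u. T (exp u) z) \<longlongrightarrow> z) at_bot"
      using filterlim_compose[of "\<lambda>t. T t z"] by (simp add: TD(2))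
    from bounded_linear.tendsto[OF \<phi>D(4) this]
    have 1: "((\<lambda>u. \<phi> (T (exp u) z)) \<longlongrightarrow> \<phi> z) at_bot" .
    have 2: "((\<lambda>u. exp (- x * exp u)) \<longlongrightarrow> 1) at_bot" by real_asymp
    show "(G \<longlongrightarrow> - \<phi> z) at_bot"
      unfolding G_def[abs_def] using tendsto_minus[OF tendsto_scaleR[OF 2 1]] by simp
  qed auto
  then show ?thesis by (simp add: ray_laplace_def z_def integral_unique)
qed

text \<open>Compactness of the half-annulus 1 \<le> \<bar>z\<bar> \<le> \<Lambda> first extends the
  power bound to the left half of the disc of radius \<Lambda>. If Re \<mu> < 0, then - \<mu> is
  compared with the point of the imaginary axis at the same height.\<close>

lemma shift_inverse_bound_parabolic:
  fixes A :: "'a::complex_banach oper"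
  assumes A: "linear_operator A" and res: "{z. Re z \<le> 0} - {0} \<subseteq> resolvent_set A" and \<alpha>: "\<alpha> \<ge> 1"
    and bound: "\<And>\<mu>. \<mu> \<in> {z. Re z \<le> 0} - {0} \<Longrightarrow> cmod \<mu> \<le> 1 \<Longrightarrow> norm (resolvent A \<mu>) \<le> C * cmod \<mu> powr (- \<alpha>)"
    and \<Lambda>: "\<Lambda> > 0"
  obtains \<kappa> C' where "\<kappa> > 0" "C' > 0"
    "\<And>\<mu>. \<mu> \<noteq> 0 \<Longrightarrow> cmod \<mu> \<le> \<Lambda> \<Longrightarrow> - \<kappa> * \<bar>Im \<mu>\<bar> powr \<alpha> \<le> Re \<mu> \<Longrightarrow>
       - \<mu> \<in> resolvent_set A \<and> norm (shift_inverse A \<mu>) \<le> C' * cmod \<mu> powr (- \<alpha>)"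
proof -
  define S where "S = {z. Re z \<le> 0} \<inter> {z. 1 \<le> cmod z} \<inter> cball 0 \<Lambda>"
  have "compact S"
    unfolding S_def by (intro closed_Int_compact closed_Int closed_halfspace_Re_le closed_Collect_le continuous_intros compact_cball)
  have "0 \<notin> S" by (simp add: S_def)
  then have "S \<subseteq> resolvent_set A" using res by (auto simp: S_def)
  then have "compact (resolvent A ` S)"
    using \<open>compact S\<close> by (intro compact_continuous_image continuous_on_subset[OF continuous_on_resolvent[OF A]])
  then obtain L where L: "L > 0" "\<And>z. z \<in> S \<Longrightarrow> norm (resolvent A z) \<le> L"
    using compact_imp_bounded bounded_pos by (metis (no_types, lifting) imageI)
  define K where "K = max C (L * \<Lambda> powr \<alpha>)"
  have K: "K > 0" using L(1) \<Lambda> by (auto simp: K_def less_max_iff_disj)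
  have left: "norm (resolvent A z) \<le> K * cmod z powr (- \<alpha>)" if "Re z \<le> 0" "z \<noteq> 0" "cmod z \<le> \<Lambda>" for z
  proof (cases "cmod z \<le> 1")
    case True
    then have "norm (resolvent A z) \<le> C * cmod z powr (- \<alpha>)" using that by (intro bound) auto
    also have "\<dots> \<le> K * cmod z powr (- \<alpha>)" by (intro mult_right_mono) (auto simp: K_def)
    finally show ?thesis .
  next
    case False
    then have "norm (resolvent A z) \<le> L" using that by (intro L(2)) (auto simp: S_def)
    also have "\<dots> = L * \<Lambda> powr \<alpha> * \<Lambda> powr (- \<alpha>)" using \<Lambda> by (simp add: powr_minus)
    also have "\<dots> \<le> K * cmod z powr (- \<alpha>)"
      using that \<alpha> K by (intro mult_mono powr_mono2') (auto simp: K_def)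
    finally show ?thesis .
  qed
  \<comment> \<open>Chosen so that \<kappa> y^\<alpha> times K y^(-\<alpha>) equals 1 / 2, the
    smallness required by \<open>resolvent_perturbation\<close>.\<close>
  define \<kappa> where "\<kappa> = 1 / (2 * K)"
  have \<kappa>: "\<kappa> > 0" using K by (simp add: \<kappa>_def)
  \<comment> \<open>To the left of the imaginary axis the region satisfies \<bar>\<mu>\<bar> \<le> a
    \<bar>Im \<mu>\<bar>, so powers of \<bar>Im \<mu>\<bar> can be replaced by powers of
    \<bar>\<mu>\<bar>.\<close>
  define a where "a = 1 + \<kappa> * \<Lambda> powr (\<alpha> - 1)"
  have a: "a \<ge> 1" using \<kappa> by (simp add: a_def)
  have "- \<mu> \<in> resolvent_set A \<and> norm (shift_inverse A \<mu>) \<le> (2 * K * a powr \<alpha>) * cmod \<mu> powr (- \<alpha>)"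
    if \<mu>: "\<mu> \<noteq> 0" "cmod \<mu> \<le> \<Lambda>" "- \<kappa> * \<bar>Im \<mu>\<bar> powr \<alpha> \<le> Re \<mu>" for \<mu>
  proof (cases "Re \<mu> \<ge> 0")
    case True
    have "norm (shift_inverse A \<mu>) \<le> K * cmod \<mu> powr (- \<alpha>)"
      using left[of "- \<mu>"] True \<mu> by (simp add: shift_inverse_def)
    also have "\<dots> \<le> (2 * K * a powr \<alpha>) * cmod \<mu> powr (- \<alpha>)"
    proof (rule mult_right_mono)
      have "1 \<le> a powr \<alpha>" using a \<alpha> by (intro ge_one_powr_ge_zero) auto
      then have "K * 1 \<le> 2 * K * a powr \<alpha>" using K by (intro mult_mono) auto
      then show "K \<le> 2 * K * a powr \<alpha>" by simp
    qed simp
    finally show ?thesis using res True \<mu> by auto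
  next
    case False
    define y where "y = \<bar>Im \<mu>\<bar>"
    have "y \<noteq> 0" using False \<mu>(3) by (auto simp: y_def)
    then have y: "y > 0" by (simp add: y_def)
    have y\<Lambda>: "y \<le> \<Lambda>" using abs_Im_le_cmod[of \<mu>] \<mu>(2) by (simp add: y_def)
    define z where "z = Complex 0 (- Im \<mu>)"
    have z: "cmod z = y" "z \<in> resolvent_set A" "norm (resolvent A z) \<le> K * y powr (- \<alpha>)"
    proof -
      show cz: "cmod z = y" by (simp add: z_def y_def cmod_def)
      have "z \<noteq> 0" using y by (auto simp: z_def y_def complex_eq_iff)
      then show "z \<in> resolvent_set A" using res by (auto simp: z_def)
      show "norm (resolvent A z) \<le> K * y powr (- \<alpha>)"
        using left[of z] \<open>z \<noteq> 0\<close> y\<Lambda> unfolding cz by (simp add: z_def)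
    qed
    have re: "\<bar>Re \<mu>\<bar> \<le> \<kappa> * y powr \<alpha>" using \<mu>(3) False by (simp add: y_def)
    have "cmod (- \<mu> - z) * norm (resolvent A z) \<le> (\<kappa> * y powr \<alpha>) * (K * y powr (- \<alpha>))"
    proof (rule mult_mono)
      have "- \<mu> - z = of_real (- Re \<mu>)" by (simp add: complex_eq_iff z_def)
      then show "cmod (- \<mu> - z) \<le> \<kappa> * y powr \<alpha>" using re by simp
    qed (use z \<kappa> in auto)
    also have "\<dots> = 1 / 2" using K y by (simp add: \<kappa>_def powr_minus)
    finally have small: "cmod (- \<mu> - z) * norm (resolvent A z) \<le> 1 / 2" .
    note P = resolvent_perturbation[OF A z(2) small]
    have "cmod \<mu> \<le> a * y"
    proof -
      have "y powr \<alpha> = y powr (\<alpha> - 1) * y" using y powr_add[of y "\<alpha> - 1" 1] by simp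
      also have "\<dots> \<le> \<Lambda> powr (\<alpha> - 1) * y" using y y\<Lambda> \<alpha> by (intro mult_right_mono powr_mono2) auto
      finally have "\<kappa> * y powr \<alpha> \<le> \<kappa> * (\<Lambda> powr (\<alpha> - 1) * y)" using \<kappa> by (intro mult_left_mono) auto
      then have "\<bar>Re \<mu>\<bar> + y \<le> a * y" using re by (simp add: a_def algebra_simps)
      then show ?thesis using cmod_le[of \<mu>] by (simp add: y_def)
    qed
    then have "(a * y) powr (- \<alpha>) \<le> cmod \<mu> powr (- \<alpha>)" using \<mu> \<alpha> by (intro powr_mono2') auto
    then have "a powr \<alpha> * (a * y) powr (- \<alpha>) \<le> a powr \<alpha> * cmod \<mu> powr (- \<alpha>)" by (intro mult_left_mono) auto
    moreover have "a powr \<alpha> * (a * y) powr (- \<alpha>) = y powr (- \<alpha>)"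
      using a y by (simp add: powr_mult powr_minus)
    ultimately have "y powr (- \<alpha>) \<le> a powr \<alpha> * cmod \<mu> powr (- \<alpha>)" by (simp only:)
    then have "2 * K * y powr (- \<alpha>) \<le> 2 * K * (a powr \<alpha> * cmod \<mu> powr (- \<alpha>))"
      using K by (intro mult_left_mono) auto
    then have "norm (shift_inverse A \<mu>) \<le> (2 * K * a powr \<alpha>) * cmod \<mu> powr (- \<alpha>)"
      using P(2) z(3) by (simp add: shift_inverse_def mult_ac)
    then show ?thesis using P(1) by simp
  qed
  moreover have "2 * K * a powr \<alpha> > 0" using K a by simp
  ultimately show ?thesis using that[OF \<kappa>] by blast
qed

section \<open>Gain of powers of the spectral parameter\<close>

context sector_calculus
begin

text \<open>The factor 1 - (1 + A)^-1 is A (1 + A)^-1. Writing A = (\<mu> + A) - \<mu> trades it for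
  a term free of the resolvent at - \<mu> and a term with the factor \<mu>.\<close>

lemma shift_inverse_comp_complement:
  assumes "- \<mu> \<in> resolvent_set A"
  shows "shift_inverse A \<mu> o\<^sub>L (id_blinfun - shift_inverse A 1) =
    shift_inverse A 1 - \<mu> *\<^sub>C (shift_inverse A 1 o\<^sub>L shift_inverse A \<mu>)"
proof -
  have 1: "- 1 \<in> resolvent_set A" using neg_resolvent_set[of 1] by simp
  have c: "shift_inverse A 1 o\<^sub>L shift_inverse A \<mu> = shift_inverse A \<mu> o\<^sub>L shift_inverse A 1"
    using resolvent_commute[OF linear 1 assms] by (simp add: shift_inverse_def blinfun_compose_simps)
  have "shift_inverse A \<mu> o\<^sub>L shift_inverse A 1 =
      shift_inverse A \<mu> - shift_inverse A 1 + \<mu> *\<^sub>C (shift_inverse A \<mu> o\<^sub>L shift_inverse A 1)"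
    unfolding shift_inverse_identity[OF assms 1] by (simp add: scaleC_diff)
  then show ?thesis
    unfolding c by (simp add: bounded_bilinear.diff_right[OF bounded_bilinear_blinfun_compose] blinfun_compose_id algebra_simps)
qed

text \<open>Up to a polynomial in \<open>\<mu>\<close>, each factor \<open>A (1 + A)\<^sup>-\<^sup>1\<close> gains a factor \<open>\<mu>\<close> near \<open>0\<close>.\<close>

lemma shift_inverse_comp_power:
  "\<exists>B. \<forall>\<mu>. - \<mu> \<in> resolvent_set A \<longrightarrow>
    shift_inverse A \<mu> o\<^sub>L op_power (id_blinfun - shift_inverse A 1) k =
    (\<Sum>j<k. \<mu> ^ j *\<^sub>C B j) + (- \<mu>) ^ k *\<^sub>C (op_power (shift_inverse A 1) k o\<^sub>L shift_inverse A \<mu>)"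
proof (induction k)
  case (Suc k)
  let ?N = "id_blinfun - shift_inverse A 1" and ?J = "shift_inverse A 1"
  note bb = bounded_bilinear_blinfun_compose
  obtain B where B: "\<And>\<mu>. - \<mu> \<in> resolvent_set A \<Longrightarrow>
    shift_inverse A \<mu> o\<^sub>L op_power ?N k = (\<Sum>j<k. \<mu> ^ j *\<^sub>C B j) + (- \<mu>) ^ k *\<^sub>C (op_power ?J k o\<^sub>L shift_inverse A \<mu>)"
    using Suc.IH by blast
  have Jc: "op_power ?J k \<in> bounded_clinear_ops" using shift_inverse_clinear[of 1] by (intro op_power_clinear) simp
  \<comment> \<open>The coefficients may not depend on \<mu>: the polynomial part is to be entire,
    so that its contour integral can be moved.\<close>
  define B' where "B' j = (if j < k then B j o\<^sub>L ?N else (- 1) ^ k *\<^sub>C op_power ?J (Suc k))" for j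
  have "shift_inverse A \<mu> o\<^sub>L op_power ?N (Suc k) =
      (\<Sum>j<Suc k. \<mu> ^ j *\<^sub>C B' j) + (- \<mu>) ^ Suc k *\<^sub>C (op_power ?J (Suc k) o\<^sub>L shift_inverse A \<mu>)"
    if \<mu>: "- \<mu> \<in> resolvent_set A" for \<mu>
  proof -
    have "shift_inverse A \<mu> o\<^sub>L op_power ?N (Suc k) = (shift_inverse A \<mu> o\<^sub>L op_power ?N k) o\<^sub>L ?N"
      by (simp add: blinfun_compose_assoc)
    also have "\<dots> = (\<Sum>j<k. \<mu> ^ j *\<^sub>C (B j o\<^sub>L ?N)) + (- \<mu>) ^ k *\<^sub>C (op_power ?J k o\<^sub>L (shift_inverse A \<mu> o\<^sub>L ?N))"
      unfolding B[OF \<mu>]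
      by (simp only: bounded_bilinear.add_left[OF bb] bounded_bilinear.sum_left[OF bb] scaleC_compose(1) blinfun_compose_assoc)
    also have "op_power ?J k o\<^sub>L (shift_inverse A \<mu> o\<^sub>L ?N) =
        op_power ?J (Suc k) - \<mu> *\<^sub>C (op_power ?J (Suc k) o\<^sub>L shift_inverse A \<mu>)"
      unfolding shift_inverse_comp_complement[OF \<mu>]
      by (simp add: bounded_bilinear.diff_right[OF bb] scaleC_compose(2)[OF Jc] blinfun_compose_assoc)
    also have "(- \<mu>) ^ k *\<^sub>C (op_power ?J (Suc k) - \<mu> *\<^sub>C (op_power ?J (Suc k) o\<^sub>L shift_inverse A \<mu>)) =
        \<mu> ^ k *\<^sub>C B' k + (- \<mu>) ^ Suc k *\<^sub>C (op_power ?J (Suc k) o\<^sub>L shift_inverse A \<mu>)"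
      by (simp add: B'_def scaleC_diff scaleC_scaleC power_minus[of \<mu>] mult_ac del: op_power_simps)
    also have "(\<Sum>j<k. \<mu> ^ j *\<^sub>C (B j o\<^sub>L ?N)) = (\<Sum>j<k. \<mu> ^ j *\<^sub>C B' j)"
      by (rule sum.cong) (auto simp: B'_def)
    finally show ?thesis by (simp add: add.assoc del: op_power_simps)
  qed
  then show ?case by blast
qed (simp add: blinfun_compose_id)

text \<open>Put m = \<bar>\<mu>\<bar>. The operator (\<mu> + A)^-1 (1 - r (r + A)^-1) is of size
  m^(-\<alpha>) by sectoriality, and by the resolvent identity also of size m^(-\<alpha>) m / r.
  Against the kernel exp (s v) / (exp v + 1) the two bounds balance at exp v = m, which produces the
  factor m^s.\<close>

lemma shift_inverse_ratio_bound:
  assumes s: "0 < s" "s < 1" and "\<Lambda> > 0" and \<alpha>: "\<alpha> \<ge> 1" and "C > 0"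
  obtains C' where "C' > 0"
    "\<And>\<mu>. \<mu> \<noteq> 0 \<Longrightarrow> cmod \<mu> \<le> \<Lambda> \<Longrightarrow> - \<mu> \<in> resolvent_set A \<Longrightarrow>
      norm (shift_inverse A \<mu>) \<le> C * cmod \<mu> powr (- \<alpha>) \<Longrightarrow>
      norm (shift_inverse A \<mu> o\<^sub>L ratio_power_op A s) \<le> C' * cmod \<mu> powr (s - \<alpha>)"
proof -
  note bb = bounded_bilinear_blinfun_compose
  obtain M where M: "M > 0" "\<And>r. r > 0 \<Longrightarrow> norm (shift_inverse A (of_real r)) \<le> M / r"
    using shift_inverse_bound by blast
  \<comment> \<open>One entry for each of the two bounds;
    \<open>\<Lambda> powr (\<alpha> - 1)\<close> absorbs the constant 1 into m^(1 - \<alpha>) for m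
    \<le> \<Lambda>.\<close>
  define P where "P = max ((1 + M) * C) (M * (\<Lambda> powr (\<alpha> - 1) + C))"
  have P: "P > 0" using M(1) \<open>C > 0\<close> by (simp add: P_def less_max_iff_disj)
  define a where "a = min s (1 - s)"
  have a: "a > 0" "a \<le> s" "a \<le> 1 - s" using s by (auto simp: a_def)
  define C' where "C' = 2 * P / a / cmod (frac_const (1 - s))"
  have "C' > 0" using P a frac_const_nonzero[of "1 - s"] s by (simp add: C'_def)
  moreover have "norm (shift_inverse A \<mu> o\<^sub>L ratio_power_op A s) \<le> C' * cmod \<mu> powr (s - \<alpha>)"
    if \<mu>: "\<mu> \<noteq> 0" "cmod \<mu> \<le> \<Lambda>" "- \<mu> \<in> resolvent_set A" "norm (shift_inverse A \<mu>) \<le> C * cmod \<mu> powr (- \<alpha>)" for \<mu>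
  proof -
    let ?K = "shift_inverse A \<mu>"
    define m where "m = cmod \<mu>"
    define p where "p = ln m"
    have m: "m > 0" "exp p = m" using \<mu>(1) by (auto simp: m_def p_def)
    have Kc: "?K \<in> bounded_clinear_ops"
      using resolvent_clinear[OF \<mu>(3)] by (auto simp: shift_inverse_def intro: bounded_clinear_ops_intros)
    have kern: "norm (?K o\<^sub>L (id_blinfun - r *\<^sub>R shift_inverse A (of_real r))) \<le> P * m powr (- \<alpha>) * min 1 (m / r)"
      (is "norm ?L \<le> _") if r: "r > 0" for r
    proof -
      let ?R = "shift_inverse A (of_real r)"
      have nR: "norm ?R \<le> M / r" by (rule M(2)[OF r])
      have "norm (r *\<^sub>R ?R) \<le> M" using nR r by (simp add: field_simps)
      then have "norm (id_blinfun - r *\<^sub>R ?R) \<le> 1 + M"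
        by (intro order_trans[OF norm_triangle_ineq4] add_mono norm_blinfun_id_le)
      then have "norm ?L \<le> (C * m powr (- \<alpha>)) * (1 + M)"
        using \<mu>(4) M(1) \<open>C > 0\<close> unfolding m_def by (intro order_trans[OF norm_blinfun_compose] mult_mono) auto
      also have "\<dots> \<le> P * m powr (- \<alpha>)"
        using mult_right_mono[of "(1 + M) * C" P "m powr (- \<alpha>)"] by (simp add: P_def mult_ac)
      finally have 1: "norm ?L \<le> P * m powr (- \<alpha>)" .
      have "?K - ?R = (of_real r - \<mu>) *\<^sub>C (?K o\<^sub>L ?R)"
        by (rule shift_inverse_identity[OF \<mu>(3)]) (use neg_resolvent_set[OF r] in simp)
      then have "?L = ?R - \<mu> *\<^sub>C (?K o\<^sub>L ?R)"
        by (simp add: bounded_bilinear.diff_right[OF bb] bounded_bilinear.scaleR_right[OF bb] blinfun_compose_id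
            scaleC_diff scaleC_of_real algebra_simps)
      then have "norm ?L \<le> norm ?R + norm (\<mu> *\<^sub>C (?K o\<^sub>L ?R))" by (simp add: norm_triangle_ineq4)
      also have "norm (\<mu> *\<^sub>C (?K o\<^sub>L ?R)) \<le> m * ((C * m powr (- \<alpha>)) * norm ?R)"
        using \<mu>(4) m unfolding norm_scaleC m_def
        by (intro mult_left_mono order_trans[OF norm_blinfun_compose] mult_right_mono) auto
      also have "norm ?R + \<dots> = norm ?R * (1 + C * (m powr (- \<alpha>) * m))" by (simp add: algebra_simps)
      also have "m powr (- \<alpha>) * m = m powr (1 - \<alpha>)" using m powr_add[of m "- \<alpha>" 1] by simp
      also have "norm ?R * (1 + C * m powr (1 - \<alpha>)) \<le> M / r * ((\<Lambda> powr (\<alpha> - 1) + C) * m powr (1 - \<alpha>))"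
      proof (rule mult_mono[OF nR])
        have "1 = m powr (\<alpha> - 1) * m powr (1 - \<alpha>)" using m by (simp flip: powr_add)
        also have "\<dots> \<le> \<Lambda> powr (\<alpha> - 1) * m powr (1 - \<alpha>)"
          using m \<alpha> \<mu>(2) by (intro mult_right_mono powr_mono2) (auto simp: m_def)
        finally show "1 + C * m powr (1 - \<alpha>) \<le> (\<Lambda> powr (\<alpha> - 1) + C) * m powr (1 - \<alpha>)"
          by (simp add: algebra_simps)
      qed (use M(1) r \<open>C > 0\<close> in auto)
      also have "\<dots> = (M * (\<Lambda> powr (\<alpha> - 1) + C)) * (m powr (1 - \<alpha>) / r)" by simp
      also have "\<dots> \<le> P * (m powr (1 - \<alpha>) / r)" using r by (intro mult_right_mono) (auto simp: P_def)
      also have "m powr (1 - \<alpha>) = m powr (- \<alpha>) * m" using m powr_add[of m "- \<alpha>" 1] by simp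
      finally have 2: "norm ?L \<le> P * m powr (- \<alpha>) * (m / r)" by simp
      show ?thesis using 1 2 by (simp add: min_def)
    qed
    define Q where "Q v = ?K o\<^sub>L ratio_power_kernel A s v" for v
    have bound: "norm (Q v) \<le> (P * m powr (s - \<alpha>)) * exp (- a * \<bar>v - p\<bar>)" for v
    proof -
      define r where "r = exp v / (exp v + 1)"
      have e: "exp v + 1 > 0" by (simp add: add_pos_pos)
      have r: "r > 0" using e by (simp add: r_def)
      have "norm (Q v) = exp (s * v) / (exp v + 1) * norm (?K o\<^sub>L (id_blinfun - r *\<^sub>R shift_inverse A (of_real r)))"
        using e by (simp add: Q_def ratio_power_kernel_def r_def bounded_bilinear.scaleR_right[OF bb] abs_of_pos)
      also have "\<dots> \<le> exp (s * v) / (exp v + 1) * (P * m powr (- \<alpha>) * min 1 (m / r))"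
        using e by (intro mult_left_mono kern r) auto
      also have "\<dots> = (P * m powr (- \<alpha>)) * (exp (s * v) / (exp v + 1) * min 1 (m / r))" by simp
      also have "\<dots> \<le> (P * m powr (- \<alpha>)) * (exp (s * p) * exp (- a * \<bar>v - p\<bar>))"
      proof (rule mult_left_mono)
        show "exp (s * v) / (exp v + 1) * min 1 (m / r) \<le> exp (s * p) * exp (- a * \<bar>v - p\<bar>)"
        \<comment> \<open>Below p = ln m the bound 1 is used, above it the gain m / r; in both cases
          the product decays away from p.\<close>
        proof (cases "v \<le> p")
          case True
          have "exp (s * v) / (exp v + 1) * min 1 (m / r) \<le> exp (s * v) / 1 * 1"
            using e m r by (intro mult_mono divide_left_mono) auto
          also have "s * v \<le> s * p + - a * \<bar>v - p\<bar>"
            using mult_right_mono[OF a(2), of "p - v"] True by (simp add: algebra_simps)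
          then have "exp (s * v) / 1 * 1 \<le> exp (s * p) * exp (- a * \<bar>v - p\<bar>)" unfolding mult_exp_exp by simp
          finally show ?thesis .
        next
          case False
          have "exp (s * v) / (exp v + 1) * min 1 (m / r) \<le> exp (s * v) / (exp v + 1) * (m / r)"
            using e by (intro mult_left_mono) auto
          also have "\<dots> = exp (s * v) * exp p / exp v"
          proof -
            define q where "q = exp v + 1"
            have "q \<noteq> 0" using e by (simp add: q_def)
            then show ?thesis unfolding r_def m(2) q_def[symmetric] by simp
          qed
          also have "\<dots> = exp (s * v + p - v)" by (simp add: exp_add exp_diff)
          also have "s * v + p - v \<le> s * p + - a * \<bar>v - p\<bar>"
            using mult_right_mono[OF a(3), of "v - p"] False by (simp add: algebra_simps)
          then have "exp (s * v + p - v) \<le> exp (s * p) * exp (- a * \<bar>v - p\<bar>)" unfolding mult_exp_exp by simp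
          finally show ?thesis .
        qed
      qed (use P in simp)
      also have "exp (s * p) = m powr s" using m by (simp add: p_def powr_def)
      also have "P * m powr (- \<alpha>) * (m powr s * exp (- a * \<bar>v - p\<bar>)) = (P * (m powr s * m powr (- \<alpha>))) * exp (- a * \<bar>v - p\<bar>)"
        by simp
      also have "m powr s * m powr (- \<alpha>) = m powr (s - \<alpha>)" by (simp flip: powr_add)
      finally show ?thesis .
    qed
    have cont: "continuous_on UNIV Q"
      unfolding Q_def[abs_def]
      by (intro bounded_bilinear.continuous_on[OF bb] continuous_on_const ratio_power_kernel_props(1)[OF s])
    obtain c where "\<And>v. norm (ratio_power_kernel A s v) \<le> c * exp (- min s (1 - s) * \<bar>v\<bar>)"
      using ratio_power_kernel_props(2)[OF s] by blast
    then have int: "ratio_power_kernel A s integrable_on UNIV"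
      using s by (intro exp_decay_integrable0(1)[OF ratio_power_kernel_props(1)[OF s], of "min s (1 - s)"]) auto
    have "?K o\<^sub>L ratio_power_op A s = (1 / frac_const (1 - s)) *\<^sub>C integral UNIV Q"
      unfolding ratio_power_op_def scaleC_compose(2)[OF Kc]
      using integral_linear[OF int bounded_bilinear.bounded_linear_right[OF bb, of ?K]] by (simp add: Q_def[abs_def] o_def)
    then have "norm (?K o\<^sub>L ratio_power_op A s) = norm (integral UNIV Q) / cmod (frac_const (1 - s))"
      by (simp add: norm_scaleC norm_divide)
    also have "\<dots> \<le> (2 * (P * m powr (s - \<alpha>)) / a) / cmod (frac_const (1 - s))"
      by (intro divide_right_mono exp_decay_integrable(2)[OF cont a(1) bound]) auto
    also have "\<dots> = C' * cmod \<mu> powr (s - \<alpha>)" by (simp add: C'_def m_def)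
    finally show ?thesis .
  qed
  ultimately show ?thesis using that by blast
qed

end


section \<open>Decay of the semigroup on the range of the product of powers\<close>

lemma asymptotically_analytic_decomposition:
  fixes T :: "real \<Rightarrow> 'a::complex_banach \<Rightarrow>\<^sub>L 'a"
  assumes "asymptotically_analytic T"
  obtains \<omega> \<theta> F M w where "\<omega> > 0" "0 < \<theta>" "\<theta> < pi" "M \<ge> 0" "w \<ge> 1"
    "vector_holomorphic_on F (sector \<theta>)" "\<And>z. z \<in> sector \<theta> \<Longrightarrow> norm (F z) \<le> M * exp (w * cmod z)"
    "\<And>t. t > 0 \<Longrightarrow> norm (T t - F (of_real t)) \<le> M * exp (- \<omega> * t)"
proof -
  obtain w0 S M0 where S: "w0 < 0" "S \<in> exp_bounded_analytic" "\<And>t. t > 0 \<Longrightarrow> exp (- t * w0) * norm (T t - S t) \<le> M0"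
    using assms unfolding asymptotically_analytic_def nonanalytic_growth_bound_def Inf_less_iff by auto
  obtain \<theta> F M1 w1 where F: "0 < \<theta>" "\<theta> < pi" "vector_holomorphic_on F (sector \<theta>)"
      "\<And>z. z \<in> sector \<theta> \<Longrightarrow> norm (F z) \<le> M1 * exp (w1 * cmod z)" "\<And>t. t > 0 \<Longrightarrow> S t = F (of_real t)"
    using S(2) unfolding exp_bounded_analytic_def by blast
  define M where "M = max 0 (max M0 M1)"
  show ?thesis
  proof (rule that[of "- w0" \<theta> M "max 1 w1" F])
    show "norm (F z) \<le> M * exp (max 1 w1 * cmod z)" if "z \<in> sector \<theta>" for z
    proof -
      have "M1 * exp (w1 * cmod z) \<le> M * exp (max 1 w1 * cmod z)"
        by (intro mult_mono) (auto simp: M_def intro!: mult_right_mono)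
      with F(4)[OF that] show ?thesis by simp
    qed
    show "norm (T t - F (of_real t)) \<le> M * exp (- (- w0) * t)" if "t > 0" for t
    proof -
      have "norm (T t - S t) = exp (w0 * t) * (exp (- t * w0) * norm (T t - S t))"
        by (simp add: mult.commute exp_minus)
      also have "\<dots> \<le> exp (w0 * t) * M"
        using S(3)[OF that] by (intro mult_left_mono) (auto simp: M_def)
      finally show ?thesis using F(5)[OF that] by (simp add: mult.commute)
    qed
  qed (use S F in \<open>auto simp: M_def\<close>)
qed

lemma vector_holomorphic_functional:
  fixes F :: "complex \<Rightarrow> 'a::complex_banach \<Rightarrow>\<^sub>L 'a"
  assumes F: "vector_holomorphic_on F S" and \<phi>: "contractive_functional \<phi>"
  shows "(\<lambda>z. \<phi> (F z x)) holomorphic_on S"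
  unfolding holomorphic_on_def field_differentiable_def
proof
  fix z assume "z \<in> S"
  then obtain D where D: "(F has_derivative (\<lambda>h. h *\<^sub>C D)) (at z within S)"
    using F by (auto simp: vector_holomorphic_on_def)
  have "bounded_linear (\<lambda>B. \<phi> (blinfun_apply B x))"
    by (rule bounded_linear_compose[OF contractive_functionalD(4)[OF \<phi>] blinfun.bounded_linear_left])
  from bounded_linear.has_derivative[OF this D]
  have "((\<lambda>z. \<phi> (F z x)) has_derivative (\<lambda>h. \<phi> (D x) * h)) (at z within S)"
    by (simp add: scaleC_blinfun.rep_eq contractive_functionalD[OF \<phi>] mult.commute)
  then have "((\<lambda>z. \<phi> (F z x)) has_field_derivative \<phi> (D x)) (at z within S)"
    unfolding has_field_derivative_def .
  then show "\<exists>f'. ((\<lambda>z. \<phi> (F z x)) has_field_derivative f') (at z within S)" by blast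
qed

text \<open>An entire integrand has a primitive, so the two half curves may be replaced by the
  segment Re \<mu> = - \<epsilon>. This disposes of the polynomial part, which lacks the factor
  \<bar>\<mu>\<bar>^(\<sigma> - \<alpha>) on the curve but carries exp (- \<epsilon> t) on the
  segment.\<close>

lemma entire_curve_integral:
  assumes h: "h holomorphic_on UNIV" and "\<alpha> > 0" "Y > 0" and B: "B \<ge> 0"
    and bound: "\<And>y. \<bar>y\<bar> \<le> Y \<Longrightarrow> cmod (h (Complex (- \<epsilon>) y)) \<le> B"
  shows "cmod (contour_integral (curve \<alpha> \<epsilon> b Y) h - contour_integral (curve \<alpha> \<epsilon> b (- Y)) h) \<le> B * (2 * Y)"
proof -
  obtain H where H: "\<And>x. x \<in> UNIV \<Longrightarrow> (H has_field_derivative h x) (at x within UNIV)"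
    using holomorphic_convex_primitive'[of UNIV h] h by auto
  have int: "(h has_contour_integral (H (pathfinish g) - H (pathstart g))) g" if "valid_path g" for g
    by (rule contour_integral_primitive[OF H that]) auto
  have "contour_integral (curve \<alpha> \<epsilon> b y) h = H (Complex (- \<epsilon>) y) - H (of_real b)" for y
    using contour_integral_unique[OF int[OF valid_path_curve[OF \<open>\<alpha> > 0\<close>]]] by (simp add: curve_endpoints)
  then have "contour_integral (curve \<alpha> \<epsilon> b Y) h - contour_integral (curve \<alpha> \<epsilon> b (- Y)) h =
      H (Complex (- \<epsilon>) Y) - H (Complex (- \<epsilon>) (- Y))" by simp
  also have "cmod \<dots> \<le> B * norm (Complex (- \<epsilon>) Y - Complex (- \<epsilon>) (- Y))"
  proof (rule has_contour_integral_bound_linepath[OF _ B])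
    show "(h has_contour_integral H (Complex (- \<epsilon>) Y) - H (Complex (- \<epsilon>) (- Y)))
        (linepath (Complex (- \<epsilon>) (- Y)) (Complex (- \<epsilon>) Y))"
      using int[of "linepath (Complex (- \<epsilon>) (- Y)) (Complex (- \<epsilon>) Y)"] by simp
    fix x assume "x \<in> closed_segment (Complex (- \<epsilon>) (- Y)) (Complex (- \<epsilon>) Y)"
    then have "Re x = - \<epsilon>" "\<bar>Im x\<bar> \<le> Y"
      using \<open>Y > 0\<close> by (auto simp: closed_segment_same_Re closed_segment_eq_real_ivl)
    then show "cmod (h x) \<le> B" using bound[of "Im x"] by (metis complex.collapse)
  qed
  also have "Complex (- \<epsilon>) Y - Complex (- \<epsilon>) (- Y) = Complex 0 (2 * Y)" by (simp add: complex_eq_iff)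
  finally show "cmod (contour_integral (curve \<alpha> \<epsilon> b Y) h - contour_integral (curve \<alpha> \<epsilon> b (- Y)) h) \<le> B * (2 * Y)"
    using \<open>Y > 0\<close> by (simp add: cmod_eq_Im)
qed

text \<open>All constants are fixed before a functional and a vector are chosen. The scalar estimate
  \<open>key\<close> is therefore uniform, and a norming functional turns it into a bound for the
  operator.\<close>

lemma semigroup_ratio_power_decay:
  fixes A :: "'a::complex_banach oper" and T :: "real \<Rightarrow> 'a \<Rightarrow>\<^sub>L 'a"
  assumes sec: "sectorial_of_angle \<omega>0 A" and T: "C0_semigroup T" and gen: "generator T = minus_op A"
    and asym: "asymptotically_analytic T" and res: "{z. Re z \<le> 0} - {0} \<subseteq> resolvent_set A"
    and \<alpha>: "\<alpha> \<ge> 1"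
    and bound: "\<And>\<mu>. \<mu> \<in> {z. Re z \<le> 0} - {0} \<Longrightarrow> cmod \<mu> \<le> 1 \<Longrightarrow> norm (resolvent A \<mu>) \<le> C * cmod \<mu> powr (- \<alpha>)"
    and \<sigma>: "\<sigma> > \<alpha> - 1"
  obtains c where "c > 0" "\<And>t. t \<ge> 1 \<Longrightarrow> norm (T t o\<^sub>L ratio_power A \<sigma>) \<le> c * t powr (1 - (\<sigma> + 1) / \<alpha>)"
proof -
  obtain \<theta>' \<phi>' where "sector_calculus A \<omega>0 \<theta>' \<phi>'" using sectorial_imp_calculus[OF sec] by blast
  then interpret sector_calculus A \<omega>0 \<theta>' \<phi>' .
  note TD = C0_semigroupD[OF T]
  obtain \<omega> \<theta> F M w where \<omega>: "\<omega> > 0" and \<theta>0: "0 < \<theta>" "\<theta> < pi" and M0: "M \<ge> 0" and w1: "w \<ge> 1"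
    and F: "vector_holomorphic_on F (sector \<theta>)" "\<And>z. z \<in> sector \<theta> \<Longrightarrow> norm (F z) \<le> M * exp (w * cmod z)"
      "\<And>t. t > 0 \<Longrightarrow> norm (T t - F (of_real t)) \<le> M * exp (- \<omega> * t)"
    by (rule asymptotically_analytic_decomposition[OF asym], rule that)
  have TF: "norm (T t) \<le> (2 * M) * exp (w * t)" if "t > 0" for t
  proof -
    have "complex_of_real t \<in> sector \<theta>" using that \<theta>0 by (simp add: sector_def)
    then have "norm (F (of_real t)) \<le> M * exp (w * t)" using F(2)[of "of_real t"] that by simp
    moreover have "norm (T t - F (of_real t)) \<le> M * exp (w * t)"
    proof -
      have "- \<omega> * t \<le> w * t" using \<omega> w1 that by (intro mult_right_mono) auto
      then have "M * exp (- \<omega> * t) \<le> M * exp (w * t)" using M0 by (intro mult_left_mono) auto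
      with F(3)[OF that] show ?thesis by linarith
    qed
    ultimately show ?thesis using norm_triangle_sub[of "T t" "F (of_real t)"] by linarith
  qed
  \<comment> \<open>Strictly inside the sector of analyticity and strictly below a right
    angle.\<close>
  define \<psi> where "\<psi> = min \<theta> (pi / 2) / 2"
  have \<psi>: "0 < \<psi>" "\<psi> < \<theta>" "\<psi> < pi / 2" using \<theta>0 by (auto simp: \<psi>_def min_def field_simps)
  have sc: "sin \<psi> > 0" "cos \<psi> > 0" "sin \<psi> \<le> 1" "cos \<psi> \<le> 1"
    using \<psi> by (auto intro!: sin_gt_zero cos_gt_zero)
  \<comment> \<open>The first entry serves Cauchy's formula on the two rays, the second the homotopy
    to the curve, where b + \<epsilon> is at most 1.\<close>
  define W where "W = max ((w + 1) / cos \<psi>) (2 * \<alpha>)"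
  have W: "W * cos \<psi> \<ge> w + 1" "W \<ge> 0" "W \<ge> 2 * \<alpha>"
    using sc \<alpha> mult_right_mono[of "(w + 1) / cos \<psi>" W "cos \<psi>"] by (auto simp: W_def)
  \<comment> \<open>As \<epsilon> cos \<psi> will be at most 1, the value w + 2 leaves the margin w
    + 1 at the endpoints with real part - \<epsilon>.\<close>
  define Y where "Y = (w + 2) / sin \<psi>"
  have Y: "Y > 0" "Y * sin \<psi> = w + 2" using sc w1 by (auto simp: Y_def)
  \<comment> \<open>Bounds \<bar>\<mu>\<bar> wherever the parabolic estimate is applied: there
    \<bar>Re \<mu>\<bar> \<le> 1 and \<bar>Im \<mu>\<bar> < Y + 1.\<close>
  define \<Lambda> where "\<Lambda> = Y + 3"
  have \<Lambda>: "\<Lambda> > 0" using Y by (simp add: \<Lambda>_def)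
  obtain \<kappa> C1 where \<kappa>: "\<kappa> > 0" and C1: "C1 > 0"
    and par: "\<And>\<mu>. \<mu> \<noteq> 0 \<Longrightarrow> cmod \<mu> \<le> \<Lambda> \<Longrightarrow> - \<kappa> * \<bar>Im \<mu>\<bar> powr \<alpha> \<le> Re \<mu> \<Longrightarrow>
       - \<mu> \<in> resolvent_set A \<and> norm (shift_inverse A \<mu>) \<le> C1 * cmod \<mu> powr (- \<alpha>)"
    by (rule shift_inverse_bound_parabolic[OF linear res \<alpha> _ \<Lambda>, of C], erule bound, assumption, rule that)
  \<comment> \<open>The bound by \<omega> is for the transform of the remainder. The bound by
    \<kappa> puts all points with \<bar>Im \<mu>\<bar> \<ge> 1 and Re \<mu> > - \<delta> into the
    parabolic region.\<close>
  define \<delta> where "\<delta> = min 1 (min \<omega> \<kappa>)"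
  have \<delta>: "0 < \<delta>" "\<delta> \<le> 1" "\<delta> \<le> \<omega>" "\<delta> \<le> \<kappa>" using \<omega> \<kappa> by (auto simp: \<delta>_def)
  \<comment> \<open>The second entry gives 2 \<epsilon> u^\<alpha> \<le> \<kappa> (Y u)^\<alpha>,
    which keeps the curve inside the parabolic region for every b \<le> \<epsilon>.\<close>
  define \<epsilon> where "\<epsilon> = min (\<delta> / 2) (\<kappa> * Y powr \<alpha> / 2)"
  have \<epsilon>: "0 < \<epsilon>" "\<epsilon> < \<delta>" "2 * \<epsilon> \<le> \<kappa> * Y powr \<alpha>" "2 * \<epsilon> \<le> 1" "\<epsilon> < \<omega>"
    using \<delta> \<kappa> Y by (auto simp: \<epsilon>_def min_def)
  have Yc: "Y * sin \<psi> - \<epsilon> * cos \<psi> \<ge> w + 1"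
    using mult_mono[of \<epsilon> 1 "cos \<psi>" 1] \<epsilon> sc Y by simp
  \<comment> \<open>On the curve the integrand has size \<bar>\<mu>\<bar>^(\<beta> - 1), up to the
    exponential. The hypothesis on \<sigma> says \<beta> > 0, and - \<beta> / \<alpha> is the
    exponent to be reached.\<close>
  define \<beta> where "\<beta> = \<sigma> - \<alpha> + 1"
  have \<beta>: "\<beta> > 0" using \<sigma> by (simp add: \<beta>_def)
  have \<sigma>0: "\<sigma> \<ge> 0" using \<alpha> \<sigma> by simp
  define s where "s = frac \<sigma>"
  define k where "k = nat \<lfloor>\<sigma>\<rfloor>"
  have sk: "s + real k = \<sigma>" using frac_plus_nat_floor[OF \<sigma>0] by (simp add: s_def k_def)
  define N where "N = op_power (id_blinfun - shift_inverse A 1) k"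
  define R where "R = (if s = 0 then id_blinfun else ratio_power_op A s)"
  define Q where "Q = ratio_power A \<sigma>"
  have Q: "Q = N o\<^sub>L R" by (simp add: Q_def ratio_power_def N_def R_def s_def k_def)
  obtain C2 where C2: "C2 > 0" and RB: "\<And>\<mu>. \<mu> \<noteq> 0 \<Longrightarrow> cmod \<mu> \<le> \<Lambda> \<Longrightarrow> - \<kappa> * \<bar>Im \<mu>\<bar> powr \<alpha> \<le> Re \<mu> \<Longrightarrow>
      norm (shift_inverse A \<mu> o\<^sub>L R) \<le> C2 * cmod \<mu> powr (s - \<alpha>)"
  proof (cases "s = 0")
    case True
    then show ?thesis using that[OF C1] par by (simp add: R_def blinfun_compose_id)
  next
    case False
    then have s: "0 < s" "s < 1" using frac_cases[of \<sigma>] by (auto simp: s_def)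
    show ?thesis
      by (rule shift_inverse_ratio_bound[OF s \<Lambda> \<alpha> C1], rule that, assumption) (use False par in \<open>simp add: R_def\<close>)
  qed
  define J where "J = op_power (shift_inverse A 1) k"
  obtain B where B: "\<And>\<mu>. - \<mu> \<in> resolvent_set A \<Longrightarrow>
      shift_inverse A \<mu> o\<^sub>L N = (\<Sum>j<k. \<mu> ^ j *\<^sub>C B j) + (- \<mu>) ^ k *\<^sub>C (J o\<^sub>L shift_inverse A \<mu>)"
    using shift_inverse_comp_power[of k] unfolding N_def J_def by blast
  have Y0: "Y \<noteq> 0" "- Y \<noteq> 0" using Y(1) by simp_all
  obtain Cp where Cp: "Cp \<ge> 0" "\<forall>t N F. t \<ge> 1 \<and> N \<ge> 0 \<and> F contour_integrable_on curve \<alpha> \<epsilon> (\<epsilon> / t) Y \<and>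
    (\<forall>u. 0 < u \<and> u < 1 \<longrightarrow> cmod (F (curve \<alpha> \<epsilon> (\<epsilon> / t) Y u)) \<le>
        N * cmod (curve \<alpha> \<epsilon> (\<epsilon> / t) Y u) powr (\<beta> - 1) * exp (t * Re (curve \<alpha> \<epsilon> (\<epsilon> / t) Y u))) \<longrightarrow>
    cmod (contour_integral (curve \<alpha> \<epsilon> (\<epsilon> / t) Y) F) \<le> Cp * N * t powr (- (\<beta> / \<alpha>))"
    using curve_integral_bound[OF \<alpha> \<beta> \<epsilon>(1) Y0(1)] by (elim exE conjE)
  obtain Cm where Cm: "Cm \<ge> 0" "\<forall>t N F. t \<ge> 1 \<and> N \<ge> 0 \<and> F contour_integrable_on curve \<alpha> \<epsilon> (\<epsilon> / t) (- Y) \<and>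
    (\<forall>u. 0 < u \<and> u < 1 \<longrightarrow> cmod (F (curve \<alpha> \<epsilon> (\<epsilon> / t) (- Y) u)) \<le>
        N * cmod (curve \<alpha> \<epsilon> (\<epsilon> / t) (- Y) u) powr (\<beta> - 1) * exp (t * Re (curve \<alpha> \<epsilon> (\<epsilon> / t) (- Y) u))) \<longrightarrow>
    cmod (contour_integral (curve \<alpha> \<epsilon> (\<epsilon> / t) (- Y)) F) \<le> Cm * N * t powr (- (\<beta> / \<alpha>))"
    using curve_integral_bound[OF \<alpha> \<beta> \<epsilon>(1) Y0(2)] by (elim exE conjE)
  define E where "E = {\<mu>. - \<mu> \<in> resolvent_set A}"
  have openE: "open E"
    using open_vimage[OF open_resolvent_set[OF linear], of uminus] by (simp add: E_def vimage_def continuous_intros)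
  have E_right: "\<mu> \<in> E" if "Re \<mu> \<ge> 0" "\<mu> \<noteq> 0" for \<mu>
    using res that by (auto simp: E_def)
  have region: "Complex x y \<noteq> 0" "- \<kappa> * \<bar>y\<bar> powr \<alpha> \<le> x" "- 1 \<le> x" "\<bar>y\<bar> \<le> Y"
    if u: "0 \<le> u" "u \<le> 1" and x: "b - (b + \<epsilon>) * u powr \<alpha> \<le> x" and y: "\<bar>y\<bar> = Y * u" and b: "0 < b" "b \<le> \<epsilon>" for x y u b
  proof -
    have "(b + \<epsilon>) * u powr \<alpha> \<le> 2 * \<epsilon> * u powr \<alpha>" using b by (intro mult_right_mono) auto
    then have x': "- (2 * \<epsilon> * u powr \<alpha>) \<le> x" using x b by linarith
    have "2 * \<epsilon> * u powr \<alpha> \<le> (\<kappa> * Y powr \<alpha>) * u powr \<alpha>" using \<epsilon>(3) by (intro mult_right_mono) auto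
    also have "\<dots> = \<kappa> * \<bar>y\<bar> powr \<alpha>" using u Y unfolding y by (simp add: powr_mult)
    finally show "- \<kappa> * \<bar>y\<bar> powr \<alpha> \<le> x" using x' by linarith
    have "2 * \<epsilon> * u powr \<alpha> \<le> 1 * 1" using \<epsilon> u \<alpha> by (intro mult_mono powr_le1) auto
    then show "- 1 \<le> x" using x' by linarith
    show "\<bar>y\<bar> \<le> Y" unfolding y using Y(1) u by (simp add: mult_left_le)
    show "Complex x y \<noteq> 0"
    proof (cases "u = 0")
      case True
      then show ?thesis using x b by (auto simp: complex_eq_iff)
    next
      case False
      then show ?thesis using y Y(1) by (auto simp: complex_eq_iff)
    qed
  qed
  define L where "L = (2 / sin \<psi> + 2 * Y / (\<omega> - \<epsilon>) + 2 * pi) * (M * norm Q)"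
  define H where "H = (\<Sum>j<k. \<Lambda> ^ j * norm (B j)) * norm R"
  define ce where "ce = exp (\<epsilon> - \<beta> / \<alpha> + \<beta> / \<alpha> * ln (\<beta> / \<alpha> / \<epsilon>))"
  define c where "c = (L + H * (2 * Y)) * ce + (Cp + Cm) * (norm J * C2)"
  have H: "H \<ge> 0" using \<Lambda> by (auto simp: H_def intro!: sum_nonneg mult_nonneg_nonneg)
  have L: "L \<ge> 0" using sc Y M0 \<epsilon> by (auto simp: L_def intro!: mult_nonneg_nonneg add_nonneg_nonneg)
  have key: "2 * pi * cmod (\<phi> (T t (Q x))) \<le> c * t powr (- (\<beta> / \<alpha>)) * norm x"
    if \<phi>: "contractive_functional \<phi>" and t: "t \<ge> 1" for \<phi> x t
  proof -
    note \<phi>D = contractive_functionalD[OF \<phi>]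
    define \<rho> where "\<rho> \<mu> = \<phi> (shift_inverse A \<mu> (Q x))" for \<mu>
    have hol\<rho>: "\<rho> holomorphic_on E"
    proof -
      have "((\<lambda>z. \<phi> (resolvent A z (Q x))) \<circ> uminus) holomorphic_on E"
        by (rule holomorphic_on_compose_gen[OF _ resolvent_holomorphic[OF linear \<phi>]])
          (auto simp: E_def intro!: holomorphic_intros)
      then have "(\<lambda>\<mu>. - (((\<lambda>z. \<phi> (resolvent A z (Q x))) \<circ> uminus) \<mu>)) holomorphic_on E"
        by (rule holomorphic_on_minus)
      then show ?thesis
        by (simp add: \<rho>_def[abs_def] shift_inverse_def blinfun.minus_left \<phi>D o_def)
    qed
    interpret analytic_exp_bounded "\<lambda>z. \<phi> (F z (Q x))" \<theta> "M * norm (Q x)" w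
    proof
      show "cmod (\<phi> (F z (Q x))) \<le> M * norm (Q x) * exp (w * cmod z)" if "z \<in> sector \<theta>" for z
      proof -
        have "cmod (\<phi> (F z (Q x))) \<le> norm (F z) * norm (Q x)" by (rule order_trans[OF \<phi>D(3) norm_blinfun])
        also have "\<dots> \<le> (M * exp (w * cmod z)) * norm (Q x)" by (intro mult_right_mono F(2) that) auto
        finally show ?thesis by (simp add: mult_ac)
      qed
    qed (use \<theta>0 w1 M0 vector_holomorphic_functional[OF F(1) \<phi>] in auto)
    define I where "I = contour_integral (linepath (Complex (- \<epsilon>) (- Y)) (of_real W) +++ linepath (of_real W) (Complex (- \<epsilon>) Y))
      (\<lambda>\<mu>. exp (\<mu> * of_real t) * \<rho> \<mu>)"
    have "cmod (2 * complex_of_real pi * \<i> * \<phi> (T t (Q x)) - I)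
        \<le> (2 / sin \<psi> + 2 * Y / (\<omega> - \<epsilon>) + 2 * pi) * (M * norm (Q x)) * exp (- \<epsilon> * t)"
      unfolding I_def
    proof (rule contour_representation[where Y' = "Y + 1" and \<delta> = \<delta> and \<omega> = \<omega> and ?x0.0 = "w + 1"])
      have "continuous_on UNIV (\<lambda>u::real. T (exp u) (Q x))"
        by (rule continuous_on_compose2[OF TD(4)]) (auto intro!: continuous_intros)
      then show "continuous_on UNIV (\<lambda>u. \<phi> (T (exp u) (Q x)))"
        by (rule bounded_linear.continuous_on[OF \<phi>D(4)])
      show "cmod (\<phi> (T t (Q x)) - \<phi> (F (of_real t) (Q x))) \<le> M * norm (Q x) * exp (- \<omega> * t)" if "t > 0" for t
      proof -
        have "cmod (\<phi> (T t (Q x)) - \<phi> (F (of_real t) (Q x))) = cmod (\<phi> ((T t - F (of_real t)) (Q x)))"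
          by (simp add: \<phi>D blinfun.diff_left)
        also have "\<dots> \<le> norm (T t - F (of_real t)) * norm (Q x)" by (rule order_trans[OF \<phi>D(3) norm_blinfun])
        also have "\<dots> \<le> (M * exp (- \<omega> * t)) * norm (Q x)" by (intro mult_right_mono F(3) that) auto
        finally show ?thesis by (simp add: mult_ac)
      qed
      show "\<rho> (of_real x') = ray_laplace 0 (\<lambda>u. \<phi> (T (exp u) (Q x))) (of_real x')" if "x' \<ge> w + 1" for x'
        unfolding \<rho>_def using that w1 neg_resolvent_set[of x']
        by (intro semigroup_laplace[OF T TF _ gen linear _ _ \<phi>]) auto
      show "\<rho> holomorphic_on {\<mu>. w < Re (\<mu> * cis \<tau>) \<and> - \<delta> < Re \<mu> \<and> \<bar>Im \<mu>\<bar> < Y + 1}" if \<tau>: "\<bar>\<tau>\<bar> = \<psi>" for \<tau>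
      proof (rule holomorphic_on_subset[OF hol\<rho>], rule subsetI, elim CollectE conjE)
        fix \<mu> assume \<mu>: "w < Re (\<mu> * cis \<tau>)" "- \<delta> < Re \<mu>" "\<bar>Im \<mu>\<bar> < Y + 1"
        have "\<mu> \<noteq> 0" using \<mu>(1) w1 by auto
        show "\<mu> \<in> E"
        proof (cases "Re \<mu> \<ge> 0")
          case False
          have "cos \<tau> = cos \<psi>" "\<bar>sin \<tau>\<bar> = sin \<psi>" using \<tau> sc by (auto simp: abs_if split: if_splits)
          then have "Re \<mu> * cos \<tau> \<le> 0" "- (Im \<mu> * sin \<tau>) \<le> \<bar>Im \<mu>\<bar> * sin \<psi>"
            using False sc abs_ge_minus_self[of "Im \<mu> * sin \<tau>"] by (auto simp: abs_mult mult_nonpos_nonneg)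
          \<comment> \<open>To the left of the imaginary axis the half-plane condition forces
            \<bar>Im \<mu>\<bar> > w \<ge> 1, far from the tip of the parabolic region at 0.\<close>
          then have "w < \<bar>Im \<mu>\<bar> * sin \<psi>" using \<mu>(1) by simp
          also have "\<dots> \<le> \<bar>Im \<mu>\<bar> * 1" using sc by (intro mult_left_mono) auto
          finally have "1 \<le> \<bar>Im \<mu>\<bar>" using w1 by simp
          then have "1 \<le> \<bar>Im \<mu>\<bar> powr \<alpha>" using \<alpha> by (intro ge_one_powr_ge_zero) auto
          then have "\<kappa> * 1 \<le> \<kappa> * \<bar>Im \<mu>\<bar> powr \<alpha>" using \<kappa> by (intro mult_left_mono) auto
          then have "- \<kappa> * \<bar>Im \<mu>\<bar> powr \<alpha> \<le> Re \<mu>" using \<mu>(2) \<delta> by linarith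
          moreover have "cmod \<mu> \<le> \<Lambda>" using cmod_le[of \<mu>] \<mu> False \<delta> by (simp add: \<Lambda>_def)
          ultimately show ?thesis using par[OF \<open>\<mu> \<noteq> 0\<close>] by (simp add: E_def)
        qed (use \<open>\<mu> \<noteq> 0\<close> E_right in auto)
      qed
    qed (use \<psi> W \<epsilon> \<delta> Y Yc t in auto)
    also have "\<dots> \<le> (2 / sin \<psi> + 2 * Y / (\<omega> - \<epsilon>) + 2 * pi) * (M * (norm Q * norm x)) * exp (- \<epsilon> * t)"
      using sc Y M0 \<epsilon> by (intro mult_right_mono mult_left_mono norm_blinfun) (auto intro!: add_nonneg_nonneg)
    also have "\<dots> = L * norm x * exp (- \<epsilon> * t)" by (simp add: L_def)
    finally have rep: "cmod (2 * complex_of_real pi * \<i> * \<phi> (T t (Q x)) - I) \<le> L * norm x * exp (- \<epsilon> * t)" .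
    define b where "b = \<epsilon> / t"
    have b: "0 < b" "b \<le> \<epsilon>" using \<epsilon> t by (auto simp: b_def divide_le_eq mult_left_le)
    \<comment> \<open>The part of the integrand that is polynomial in \<mu> up to the exponential;
      the difference \<open>G\<close> carries the factor \<mu>^k.\<close>
    define h where "h \<mu> = exp (\<mu> * of_real t) * (\<Sum>j<k. \<mu> ^ j * \<phi> (B j (R x)))" for \<mu>
    define G where "G \<mu> = exp (\<mu> * of_real t) * \<rho> \<mu> - h \<mu>" for \<mu>
    have holh: "h holomorphic_on UNIV" unfolding h_def[abs_def] by (intro holomorphic_intros)
    have ab: "\<alpha> * (b + \<epsilon>) \<le> W + \<epsilon>"
    proof -
      have "\<alpha> * (b + \<epsilon>) \<le> \<alpha> * 1" using b \<epsilon> \<alpha> by (intro mult_left_mono) auto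
      then show ?thesis using W(3) \<alpha> \<epsilon>(1) by linarith
    qed
    have Ein: "Complex p q \<in> E"
      if "0 \<le> u" "u \<le> 1" "b - (b + \<epsilon>) * u powr \<alpha> \<le> p" "\<bar>q\<bar> = Y * u" for p q u
    proof (cases "p \<ge> 0")
      case True
      then show ?thesis using region(1)[OF that b] by (intro E_right) auto
    next
      case False
      have "cmod (Complex p q) \<le> \<Lambda>"
        using cmod_le[of "Complex p q"] region(3,4)[OF that b] False by (simp add: \<Lambda>_def)
      then show ?thesis using par[of "Complex p q"] region(1,2)[OF that b] by (simp add: E_def)
    qed
    have holG: "(\<lambda>\<mu>. exp (\<mu> * of_real t) * \<rho> \<mu>) holomorphic_on E"
      by (intro holomorphic_intros hol\<rho>)
    have integrable: "(\<lambda>\<mu>. exp (\<mu> * of_real t) * \<rho> \<mu>) contour_integrable_on curve \<alpha> \<epsilon> b Y"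
      "(\<lambda>\<mu>. exp (\<mu> * of_real t) * \<rho> \<mu>) contour_integrable_on curve \<alpha> \<epsilon> b (- Y)"
      and I: "I = contour_integral (curve \<alpha> \<epsilon> b Y) (\<lambda>\<mu>. exp (\<mu> * of_real t) * \<rho> \<mu>) -
        contour_integral (curve \<alpha> \<epsilon> b (- Y)) (\<lambda>\<mu>. exp (\<mu> * of_real t) * \<rho> \<mu>)"
      unfolding I_def by (rule contour_deformation[OF \<alpha> \<epsilon>(1) b(1) ab holG openE Ein Y(1)], assumption+)+
    have hcurve: "h contour_integrable_on curve \<alpha> \<epsilon> b y" for y
      using holh valid_path_curve[of \<alpha>] \<alpha> by (intro contour_integrable_holomorphic_simple[of _ UNIV]) auto
    have Gi: "G contour_integrable_on curve \<alpha> \<epsilon> b y"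
      "contour_integral (curve \<alpha> \<epsilon> b y) (\<lambda>\<mu>. exp (\<mu> * of_real t) * \<rho> \<mu>) =
        contour_integral (curve \<alpha> \<epsilon> b y) G + contour_integral (curve \<alpha> \<epsilon> b y) h" if "y = Y \<or> y = - Y" for y
    proof -
      have i: "(\<lambda>\<mu>. exp (\<mu> * of_real t) * \<rho> \<mu>) contour_integrable_on curve \<alpha> \<epsilon> b y" using integrable that by auto
      show Gy: "G contour_integrable_on curve \<alpha> \<epsilon> b y"
        unfolding G_def[abs_def] by (intro contour_integrable_diff i hcurve)
      have "contour_integral (curve \<alpha> \<epsilon> b y) G =
          contour_integral (curve \<alpha> \<epsilon> b y) (\<lambda>\<mu>. exp (\<mu> * of_real t) * \<rho> \<mu>) - contour_integral (curve \<alpha> \<epsilon> b y) h"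
        unfolding G_def[abs_def] by (intro contour_integral_diff i hcurve)
      then show "contour_integral (curve \<alpha> \<epsilon> b y) (\<lambda>\<mu>. exp (\<mu> * of_real t) * \<rho> \<mu>) =
        contour_integral (curve \<alpha> \<epsilon> b y) G + contour_integral (curve \<alpha> \<epsilon> b y) h" by simp
    qed
    have hbound: "cmod (contour_integral (curve \<alpha> \<epsilon> b Y) h - contour_integral (curve \<alpha> \<epsilon> b (- Y)) h)
        \<le> exp (- \<epsilon> * t) * (H * norm x) * (2 * Y)"
    proof (rule entire_curve_integral[OF holh])
      fix y :: real assume y: "\<bar>y\<bar> \<le> Y"
      have cm: "cmod (Complex (- \<epsilon>) y) \<le> \<Lambda>" using cmod_le[of "Complex (- \<epsilon>) y"] y \<epsilon> by (simp add: \<Lambda>_def)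
      have "cmod (h (Complex (- \<epsilon>) y)) = exp (- \<epsilon> * t) * cmod (\<Sum>j<k. Complex (- \<epsilon>) y ^ j * \<phi> (B j (R x)))"
        by (simp add: h_def norm_mult)
      also have "\<dots> \<le> exp (- \<epsilon> * t) * (\<Sum>j<k. \<Lambda> ^ j * (norm (B j) * (norm R * norm x)))"
      proof (intro mult_left_mono order_trans[OF norm_sum] sum_mono)
        fix j
        have "cmod (\<phi> (B j (R x))) \<le> norm (B j) * (norm R * norm x)"
          by (intro order_trans[OF \<phi>D(3)] order_trans[OF norm_blinfun] mult_left_mono norm_blinfun) auto
        then show "cmod (Complex (- \<epsilon>) y ^ j * \<phi> (B j (R x))) \<le> \<Lambda> ^ j * (norm (B j) * (norm R * norm x))"
          unfolding norm_mult norm_power using cm \<Lambda> by (intro mult_mono power_mono) auto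
      qed auto
      also have "(\<Sum>j<k. \<Lambda> ^ j * (norm (B j) * (norm R * norm x))) = H * norm x"
        by (simp add: H_def sum_distrib_right mult.assoc)
      finally show "cmod (h (Complex (- \<epsilon>) y)) \<le> exp (- \<epsilon> * t) * (H * norm x)" .
    qed (use \<alpha> Y H in auto)
    have Gb: "cmod (G (curve \<alpha> \<epsilon> b y u)) \<le> (norm J * C2 * norm x) * cmod (curve \<alpha> \<epsilon> b y u) powr (\<beta> - 1) * exp (t * Re (curve \<alpha> \<epsilon> b y u))"
      if y: "y = Y \<or> y = - Y" and u: "0 < u" "u < 1" for y u
    proof -
      define \<mu> where "\<mu> = curve \<alpha> \<epsilon> b y u"
      define p where "p = b - (b + \<epsilon>) * u powr \<alpha>"
      have \<mu>': "\<mu> = Complex p (y * u)" by (simp add: \<mu>_def curve_def p_def)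
      have yu: "\<bar>y * u\<bar> = Y * u" using y Y(1) u by (auto simp: abs_mult)
      have u': "0 \<le> u" "u \<le> 1" using u by auto
      note reg = region[OF u' _ yu b, of p, folded p_def, OF order_refl]
      have "\<mu> \<in> E" unfolding \<mu>' by (rule Ein[OF u' _ yu]) (simp add: p_def)
      then have \<mu>E: "- \<mu> \<in> resolvent_set A" by (simp add: E_def)
      have "p \<le> b - 0" unfolding p_def using b \<epsilon> by (intro diff_left_mono) auto
      then have "cmod \<mu> \<le> \<Lambda>" using cmod_le[of \<mu>] reg(3,4) b \<epsilon> by (simp add: \<mu>' \<Lambda>_def)
      then have RB': "norm (shift_inverse A \<mu> o\<^sub>L R) \<le> C2 * cmod \<mu> powr (s - \<alpha>)"
        using reg(1,2) by (intro RB) (auto simp: \<mu>')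
      have "shift_inverse A \<mu> (Q x) = (shift_inverse A \<mu> o\<^sub>L N) (R x)" by (simp add: Q)
      also have "\<dots> = (\<Sum>j<k. \<mu> ^ j *\<^sub>C B j (R x)) + (- \<mu>) ^ k *\<^sub>C J ((shift_inverse A \<mu> o\<^sub>L R) x)"
        unfolding B[OF \<mu>E] by (simp add: blinfun.add_left blinfun.sum_left scaleC_blinfun.rep_eq)
      finally have "\<rho> \<mu> = (\<Sum>j<k. \<mu> ^ j * \<phi> (B j (R x))) + (- \<mu>) ^ k * \<phi> (J ((shift_inverse A \<mu> o\<^sub>L R) x))"
        unfolding \<rho>_def by (simp only: \<phi>D(1,2) linear_sum[OF bounded_linear.linear[OF \<phi>D(4)]])
      then have "G \<mu> = exp (\<mu> * of_real t) * ((- \<mu>) ^ k * \<phi> (J ((shift_inverse A \<mu> o\<^sub>L R) x)))"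
        by (simp add: G_def h_def algebra_simps)
      then have "cmod (G \<mu>) = exp (t * Re \<mu>) * (cmod \<mu> ^ k * cmod (\<phi> (J ((shift_inverse A \<mu> o\<^sub>L R) x))))"
        by (simp add: norm_mult norm_power mult.commute)
      also have "\<dots> \<le> exp (t * Re \<mu>) * (cmod \<mu> ^ k * (norm J * ((C2 * cmod \<mu> powr (s - \<alpha>)) * norm x)))"
      proof (intro mult_left_mono)
        have "cmod (\<phi> (J ((shift_inverse A \<mu> o\<^sub>L R) x))) \<le> norm J * norm ((shift_inverse A \<mu> o\<^sub>L R) x)"
          by (rule order_trans[OF \<phi>D(3) norm_blinfun])
        also have "\<dots> \<le> norm J * ((C2 * cmod \<mu> powr (s - \<alpha>)) * norm x)"
          by (intro mult_left_mono order_trans[OF norm_blinfun] mult_right_mono RB') auto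
        finally show "cmod (\<phi> (J ((shift_inverse A \<mu> o\<^sub>L R) x))) \<le> norm J * ((C2 * cmod \<mu> powr (s - \<alpha>)) * norm x)" .
      qed auto
      also have "\<dots> = (norm J * C2 * norm x) * (cmod \<mu> ^ k * cmod \<mu> powr (s - \<alpha>)) * exp (t * Re \<mu>)" by simp
      also have "cmod \<mu> ^ k * cmod \<mu> powr (s - \<alpha>) = cmod \<mu> powr (\<beta> - 1)"
      proof -
        have "cmod \<mu> > 0" using reg(1) by (simp add: \<mu>')
        then have "cmod \<mu> ^ k * cmod \<mu> powr (s - \<alpha>) = cmod \<mu> powr (real k + (s - \<alpha>))"
          by (simp add: powr_add powr_realpow)
        also have "real k + (s - \<alpha>) = \<beta> - 1" using sk by (simp add: \<beta>_def)
        finally show ?thesis .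
      qed
      finally show ?thesis by (simp only: \<mu>_def)
    qed
    have N0: "0 \<le> norm J * C2 * norm x" using C2 by simp
    have Gp: "cmod (contour_integral (curve \<alpha> \<epsilon> b Y) G) \<le> Cp * (norm J * C2 * norm x) * t powr (- (\<beta> / \<alpha>))"
      unfolding b_def
      by (rule Cp(2)[rule_format], intro conjI t N0 allI impI) (use Gi(1)[of Y] Gb[of Y] in \<open>auto simp: b_def\<close>)
    have Gm: "cmod (contour_integral (curve \<alpha> \<epsilon> b (- Y)) G) \<le> Cm * (norm J * C2 * norm x) * t powr (- (\<beta> / \<alpha>))"
      unfolding b_def
      by (rule Cm(2)[rule_format], intro conjI t N0 allI impI) (use Gi(1)[of "- Y"] Gb[of "- Y"] in \<open>auto simp: b_def\<close>)
    have "I = (contour_integral (curve \<alpha> \<epsilon> b Y) G - contour_integral (curve \<alpha> \<epsilon> b (- Y)) G) +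
        (contour_integral (curve \<alpha> \<epsilon> b Y) h - contour_integral (curve \<alpha> \<epsilon> b (- Y)) h)"
      unfolding I using Gi(2)[of Y] Gi(2)[of "- Y"] by simp
    then have "cmod I \<le> cmod (contour_integral (curve \<alpha> \<epsilon> b Y) G) + cmod (contour_integral (curve \<alpha> \<epsilon> b (- Y)) G) +
        exp (- \<epsilon> * t) * (H * norm x) * (2 * Y)"
      using norm_triangle_ineq norm_triangle_ineq4 hbound by (smt (verit, best))
    then have "cmod (2 * complex_of_real pi * \<i> * \<phi> (T t (Q x))) \<le>
        (Cp + Cm) * (norm J * C2) * t powr (- (\<beta> / \<alpha>)) * norm x + (L + H * (2 * Y)) * norm x * exp (- \<epsilon> * t)"
      using norm_triangle_sub[of "2 * complex_of_real pi * \<i> * \<phi> (T t (Q x))" I] rep Gp Gm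
      by (simp add: algebra_simps)
    also have "exp (- \<epsilon> * t) \<le> ce * t powr (- (\<beta> / \<alpha>))"
    proof -
      have "exp (- \<epsilon> * t) \<le> ce * (1 + t) powr (- (\<beta> / \<alpha>))"
        unfolding ce_def using \<alpha> \<beta> \<epsilon> t by (intro exp_neg_le_powr) auto
      also have "\<dots> \<le> ce * t powr (- (\<beta> / \<alpha>))"
        using \<alpha> \<beta> t by (intro mult_left_mono powr_mono2') (auto simp: ce_def)
      finally show ?thesis .
    qed
    finally have "cmod (2 * complex_of_real pi * \<i> * \<phi> (T t (Q x))) \<le>
        (Cp + Cm) * (norm J * C2) * t powr (- (\<beta> / \<alpha>)) * norm x + (L + H * (2 * Y)) * norm x * (ce * t powr (- (\<beta> / \<alpha>)))"
      using L H Y by (simp add: mult_left_mono)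
    also have "\<dots> = c * t powr (- (\<beta> / \<alpha>)) * norm x" by (simp add: c_def algebra_simps)
    finally show ?thesis by (simp add: norm_mult)
  qed
  have c: "c \<ge> 0"
    using L H Y Cp(1) Cm(1) C2 by (auto simp: c_def ce_def intro!: add_nonneg_nonneg mult_nonneg_nonneg)
  show ?thesis
  \<comment> \<open>\<open>c\<close> is only known to be nonnegative, while a positive constant is
    wanted.\<close>
  proof (rule that[of "c + 1"])
    fix t :: real assume t: "t \<ge> 1"
    have "norm (T t o\<^sub>L Q) \<le> (c + 1) * t powr (- (\<beta> / \<alpha>))"
    proof (rule norm_blinfun_bound)
      fix x
      obtain \<phi> where \<phi>: "contractive_functional \<phi>" "\<phi> (T t (Q x)) = of_real (norm (T t (Q x)))"
        using norming_functional[of "T t (Q x)"] by blast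
      have "1 * norm (T t (Q x)) \<le> 2 * pi * norm (T t (Q x))" using pi_ge_two by (intro mult_right_mono) auto
      also have "\<dots> \<le> c * t powr (- (\<beta> / \<alpha>)) * norm x" using key[OF \<phi>(1) t, of x] \<phi>(2) by simp
      also have "\<dots> \<le> (c + 1) * t powr (- (\<beta> / \<alpha>)) * norm x" by (intro mult_right_mono) auto
      finally show "norm ((T t o\<^sub>L Q) x) \<le> (c + 1) * t powr (- (\<beta> / \<alpha>)) * norm x" by simp
    qed (use c in auto)
    moreover have "- (\<beta> / \<alpha>) = 1 - (\<sigma> + 1) / \<alpha>" using \<alpha> by (simp add: \<beta>_def field_simps)
    ultimately show "norm (T t o\<^sub>L ratio_power A \<sigma>) \<le> (c + 1) * t powr (1 - (\<sigma> + 1) / \<alpha>)" by (simp add: Q_def)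
  qed (use c in simp)
qed

theorem corollary1p5:
  fixes A :: "('a::complex_banach \<times> 'a) set"
    and T :: "real \<Rightarrow> 'a \<Rightarrow>\<^sub>L 'a"
    and \<alpha> C \<sigma> :: real
  assumes "sectorial A" and "injective_operator A"
    and "C0_semigroup T" and "generator T = minus_op A"
    and "asymptotically_analytic T"
    and "{z. Re z \<le> 0} - {0} \<subseteq> resolvent_set A"
    and "\<alpha> \<ge> 1" and "C > 0"
    and "\<And>\<mu>. \<mu> \<in> {z. Re z \<le> 0} - {0} \<Longrightarrow> cmod \<mu> \<le> 1 \<Longrightarrow>
           norm (resolvent A \<mu>) \<le> C * cmod \<mu> powr (- \<alpha>)"
    and "\<sigma> > \<alpha> - 1"
  shows "\<forall>\<delta>>0. \<exists>c>0. \<forall>t\<ge>1. \<exists>B\<in>bounded_clinear_ops.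
           bounded_graph B =
             fractional_power (one_plus_op A) (- \<sigma>) O fractional_power A \<sigma> O bounded_graph (T t) \<and>
           norm B \<le> c * t powr (1 - (\<sigma> + 1) / \<alpha>) * ln (1 + t) powr (1 + \<delta>)"
proof (intro allI impI)
  fix \<delta> :: real assume "\<delta> > 0"
  obtain \<omega>0 where sec: "sectorial_of_angle \<omega>0 A" using assms(1) by (auto simp: sectorial_def)
  then obtain \<theta>' \<phi>' where calc: "sector_calculus A \<omega>0 \<theta>' \<phi>'" using sectorial_imp_calculus by blast
  have \<sigma>: "\<sigma> \<ge> 0" using assms(7,10) by simp
  obtain c where c: "c > 0" "\<And>t. t \<ge> 1 \<Longrightarrow> norm (T t o\<^sub>L ratio_power A \<sigma>) \<le> c * t powr (1 - (\<sigma> + 1) / \<alpha>)"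
    by (rule semigroup_ratio_power_decay[OF sec assms(3,4,5,6,7) _ assms(10), of C], erule assms(9), assumption, rule that)
  have l: "ln 2 powr (1 + \<delta>) > 0" by simp
  show "\<exists>c>0. \<forall>t\<ge>1. \<exists>B\<in>bounded_clinear_ops.
           bounded_graph B =
             fractional_power (one_plus_op A) (- \<sigma>) O fractional_power A \<sigma> O bounded_graph (T t) \<and>
           norm B \<le> c * t powr (1 - (\<sigma> + 1) / \<alpha>) * ln (1 + t) powr (1 + \<delta>)"
  \<comment> \<open>The power bound is available without a logarithm, and ln (1 + t) \<ge> ln 2 for
    t \<ge> 1; dividing by the power of ln 2 makes room for the logarithmic factor.\<close>
  proof (intro exI[of _ "c / ln 2 powr (1 + \<delta>)"] conjI allI impI bexI)
    fix t :: real assume t: "t \<ge> 1"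
    show "T t o\<^sub>L ratio_power A \<sigma> \<in> bounded_clinear_ops"
      using t C0_semigroupD(1)[OF assms(3)] sector_calculus.powers_clinear(2)[OF calc]
      by (intro bounded_clinear_ops_intros) auto
    \<comment> \<open>\<open>O\<close> composes from left to right: the value of the everywhere
      defined (1 + A)^(-\<sigma>) is fed into A^\<sigma>, where
      \<open>fractional_power_inv_power_iff\<close> evaluates it.\<close>
    show "bounded_graph (T t o\<^sub>L ratio_power A \<sigma>) =
        fractional_power (one_plus_op A) (- \<sigma>) O fractional_power A \<sigma> O bounded_graph (T t)"
      unfolding fractional_power_one_plus_eq[OF sec \<sigma>]
      by (auto simp: bounded_graph_def relcomp_unfold fractional_power_inv_power_iff[OF sec assms(2) \<sigma>])
    have "norm (T t o\<^sub>L ratio_power A \<sigma>) \<le> c / ln 2 powr (1 + \<delta>) * t powr (1 - (\<sigma> + 1) / \<alpha>) * ln 2 powr (1 + \<delta>)"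
      using c(2)[OF t] l by simp
    also have "\<dots> \<le> c / ln 2 powr (1 + \<delta>) * t powr (1 - (\<sigma> + 1) / \<alpha>) * ln (1 + t) powr (1 + \<delta>)"
      using t c(1) \<open>\<delta> > 0\<close> by (intro mult_left_mono powr_mono2) auto
    finally show "norm (T t o\<^sub>L ratio_power A \<sigma>) \<le>
        c / ln 2 powr (1 + \<delta>) * t powr (1 - (\<sigma> + 1) / \<alpha>) * ln (1 + t) powr (1 + \<delta>)" .
  qed (use c(1) l in simp)
qed

end
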